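(* Let $\sigma=(f_1,f_2)$ be an algebraically independent sequence of homogeneous polynomials in $\kappa[x_0,x_1,x_2,x_3]$ and let $d_i:=\deg(f_i)-1$; assume that $d_1+d_2>0$ and $c_1(\mathcal{Q}_\sigma)=0$. 1. If $d_1+d_2$ is even, then - if $\deg(\mathcal{Q}_\sigma)<(d_1^2+d_2^2-d_1-d_2-2)/2$, then $\mathcal{T}_\sigma$ is slope-stable; - if $\deg(\mathcal{Q}_\sigma)<(d_1^2+d_2^2+d_1+d_2)/2$, then $\mathcal{T}_\sigma$ is slope-semistable. 2. If $d_1+d_2$ is odd and $\deg(\mathcal{Q}_\sigma)<(d_1^2+d_2^2-1)/2$, then $\mathcal{T}_\sigma$ is slope-stable. In particular, if the Jacobian scheme of $\sigma$ is $0$-dimensional, then $\mathcal{T}_\sigma$ is slope-stable.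
   Context: $\kappa$ is an algebraically closed field of characteristic zero; the $f_i$ have positive degree. The Jacobian matrix $\nabla\sigma=(\partial f_i/\partial x_j)$ defines $\nabla\sigma:\mathcal{O}_{\mathbb{P}^3}^{\oplus4}\to\mathcal{O}_{\mathbb{P}^3}(d_1)\oplus\mathcal{O}_{\mathbb{P}^3}(d_2)$; $\mathcal{T}_\sigma:=\ker(\nabla\sigma)$ (rank 2, reflexive) and $\mathcal{Q}_\sigma:=\operatorname{coker}(\nabla\sigma)$. The Jacobian scheme is the subscheme of $\mathbb{P}^3$ defined by the $2\times2$ minors of $\nabla\sigma$. The condition $c_1(\mathcal{Q}_\sigma)=0$ means that $\mathcal{Q}_\sigma$ is supported in dimension at most 1; $\deg(\mathcal{Q}_\sigma)$ denotes the coefficient of $t$ in the Hilbert polynomial of $\mathcal{Q}_\sigma$ (so it is $0$ if $\mathcal{Q}_\sigma$ has support of dimension $\le 0$). The slope of a torsion-free sheaf $F$ of positive rank is $c_1(F)/\operatorname{rk}(F)$; $F$ is slope-stable (slope-semistable) if every subsheaf $K$ with $0<\operatorname{rk}K<\operatorname{rk}F$ has $\mu(K)<\mu(F)$ (resp. $\le$). *)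

theory Defs
  imports
    "HOL-Analysis.Analysis"
    "HOL-Library.Poly_Mapping"
    "HOL-Library.Function_Algebras"
    "HOL-Computational_Algebra.Computational_Algebra"
begin

section \<open>Polynomials in four variables\<close>

text \<open>Monomials in variables indexed by \<open>'n\<close> are exponent vectors \<open>'n \<Rightarrow>\<^sub>0 nat\<close>; a polynomial is
  a finitely supported family of coefficients.  The index type \<open>4\<close> has the elements
  \<open>0, 1, 2, 3\<close>, so that \<open>'k poly4\<close> is the ring $\kappa[x_0,x_1,x_2,x_3]$.\<close>

type_synonym ('n, 'k) mpoly = "('n \<Rightarrow>\<^sub>0 nat) \<Rightarrow>\<^sub>0 'k"
type_synonym 'k poly4 = "(4, 'k) mpoly"

definition total_degree :: "('n::finite \<Rightarrow>\<^sub>0 nat) \<Rightarrow> nat" where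
  "total_degree m = (\<Sum>i\<in>UNIV. Poly_Mapping.lookup m i)"

definition homogeneous :: "nat \<Rightarrow> ('n::finite, 'k::zero) mpoly \<Rightarrow> bool" where
  "homogeneous n f \<longleftrightarrow> (\<forall>m\<in>Poly_Mapping.keys f. total_degree m = n)"

definition homogeneous_part :: "nat \<Rightarrow> ('n::finite, 'k::comm_ring_1) mpoly \<Rightarrow> ('n, 'k) mpoly" where
  "homogeneous_part n f =
     (\<Sum>m\<in>{m \<in> Poly_Mapping.keys f. total_degree m = n}.
        Poly_Mapping.single m (Poly_Mapping.lookup f m))"

definition const_poly :: "'k::comm_ring_1 \<Rightarrow> ('n, 'k) mpoly" where
  "const_poly c = Poly_Mapping.single 0 c"

definition var :: "'n \<Rightarrow> ('n, 'k::comm_ring_1) mpoly" where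
  "var i = Poly_Mapping.single (Poly_Mapping.single i 1) 1"

text \<open>The truncated exponent subtraction is harmless: if \<open>x_i\<close> does not occur in the monomial,
  then the coefficient vanishes.\<close>

definition partial_deriv :: "'n \<Rightarrow> ('n, 'k::comm_ring_1) mpoly \<Rightarrow> ('n, 'k) mpoly" where
  "partial_deriv i f =
     (\<Sum>m\<in>Poly_Mapping.keys f. Poly_Mapping.single (m - Poly_Mapping.single i 1)
        (of_nat (Poly_Mapping.lookup m i) * Poly_Mapping.lookup f m))"

definition subst_poly ::
  "('m::finite \<Rightarrow> ('n, 'k::comm_ring_1) mpoly) \<Rightarrow> ('m, 'k) mpoly \<Rightarrow> ('n, 'k) mpoly" where
  "subst_poly \<phi> P =
     (\<Sum>m\<in>Poly_Mapping.keys P. const_poly (Poly_Mapping.lookup P m) * (\<Prod>i\<in>UNIV. \<phi> i ^ Poly_Mapping.lookup m i))"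

definition algebraically_independent :: "('n, 'k::comm_ring_1) mpoly ^ 'm::finite \<Rightarrow> bool" where
  "algebraically_independent \<sigma> \<longleftrightarrow>
     (\<forall>P :: ('m, 'k) mpoly. subst_poly (\<lambda>i. \<sigma> $ i) P = 0 \<longrightarrow> P = 0)"


section \<open>Projective 3-space\<close>

text \<open>The points of the scheme $\mathbb{P}^3 = \mathrm{Proj}\,\kappa[x_0,\dots,x_3]$: homogeneous prime
  ideals not containing all variables.\<close>

definition Proj :: "'k::field poly4 set set" where
  "Proj = {\<pp>. 0 \<in> \<pp> \<and> 1 \<notin> \<pp>
     \<and> (\<forall>f\<in>\<pp>. \<forall>g\<in>\<pp>. f + g \<in> \<pp>) \<and> (\<forall>f\<in>\<pp>. \<forall>h. h * f \<in> \<pp>)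
     \<and> (\<forall>f g. f * g \<in> \<pp> \<longrightarrow> f \<in> \<pp> \<or> g \<in> \<pp>)
     \<and> (\<forall>f\<in>\<pp>. \<forall>n. homogeneous_part n f \<in> \<pp>)
     \<and> (\<exists>i. var i \<notin> \<pp>)}"

definition vanishing_locus :: "'k::field poly4 set \<Rightarrow> 'k poly4 set set" where
  "vanishing_locus I = {\<pp>\<in>Proj. I \<subseteq> \<pp>}"

definition zariski :: "'k::field poly4 set topology" where
  "zariski = topology (\<lambda>U. \<exists>I. U = Proj - vanishing_locus I)"

lemma openin_zariski:
  fixes U :: "'k::field poly4 set set"
  shows "openin zariski U \<longleftrightarrow> (\<exists>I. U = Proj - vanishing_locus I)"
proof -
  have "istopology (\<lambda>U :: 'k poly4 set set. \<exists>I. U = Proj - vanishing_locus I)"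
    unfolding istopology_def
  proof (intro conjI allI impI)
    fix U V :: "'k poly4 set set"
    assume "\<exists>I. U = Proj - vanishing_locus I" "\<exists>I. V = Proj - vanishing_locus I"
    then obtain I J where U: "U = Proj - vanishing_locus I" and V: "V = Proj - vanishing_locus J"
      by blast
    have "U \<inter> V = Proj - vanishing_locus {f * g | f g. f \<in> I \<and> g \<in> J}"
    proof (intro set_eqI iffI)
      fix \<pp> assume "\<pp> \<in> U \<inter> V"
      then obtain f g where "\<pp> \<in> Proj" "f \<in> I" "f \<notin> \<pp>" "g \<in> J" "g \<notin> \<pp>"
        unfolding U V vanishing_locus_def by blast
      moreover from this have "f * g \<notin> \<pp>" unfolding Proj_def by blast
      ultimately show "\<pp> \<in> Proj - vanishing_locus {f * g | f g. f \<in> I \<and> g \<in> J}"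
        unfolding vanishing_locus_def by blast
    next
      fix \<pp> assume "\<pp> \<in> Proj - vanishing_locus {f * g | f g. f \<in> I \<and> g \<in> J}"
      then obtain f g where *: "\<pp> \<in> Proj" "f \<in> I" "g \<in> J" "f * g \<notin> \<pp>"
        unfolding vanishing_locus_def by blast
      have "g \<notin> \<pp>" using * unfolding Proj_def by blast
      moreover have "f \<notin> \<pp>" using * unfolding Proj_def by (auto simp: mult.commute)
      ultimately show "\<pp> \<in> U \<inter> V" using * unfolding U V vanishing_locus_def by blast
    qed
    then show "\<exists>I. U \<inter> V = Proj - vanishing_locus I" by blast
  next
    fix \<U> :: "'k poly4 set set set"
    assume "\<forall>U\<in>\<U>. \<exists>I. U = Proj - vanishing_locus I"
    then obtain I where I: "\<And>U. U \<in> \<U> \<Longrightarrow> U = Proj - vanishing_locus (I U)" by metis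
    have "\<Union>\<U> = (\<Union>U\<in>\<U>. Proj - vanishing_locus (I U))" using I by blast
    also have "\<dots> = Proj - vanishing_locus (\<Union>U\<in>\<U>. I U)"
      unfolding vanishing_locus_def by blast
    finally show "\<exists>J. \<Union>\<U> = Proj - vanishing_locus J" by blast
  qed
  then show ?thesis unfolding zariski_def by (simp only: topology_inverse')
qed

definition irreducible_closedin :: "'a topology \<Rightarrow> 'a set \<Rightarrow> bool" where
  "irreducible_closedin X C \<longleftrightarrow> closedin X C \<and> C \<noteq> {}
     \<and> (\<forall>A B. closedin X A \<and> closedin X B \<and> C \<subseteq> A \<union> B \<longrightarrow> C \<subseteq> A \<or> C \<subseteq> B)"

text \<open>\<open>n\<close> is the supremum of the lengths of chains of irreducible closed subsets; in
  particular the space is nonempty.\<close>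

definition has_krull_dimension :: "'a topology \<Rightarrow> nat \<Rightarrow> bool" where
  "has_krull_dimension X n \<longleftrightarrow>
     (let chain = (\<lambda>l C. (\<forall>i\<le>l. irreducible_closedin X (C i)) \<and> (\<forall>i<l. C i \<subset> C (Suc i)))
      in (\<exists>C :: nat \<Rightarrow> 'a set. chain n C) \<and> (\<forall>l C. chain l C \<longrightarrow> l \<le> n))"


section \<open>Coherent sheaves\<close>

text \<open>$\mathbb{P}^3$ is integral, so the stalks of the line bundles $\mathcal{O}(d)$, their localisations
  and their sections all live in the fraction field of the coordinate ring.  The stalk
  $\mathcal{O}(d)_{\mathfrak{p}}$ consists of the fractions that are homogeneous of degree \<open>d\<close> with
  homogeneous denominator outside $\mathfrak{p}$.\<close>

type_synonym 'k ratfun = "'k poly4 fract"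

definition O_stalk :: "int \<Rightarrow> 'k::field poly4 set \<Rightarrow> 'k ratfun set" where
  "O_stalk d \<pp> = {Fract a b | a b m n.
     homogeneous m a \<and> homogeneous n b \<and> b \<notin> \<pp> \<and> int m = int n + d}"

text \<open>A subsheaf of \<open>\<O>\<close>-modules $A$ of a constant sheaf $V$ on $\mathbb{P}^3$ is determined by its
  stalks $A_{\mathfrak{p}} \subseteq V$, a family that is open in the sense that an element of
  $A_{\mathfrak{p}}$ lies in $A_{\mathfrak{q}}$ for all $\mathfrak{q}$ in a neighbourhood of $\mathfrak{p}$;
  then $A(U) = \bigcap_{\mathfrak{p} \in U} A_{\mathfrak{p}}$ for nonempty open \<open>U\<close>.
  All sheaves considered here are quotients $A/B$ of two such sheaves $B \subseteq A$.\<close>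

type_synonym ('k, 'n) stalks = "'k poly4 set \<Rightarrow> ('k ratfun ^ 'n) set"

record ('p, 'v) sheaf =
  num :: "'p \<Rightarrow> 'v set"
  den :: "'p \<Rightarrow> 'v set"

type_synonym ('k, 'n) P3_sheaf = "('k poly4 set, 'k ratfun ^ 'n) sheaf"

definition sum_O :: "('n::finite \<Rightarrow> int) \<Rightarrow> ('k::field, 'n) stalks" where
  "sum_O e \<pp> = {v. \<forall>i. v $ i \<in> O_stalk (e i) \<pp>}"

definition O_span :: "'k::field poly4 set \<Rightarrow> ('k ratfun ^ 'n::finite) set \<Rightarrow> ('k ratfun ^ 'n) set" where
  "O_span \<pp> G = {\<Sum>g\<in>G. c g *s g | c. \<forall>g\<in>G. c g \<in> O_stalk 0 \<pp>}"

text \<open>Locally generated by finitely many sections.  Since $\mathbb{P}^3$ is noetherian, this is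
  coherence for subsheaves of direct sums of line bundles.  It includes the openness of the
  family and the module property.\<close>

definition coherent :: "('k::field, 'n::finite) stalks \<Rightarrow> bool" where
  "coherent A \<longleftrightarrow> (\<forall>\<pp>\<in>Proj. \<exists>U G. openin zariski U \<and> \<pp> \<in> U \<and> finite G
     \<and> (\<forall>\<qq>\<in>U. A \<qq> = O_span \<qq> G))"

definition coherent_subsheaf :: "('k::field, 'n::finite) P3_sheaf \<Rightarrow> ('k, 'n) P3_sheaf \<Rightarrow> bool" where
  "coherent_subsheaf K F \<longleftrightarrow> coherent (num K)
     \<and> (\<forall>\<pp>\<in>Proj. den K \<pp> = den F \<pp> \<and> den F \<pp> \<subseteq> num K \<pp> \<and> num K \<pp> \<subseteq> num F \<pp>)"

text \<open>Serre twist $F(t) = F \otimes \mathcal{O}(t)$; the stalks of $\mathcal{O}(t)$ are free of rank one over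
  those of $\mathcal{O}$, hence the products already form a module.\<close>

definition twist_stalks :: "int \<Rightarrow> ('k::field, 'n::finite) stalks \<Rightarrow> ('k, 'n) stalks" where
  "twist_stalks t A \<pp> = {c *s v | c v. c \<in> O_stalk t \<pp> \<and> v \<in> A \<pp>}"

definition twist :: "int \<Rightarrow> ('k::field, 'n::finite) P3_sheaf \<Rightarrow> ('k, 'n) P3_sheaf" where
  "twist t F = \<lparr>num = twist_stalks t (num F), den = twist_stalks t (den F)\<rparr>"

text \<open>The global sections of the quotient sheaf $A/B$ are the families of elements of the
  stalks $A_{\mathfrak{p}}/B_{\mathfrak{p}}$ which locally come from sections of $A$.  They are represented
  by families of elements of $A_{\mathfrak{p}}$, to be taken modulo those with values in the
  $B_{\mathfrak{p}}$.\<close>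

definition sections :: "('k::field, 'n::finite) P3_sheaf \<Rightarrow> ('k poly4 set \<Rightarrow> 'k ratfun ^ 'n) set" where
  "sections F = {s. \<forall>\<pp>\<in>Proj. \<exists>U a. openin zariski U \<and> \<pp> \<in> U
     \<and> (\<forall>\<qq>\<in>U. a \<in> num F \<qq> \<and> s \<qq> - a \<in> den F \<qq>)}"

definition null_sections :: "('k::field, 'n::finite) P3_sheaf \<Rightarrow> ('k poly4 set \<Rightarrow> 'k ratfun ^ 'n) set" where
  "null_sections F = {s. \<forall>\<pp>\<in>Proj. s \<pp> \<in> den F \<pp>}"

text \<open>\<open>W/N\<close> has a basis of \<open>n\<close> elements over the field of scalars \<open>C\<close>,
  which acts through \<open>\<mu>\<close>.\<close>

definition has_quotient_dim ::
  "'c set \<Rightarrow> ('c \<Rightarrow> 'v \<Rightarrow> 'v) \<Rightarrow> 'v::ab_group_add set \<Rightarrow> 'v set \<Rightarrow> nat \<Rightarrow> bool" where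
  "has_quotient_dim C \<mu> W N n \<longleftrightarrow> (\<exists>b :: nat \<Rightarrow> 'v. (\<forall>i<n. b i \<in> W)
     \<and> (\<forall>w\<in>W. \<exists>!c. c \<in> {..<n} \<rightarrow>\<^sub>E C \<and> w - (\<Sum>i<n. \<mu> (c i) (b i)) \<in> N))"

definition h0 :: "('k::field, 'n::finite) P3_sheaf \<Rightarrow> nat" where
  "h0 F = (THE n. has_quotient_dim UNIV (\<lambda>c s \<pp>. to_fract (const_poly c) *s s \<pp>)
     (sections F) (null_sections F) n)"

definition hilbert_poly :: "('k::field, 'n::finite) P3_sheaf \<Rightarrow> rat poly" where
  "hilbert_poly F =
     (THE P. \<forall>\<^sub>F t in sequentially. poly P (of_nat t) = of_nat (h0 (twist (int t) F)))"

text \<open>The zero ideal is the generic point, with local ring the function field.\<close>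

definition rk :: "('k::field, 'n::finite) P3_sheaf \<Rightarrow> nat" where
  "rk F = (THE n. has_quotient_dim (O_stalk 0 {0}) (*s) (num F {0}) (den F {0}) n)"

text \<open>By Riemann-Roch the Hilbert polynomial of \<open>F\<close> on $\mathbb{P}^3$ is
  $\mathrm{rk}(F) \binom{t+3}{3} + c_1(F) \binom{t+2}{2} + O(t)$, whose coefficient of $t^2$ is
  $\mathrm{rk}(F) + c_1(F)/2$.\<close>

definition c1 :: "('k::field, 'n::finite) P3_sheaf \<Rightarrow> rat" where
  "c1 F = 2 * (coeff (hilbert_poly F) 2 - of_nat (rk F))"

text \<open>The degree of a sheaf with support of dimension at most one.\<close>

definition deg1 :: "('k::field, 'n::finite) P3_sheaf \<Rightarrow> rat" where
  "deg1 F = coeff (hilbert_poly F) 1"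

definition slope :: "('k::field, 'n::finite) P3_sheaf \<Rightarrow> rat" where
  "slope F = c1 F / of_nat (rk F)"

definition slope_stable :: "('k::field, 'n::finite) P3_sheaf \<Rightarrow> bool" where
  "slope_stable F \<longleftrightarrow>
     (\<forall>K. coherent_subsheaf K F \<and> 0 < rk K \<and> rk K < rk F \<longrightarrow> slope K < slope F)"

definition slope_semistable :: "('k::field, 'n::finite) P3_sheaf \<Rightarrow> bool" where
  "slope_semistable F \<longleftrightarrow>
     (\<forall>K. coherent_subsheaf K F \<and> 0 < rk K \<and> rk K < rk F \<longrightarrow> slope K \<le> slope F)"


section \<open>Kernel, cokernel and Jacobian scheme of a pair of polynomials\<close>

definition jacobian :: "'k::field poly4 ^ 2 \<Rightarrow> 'k poly4 ^ 4 ^ 2" where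
  "jacobian \<sigma> = (\<chi> i j. partial_deriv j (\<sigma> $ i))"

definition jacobian_map :: "'k::field poly4 ^ 2 \<Rightarrow> 'k ratfun ^ 4 \<Rightarrow> 'k ratfun ^ 2" where
  "jacobian_map \<sigma> v = (\<chi> i j. to_fract (jacobian \<sigma> $ i $ j)) *v v"

text \<open>Kernel and cokernel of $\nabla\sigma : \mathcal{O}^{\oplus 4} \to \bigoplus_i \mathcal{O}(d_i)$, stalk by stalk.\<close>

definition T_sheaf :: "'k::field poly4 ^ 2 \<Rightarrow> ('k, 4) P3_sheaf" where
  "T_sheaf \<sigma> = \<lparr>num = (\<lambda>\<pp>. {v \<in> sum_O (\<lambda>_. 0) \<pp>. jacobian_map \<sigma> v = 0}), den = (\<lambda>\<pp>. {0})\<rparr>"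

definition Q_sheaf :: "'k::field poly4 ^ 2 \<Rightarrow> (2 \<Rightarrow> nat) \<Rightarrow> ('k, 2) P3_sheaf" where
  "Q_sheaf \<sigma> d = \<lparr>num = sum_O (\<lambda>i. int (d i)), den = (\<lambda>\<pp>. jacobian_map \<sigma> ` sum_O (\<lambda>_. 0) \<pp>)\<rparr>"

definition jacobian_locus :: "'k::field poly4 ^ 2 \<Rightarrow> 'k poly4 set set" where
  "jacobian_locus \<sigma> = vanishing_locus
     {jacobian \<sigma> $ 1 $ j * jacobian \<sigma> $ 2 $ k - jacobian \<sigma> $ 1 $ k * jacobian \<sigma> $ 2 $ j | j k. True}"

end

theory Submission
  imports Defs "Berlekamp_Zassenhaus.Unique_Factorization_Poly"
begin

no_notation vec_index (infixl "$" 100)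
no_notation fps_nth (infixl "$" 75)

text \<open>Let \<open>T\<close> and \<open>Q\<close> be the kernel and the cokernel of the Jacobian matrix, let $S$ be the coordinate
  ring and $d = d_1 + d_2$.  The Hilbert polynomials of \<open>T\<close> and \<open>Q\<close> differ by those of sums of line
  bundles (\<open>hilbert_poly_coker\<close>).  Hence $c_1(Q) = 0$ gives $c_1(T) = -d$, so that \<open>T\<close> has slope
  $-d/2$, and $\deg Q$ is determined by the linear coefficient of the Hilbert polynomial of \<open>T\<close>.

  A subsheaf \<open>K\<close> which violates stability has rank one, so at the generic point it is a line.  Let \<open>a\<close> be a
  vector of forms of the least degree \<open>m\<close> on this line.  Its entries are coprime, hence the sections of
  the twists of \<open>K\<close> are multiples of \<open>a\<close>, and $\mu(K) \le -m$ (\<open>slope_rank_one_subsheaf_le\<close>).  So the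
  kernel contains a vector \<open>a\<close> of degree $m \le d/2$, or $m < d/2$ if \<open>K\<close> violates semistability.

  On the other hand, a kernel vector of low degree makes \<open>Q\<close> large.  The $3 \times 3$ minors of the matrix with
  an additional row \<open>z\<close> form a kernel vector \<open>cross z\<close> of degree $d + \deg z$ for every $z \in S^4$.  Since the entries of \<open>a\<close>
  are coprime, the products of \<open>a\<close> with two general constant vectors form a regular sequence,
  and up to the Koszul relation between them there are no relations between \<open>a\<close> and the two kernel
  vectors (\<open>dim_kernel_ge\<close>).  With $s(n) = \binom{n+3}{3}$ this shows
  $h^0(T(t)) \ge s(t-m) + 2 s(t-d) - s(t-d-m)$, and a comparison of linear coefficients gives
  $\deg Q \ge (d_1^2 + d_2^2)/2 + d^2/2 - dm$ (\<open>deg1_coker_ge\<close>).  For $m \le d/2$ the right-hand side is at least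
  $(d_1^2 + d_2^2)/2$; if $d$ is even and $m < d/2$, it is at least $(d_1^2 + d_2^2)/2 + d$.  Both exceed the respective
  assumptions on $\deg Q$.  If the Jacobian scheme is $0$-dimensional, then a general plane misses it,
  so the Hilbert polynomial of \<open>Q\<close> is constant and $\deg Q = 0$ (\<open>deg1_coker_eq_0\<close>), which is again too
  small.

  The Hilbert polynomials are accessible because in large degrees the sections of the twisted cokernel
  are the quotient of $S(d_1) \oplus S(d_2)$ by the image of the matrix (\<open>h0_coker_sheaf\<close>), which rests
  on the equality of a submodule and its saturation in large degrees (\<open>sat_eventually\<close>) and on general
  linear forms not being zero divisors modulo a saturated submodule (\<open>finite_lin_zero_divisors\<close>).  Algebraic independence
  enters through a nonzero minor of the Jacobian matrix (\<open>minor_jacobian_neq_0\<close>).\<close>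

section \<open>Homogeneous polynomials\<close>

lemma total_degree_add [simp]: "total_degree (m + m') = total_degree m + total_degree m'"
  by (simp add: total_degree_def lookup_add sum.distrib)

lemma total_degree_zero [simp]: "total_degree 0 = 0"
  by (simp add: total_degree_def)

lemma total_degree_single [simp]: "total_degree (Poly_Mapping.single i c) = c"
  by (simp add: total_degree_def lookup_single when_def)

lemma total_degree_eq_0_iff: "total_degree m = 0 \<longleftrightarrow> m = 0"
  by (auto simp: total_degree_def poly_mapping_eq_iff fun_eq_iff)

lemma homogeneous_iff: "homogeneous n f \<longleftrightarrow> (\<forall>m. Poly_Mapping.lookup f m \<noteq> 0 \<longrightarrow> total_degree m = n)"
  by (auto simp: homogeneous_def in_keys_iff)

lemma homogeneous_zero [simp]: "homogeneous n 0"
  by (simp add: homogeneous_def)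

lemma homogeneous_add: "homogeneous n f \<Longrightarrow> homogeneous n g \<Longrightarrow> homogeneous n (f + g)"
  for f :: "('n::finite, 'k::comm_ring_1) mpoly"
  by (simp add: homogeneous_iff lookup_add) (metis add_0)

lemma homogeneous_uminus: "homogeneous n f \<Longrightarrow> homogeneous n (- f)"
  for f :: "('n::finite, 'k::comm_ring_1) mpoly"
  by (simp add: homogeneous_iff)

lemma homogeneous_diff: "homogeneous n f \<Longrightarrow> homogeneous n g \<Longrightarrow> homogeneous n (f - g)"
  for f :: "('n::finite, 'k::comm_ring_1) mpoly"
  by (metis homogeneous_add homogeneous_uminus add_uminus_conv_diff)

lemma homogeneous_sum: "(\<And>i. i \<in> A \<Longrightarrow> homogeneous n (f i)) \<Longrightarrow> homogeneous n (sum f A)"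
  for f :: "'a \<Rightarrow> ('n::finite, 'k::comm_ring_1) mpoly"
  by (induction A rule: infinite_finite_induct) (auto intro: homogeneous_add)

lemma homogeneous_mult: "homogeneous n f \<Longrightarrow> homogeneous m g \<Longrightarrow> homogeneous (n + m) (f * g)"
  for f :: "('n::finite, 'k::comm_ring_1) mpoly"
  using keys_mult[of f g] unfolding homogeneous_def by fastforce

lemma homogeneous_single: "total_degree m = n \<Longrightarrow> homogeneous n (Poly_Mapping.single m c)"
  by (auto simp: homogeneous_def split: if_splits)

lemma homogeneous_const [simp]: "homogeneous 0 (const_poly c)"
  by (simp add: const_poly_def homogeneous_single)

lemma homogeneous_one [simp]: "homogeneous 0 (1 :: ('n::finite, 'k::comm_ring_1) mpoly)"
  by (simp add: homogeneous_def)

lemma homogeneous_var [simp]: "homogeneous (Suc 0) (var i)" "homogeneous 1 (var i)"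
  by (simp_all add: var_def homogeneous_single)

lemma homogeneous_power: "homogeneous n f \<Longrightarrow> homogeneous (n * k) (f ^ k)"
  for f :: "('n::finite, 'k::comm_ring_1) mpoly"
  by (induction k) (auto intro: homogeneous_mult)

lemma homogeneous_prod: "(\<And>i. i \<in> A \<Longrightarrow> homogeneous (n i) (f i)) \<Longrightarrow> homogeneous (sum n A) (prod f A)"
  for f :: "'a \<Rightarrow> ('n::finite, 'k::comm_ring_1) mpoly"
  by (induction A rule: infinite_finite_induct) (auto intro: homogeneous_mult)

lemma homogeneous_const_mult: "homogeneous n f \<Longrightarrow> homogeneous n (const_poly c * f)"
  for f :: "('n::finite, 'k::comm_ring_1) mpoly"
  using homogeneous_mult[of 0 "const_poly c" n f] by simp

lemma homogeneous_unique: "homogeneous n f \<Longrightarrow> homogeneous m f \<Longrightarrow> f \<noteq> 0 \<Longrightarrow> n = m"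
  by (metis homogeneous_iff poly_mapping_eqI lookup_zero)

lemma const_poly_add: "const_poly (a + b) = const_poly a + const_poly b"
  by (simp add: const_poly_def single_add)

lemma const_poly_diff: "const_poly (a - b) = const_poly a - const_poly b"
  by (simp add: const_poly_def single_diff)

lemma const_poly_mult: "const_poly (a * b) = const_poly a * const_poly b"
  by (simp add: const_poly_def mult_single)

lemma const_poly_0 [simp]: "const_poly 0 = 0"
  by (simp add: const_poly_def)

lemma const_poly_1 [simp]: "const_poly 1 = 1"
  by (simp add: const_poly_def)

lemma const_poly_eq_0_iff [simp]: "const_poly c = 0 \<longleftrightarrow> c = 0"
  by (metis const_poly_0 const_poly_def lookup_single_eq)

lemma homogeneous_0_imp_const: "homogeneous 0 f \<Longrightarrow> \<exists>c. f = const_poly c"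
  by (rule exI[of _ "Poly_Mapping.lookup f 0"], rule poly_mapping_eqI)
    (auto simp: homogeneous_iff const_poly_def lookup_single when_def total_degree_eq_0_iff)

lemma poly_mapping_sum_singles: "f = (\<Sum>m\<in>Poly_Mapping.keys f. Poly_Mapping.single m (Poly_Mapping.lookup f m))"
  for f :: "'a \<Rightarrow>\<^sub>0 'b::comm_monoid_add"
  by (rule poly_mapping_eqI)
    (auto simp: lookup_sum lookup_single when_def in_keys_iff)

lemma lookup_times:
  fixes f g :: "('n, 'k::comm_ring_1) mpoly"
  shows "Poly_Mapping.lookup (f * g) k = (\<Sum>a\<in>Poly_Mapping.keys f. \<Sum>b\<in>Poly_Mapping.keys g.
     (if a + b = k then Poly_Mapping.lookup f a * Poly_Mapping.lookup g b else 0))"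
proof -
  have "f * g = (\<Sum>a\<in>Poly_Mapping.keys f. Poly_Mapping.single a (Poly_Mapping.lookup f a)) *
      (\<Sum>b\<in>Poly_Mapping.keys g. Poly_Mapping.single b (Poly_Mapping.lookup g b))"
    using poly_mapping_sum_singles[of f] poly_mapping_sum_singles[of g] by simp
  then show ?thesis
    by (simp add: sum_product mult_single lookup_sum lookup_single when_def)
qed

lemma lookup_single_mult:
  fixes f :: "('n, 'k::comm_ring_1) mpoly"
  shows "Poly_Mapping.lookup (Poly_Mapping.single a c * f) (a + k) = c * Poly_Mapping.lookup f k"
proof (cases "c = 0")
  case False
  then have "Poly_Mapping.keys (Poly_Mapping.single a c) = {a}" by simp
  then have "Poly_Mapping.lookup (Poly_Mapping.single a c * f) (a + k) =
      (\<Sum>b\<in>Poly_Mapping.keys f. if b = k then c * Poly_Mapping.lookup f b else 0)"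
    by (simp only: lookup_times) simp
  also have "\<dots> = c * Poly_Mapping.lookup f k" by (auto simp: in_keys_iff)
  finally show ?thesis .
qed simp

lemma lookup_const_mult [simp]:
  fixes f :: "('n, 'k::comm_ring_1) mpoly"
  shows "Poly_Mapping.lookup (const_poly c * f) k = c * Poly_Mapping.lookup f k"
  using lookup_single_mult[of 0 c f k] by (simp add: const_poly_def)

lemma lookup_homogeneous_part [simp]:
  "Poly_Mapping.lookup (homogeneous_part n f) m = (if total_degree m = n then Poly_Mapping.lookup f m else 0)"
  unfolding homogeneous_part_def lookup_sum
  by (auto simp: lookup_single when_def in_keys_iff)

lemma homogeneous_homogeneous_part [simp]: "homogeneous n (homogeneous_part n f)"
  by (simp add: homogeneous_iff)

lemma homogeneous_part_add: "homogeneous_part n (f + g) = homogeneous_part n f + homogeneous_part n g"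
  by (rule poly_mapping_eqI) (simp add: lookup_add)

lemma homogeneous_part_zero [simp]: "homogeneous_part n 0 = 0"
  by (rule poly_mapping_eqI) simp

lemma homogeneous_part_sum: "homogeneous_part n (sum f A) = (\<Sum>i\<in>A. homogeneous_part n (f i))"
  by (induction A rule: infinite_finite_induct) (auto simp: homogeneous_part_add)

lemma homogeneous_part_homogeneous:
  "homogeneous m f \<Longrightarrow> homogeneous_part n f = (if n = m then f else 0)"
  by (rule poly_mapping_eqI) (auto simp: homogeneous_iff)

lemma sum_homogeneous_parts:
  "\<exists>D. \<forall>d\<ge>D. f = (\<Sum>n\<le>d. homogeneous_part n f) \<and> homogeneous_part (Suc d) f = 0"
  for f :: "('n::finite, 'k::comm_ring_1) mpoly"
proof (intro exI allI impI conjI)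
  let ?D = "\<Sum>m\<in>Poly_Mapping.keys f. total_degree m"
  fix d assume d: "?D \<le> d"
  have le: "total_degree m \<le> d" if "Poly_Mapping.lookup f m \<noteq> 0" for m
    using d member_le_sum[of m "Poly_Mapping.keys f" total_degree] that
    by (auto simp: in_keys_iff)
  show "f = (\<Sum>n\<le>d. homogeneous_part n f)"
    by (rule poly_mapping_eqI) (use le in \<open>auto simp: lookup_sum\<close>)
  show "homogeneous_part (Suc d) f = 0"
    by (rule poly_mapping_eqI) (use le in fastforce)
qed

lemma homogeneous_part_mult_homogeneous:
  fixes f g :: "('n::finite, 'k::comm_ring_1) mpoly"
  assumes "homogeneous i f"
  shows "homogeneous_part n (f * g) = (if i \<le> n then f * homogeneous_part (n - i) g else 0)"
proof -
  obtain d where d: "g = (\<Sum>j\<le>d. homogeneous_part j g)" "n \<le> d"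
    using sum_homogeneous_parts[of g] by (metis nle_le)
  have "f * g = (\<Sum>j\<le>d. f * homogeneous_part j g)" by (subst d(1)) (simp add: sum_distrib_left)
  then have "homogeneous_part n (f * g) = (\<Sum>j\<le>d. homogeneous_part n (f * homogeneous_part j g))"
    by (simp only: homogeneous_part_sum)
  also have "\<dots> = (\<Sum>j\<le>d. if n = i + j then f * homogeneous_part j g else 0)"
    by (intro sum.cong refl homogeneous_part_homogeneous homogeneous_mult assms homogeneous_homogeneous_part)
  also have "\<dots> = (\<Sum>j\<le>d. if j = n - i then (if i \<le> n then f * homogeneous_part (n - i) g else 0) else 0)"
    by (intro sum.cong refl) auto
  also have "\<dots> = (if i \<le> n then f * homogeneous_part (n - i) g else 0)"
    using d(2) by auto
  finally show ?thesis .
qed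

lemma homogeneous_part_mult:
  fixes f g :: "('n::finite, 'k::comm_ring_1) mpoly"
  shows "homogeneous_part n (f * g) = (\<Sum>i\<le>n. homogeneous_part i f * homogeneous_part (n - i) g)"
proof -
  obtain d where d: "f = (\<Sum>j\<le>d. homogeneous_part j f)" "n \<le> d"
    using sum_homogeneous_parts[of f] by (metis nle_le)
  have "f * g = (\<Sum>i\<le>d. homogeneous_part i f * g)" by (subst d(1)) (simp add: sum_distrib_right)
  then have "homogeneous_part n (f * g) = (\<Sum>i\<le>d. homogeneous_part n (homogeneous_part i f * g))"
    by (simp only: homogeneous_part_sum)
  also have "\<dots> = (\<Sum>i\<le>d. if i \<le> n then homogeneous_part i f * homogeneous_part (n - i) g else 0)"
    by (intro sum.cong refl homogeneous_part_mult_homogeneous homogeneous_homogeneous_part)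
  also have "\<dots> = (\<Sum>i\<in>{i\<in>{..d}. i \<le> n}. homogeneous_part i f * homogeneous_part (n - i) g)"
    by (rule sum.inter_filter[symmetric]) simp
  also have "{i\<in>{..d}. i \<le> n} = {..n}" using d(2) by auto
  finally show ?thesis .
qed

lemma ex_homogeneous_part_neq_0: "f \<noteq> 0 \<Longrightarrow> \<exists>n. homogeneous_part n f \<noteq> 0"
  for f :: "('n::finite, 'k::comm_ring_1) mpoly"
  by (metis sum_homogeneous_parts order_refl sum.neutral)

lemma finite_homogeneous_parts: "finite {n. homogeneous_part n f \<noteq> 0}"
  for f :: "('n::finite, 'k::comm_ring_1) mpoly"
proof -
  obtain D where D: "\<And>d. d \<ge> D \<Longrightarrow> homogeneous_part (Suc d) f = 0"
    using sum_homogeneous_parts[of f] by blast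
  have "{n. homogeneous_part n f \<noteq> 0} \<subseteq> {..D}"
    by (metis (mono_tags, lifting) D Suc_le_D atMost_iff linorder_le_cases mem_Collect_eq not_less_eq_eq subsetI)
  then show ?thesis by (rule finite_subset) simp
qed

text \<open>The lowest and the highest homogeneous parts of a product are the products of those of the
  factors; for a homogeneous product they have the same degree.\<close>

lemma homogeneous_factors:
  fixes f g :: "('n::{finite,linorder}, 'k::field) mpoly"
  assumes "homogeneous n (f * g)" "f * g \<noteq> 0"
  shows "\<exists>a b. homogeneous a f \<and> homogeneous b g \<and> n = a + b"
proof -
  let ?A = "{n. homogeneous_part n f \<noteq> 0}" and ?B = "{n. homogeneous_part n g \<noteq> 0}"
  have fin: "finite ?A" "finite ?B" by (rule finite_homogeneous_parts)+
  have ne: "?A \<noteq> {}" "?B \<noteq> {}" using assms(2) ex_homogeneous_part_neq_0 by fastforce+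
  define a b a' b' where "a = Max ?A" and "b = Max ?B" and "a' = Min ?A" and "b' = Min ?B"
  have mem: "a \<in> ?A" "a' \<in> ?A" "b \<in> ?B" "b' \<in> ?B"
    unfolding a_def a'_def b_def b'_def using fin ne by (auto intro!: Max_in Min_in simp del: mem_Collect_eq)
  have bd: "i \<le> a \<and> a' \<le> i" if "homogeneous_part i f \<noteq> 0" for i
    using that fin ne by (simp add: a_def a'_def)
  have bd': "i \<le> b \<and> b' \<le> i" if "homogeneous_part i g \<noteq> 0" for i
    using that fin ne by (simp add: b_def b'_def)
  have "homogeneous_part (a + b) (f * g) = (\<Sum>i\<le>a + b. if i = a then homogeneous_part a f * homogeneous_part b g else 0)"
    unfolding homogeneous_part_mult
  proof (intro sum.cong refl)
    fix i assume "i \<in> {..a + b}"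
    then show "homogeneous_part i f * homogeneous_part (a + b - i) g =
        (if i = a then homogeneous_part a f * homogeneous_part b g else 0)"
      using bd[of i] bd'[of "a + b - i"] by force
  qed
  then have "homogeneous_part (a + b) (f * g) \<noteq> 0" using mem by simp
  then have n1: "n = a + b" using assms(1) homogeneous_part_homogeneous by metis
  have "homogeneous_part (a' + b') (f * g) = (\<Sum>i\<le>a' + b'. if i = a' then homogeneous_part a' f * homogeneous_part b' g else 0)"
    unfolding homogeneous_part_mult
  proof (intro sum.cong refl)
    fix i assume "i \<in> {..a' + b'}"
    then show "homogeneous_part i f * homogeneous_part (a' + b' - i) g =
        (if i = a' then homogeneous_part a' f * homogeneous_part b' g else 0)"
      using bd[of i] bd'[of "a' + b' - i"] by force
  qed
  then have "homogeneous_part (a' + b') (f * g) \<noteq> 0" using mem by simp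
  then have n2: "n = a' + b'" using assms(1) homogeneous_part_homogeneous by metis
  have "a' \<le> a" "b' \<le> b" using bd bd' mem by auto
  then have eq: "a' = a" "b' = b" using n1 n2 by auto
  have "homogeneous_part i f = 0" if "i \<noteq> a" for i using bd[of i] eq that by force
  then have "f = homogeneous_part a f"
    using sum_homogeneous_parts[of f] bd[of a] 
    by (intro poly_mapping_eqI) (metis lookup_homogeneous_part lookup_zero)
  moreover have "homogeneous_part i g = 0" if "i \<noteq> b" for i using bd'[of i] eq that by force
  then have "g = homogeneous_part b g"
    by (intro poly_mapping_eqI) (metis lookup_homogeneous_part lookup_zero)
  ultimately show ?thesis using n1 by (metis homogeneous_homogeneous_part)
qed

lemma var_power: "var i ^ K = Poly_Mapping.single (Poly_Mapping.single i K) 1"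
  by (induction K) (auto simp: var_def mult_single single_add[symmetric])

text \<open>Pigeonhole: a monomial of large degree has a large exponent.\<close>

lemma homogeneous_split_powers:
  fixes f :: "('n::finite, 'k::comm_ring_1) mpoly"
  assumes "homogeneous n f" "card (UNIV :: 'n set) * (K - 1) < n"
  shows "\<exists>g. (\<forall>i. homogeneous (n - K) (g i)) \<and> f = (\<Sum>i\<in>UNIV. var i ^ K * g i)"
proof -
  have ex: "\<exists>i. K \<le> Poly_Mapping.lookup m i" if "total_degree m = n" for m :: "'n \<Rightarrow>\<^sub>0 nat"
  proof (rule ccontr)
    assume "\<nexists>i. K \<le> Poly_Mapping.lookup m i"
    then have "Poly_Mapping.lookup m i \<le> K - 1" for i by (metis Suc_pred' less_Suc_eq_le not_less not_less_zero le_0_eq not_gr0)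
    then have "total_degree m \<le> (\<Sum>i\<in>(UNIV::'n set). K - 1)" unfolding total_degree_def by (intro sum_mono)
    then show False using assms(2) that by simp
  qed
  define c where "c m = (SOME i. K \<le> Poly_Mapping.lookup m i)" for m :: "'n \<Rightarrow>\<^sub>0 nat"
  have c: "K \<le> Poly_Mapping.lookup m (c m)" if "total_degree m = n" for m
    unfolding c_def using ex[OF that] by (rule someI_ex)
  let ?A = "\<lambda>i. {m \<in> Poly_Mapping.keys f. c m = i}"
  define g where "g i = (\<Sum>m\<in>?A i. Poly_Mapping.single (m - Poly_Mapping.single i K) (Poly_Mapping.lookup f m))" for i
  have split: "Poly_Mapping.single i K + (m - Poly_Mapping.single i K) = m" if "m \<in> ?A i" for i m
    using that assms(1) c[of m]
    by (intro poly_mapping_eqI) (auto simp: lookup_add lookup_minus lookup_single when_def homogeneous_def)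
  have "homogeneous (n - K) (g i)" for i
    unfolding g_def
  proof (intro homogeneous_sum homogeneous_single)
    fix m assume m: "m \<in> ?A i"
    have "K + total_degree (m - Poly_Mapping.single i K) = total_degree m"
      using total_degree_add[of "Poly_Mapping.single i K" "m - Poly_Mapping.single i K"] split[OF m]
      by simp
    moreover have "total_degree m = n" using m assms(1) by (simp add: homogeneous_def)
    ultimately show "total_degree (m - Poly_Mapping.single i K) = n - K" by linarith
  qed
  moreover have "f = (\<Sum>i\<in>UNIV. var i ^ K * g i)"
  proof -
    have "(\<Sum>i\<in>UNIV. var i ^ K * g i) = (\<Sum>i\<in>UNIV. \<Sum>m\<in>?A i. Poly_Mapping.single m (Poly_Mapping.lookup f m))"
      unfolding g_def sum_distrib_left var_power mult_single using split by (intro sum.cong refl) auto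
    also have "\<dots> = (\<Sum>m\<in>Poly_Mapping.keys f. Poly_Mapping.single m (Poly_Mapping.lookup f m))"
      by (rule sum.group) auto
    also have "\<dots> = f" using poly_mapping_sum_singles[of f] by simp
    finally show ?thesis by simp
  qed
  ultimately show ?thesis by blast
qed

lemma homogeneous_Suc_split:
  fixes f :: "('n::finite, 'k::comm_ring_1) mpoly"
  assumes "homogeneous (Suc n) f"
  shows "\<exists>g. (\<forall>i. homogeneous n (g i)) \<and> f = (\<Sum>i\<in>UNIV. var i * g i)"
  using homogeneous_split_powers[OF assms, of 1] by simp

lemma card_monomials:
  "card {m :: 4 \<Rightarrow>\<^sub>0 nat. total_degree m = n} = (n + 3) choose 3"
  "finite {m :: 4 \<Rightarrow>\<^sub>0 nat. total_degree m = n}"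
proof -
  let ?L = "{l :: nat list. length l = 4 \<and> sum_list l = n}" and ?M = "{m :: 4 \<Rightarrow>\<^sub>0 nat. total_degree m = n}"
  have U: "(UNIV :: 4 set) = {0, 1, 2, 3}" using UNIV_4 by auto
  have d: "(0::4) \<noteq> 1" "(0::4) \<noteq> 2" "(0::4) \<noteq> 3" "(1::4) \<noteq> 2" "(1::4) \<noteq> 3" "(2::4) \<noteq> 3" by simp_all
  define h where "h m = map (Poly_Mapping.lookup m) [0, 1, 2, 3 :: 4]" for m :: "4 \<Rightarrow>\<^sub>0 nat"
  define k where "k l = (\<Sum>j<4. Poly_Mapping.single (of_nat j :: 4) (l ! j))" for l :: "nat list"
  have k_lookup: "Poly_Mapping.lookup (k l) 0 = l ! 0" "Poly_Mapping.lookup (k l) 1 = l ! 1"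
    "Poly_Mapping.lookup (k l) 2 = l ! 2" "Poly_Mapping.lookup (k l) 3 = l ! 3" for l
    unfolding k_def by (simp_all add: lookup_sum lookup_add lookup_single when_def numeral_eq_Suc)
  have hk: "h (k l) = l" if "length l = 4" for l
    using that unfolding h_def by (auto simp: k_lookup list_eq_iff_nth_eq less_Suc_eq numeral_eq_Suc nth_Cons split: nat.splits)
  have kh: "k (h m) = m" for m
  proof (rule poly_mapping_eqI)
    fix i :: 4
    have "i \<in> {0, 1, 2, 3}" using U by blast
    then show "Poly_Mapping.lookup (k (h m)) i = Poly_Mapping.lookup m i"
      by (auto simp: k_lookup h_def)
  qed
  have "bij_betw h ?M ?L"
  proof (rule bij_betw_byWitness[where f' = k])
    have "sum_list (h m) = total_degree m" for m unfolding h_def total_degree_def U using d by simp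
    then show "h ` ?M \<subseteq> ?L" by (auto simp: h_def)
    have "total_degree (k l) = sum_list l" if "length l = 4" for l
      using \<open>\<And>m. sum_list (h m) = total_degree m\<close>[of "k l"] hk[OF that] by simp
    then show "k ` ?L \<subseteq> ?M" by auto
  qed (auto simp: hk kh)
  moreover have "card ?L = (n + 4 - 1) choose n"
    using card_length_sum_list[of 4 n] by simp
  moreover have "finite ?L"
    using finite_lists_length_eq[of "{..n}" 4]
    by (rule rev_finite_subset) (auto simp: member_le_sum_list)
  moreover have "(n + 4 - 1) choose n = (n + 3) choose 3"
    using binomial_symmetric[of n "n + 3"] by (simp add: add.commute)
  ultimately show "card ?M = (n + 3) choose 3" "finite ?M"
    by (simp_all add: bij_betw_same_card bij_betw_finite)
qed

section \<open>Dimensions of quotients\<close>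

definition is_subfield :: "'f::field set \<Rightarrow> bool" where
  "is_subfield C \<longleftrightarrow> 0 \<in> C \<and> 1 \<in> C \<and> (\<forall>a\<in>C. \<forall>b\<in>C. a + b \<in> C) \<and> (\<forall>a\<in>C. - a \<in> C)
     \<and> (\<forall>a\<in>C. \<forall>b\<in>C. a * b \<in> C) \<and> (\<forall>a\<in>C. inverse a \<in> C)"

lemma is_subfieldD:
  assumes "is_subfield C"
  shows "0 \<in> C" "1 \<in> C" "a \<in> C \<Longrightarrow> b \<in> C \<Longrightarrow> a + b \<in> C" "a \<in> C \<Longrightarrow> - a \<in> C"
    "a \<in> C \<Longrightarrow> b \<in> C \<Longrightarrow> a * b \<in> C" "a \<in> C \<Longrightarrow> inverse a \<in> C"
  using assms unfolding is_subfield_def by blast+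

lemma is_subfield_sum: "is_subfield C \<Longrightarrow> (\<And>i. i \<in> S \<Longrightarrow> f i \<in> C) \<Longrightarrow> sum f S \<in> C"
  by (induction S rule: infinite_finite_induct) (simp_all add: is_subfieldD)

lemma is_subfield_UNIV [simp]: "is_subfield UNIV"
  by (simp add: is_subfield_def)

text \<open>Gaussian elimination: the entries stay in a subfield, and so does a solution.\<close>

lemma subfield_homogeneous_system:
  fixes A :: "'i \<Rightarrow> 'j \<Rightarrow> 'f::field"
  assumes C: "is_subfield C"
    and "finite J" "finite I" "card J < card I" "\<And>i j. i \<in> I \<Longrightarrow> j \<in> J \<Longrightarrow> A i j \<in> C"
  shows "\<exists>c. (\<forall>i\<in>I. c i \<in> C) \<and> (\<exists>i\<in>I. c i \<noteq> 0) \<and> (\<forall>j\<in>J. (\<Sum>i\<in>I. c i * A i j) = 0)"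
  using assms(2-)
proof (induction J arbitrary: I A rule: finite_induct)
  case empty
  then have "I \<noteq> {}" by auto
  then show ?case using is_subfieldD(2)[OF C] by (intro exI[of _ "\<lambda>_. 1"]) auto
next
  case (insert j J)
  show ?case
  proof (cases "\<forall>i\<in>I. A i j = 0")
    case True
    have "\<exists>c. (\<forall>i\<in>I. c i \<in> C) \<and> (\<exists>i\<in>I. c i \<noteq> 0) \<and> (\<forall>l\<in>J. (\<Sum>i\<in>I. c i * A i l) = 0)"
    proof (rule insert.IH)
      show "card J < card I" using insert.prems(2) insert.hyps(1,2) by simp
    qed (simp_all add: insert.prems)
    then obtain c where "\<forall>i\<in>I. c i \<in> C" "\<exists>i\<in>I. c i \<noteq> 0" "\<forall>l\<in>J. (\<Sum>i\<in>I. c i * A i l) = 0" by blast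
    moreover have "(\<Sum>i\<in>I. c i * A i j) = 0" using True by simp
    ultimately show ?thesis by blast
  next
    case False
    then obtain k where k: "k \<in> I" "A k j \<noteq> 0" by blast
    let ?I = "I - {k}"
    have Ak: "A k l \<in> C" if "l \<in> insert j J" for l using insert.prems(3) k(1) that by blast
    define B where "B i l = A i l + - (A i j * inverse (A k j) * A k l)" for i l
    have B: "B i l \<in> C" if "i \<in> ?I" "l \<in> J" for i l
      unfolding B_def using that insert.prems(3)[of i] Ak
      by (intro is_subfieldD[OF C]) auto
    have "\<exists>c. (\<forall>i\<in>?I. c i \<in> C) \<and> (\<exists>i\<in>?I. c i \<noteq> 0) \<and> (\<forall>l\<in>J. (\<Sum>i\<in>?I. c i * B i l) = 0)"
    proof (rule insert.IH)
      show "card J < card ?I" using insert.prems(1,2) insert.hyps(1,2) k(1) by simp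
    qed (use insert.prems(1) B in auto)
    then obtain c where c: "\<And>i. i \<in> ?I \<Longrightarrow> c i \<in> C" "\<exists>i\<in>?I. c i \<noteq> 0"
      "\<And>l. l \<in> J \<Longrightarrow> (\<Sum>i\<in>?I. c i * B i l) = 0" by blast
    define x where "x = - ((\<Sum>i\<in>?I. c i * A i j) * inverse (A k j))"
    have x: "x \<in> C" unfolding x_def using c(1) insert.prems(3) Ak
      by (intro is_subfieldD(4-6)[OF C] is_subfield_sum[OF C]) auto
    define c' where "c' = c(k := x)"
    have sum': "(\<Sum>i\<in>I. c' i * A i l) = x * A k l + (\<Sum>i\<in>?I. c i * A i l)" for l
      using k(1) insert.prems(1) by (simp add: sum.remove c'_def)
    have "(\<Sum>i\<in>I. c' i * A i l) = 0" if "l \<in> insert j J" for l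
    proof (cases "l = j")
      case True
      then show ?thesis unfolding sum' x_def using k(2) by simp
    next
      case False
      have "(\<Sum>i\<in>?I. c i * A i l) = (\<Sum>i\<in>?I. c i * B i l) + (\<Sum>i\<in>?I. c i * A i j) * inverse (A k j) * A k l"
        unfolding sum_distrib_right sum.distrib[symmetric] B_def
        by (intro sum.cong refl) (simp add: algebra_simps)
      then show ?thesis unfolding sum' x_def using c(3)[of l] that False by simp
    qed
    moreover have "\<forall>i\<in>I. c' i \<in> C" using c(1) x by (simp add: c'_def)
    moreover have "\<exists>i\<in>I. c' i \<noteq> 0" using c(2) by (auto simp: c'_def)
    ultimately show ?thesis by blast
  qed
qed

lemma Ex1_eq: "\<exists>!x. P x \<Longrightarrow> P a \<Longrightarrow> P b \<Longrightarrow> a = b"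
  by blast

lemma has_quotient_dimE:
  assumes "has_quotient_dim C \<mu> W N n"
  obtains b where "\<forall>i<n. b i \<in> W"
    "\<forall>w\<in>W. \<exists>!c. c \<in> {..<n} \<rightarrow>\<^sub>E C \<and> w - (\<Sum>i<n. \<mu> (c i) (b i)) \<in> N"
  using assms unfolding has_quotient_dim_def by (elim exE conjE) (rule that)

text \<open>More elements of \<open>W\<close> than basis elements satisfy a nontrivial linear relation modulo \<open>N\<close>, by
  \<open>subfield_homogeneous_system\<close>; for a second basis this contradicts uniqueness of coordinates.\<close>

lemma has_quotient_dim_unique:
  fixes scale :: "'f::field \<Rightarrow> 'v::ab_group_add \<Rightarrow> 'v"
  assumes "vector_space scale" and C: "is_subfield C"
    and N: "0 \<in> N" "\<And>x y. x \<in> N \<Longrightarrow> y \<in> N \<Longrightarrow> x + y \<in> N" "\<And>c x. c \<in> C \<Longrightarrow> x \<in> N \<Longrightarrow> scale c x \<in> N"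
    and W: "0 \<in> W"
    and nm: "has_quotient_dim C scale W N n" "has_quotient_dim C scale W N m"
  shows "n = m"
proof -
  interpret vector_space scale by fact
  have sumN: "(\<Sum>i\<in>S. f i) \<in> N" if "\<And>i. i \<in> S \<Longrightarrow> f i \<in> N" for S and f :: "nat \<Rightarrow> 'v"
    using that by (induction S rule: infinite_finite_induct) (simp_all add: N(1,2))
  have "\<not> n < m" if n: "has_quotient_dim C scale W N n" and m: "has_quotient_dim C scale W N m" for n m
  proof
    assume "n < m"
    obtain b where b: "\<forall>i<n. b i \<in> W"
      "\<forall>w\<in>W. \<exists>!c. c \<in> {..<n} \<rightarrow>\<^sub>E C \<and> w - (\<Sum>i<n. scale (c i) (b i)) \<in> N"
      using n by (rule has_quotient_dimE)
    obtain b' where b': "\<forall>i<m. b' i \<in> W"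
      "\<forall>w\<in>W. \<exists>!c. c \<in> {..<m} \<rightarrow>\<^sub>E C \<and> w - (\<Sum>i<m. scale (c i) (b' i)) \<in> N"
      using m by (rule has_quotient_dimE)
    have "\<forall>i\<in>{..<m}. \<exists>c. c \<in> {..<n} \<rightarrow>\<^sub>E C \<and> b' i - (\<Sum>j<n. scale (c j) (b j)) \<in> N"
    proof
      fix i assume "i \<in> {..<m}"
      then have "b' i \<in> W" using b'(1) by simp
      from ex1_implies_ex[OF bspec[OF b(2) this]]
      show "\<exists>c. c \<in> {..<n} \<rightarrow>\<^sub>E C \<and> b' i - (\<Sum>j<n. scale (c j) (b j)) \<in> N" .
    qed
    from bchoice[OF this] obtain A where A: "\<forall>i\<in>{..<m}. A i \<in> {..<n} \<rightarrow>\<^sub>E C \<and> b' i - (\<Sum>j<n. scale (A i j) (b j)) \<in> N"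
      by blast
    have "\<exists>c. (\<forall>i\<in>{..<m}. c i \<in> C) \<and> (\<exists>i\<in>{..<m}. c i \<noteq> 0) \<and> (\<forall>j\<in>{..<n}. (\<Sum>i\<in>{..<m}. c i * A i j) = 0)"
    proof (rule subfield_homogeneous_system[OF C])
      show "A i j \<in> C" if "i \<in> {..<m}" "j \<in> {..<n}" for i j
        using bspec[OF A that(1)] that(2) by (blast intro: PiE_mem)
    qed (use \<open>n < m\<close> in simp_all)
    then obtain c where c: "\<And>i. i < m \<Longrightarrow> c i \<in> C" "\<exists>i<m. c i \<noteq> 0"
      "\<And>j. j < n \<Longrightarrow> (\<Sum>i<m. c i * A i j) = 0" by (metis lessThan_iff)
    have "(\<Sum>i<m. scale (c i) (\<Sum>j<n. scale (A i j) (b j))) = (\<Sum>j<n. scale (\<Sum>i<m. c i * A i j) (b j))"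
      unfolding scale_sum_right scale_sum_left scale_scale by (rule sum.swap)
    also have "\<dots> = 0" using c(3) by simp
    finally have "(\<Sum>i<m. scale (c i) (b' i)) = (\<Sum>i<m. scale (c i) (b' i - (\<Sum>j<n. scale (A i j) (b j))))"
      by (simp add: scale_right_diff_distrib sum_subtractf)
    also have "\<dots> \<in> N" 
    proof (intro sumN N(3))
      fix i assume i: "i \<in> {..<m}"
      then show "c i \<in> C" using c(1) by simp
      show "b' i - (\<Sum>j<n. scale (A i j) (b j)) \<in> N" using bspec[OF A i] by (rule conjunct2)
    qed
    finally have "scale (-1) (\<Sum>i<m. scale (c i) (b' i)) \<in> N"
      by (intro N(3) is_subfieldD(4)[OF C] is_subfieldD(2)[OF C])
    then have "0 - (\<Sum>i<m. scale (restrict c {..<m} i) (b' i)) \<in> N" by simp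
    moreover have "restrict c {..<m} \<in> {..<m} \<rightarrow>\<^sub>E C" using c(1) by simp
    moreover have "0 - (\<Sum>i<m. scale (restrict (\<lambda>_. 0) {..<m} i) (b' i)) \<in> N" using N(1) by simp
    moreover have "restrict (\<lambda>_. 0) {..<m} \<in> {..<m} \<rightarrow>\<^sub>E C" using is_subfieldD(1)[OF C] by simp
    ultimately have eq: "restrict c {..<m} = restrict (\<lambda>_. 0) {..<m}"
      by (intro Ex1_eq[OF bspec[OF b'(2) W]] conjI)
    have "c i = 0" if "i < m" for i using fun_cong[OF eq, of i] that by simp
    then show False using c(2) by blast
  qed
  from this[OF nm] this[OF nm(2,1)] show ?thesis by simp
qed

definition finite_dim :: "('a::field \<Rightarrow> 'b::ab_group_add \<Rightarrow> 'b) \<Rightarrow> 'b set \<Rightarrow> bool" where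
  "finite_dim s W \<longleftrightarrow> (\<exists>B. finite B \<and> W \<subseteq> module.span s B)"

context vector_space
begin

lemma fin_dim_subset: "finite_dim scale W \<Longrightarrow> N \<subseteq> W \<Longrightarrow> finite_dim scale N"
  unfolding finite_dim_def by blast

lemma fin_dim_independent: "finite_dim scale W \<Longrightarrow> B \<subseteq> W \<Longrightarrow> independent B \<Longrightarrow> finite B"
  unfolding finite_dim_def using independent_span_bound by blast

lemma fin_dim_basis:
  assumes "finite_dim scale W"
  obtains B where "finite B" "B \<subseteq> W" "independent B" "W \<subseteq> span B" "card B = dim W"
  using basis_exists[of W] fin_dim_independent[OF assms] by metis

lemma fin_dim_extend_basis:
  assumes "finite_dim scale W" "N \<subseteq> W"
  obtains B C where "finite B" "finite C" "B \<inter> C = {}" "B \<subseteq> N" "N \<subseteq> span B" "B \<union> C \<subseteq> W"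
    "independent (B \<union> C)" "W \<subseteq> span (B \<union> C)" "card B = dim N" "card B + card C = dim W"
proof -
  obtain B where B: "finite B" "B \<subseteq> N" "independent B" "N \<subseteq> span B" "card B = dim N"
    using fin_dim_basis[OF fin_dim_subset[OF assms]] .
  obtain D where D: "B \<subseteq> D" "D \<subseteq> W" "independent D" "W \<subseteq> span D"
    using maximal_independent_subset_extend[of B W] B assms(2) by blast
  have fin: "finite D" using fin_dim_independent[OF assms(1) D(2,3)] .
  have "card D = dim W" using basis_card_eq_dim D by blast
  moreover have "card D = card B + card (D - B)" using D(1) fin B(1) 
    by (simp add: card_Diff_subset card_mono)
  moreover have "B \<union> (D - B) = D" using D(1) by blast
  ultimately show ?thesis using that[of B "D - B"] B D fin by simp
qed

lemma dim_mono':
  assumes "finite_dim scale W" "N \<subseteq> W"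
  shows "dim N \<le> dim W"
  using fin_dim_extend_basis[OF assms] by (metis le_add1)

lemma has_quotient_dim_exists:
  assumes W: "subspace W" and N: "subspace N" "N \<subseteq> W" and fin: "finite_dim scale W"
  shows "has_quotient_dim UNIV scale W N (dim W - dim N)"
proof -
  obtain B C where BC: "finite B" "finite C" "B \<inter> C = {}" "B \<subseteq> N" "N \<subseteq> span B" "B \<union> C \<subseteq> W"
    "independent (B \<union> C)" "W \<subseteq> span (B \<union> C)" "card B = dim N" "card B + card C = dim W"
    using fin_dim_extend_basis[OF fin N(2)] .
  obtain e where e: "bij_betw e {..<card C} C"
    using BC(2) ex_bij_betw_nat_finite lessThan_atLeast0 by metis
  have spanB: "span B = N" using BC N by (meson span_minimal subset_antisym)
  have reindex: "(\<Sum>i<card C. scale (c i) (e i)) = (\<Sum>v\<in>C. scale (c (inv_into {..<card C} e v)) v)" for c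
    using sum.reindex_bij_betw[OF e, of "\<lambda>v. scale (c (inv_into {..<card C} e v)) v"] e
    by (simp add: bij_betw_inv_into_left)
  have zero: "c i = 0" if "(\<Sum>i<card C. scale (c i) (e i)) \<in> N" "i < card C" for c i
  proof -
    define c' where "c' v = c (inv_into {..<card C} e v)" for v
    have "(\<Sum>v\<in>C. scale (c' v) v) \<in> span B" using that(1) reindex[of c] spanB by (simp add: c'_def)
    then obtain a where a: "(\<Sum>v\<in>C. scale (c' v) v) = (\<Sum>v\<in>B. scale (a v) v)"
      using span_finite[OF BC(1)] by auto
    define u where "u v = (if v \<in> C then c' v else - a v)" for v
    have "(\<Sum>v\<in>B \<union> C. scale (u v) v) = (\<Sum>v\<in>B. scale (u v) v) + (\<Sum>v\<in>C. scale (u v) v)"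
      using BC by (simp add: sum.union_disjoint)
    also have "(\<Sum>v\<in>B. scale (u v) v) = - (\<Sum>v\<in>B. scale (a v) v)"
      unfolding sum_negf[symmetric] using BC(3) by (intro sum.cong) (auto simp: u_def)
    also have "(\<Sum>v\<in>C. scale (u v) v) = (\<Sum>v\<in>C. scale (c' v) v)"
      by (intro sum.cong) (auto simp: u_def)
    finally have "(\<Sum>v\<in>B \<union> C. scale (u v) v) = 0" using a by simp
    then have "u v = 0" if "v \<in> B \<union> C" for v
      using independentD[OF BC(7), of "B \<union> C" u v] BC(1,2) that by simp
    moreover have "e i \<in> C" using e that(2) by (auto simp: bij_betw_def)
    ultimately have "c' (e i) = 0" unfolding u_def by (metis UnCI)
    then show ?thesis using e that(2) by (simp add: c'_def bij_betw_inv_into_left)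
  qed
  have "\<exists>!c. c \<in> {..<card C} \<rightarrow>\<^sub>E UNIV \<and> w - (\<Sum>i<card C. scale (c i) (e i)) \<in> N" if w: "w \<in> W" for w
  proof (rule ex_ex1I)
    have "w \<in> span (B \<union> C)" using w BC by blast
    then obtain x y where xy: "w = x + y" "x \<in> span B" "y \<in> span C" unfolding span_Un by blast
    obtain a where a: "y = (\<Sum>v\<in>C. scale (a v) v)" using xy(3) span_finite[OF BC(2)] by auto
    have "(\<Sum>i<card C. scale (restrict (a \<circ> e) {..<card C} i) (e i)) = (\<Sum>i<card C. scale (a (e i)) (e i))"
      by simp
    also have "\<dots> = y" unfolding a using sum.reindex_bij_betw[OF e, of "\<lambda>v. scale (a v) v"] by simp
    finally show "\<exists>c. c \<in> {..<card C} \<rightarrow>\<^sub>E UNIV \<and> w - (\<Sum>i<card C. scale (c i) (e i)) \<in> N"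
      using xy spanB by (intro exI[of _ "restrict (a \<circ> e) {..<card C}"]) simp
  next
    fix c c' assume c: "c \<in> {..<card C} \<rightarrow>\<^sub>E UNIV \<and> w - (\<Sum>i<card C. scale (c i) (e i)) \<in> N"
      and c': "c' \<in> {..<card C} \<rightarrow>\<^sub>E UNIV \<and> w - (\<Sum>i<card C. scale (c' i) (e i)) \<in> N"
    then have "(w - (\<Sum>i<card C. scale (c' i) (e i))) - (w - (\<Sum>i<card C. scale (c i) (e i))) \<in> N"
      using subspace_diff[OF N(1)] by blast
    then have "(\<Sum>i<card C. scale (c i - c' i) (e i)) \<in> N"
      by (simp add: scale_left_diff_distrib sum_subtractf)
    then have "c i = c' i" if "i < card C" for i using zero[of "\<lambda>i. c i - c' i"] that by simp
    then show "c = c'" using c c' by (intro PiE_ext[of c _ _ c']) auto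
  qed
  moreover have "\<forall>i<card C. e i \<in> W" using e BC(6) by (auto simp: bij_betw_def)
  moreover have "dim W - dim N = card C" using BC by simp
  ultimately show ?thesis unfolding has_quotient_dim_def by (intro exI[of _ e]) simp
qed

lemma has_quotient_dim_iff:
  assumes W: "subspace W" and N: "subspace N" "N \<subseteq> W" and fin: "finite_dim scale W"
  shows "has_quotient_dim UNIV scale W N n \<longleftrightarrow> n = dim W - dim N"
proof
  assume "has_quotient_dim UNIV scale W N n"
  then show "n = dim W - dim N"
    using has_quotient_dim_exists[OF assms] N W
    by (intro has_quotient_dim_unique[of scale UNIV N W])
      (simp_all add: vector_space_axioms subspace_0 subspace_add subspace_scale)
qed (simp add: has_quotient_dim_exists assms)

end

text \<open>The assumptions say that \<open>f\<close> induces an isomorphism \<open>W/N \<rightarrow> W'/N'\<close>, which transports bases.\<close>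

lemma has_quotient_dim_transport:
  assumes s1: "vector_space s1" and s2: "Modules.module s2"
    and add: "\<And>x y. f (x + y) = f x + f y" and scale: "\<And>c x. f (s1 c x) = s2 c (f x)"
    and W: "\<And>x y. x \<in> W \<Longrightarrow> y \<in> W \<Longrightarrow> x + y \<in> W" "\<And>c x. x \<in> W \<Longrightarrow> s1 c x \<in> W" "0 \<in> W"
    and N': "\<And>x y. x \<in> N' \<Longrightarrow> y \<in> N' \<Longrightarrow> x + y \<in> N'" "\<And>x. x \<in> N' \<Longrightarrow> - x \<in> N'"
    and img: "\<And>w. w \<in> W \<Longrightarrow> f w \<in> W'" and surj: "\<And>w'. w' \<in> W' \<Longrightarrow> \<exists>w\<in>W. w' - f w \<in> N'"
    and ker: "\<And>w. w \<in> W \<Longrightarrow> f w \<in> N' \<longleftrightarrow> w \<in> N"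
    and n: "has_quotient_dim UNIV s1 W N n"
  shows "has_quotient_dim UNIV s2 W' N' n"
proof -
  interpret s1: vector_space s1 by fact
  interpret s2: Modules.module s2 by fact
  have f0: "f 0 = 0" using add[of 0 0] by simp
  have fm: "f (- x) = - f x" for x
    using add[of x "- x"] f0 by (simp add: eq_neg_iff_add_eq_0 add.commute)
  have fd: "f (x - y) = f x - f y" for x y using add[of x "- y"] fm by simp
  have fs: "f (\<Sum>i\<in>S. g i) = (\<Sum>i\<in>S. f (g i))" for S and g :: "nat \<Rightarrow> _"
    by (induction S rule: infinite_finite_induct) (auto simp: f0 add)
  obtain b where b: "\<forall>i<n. b i \<in> W"
      "\<forall>w\<in>W. \<exists>!c. c \<in> {..<n} \<rightarrow>\<^sub>E UNIV \<and> w - (\<Sum>i<n. s1 (c i) (b i)) \<in> N"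
    using n by (rule has_quotient_dimE)
  have sumW: "(\<Sum>i<m. s1 (c i) (b i)) \<in> W" if "m \<le> n" for c m
    using that by (induction m) (simp_all add: W b(1))
  show ?thesis unfolding has_quotient_dim_def
  proof (intro exI[of _ "f \<circ> b"] conjI allI impI ballI)
    fix i assume "i < n" then show "(f \<circ> b) i \<in> W'" using b(1) img by simp
  next
    fix w' assume "w' \<in> W'"
    then obtain w where w: "w \<in> W" "w' - f w \<in> N'" using surj by blast
    have "w' - (\<Sum>i<n. s2 (c i) ((f \<circ> b) i)) \<in> N' \<longleftrightarrow> w - (\<Sum>i<n. s1 (c i) (b i)) \<in> N" for c
    proof -
      have "w + s1 (-1) (\<Sum>i<n. s1 (c i) (b i)) \<in> W" by (intro W w(1) sumW order_refl)
      then have dW: "w - (\<Sum>i<n. s1 (c i) (b i)) \<in> W" by simp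
      have eq: "w' - (\<Sum>i<n. s2 (c i) ((f \<circ> b) i)) = (w' - f w) + f (w - (\<Sum>i<n. s1 (c i) (b i)))"
        by (simp add: fd fs scale)
      have "w' - (\<Sum>i<n. s2 (c i) ((f \<circ> b) i)) \<in> N' \<longleftrightarrow> f (w - (\<Sum>i<n. s1 (c i) (b i))) \<in> N'"
      proof
        assume "w' - (\<Sum>i<n. s2 (c i) ((f \<circ> b) i)) \<in> N'"
        from N'(1)[OF N'(2)[OF w(2)] this] show "f (w - (\<Sum>i<n. s1 (c i) (b i))) \<in> N'"
          unfolding eq by simp
      next
        assume "f (w - (\<Sum>i<n. s1 (c i) (b i))) \<in> N'"
        then show "w' - (\<Sum>i<n. s2 (c i) ((f \<circ> b) i)) \<in> N'"
          unfolding eq by (rule N'(1)[OF w(2)])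
      qed
      then show ?thesis using ker[OF dW] by simp
    qed
    then show "\<exists>!c. c \<in> {..<n} \<rightarrow>\<^sub>E UNIV \<and> w' - (\<Sum>i<n. s2 (c i) ((f \<circ> b) i)) \<in> N'"
      using bspec[OF b(2) w(1)] by simp
  qed
qed

lemma (in vector_space_pair) dim_quotient_iso:
  assumes f: "Vector_Spaces.linear s1 s2 f"
    and W: "vs1.subspace W" "vs1.subspace N" "N \<subseteq> W" "finite_dim s1 W"
    and W': "vs2.subspace W'" "vs2.subspace N'" "N' \<subseteq> W'" "finite_dim s2 W'"
    and img: "\<And>w. w \<in> W \<Longrightarrow> f w \<in> W'" and surj: "\<And>w'. w' \<in> W' \<Longrightarrow> \<exists>w\<in>W. w' - f w \<in> N'"
    and ker: "\<And>w. w \<in> W \<Longrightarrow> f w \<in> N' \<longleftrightarrow> w \<in> N"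
  shows "vs1.dim W + vs2.dim N' = vs2.dim W' + vs1.dim N"
proof -
  have add: "f (x + y) = f x + f y" and scale: "f (s1 c x) = s2 c (f x)" for c x y
    using f by (simp_all add: linear_add linear_scale)
  have "has_quotient_dim UNIV s2 W' N' (vs1.dim W - vs1.dim N)"
    by (rule has_quotient_dim_transport[OF vs1.vector_space_axioms vs2.module_axioms add scale
        vs1.subspace_add[OF W(1)] vs1.subspace_scale[OF W(1)] vs1.subspace_0[OF W(1)]
        vs2.subspace_add[OF W'(2)] vs2.subspace_neg[OF W'(2)] img surj ker vs1.has_quotient_dim_exists[OF W]])
  then have "vs1.dim W - vs1.dim N = vs2.dim W' - vs2.dim N'"
    using vs2.has_quotient_dim_iff[OF W'] by simp
  moreover have "vs1.dim N \<le> vs1.dim W" "vs2.dim N' \<le> vs2.dim W'"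
    using vs1.dim_mono'[OF W(4,3)] vs2.dim_mono'[OF W'(4,3)] .
  ultimately show ?thesis by linarith
qed

lemma (in vector_space_pair) dim_image_eq':
  assumes f: "Vector_Spaces.linear s1 s2 f" and W: "vs1.subspace W" "finite_dim s1 W"
  shows "vs1.dim W = vs2.dim (f ` W) + vs1.dim {w \<in> W. f w = 0}" "finite_dim s2 (f ` W)"
proof -
  obtain B where B: "finite B" "W \<subseteq> vs1.span B" using W(2) by (auto simp: finite_dim_def)
  have "f ` W \<subseteq> f ` vs1.span B" using B(2) by blast
  also have "\<dots> = vs2.span (f ` B)" by (rule linear_span_image[OF f, symmetric])
  finally show fin: "finite_dim s2 (f ` W)" unfolding finite_dim_def using B(1) by blast
  have zero: "vs2.dim {0} = 0" using vs2.dim_le_card[of "{0}" "{}"] by simp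
  have "vs1.dim W + vs2.dim {0} = vs2.dim (f ` W) + vs1.dim {w \<in> W. f w = 0}"
  proof (rule dim_quotient_iso[OF f W(1) _ _ W(2)])
    show "vs1.subspace {w \<in> W. f w = 0}"
      unfolding vs1.subspace_def using W(1)
      by (auto simp: vs1.subspace_0 vs1.subspace_add vs1.subspace_scale linear_add[OF f] linear_scale[OF f] linear_0[OF f])
    show "vs2.subspace (f ` W)" by (rule linear_subspace_image[OF f W(1)])
    then show "{0} \<subseteq> f ` W" using vs2.subspace_0 by blast
    show "vs2.subspace {0}" by simp
  qed (use fin in auto)
  then show "vs1.dim W = vs2.dim (f ` W) + vs1.dim {w \<in> W. f w = 0}" using zero by simp
qed

section \<open>Graded submodules of free modules\<close>

definition vscale :: "'k::field \<Rightarrow> 'k poly4 ^ 'r \<Rightarrow> 'k poly4 ^ 'r" where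
  "vscale c v = const_poly c *s v"

interpretation V: vector_space "vscale :: 'k::field \<Rightarrow> 'k poly4 ^ 'r \<Rightarrow> _"
  by unfold_locales
    (simp_all add: vscale_def Finite_Cartesian_Product.vec_eq_iff const_poly_add const_poly_mult algebra_simps)

interpretation VV: vector_space_pair "vscale :: 'k::field \<Rightarrow> 'k poly4 ^ 'r \<Rightarrow> _"
    "vscale :: 'k::field \<Rightarrow> 'k poly4 ^ 's \<Rightarrow> _"
  by unfold_locales

text \<open>The piece of degree \<open>n\<close> of the graded free module $\bigoplus_i S(e_i)$.\<close>

definition gr :: "('r \<Rightarrow> nat) \<Rightarrow> nat \<Rightarrow> ('k::field poly4 ^ 'r) set" where
  "gr e n = {v. \<forall>i. homogeneous (n + e i) (v $ i)}"

definition graded_submodule :: "('r \<Rightarrow> nat) \<Rightarrow> (nat \<Rightarrow> ('k::field poly4 ^ 'r) set) \<Rightarrow> bool" where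
  "graded_submodule e N \<longleftrightarrow>
     (\<forall>n. V.subspace (N n) \<and> N n \<subseteq> gr e n \<and> (\<forall>v\<in>N n. \<forall>i. var i *s v \<in> N (Suc n)))"

lemma vscale_nth [simp]: "vscale c v $ i = const_poly c * v $ i"
  by (simp add: vscale_def)

lemma subspace_gr [simp]: "V.subspace (gr e n)"
  by (auto simp: V.subspace_def gr_def intro: homogeneous_add homogeneous_const_mult)

lemma gr_mult: "homogeneous m f \<Longrightarrow> v \<in> gr e n \<Longrightarrow> f *s v \<in> gr e (n + m)"
  using homogeneous_mult[of m f] by (fastforce simp: gr_def ac_simps)

lemma graded_submodule_gr: "graded_submodule e (gr e)"
  using gr_mult[OF homogeneous_var(1)] by (auto simp: graded_submodule_def)

lemma dim_gr:
  fixes e :: "'r::finite \<Rightarrow> nat"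
  shows "finite_dim vscale (gr e n :: ('k::field poly4 ^ 'r) set)"
    and "V.dim (gr e n :: ('k poly4 ^ 'r) set) = (\<Sum>i\<in>UNIV. (n + e i + 3) choose 3)"
proof -
  define I where "I = (SIGMA i:UNIV. {m :: 4 \<Rightarrow>\<^sub>0 nat. total_degree m = n + e i})"
  define b :: "'r \<times> (4 \<Rightarrow>\<^sub>0 nat) \<Rightarrow> 'k poly4 ^ 'r" where "b p = axis (fst p) (Poly_Mapping.single (snd p) 1)" for p
  have fin: "finite I" unfolding I_def by (intro finite_SigmaI) (auto simp: card_monomials)
  have coeff: "Poly_Mapping.lookup ((\<Sum>p\<in>J. vscale (c p) (b p)) $ i) m = (if (i, m) \<in> J then c (i, m) else 0)"
    if "finite J" for J c i m
  proof -
    have "Poly_Mapping.lookup ((\<Sum>p\<in>J. vscale (c p) (b p)) $ i) m = (\<Sum>p\<in>J. if p = (i, m) then c p else 0)"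
      unfolding sum_component lookup_sum
      by (intro sum.cong refl) (auto simp: b_def axis_def lookup_single when_def)
    also have "\<dots> = (if (i, m) \<in> J then c (i, m) else 0)" using that by simp
    finally show ?thesis .
  qed
  have inj: "inj_on b I"
  proof
    fix p q assume "b p = b q"
    then have "Poly_Mapping.lookup (b p $ i) m = Poly_Mapping.lookup (b q $ i) m" for i m by simp
    from this[of "fst p" "snd p"] show "p = q"
      by (auto simp: b_def axis_def lookup_single when_def prod_eq_iff split: if_splits)
  qed
  have sub: "b ` I \<subseteq> gr e n"
    by (auto simp: I_def b_def gr_def axis_def homogeneous_single)
  have span: "gr e n \<subseteq> V.span (b ` I)"
  proof
    fix v :: "'k poly4 ^ 'r" assume v: "v \<in> gr e n"
    have "v = (\<Sum>p\<in>I. vscale (Poly_Mapping.lookup (v $ fst p) (snd p)) (b p))"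
    proof (intro Finite_Cartesian_Product.vec_eq_iff[THEN iffD2] allI poly_mapping_eqI)
      fix i m
      show "Poly_Mapping.lookup (v $ i) m =
          Poly_Mapping.lookup ((\<Sum>p\<in>I. vscale (Poly_Mapping.lookup (v $ fst p) (snd p)) (b p)) $ i) m"
        unfolding coeff[OF fin] using v by (auto simp: I_def gr_def homogeneous_iff)
    qed
    also have "\<dots> \<in> V.span (b ` I)"
      by (intro V.span_sum V.span_scale V.span_base imageI)
    finally show "v \<in> V.span (b ` I)" .
  qed
  have ind: "V.independent (b ` I)"
  proof (rule V.independent_if_scalars_zero)
    fix f x assume s: "(\<Sum>x\<in>b ` I. vscale (f x) x) = 0" and x: "x \<in> b ` I"
    have "(\<Sum>p\<in>I. vscale (f (b p)) (b p)) = 0" using s by (simp add: sum.reindex[OF inj])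
    then have "f (b (i, m)) = 0" if "(i, m) \<in> I" for i m
      using coeff[OF fin, of "\<lambda>p. f (b p)" i m] that by simp
    then show "f x = 0" using x by auto
  qed (use fin in simp)
  show "finite_dim vscale (gr e n :: ('k poly4 ^ 'r) set)"
    unfolding finite_dim_def using span fin by blast
  have "V.dim (gr e n :: ('k poly4 ^ 'r) set) = card (b ` I)"
    using V.basis_card_eq_dim[OF sub span ind] by simp
  also have "\<dots> = card I" using inj by (rule card_image)
  also have "\<dots> = (\<Sum>i\<in>UNIV. (n + e i + 3) choose 3)"
    unfolding I_def by (simp add: card_SigmaI card_monomials)
  finally show "V.dim (gr e n :: ('k poly4 ^ 'r) set) = (\<Sum>i\<in>UNIV. (n + e i + 3) choose 3)" .
qed

lemma graded_submoduleD:
  assumes "graded_submodule e N"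
  shows "V.subspace (N n)" "N n \<subseteq> gr e n" "v \<in> N n \<Longrightarrow> var i *s v \<in> N (Suc n)"
    "0 \<in> N n" "v \<in> N n \<Longrightarrow> w \<in> N n \<Longrightarrow> v + w \<in> N n" "v \<in> N n \<Longrightarrow> w \<in> N n \<Longrightarrow> v - w \<in> N n"
    "v \<in> N n \<Longrightarrow> vscale c v \<in> N n" "(\<And>i. i \<in> A \<Longrightarrow> g i \<in> N n) \<Longrightarrow> sum g A \<in> N n"
  using assms by (auto simp: graded_submodule_def intro: V.subspace_0 V.subspace_add V.subspace_diff
      V.subspace_scale V.subspace_sum)

lemma finite_dim_graded_submodule:
  "graded_submodule e N \<Longrightarrow> finite_dim vscale (N n)" for e :: "'r::finite \<Rightarrow> nat"
  using V.fin_dim_subset[OF dim_gr(1)] graded_submoduleD(2) by blast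

lemma sum_vmult: "(\<Sum>i\<in>A. f i) *s v = (\<Sum>i\<in>A. f i *s v)" for v :: "('a::comm_ring_1) ^ 'r"
  by (simp add: Finite_Cartesian_Product.vec_eq_iff sum_distrib_right)

lemma graded_submodule_mult:
  assumes N: "graded_submodule e N"
  shows "homogeneous m f \<Longrightarrow> v \<in> N n \<Longrightarrow> f *s v \<in> N (n + m)"
proof (induction m arbitrary: f)
  case 0
  then obtain c where "f = const_poly c" using homogeneous_0_imp_const by blast
  then show ?case using graded_submoduleD(7)[OF N 0(2)] by (simp add: vscale_def)
next
  case (Suc m)
  obtain g where g: "\<And>i. homogeneous m (g i)" "f = (\<Sum>i\<in>UNIV. var i * g i)"
    using homogeneous_Suc_split[OF Suc.prems(1)] by blast
  have "f *s v = (\<Sum>i\<in>UNIV. var i *s (g i *s v))"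
    unfolding g(2) sum_vmult by (simp add: vector_smult_assoc)
  also have "\<dots> \<in> N (Suc (n + m))"
    by (intro graded_submoduleD[OF N] Suc.IH g(1) Suc.prems)
  finally show ?case by simp
qed

subsection \<open>The ascending chain condition\<close>

lemma ex_incseq_subseq:
  fixes s :: "nat \<Rightarrow> nat"
  shows "\<exists>r. strict_mono r \<and> incseq (s \<circ> r)"
proof -
  obtain f where f: "strict_mono f" "monoseq (\<lambda>n. s (f n))" using seq_monosub[of s] by blast
  show ?thesis
  proof (cases "incseq (s \<circ> f)")
    case True then show ?thesis using f by blast
  next
    case False
    then have dec: "decseq (\<lambda>n. s (f n))" using f(2) by (auto simp: monoseq_iff comp_def)
    define L where "L = (LEAST x. \<exists>n. s (f n) = x)"
    have "\<exists>n. s (f n) = L" unfolding L_def by (rule LeastI_ex) auto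
    then obtain N where N: "s (f N) = L" ..
    have "s (f (n + N)) = L" for n
    proof (rule antisym)
      show "s (f (n + N)) \<le> L" using decseqD[OF dec, of N "n + N"] N by simp
      show "L \<le> s (f (n + N))" unfolding L_def by (rule Least_le) blast
    qed
    then have "incseq (s \<circ> (\<lambda>n. f (n + N)))" by (simp add: incseq_def)
    moreover have "strict_mono (\<lambda>n. f (n + N))" using f(1) by (simp add: strict_mono_def)
    ultimately show ?thesis by blast
  qed
qed

text \<open>Dickson's lemma: pass successively to subsequences along which one exponent increases weakly.\<close>

lemma dickson:
  fixes m :: "nat \<Rightarrow> ('n::finite \<Rightarrow>\<^sub>0 nat)"
  shows "\<exists>i j. i < j \<and> (\<exists>d. m j = m i + d)"
proof -
  have "\<exists>r. strict_mono r \<and> (\<forall>x\<in>X. incseq (\<lambda>n. Poly_Mapping.lookup (m (r n)) x))" if "finite X" for X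
    using that
  proof (induction X rule: finite_induct)
    case empty then show ?case using strict_mono_id by blast
  next
    case (insert x X)
    then obtain r where r: "strict_mono r" "\<And>x. x \<in> X \<Longrightarrow> incseq (\<lambda>n. Poly_Mapping.lookup (m (r n)) x)" by blast
    obtain q where q: "strict_mono q" "incseq ((\<lambda>n. Poly_Mapping.lookup (m (r n)) x) \<circ> q)"
      using ex_incseq_subseq by blast
    have "incseq (\<lambda>n. Poly_Mapping.lookup (m (r (q n))) y)" if "y \<in> X" for y
      using r(2)[OF that] strict_mono_mono[OF q(1)] by (auto simp: incseq_def mono_def)
    then show ?case using q r(1)
      by (intro exI[of _ "r \<circ> q"]) (auto simp: comp_def strict_mono_def)
  qed
  then obtain r where r: "strict_mono r" "\<And>x. incseq (\<lambda>n. Poly_Mapping.lookup (m (r n)) x)"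
    using finite_class.finite_UNIV by blast
  have "m (r 1) = m (r 0) + (m (r 1) - m (r 0))"
    using r(2) by (intro poly_mapping_eqI) (simp add: lookup_add lookup_minus incseq_def)
  moreover have "r 0 < r 1" using r(1) by (simp add: strict_mono_def)
  ultimately show ?thesis by blast
qed

lemma upset_chain_stabilises:
  fixes U :: "nat \<Rightarrow> ('n::finite \<Rightarrow>\<^sub>0 nat) set"
  assumes up: "\<And>j m d. m \<in> U j \<Longrightarrow> m + d \<in> U j" and mono: "\<And>j. U j \<subseteq> U (Suc j)"
  shows "\<exists>j0. \<forall>j\<ge>j0. U j = U j0"
proof (rule ccontr)
  assume "\<nexists>j0. \<forall>j\<ge>j0. U j = U j0"
  then have "\<forall>j0. \<exists>j\<ge>j0. U j \<noteq> U j0" by blast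
  moreover have mono': "U i \<subseteq> U j" if "i \<le> j" for i j by (rule lift_Suc_mono_le[of U, OF mono that])
  ultimately have "\<forall>j0. \<exists>j m. j \<ge> j0 \<and> m \<in> U j \<and> m \<notin> U j0" by blast
  then obtain g m where g: "\<And>j. g j \<ge> j" "\<And>j. m j \<in> U (g j)" "\<And>j. m j \<notin> U j" by metis
  define h where "h = rec_nat 0 (\<lambda>_. g)"
  have hSuc: "h (Suc n) = g (h n)" for n by (simp add: h_def)
  have hm: "h i \<le> h j" if "i \<le> j" for i j
    by (rule lift_Suc_mono_le[of h, OF _ that]) (simp add: hSuc g(1))
  obtain i j d where ij: "i < j" "m (h j) = m (h i) + d" using dickson[of "\<lambda>n. m (h n)"] by blast
  have "m (h i) \<in> U (h (Suc i))" using g(2) by (simp add: hSuc)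
  then have "m (h i) \<in> U (h j)" using mono'[OF hm[of "Suc i" j]] ij(1) by auto
  then have "m (h j) \<in> U (h j)" using up ij(2) by simp
  then show False using g(3) by blast
qed

lemma Max_keys_single_mult:
  fixes f :: "('n::{finite,linorder}, 'k::field) mpoly"
  assumes "f \<noteq> 0"
  shows "Poly_Mapping.single d 1 * f \<noteq> 0"
    and "Max (Poly_Mapping.keys (Poly_Mapping.single d 1 * f)) = d + Max (Poly_Mapping.keys f)"
proof -
  have "Poly_Mapping.keys (Poly_Mapping.single d 1 * f) = (+) d ` Poly_Mapping.keys f"
  proof
    show "Poly_Mapping.keys (Poly_Mapping.single d 1 * f) \<subseteq> (+) d ` Poly_Mapping.keys f"
      using keys_mult[of "Poly_Mapping.single d 1" f] by (auto split: if_splits)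
    show "(+) d ` Poly_Mapping.keys f \<subseteq> Poly_Mapping.keys (Poly_Mapping.single d 1 * f)"
      by (auto simp: in_keys_iff lookup_single_mult)
  qed
  moreover have ne: "Poly_Mapping.keys f \<noteq> {}"
    using assms by simp
  moreover have "mono ((+) d)" by (simp add: mono_def add_left_mono)
  ultimately show "Max (Poly_Mapping.keys (Poly_Mapping.single d 1 * f)) = d + Max (Poly_Mapping.keys f)"
    using mono_Max_commute[of "(+) d" "Poly_Mapping.keys f"] by simp
  show "Poly_Mapping.single d 1 * f \<noteq> 0"
    using assms by (metis mult_eq_0_iff lookup_single_eq lookup_zero zero_neq_one)
qed

text \<open>Gordan's argument: a chain of submodules stabilises with its leading exponents, because
  subtracting a multiple of an element with the same leading exponent lowers that exponent, and
  there are only finitely many exponents of a given degree.  Several coordinates are treated by induction,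
  comparing leading exponents in one of them and passing to the kernel of that coordinate.\<close>

lemma graded_submodule_chain_stabilises:
  fixes e :: "'r::finite \<Rightarrow> nat" and N :: "nat \<Rightarrow> nat \<Rightarrow> ('k::field poly4 ^ 'r) set"
  assumes "\<And>j. graded_submodule e (N j)" "\<And>j n. N j n \<subseteq> N (Suc j) n"
  shows "\<exists>j0. \<forall>j\<ge>j0. N j = N j0"
proof -
  have "\<exists>j0. \<forall>j\<ge>j0. N j = N j0"
    if "finite A" "\<And>j. graded_submodule e (N j)" "\<And>j n. N j n \<subseteq> N (Suc j) n"
      "\<And>j n v i. v \<in> N j n \<Longrightarrow> i \<notin> A \<Longrightarrow> v $ i = 0"
    for A and N :: "nat \<Rightarrow> nat \<Rightarrow> ('k poly4 ^ 'r) set"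
    using that
  proof (induction A arbitrary: N rule: finite_induct)
    case empty
    have "N j n = {0}" for j n
      using empty(3) graded_submoduleD(4)[OF empty(1)] by (auto simp: Finite_Cartesian_Product.vec_eq_iff)
    then show ?case by (simp add: fun_eq_iff)
  next
    case (insert a A)
    note N = insert.prems(1)
    have mono: "N i n \<subseteq> N j n" if "i \<le> j" for i j n
      by (rule lift_Suc_mono_le[of "\<lambda>j. N j n", OF insert.prems(2) that])
    define K where "K j n = {v \<in> N j n. v $ a = 0}" for j n
    define U where "U j = {Max (Poly_Mapping.keys (v $ a)) | v n. v \<in> N j n \<and> v $ a \<noteq> 0}" for j
    have "\<exists>j0. \<forall>j\<ge>j0. K j = K j0"
    proof (rule insert.IH)
      show "graded_submodule e (K j)" for j
        unfolding graded_submodule_def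
      proof (intro allI conjI ballI)
        show "V.subspace (K j n)" for n
          unfolding V.subspace_def K_def using graded_submoduleD(4,5,7)[OF N] by simp
        show "K j n \<subseteq> gr e n" for n using graded_submoduleD(2)[OF N, of j n] by (auto simp: K_def)
      qed (use graded_submoduleD(3)[OF N] in \<open>auto simp: K_def\<close>)
      show "K j n \<subseteq> K (Suc j) n" for j n using insert.prems(2)[of j n] by (auto simp: K_def)
      show "v $ i = 0" if "v \<in> K j n" "i \<notin> A" for j n and v :: "'k poly4 ^ 'r" and i
        using that insert.prems(3)[of v j n i] by (cases "i = a") (auto simp: K_def)
    qed
    then obtain j1 where j1: "\<And>j. j \<ge> j1 \<Longrightarrow> K j = K j1" by blast
    have "\<exists>j0. \<forall>j\<ge>j0. U j = U j0"
    proof (rule upset_chain_stabilises)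
      fix j m d assume "m \<in> U j"
      then obtain v n where v: "v \<in> N j n" "v $ a \<noteq> 0" "m = Max (Poly_Mapping.keys (v $ a))"
        by (auto simp: U_def)
      have "Poly_Mapping.single d 1 *s v \<in> N j (n + total_degree d)"
        using graded_submodule_mult[OF N homogeneous_single v(1)] by blast
      then show "m + d \<in> U j"
        unfolding U_def using Max_keys_single_mult[OF v(2), of d] v(3)
        by (auto intro!: exI[of _ "Poly_Mapping.single d 1 *s v"] exI[of _ "n + total_degree d"] simp: add.commute)
    next
      show "U j \<subseteq> U (Suc j)" for j using insert.prems(2)[of j] by (fastforce simp: U_def)
    qed
    then obtain j2 where j2: "\<And>j. j \<ge> j2 \<Longrightarrow> U j = U j2" by blast
    define j0 where "j0 = max j1 j2"
    have "v \<in> N j0 n" if j: "j \<ge> j0" and v: "v \<in> N j n" for v j n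
    proof -
      have KU: "K j = K j0" "U j = U j0"
        using j1[of j] j1[of j0] j2[of j] j2[of j0] j unfolding j0_def by simp_all
      show ?thesis using v
    proof (induction "card {m :: 4 \<Rightarrow>\<^sub>0 nat. total_degree m = n + e a \<and> m < Max (Poly_Mapping.keys (v $ a))}"
        arbitrary: v rule: less_induct)
      case less
      show ?case
      proof (cases "v $ a = 0")
        case True
        then have "v \<in> K j n" using less.prems by (simp add: K_def)
        then have "v \<in> K j0 n" by (simp only: KU)
        then show ?thesis by (simp add: K_def)
      next
        case False
        let ?m = "\<lambda>v :: 'k poly4 ^ 'r. Max (Poly_Mapping.keys (v $ a))"
        have "?m v \<in> U j" unfolding U_def using less.prems False by blast
        then have "?m v \<in> U j0" by (simp only: KU)
        then obtain w n' where w: "w \<in> N j0 n'" "w $ a \<noteq> 0" "?m w = ?m v" by (auto simp: U_def)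
        have in_keys: "?m u \<in> Poly_Mapping.keys (u $ a)" if "u $ a \<noteq> 0" for u :: "'k poly4 ^ 'r"
          using that by (intro Max_in) simp_all
        have hom: "homogeneous (k + e a) (u $ a)" if "u \<in> N i k" for u i k
          using graded_submoduleD(2)[OF N] that by (auto simp: gr_def)
        have "n' + e a = n + e a"
          using hom[OF less.prems] hom[OF w(1)] in_keys[OF False] in_keys[OF w(2)] w(3)
          by (auto simp: homogeneous_def)
        then have w': "w \<in> N j n" "w \<in> N j0 n" using w(1) mono[OF j] by auto
        define c where "c = Poly_Mapping.lookup (v $ a) (?m v) / Poly_Mapping.lookup (w $ a) (?m v)"
        define u where "u = v - vscale c w"
        have u: "u \<in> N j n" unfolding u_def using w' less.prems by (intro graded_submoduleD[OF N])
        have "Poly_Mapping.lookup (w $ a) (?m v) \<noteq> 0" using in_keys[OF w(2)] w(3) by (simp add: in_keys_iff)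
        then have u0: "Poly_Mapping.lookup (u $ a) (?m v) = 0"
          by (simp add: u_def c_def lookup_minus)
        have "u \<in> N j0 n"
        proof (cases "u $ a = 0")
          case True
          then have "u \<in> K j n" using u by (simp add: K_def)
          then have "u \<in> K j0 n" by (simp only: KU)
          then show ?thesis by (simp add: K_def)
        next
          case uF: False
          have "k \<le> ?m v" if "k \<in> Poly_Mapping.keys (u $ a)" for k
          proof -
            have "k \<in> Poly_Mapping.keys (v $ a) \<or> k \<in> Poly_Mapping.keys (w $ a)"
              using that by (auto simp: in_keys_iff u_def lookup_minus)
            then show ?thesis using w(3) by (metis Max_ge finite_keys)
          qed
          then have lt: "?m u < ?m v"
            using in_keys[OF uF] u0 by (metis in_keys_iff order_le_less)
          have "total_degree (?m u) = n + e a" using hom[OF u] in_keys[OF uF] by (simp add: homogeneous_def)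
          then have "{m. total_degree m = n + e a \<and> m < ?m u} \<subset> {m. total_degree m = n + e a \<and> m < ?m v}"
            using lt by (auto dest: order_less_trans)
          moreover have "finite {m :: 4 \<Rightarrow>\<^sub>0 nat. total_degree m = n + e a \<and> m < ?m v}"
            by (rule finite_subset[OF _ card_monomials(2)]) auto
          ultimately show ?thesis using psubset_card_mono less.hyps u by blast
        qed
        then have "u + vscale c w \<in> N j0 n" using w'(2) by (intro graded_submoduleD[OF N])
        then show ?thesis by (simp add: u_def)
      qed
    qed
    qed
    then have "N j = N j0" if "j \<ge> j0" for j using mono[OF that] that by (intro ext) blast
    then show ?case by blast
  qed
  from this[of UNIV N] show ?thesis using assms by simp
qed

text \<open>Generation in bounded degree: the submodules \<open>G j\<close> generated by the elements of degree at most \<open>j\<close>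
  form a chain, so they are all equal for large \<open>j\<close>.\<close>

lemma graded_submodule_generated:
  fixes e :: "'r::finite \<Rightarrow> nat" and N :: "nat \<Rightarrow> ('k::field poly4 ^ 'r) set"
  assumes N: "graded_submodule e N"
  shows "\<exists>D. \<forall>n\<ge>D. N (Suc n) \<subseteq> V.span (\<Union>i. (*s) (var i) ` N n)"
proof -
  define G where "G j = rec_nat (N 0) (\<lambda>n X. if Suc n \<le> j then N (Suc n) else V.span (\<Union>i. (*s) (var i) ` X))" for j
  have G0: "G j 0 = N 0" and GS: "G j (Suc n) = (if Suc n \<le> j then N (Suc n) else V.span (\<Union>i. (*s) (var i) ` G j n))" for j n
    by (simp_all add: G_def)
  have low: "G j n = N n" if "n \<le> j" for j n using that by (cases n) (simp_all add: G0 GS)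
  have sub: "V.subspace (G j n) \<and> G j n \<subseteq> N n" for j n
  proof (induction n)
    case (Suc n)
    have "(\<Union>i. (*s) (var i) ` G j n) \<subseteq> N (Suc n)" using Suc graded_submoduleD(3)[OF N] by blast
    then show ?case using graded_submoduleD(1)[OF N] by (auto simp: GS dest: V.span_minimal)
  qed (simp add: G0 graded_submoduleD(1)[OF N])
  have "\<exists>j0. \<forall>j\<ge>j0. G j = G j0"
  proof (rule graded_submodule_chain_stabilises[of e])
    show "graded_submodule e (G j)" for j
      unfolding graded_submodule_def
    proof (intro allI conjI ballI)
      fix n v i assume v: "v \<in> G j n"
      show "var i *s v \<in> G j (Suc n)"
      proof (cases "Suc n \<le> j")
        case True then show ?thesis using v sub[of j n] graded_submoduleD(3)[OF N, of v n i] by (auto simp: GS)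
      next
        case False then show ?thesis using v by (auto simp: GS intro!: V.span_base)
      qed
    qed (use sub graded_submoduleD(2)[OF N] in blast)+
    fix j n show "G j n \<subseteq> G (Suc j) n"
    proof (induction n)
      case (Suc n)
      show ?case
      proof (cases "Suc n \<le> Suc j")
        case True then show ?thesis using low[of "Suc n" "Suc j"] sub by simp
      next
        case False
        then have "G j (Suc n) = V.span (\<Union>i. (*s) (var i) ` G j n)"
          "G (Suc j) (Suc n) = V.span (\<Union>i. (*s) (var i) ` G (Suc j) n)" by (simp_all add: GS)
        moreover have "(\<Union>i. (*s) (var i) ` G j n) \<subseteq> (\<Union>i. (*s) (var i) ` G (Suc j) n)"
          using Suc by blast
        ultimately show ?thesis by (simp only: V.span_mono)
      qed
    qed (simp add: G0)
  qed
  then obtain D where D: "\<And>j. j \<ge> D \<Longrightarrow> G j = G D" by blast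
  have "N (Suc n) \<subseteq> V.span (\<Union>i. (*s) (var i) ` N n)" if "n \<ge> D" for n
  proof -
    have "N (Suc n) = G D (Suc n)" using low[of "Suc n" "Suc n"] D[of "Suc n"] that by simp
    moreover have "G D n = N n" using low[of n n] D[OF that] by simp
    ultimately show ?thesis using that by (simp add: GS)
  qed
  then show ?thesis by blast
qed

subsection \<open>Saturation\<close>

text \<open>The elements killed modulo \<open>N\<close> by a power of the irrelevant ideal; they define the zero section of the
  sheaf associated with the quotient by \<open>N\<close>.\<close>

definition sat :: "('r \<Rightarrow> nat) \<Rightarrow> (nat \<Rightarrow> ('k::field poly4 ^ 'r) set) \<Rightarrow> nat \<Rightarrow> ('k poly4 ^ 'r) set" where
  "sat e N n = {v \<in> gr e n. \<exists>k. \<forall>f. homogeneous k f \<longrightarrow> f *s v \<in> N (n + k)}"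

lemma mult_mem_le:
  assumes N: "graded_submodule e N" and k: "\<And>f. homogeneous k f \<Longrightarrow> f *s v \<in> N (n + k)"
    and "k \<le> l" "homogeneous l f"
  shows "f *s v \<in> N (n + l)"
proof -
  have "f *s v \<in> N (n + (k + d))" if "homogeneous (k + d) f" for d f
    using that
  proof (induction d arbitrary: f)
    case 0 then show ?case using k by simp
  next
    case (Suc d)
    obtain g where g: "\<And>i. homogeneous (k + d) (g i)" "f = (\<Sum>i\<in>UNIV. var i * g i)"
      using homogeneous_Suc_split[of "k + d" f] Suc.prems by auto
    have "f *s v = (\<Sum>i\<in>UNIV. var i *s (g i *s v))"
      unfolding g(2) sum_vmult by (simp add: vector_smult_assoc)
    also have "\<dots> \<in> N (Suc (n + (k + d)))"
      by (intro graded_submoduleD[OF N] Suc.IH g(1))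
    finally show ?case by simp
  qed
  from this[of "l - k" f] show ?thesis using assms(3,4) by simp
qed

lemma satI_powers:
  fixes v :: "'k::field poly4 ^ 'r"
  assumes N: "graded_submodule e N" and v: "v \<in> gr e n" and K: "\<And>i. \<exists>K. var i ^ K *s v \<in> N (n + K)"
  shows "v \<in> sat e N n"
proof -
  obtain K where K: "\<And>i. var i ^ K i *s v \<in> N (n + K i)" using K by metis
  define M where "M = (\<Sum>i\<in>UNIV. K i)"
  have M: "var i ^ M *s v \<in> N (n + M)" for i
  proof -
    have "K i \<le> M" unfolding M_def by (rule member_le_sum) auto
    have "homogeneous (M - K i) (var i ^ (M - K i) :: 'k poly4)"
      using homogeneous_power[OF homogeneous_var(2)[of i], of "M - K i"] by simp
    from graded_submodule_mult[OF N this K[of i]]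
    show ?thesis using \<open>K i \<le> M\<close> by (simp add: vector_smult_assoc power_add[symmetric])
  qed
  \<comment> \<open>every monomial of this degree contains one of the powers \<open>var i ^ M\<close>\<close>
  define k where "k = 4 * M + 1"
  have "f *s v \<in> N (n + k)" if f: "homogeneous k f" for f
  proof -
    obtain g where g: "\<And>i. homogeneous (k - M) (g i)" "f = (\<Sum>i\<in>UNIV. var i ^ M * g i)"
    proof -
      have "card (UNIV :: 4 set) * (M - 1) < k" by (simp add: k_def)
      from homogeneous_split_powers[OF f this] show ?thesis using that by blast
    qed
    have "f *s v = (\<Sum>i\<in>UNIV. g i *s (var i ^ M *s v))"
      unfolding g(2) sum_vmult by (simp add: vector_smult_assoc mult.commute)
    also have "\<dots> \<in> N (n + M + (k - M))"
      by (intro graded_submoduleD(8)[OF N] graded_submodule_mult[OF N] g(1) M)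
    also have "n + M + (k - M) = n + k" by (simp add: k_def)
    finally show ?thesis .
  qed
  then show ?thesis using v by (auto simp: sat_def)
qed

lemma sat_incl: "graded_submodule e N \<Longrightarrow> N n \<subseteq> sat e N n"
  using graded_submoduleD(2)[of e N n] graded_submodule_mult[of e N 0 _ _ n]
  by (auto simp: sat_def intro!: exI[of _ 0])

lemma graded_submodule_sat:
  assumes N: "graded_submodule e N"
  shows "graded_submodule e (sat e N)"
  unfolding graded_submodule_def
proof (intro allI conjI ballI)
  fix n
  show "sat e N n \<subseteq> gr e n" by (auto simp: sat_def)
  show "V.subspace (sat e N n)"
    unfolding V.subspace_def
  proof (intro conjI ballI allI)
    show "0 \<in> sat e N n"
      using graded_submoduleD(4)[OF N] graded_submoduleD(4)[OF graded_submodule_gr] by (auto simp: sat_def)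
    fix v assume "v \<in> sat e N n"
    then obtain k where v: "v \<in> gr e n" and k: "\<And>f. homogeneous k f \<Longrightarrow> f *s v \<in> N (n + k)"
      by (auto simp: sat_def)
    show "vscale c v \<in> sat e N n" for c
    proof -
      have "f *s vscale c v \<in> N (n + k)" if "homogeneous k f" for f
      proof -
        have "f *s vscale c v = vscale c (f *s v)" by (simp add: Finite_Cartesian_Product.vec_eq_iff ac_simps)
        then show ?thesis using graded_submoduleD(7)[OF N k[OF that]] by simp
      qed
      then show ?thesis using graded_submoduleD(7)[OF graded_submodule_gr v] by (auto simp: sat_def)
    qed
    fix w assume "w \<in> sat e N n"
    then obtain l where w: "w \<in> gr e n" and l: "\<And>f. homogeneous l f \<Longrightarrow> f *s w \<in> N (n + l)"
      by (auto simp: sat_def)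
    have "f *s (v + w) \<in> N (n + max k l)" if f: "homogeneous (max k l) f" for f
      unfolding vector_add_ldistrib
      by (intro graded_submoduleD(5)[OF N] mult_mem_le[OF N k _ f] mult_mem_le[OF N l _ f]) auto
    then show "v + w \<in> sat e N n"
      using graded_submoduleD(5)[OF graded_submodule_gr v w] by (auto simp: sat_def)
  qed
  fix v i assume "v \<in> sat e N n"
  then obtain k where v: "v \<in> gr e n" and k: "\<And>f. homogeneous k f \<Longrightarrow> f *s v \<in> N (n + k)"
    by (auto simp: sat_def)
  have "f *s (var i *s v) \<in> N (Suc n + k)" if f: "homogeneous k f" for f
    using graded_submoduleD(3)[OF N k[OF f], of i] by (simp add: vector_smult_assoc mult.commute)
  then show "var i *s v \<in> sat e N (Suc n)"
    using graded_submoduleD(3)[OF graded_submodule_gr v] by (auto simp: sat_def)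
qed

text \<open>The saturation is generated in degree at most some \<open>D\<close>, and a single power of the
  irrelevant ideal moves its piece of degree \<open>D\<close> into the submodule.\<close>

lemma sat_eventually:
  fixes e :: "'r::finite \<Rightarrow> nat" and N :: "nat \<Rightarrow> ('k::field poly4 ^ 'r) set"
  assumes N: "graded_submodule e N"
  shows "\<exists>n0. \<forall>n\<ge>n0. sat e N n = N n"
proof -
  let ?P = "sat e N"
  note P = graded_submodule_sat[OF N]
  obtain D where D: "\<And>n. n \<ge> D \<Longrightarrow> ?P (Suc n) \<subseteq> V.span (\<Union>i. (*s) (var i) ` ?P n)"
    using graded_submodule_generated[OF P] by blast
  obtain B where B: "finite B" "B \<subseteq> ?P D" "?P D \<subseteq> V.span B"
    by (rule V.fin_dim_basis[OF finite_dim_graded_submodule[OF P, of D]])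
  have "\<forall>v\<in>B. \<exists>k. \<forall>f. homogeneous k f \<longrightarrow> f *s v \<in> N (D + k)" using B(2) by (auto simp: sat_def)
  then obtain k where k: "\<And>v f. v \<in> B \<Longrightarrow> homogeneous (k v) f \<Longrightarrow> f *s v \<in> N (D + k v)" by metis
  define K where "K = (\<Sum>v\<in>B. k v)"
  have mem: "f *s v \<in> N (D + l)" if f: "homogeneous l f" and l: "K \<le> l" and v: "v \<in> ?P D" for f v l
  proof -
    have "B \<subseteq> {v. f *s v \<in> N (D + l)}"
    proof safe
      fix v assume v: "v \<in> B"
      then have "k v \<le> l" using l member_le_sum[of v B k] B(1) by (simp add: K_def)
      from mult_mem_le[OF N k[OF v] this f] show "f *s v \<in> N (D + l)" .
    qed
    moreover have "V.subspace {v. f *s v \<in> N (D + l)}"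
      unfolding V.subspace_def
    proof (intro conjI ballI allI)
      show "0 \<in> {v. f *s v \<in> N (D + l)}" using graded_submoduleD(4)[OF N] by simp
      fix v assume v: "v \<in> {v. f *s v \<in> N (D + l)}"
      show "vscale c v \<in> {v. f *s v \<in> N (D + l)}" for c
      proof -
        have "f *s vscale c v = vscale c (f *s v)" by (simp add: Finite_Cartesian_Product.vec_eq_iff ac_simps)
        then show ?thesis using graded_submoduleD(7)[OF N] v by simp
      qed
      fix w assume "w \<in> {v. f *s v \<in> N (D + l)}"
      then show "v + w \<in> {v. f *s v \<in> N (D + l)}"
        using v graded_submoduleD(5)[OF N] by (simp add: vector_add_ldistrib)
    qed
    ultimately have "V.span B \<subseteq> {v. f *s v \<in> N (D + l)}" by (rule V.span_minimal)
    then show ?thesis using v B(3) by blast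
  qed
  have gen: "?P (D + n) \<subseteq> V.span {f *s v | f v. homogeneous n f \<and> v \<in> ?P D}" for n
  proof (induction n)
    case 0
    have "v = 1 *s v \<and> homogeneous 0 (1 :: 'k poly4)" for v :: "'k poly4 ^ 'r" by simp
    then have "?P D \<subseteq> {f *s v | f v. homogeneous 0 f \<and> v \<in> ?P D}" by blast
    also have "\<dots> \<subseteq> V.span {f *s v | f v. homogeneous 0 f \<and> v \<in> ?P D}" by (rule V.span_superset)
    finally show ?case by simp
  next
    case (Suc n)
    let ?S = "\<lambda>n. {f *s v | f v. homogeneous n f \<and> v \<in> ?P D}"
    have "var i *s v \<in> V.span (?S (Suc n))" if "v \<in> V.span (?S n)" for i v
      using that
    proof (induction rule: V.span_induct_alt)
      case base then show ?case by (simp add: V.span_zero)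
    next
      case (step c x y)
      then obtain f v where fv: "x = f *s v" "homogeneous n f" "v \<in> ?P D" by blast
      have "var i *s x \<in> ?S (Suc n)"
        using homogeneous_mult[OF homogeneous_var(1) fv(2), of i] fv
        by (auto simp: vector_smult_assoc intro!: exI[of _ "var i * f"] exI[of _ v])
      moreover have "var i *s (vscale c x + y) = vscale c (var i *s x) + var i *s y"
        by (simp add: Finite_Cartesian_Product.vec_eq_iff algebra_simps)
      ultimately show ?case using step by (simp add: V.span_add V.span_scale V.span_base)
    qed
    then have "(\<Union>i. (*s) (var i) ` ?P (D + n)) \<subseteq> V.span (?S (Suc n))" using Suc by blast
    then have "V.span (\<Union>i. (*s) (var i) ` ?P (D + n)) \<subseteq> V.span (?S (Suc n))"
      by (intro V.span_minimal) auto
    then show ?case using D[of "D + n"] by fastforce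
  qed
  have "?P n \<subseteq> N n" if "n \<ge> D + K" for n
  proof -
    have "{f *s v | f v. homogeneous (n - D) f \<and> v \<in> ?P D} \<subseteq> N (D + (n - D))"
      using mem[of "n - D"] that by auto
    then have "V.span {f *s v | f v. homogeneous (n - D) f \<and> v \<in> ?P D} \<subseteq> N (D + (n - D))"
      using graded_submoduleD(1)[OF N] by (rule V.span_minimal)
    then show ?thesis using gen[of "n - D"] that by auto
  qed
  then show ?thesis using sat_incl[OF N] by blast
qed

lemma sat_sat:
  fixes e :: "'r::finite \<Rightarrow> nat" and N :: "nat \<Rightarrow> ('k::field poly4 ^ 'r) set"
  assumes N: "graded_submodule e N"
  shows "sat e (sat e N) n = sat e N n"
proof
  obtain n0 where n0: "\<And>n. n \<ge> n0 \<Longrightarrow> sat e N n = N n" using sat_eventually[OF N] by blast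
  show "sat e (sat e N) n \<subseteq> sat e N n"
  proof
    fix v assume "v \<in> sat e (sat e N) n"
    then obtain k where v: "v \<in> gr e n" and k: "\<And>f. homogeneous k f \<Longrightarrow> f *s v \<in> sat e N (n + k)"
      by (auto simp: sat_def)
    have "f *s v \<in> N (n + (k + n0))" if "homogeneous (k + n0) f" for f
      using mult_mem_le[OF graded_submodule_sat[OF N] k _ that] n0[of "n + (k + n0)"] by simp
    then show "v \<in> sat e N n" using v by (auto simp: sat_def)
  qed
qed (rule sat_incl[OF graded_submodule_sat[OF N]])

subsection \<open>Linear forms which are not zero divisors\<close>

text \<open>By Vandermonde, any four of these linear forms span all linear forms.\<close>

definition lin :: "'k::field \<Rightarrow> 'k poly4" where
  "lin \<alpha> = var 0 + const_poly \<alpha> * var 1 + const_poly (\<alpha> ^ 2) * var 2 + const_poly (\<alpha> ^ 3) * var 3"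

lemma homogeneous_lin [simp]: "homogeneous (Suc 0) (lin \<alpha>)"
  unfolding lin_def by (intro homogeneous_add homogeneous_const_mult homogeneous_var)

lemma UNIV_4_eq: "(UNIV :: 4 set) = {0, 1, 2, 3}"
  unfolding UNIV_4 by auto

lemma lin_span:
  fixes v :: "'k::field poly4 ^ 'r"
  assumes X: "V.subspace X" and "finite \<Lambda>" "card \<Lambda> = 4" and lin: "\<And>\<alpha>. \<alpha> \<in> \<Lambda> \<Longrightarrow> lin \<alpha> *s v \<in> X"
  shows "var i *s v \<in> X"
proof -
  obtain a b c d where "\<Lambda> = {a, b, c, d}" and ne: "a \<noteq> b" "b \<noteq> c" "c \<noteq> d"
    using \<open>card \<Lambda> = 4\<close> by (auto simp: card_Suc_eq numeral_eq_Suc)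
  then have L: "lin a *s v \<in> X" "lin b *s v \<in> X" "lin c *s v \<in> X" "lin d *s v \<in> X"
    using lin by auto
  have abc: "a \<noteq> c" "a \<noteq> d" "b \<noteq> d" using \<open>card \<Lambda> = 4\<close> \<open>\<Lambda> = _\<close> by (auto simp: card_insert_if split: if_splits)
  have unscale: "x \<in> X" if "vscale t x \<in> X" "t \<noteq> 0" for x t
    using V.subspace_scale[OF X that(1), of "inverse t"] that(2) by simp
  define w where "w i = var i *s v" for i
  define g where "g x y = w 1 + vscale (x + y) (w 2) + vscale (x ^ 2 + x * y + y ^ 2) (w 3)" for x y
  define h where "h x y z = w 2 + vscale (x + y + z) (w 3)" for x y z
  have g: "g x y \<in> X" if "lin x *s v \<in> X" "lin y *s v \<in> X" "x \<noteq> y" for x y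
  proof (rule unscale)
    have "vscale (x - y) (g x y) = lin x *s v - lin y *s v"
      by (simp add: g_def w_def lin_def Finite_Cartesian_Product.vec_eq_iff const_poly_add const_poly_mult const_poly_diff
          power2_eq_square power3_eq_cube algebra_simps)
    then show "vscale (x - y) (g x y) \<in> X" using V.subspace_diff[OF X that(1,2)] by simp
  qed (use that in simp)
  have h: "h x y z \<in> X" if "g x y \<in> X" "g x z \<in> X" "y \<noteq> z" for x y z
  proof (rule unscale)
    have "vscale (y - z) (h x y z) = g x y - g x z"
      by (simp add: g_def h_def Finite_Cartesian_Product.vec_eq_iff const_poly_add const_poly_mult const_poly_diff
          power2_eq_square power3_eq_cube algebra_simps)
    then show "vscale (y - z) (h x y z) \<in> X" using V.subspace_diff[OF X that(1,2)] by simp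
  qed (use that in simp)
  have hs: "h a b c \<in> X" "h a b d \<in> X" and gs: "g a b \<in> X" using g h L ne abc by blast+
  have w3: "w 3 \<in> X"
  proof (rule unscale)
    have "vscale (c - d) (w 3) = h a b c - h a b d"
      by (simp add: h_def Finite_Cartesian_Product.vec_eq_iff const_poly_add const_poly_diff algebra_simps)
    then show "vscale (c - d) (w 3) \<in> X" using V.subspace_diff[OF X hs] by simp
  qed (use ne in simp)
  have "w 2 = h a b c - vscale (a + b + c) (w 3)" by (simp add: h_def)
  then have w2: "w 2 \<in> X" using hs w3 by (simp add: V.subspace_diff[OF X] V.subspace_scale[OF X])
  have "w 1 = g a b - vscale (a + b) (w 2) - vscale (a ^ 2 + a * b + b ^ 2) (w 3)" by (simp add: g_def)
  then have w1: "w 1 \<in> X" using gs w2 w3 by (simp add: V.subspace_diff[OF X] V.subspace_scale[OF X])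
  have "w 0 = lin a *s v - vscale a (w 1) - vscale (a ^ 2) (w 2) - vscale (a ^ 3) (w 3)"
    by (simp add: lin_def w_def Finite_Cartesian_Product.vec_eq_iff algebra_simps)
  then have w0: "w 0 \<in> X" using L w1 w2 w3 by (simp add: V.subspace_diff[OF X] V.subspace_scale[OF X])
  have "i \<in> {0, 1, 2, 3}" using UNIV_4_eq by blast
  then show ?thesis using w0 w1 w2 w3 by (auto simp: w_def)
qed

text \<open>If infinitely many \<open>lin \<alpha>\<close> were zero divisors modulo the saturation \<open>P\<close>, then, by the chain
  condition for the annihilators of their products, one of them would share a killed element with
  infinitely many others.  Repeating this yields an element killed by four of them, hence by all
  variables, which a saturated submodule does not admit.\<close>

lemma finite_lin_zero_divisors:
  fixes e :: "'r::finite \<Rightarrow> nat" and N :: "nat \<Rightarrow> ('k::field poly4 ^ 'r) set"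
  assumes N: "graded_submodule e N"
  shows "finite {\<alpha>. \<exists>n. \<exists>v\<in>gr e n. lin \<alpha> *s v \<in> sat e N (Suc n) \<and> v \<notin> sat e N n}"
proof (rule ccontr)
  let ?P = "sat e N"
  note P = graded_submodule_sat[OF N]
  \<comment> \<open>\<open>bad \<Lambda>\<close> collects the parameters that kill a nonzero element together with all those in \<open>\<Lambda>\<close>\<close>
  define W where "W \<Lambda> n = {v \<in> gr e n. \<forall>\<alpha>\<in>\<Lambda>. lin \<alpha> *s v \<in> ?P (Suc n)}" for \<Lambda> n
  define bad where "bad \<Lambda> = {\<alpha>. \<alpha> \<notin> \<Lambda> \<and> (\<exists>n. \<exists>v\<in>W \<Lambda> n. lin \<alpha> *s v \<in> ?P (Suc n) \<and> v \<notin> ?P n)}" for \<Lambda>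
  assume "infinite {\<alpha>. \<exists>n. \<exists>v\<in>gr e n. lin \<alpha> *s v \<in> ?P (Suc n) \<and> v \<notin> ?P n}"
  then have inf0: "infinite (bad {})" by (simp add: bad_def W_def)
  have P_mult: "f *s v \<in> ?P (n + m)" if "homogeneous m f" "v \<in> ?P n" for f m v n
    using graded_submodule_mult[OF P] that by blast
  have W_mult: "f *s v \<in> W \<Lambda> (n + m)" if "homogeneous m f" "v \<in> W \<Lambda> n" for f m v n \<Lambda>
  proof -
    have "lin \<alpha> *s (f *s v) \<in> ?P (Suc (n + m))" if "\<alpha> \<in> \<Lambda>" for \<alpha>
    proof -
      have "lin \<alpha> *s v \<in> ?P (Suc n)" using \<open>v \<in> W \<Lambda> n\<close> that by (simp add: W_def)
      from P_mult[OF \<open>homogeneous m f\<close> this] show ?thesis by (simp add: vector_smult_assoc mult.commute)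
    qed
    then show ?thesis using gr_mult[OF that(1)] that(2) by (auto simp: W_def)
  qed
  have W_add: "v + w \<in> W \<Lambda> n" if "v \<in> W \<Lambda> n" "w \<in> W \<Lambda> n" for v w \<Lambda> n
    using that unfolding W_def
    by (auto simp: vector_add_ldistrib intro: graded_submoduleD(5)[OF P] graded_submoduleD(5)[OF graded_submodule_gr])
  have W0: "0 \<in> W \<Lambda> n" for \<Lambda> n
    using graded_submoduleD(4)[OF P] graded_submoduleD(4)[OF graded_submodule_gr] by (simp add: W_def)
  have W_scale: "vscale c v \<in> W \<Lambda> n" if "v \<in> W \<Lambda> n" for v \<Lambda> n c
    using W_mult[OF homogeneous_const that] by (simp add: vscale_def)
  have step: "\<exists>\<alpha>. \<alpha> \<notin> \<Lambda> \<and> infinite (bad (insert \<alpha> \<Lambda>))" if inf: "infinite (bad \<Lambda>)" for \<Lambda>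
  proof -
    obtain l :: "nat \<Rightarrow> 'k" where l: "inj l" "range l \<subseteq> bad \<Lambda>" using infinite_countable_subset[OF inf] by blast
    define q where "q n = (\<Prod>i<n. lin (l i))" for n
    have q: "homogeneous n (q n)" for n
      unfolding q_def using homogeneous_prod[of "{..<n}" "\<lambda>_. Suc 0" "\<lambda>i. lin (l i)"] by simp
    have q_Suc: "q (Suc n) *s v = lin (l n) *s (q n *s v)" for n v
      by (simp add: q_def vector_smult_assoc mult.commute)
    define B where "B n m = {v \<in> W \<Lambda> m. q n *s v \<in> ?P (m + n)}" for n m
    have B_mono: "B n m \<subseteq> B (Suc n) m" for n m
    proof
      fix v assume "v \<in> B n m"
      then show "v \<in> B (Suc n) m" using P_mult[OF homogeneous_lin, of "q n *s v" "m + n" "l n"]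
        unfolding B_def q_Suc mem_Collect_eq by simp
    qed
    have "\<exists>n0. \<forall>n\<ge>n0. B n = B n0"
    proof (rule graded_submodule_chain_stabilises[of e])
      show "graded_submodule e (B n)" for n
        unfolding graded_submodule_def
      proof (intro allI conjI ballI)
        show "B n m \<subseteq> gr e m" for m by (auto simp: B_def W_def)
        show "V.subspace (B n m)" for m
          unfolding V.subspace_def
        proof (intro conjI ballI allI)
          show "0 \<in> B n m" using W0 graded_submoduleD(4)[OF P] by (simp add: B_def)
          show "v + w \<in> B n m" if "v \<in> B n m" "w \<in> B n m" for v w
            using that W_add graded_submoduleD(5)[OF P] by (simp add: B_def vector_add_ldistrib)
          show "vscale c v \<in> B n m" if "v \<in> B n m" for c v
          proof -
            have "q n *s vscale c v = vscale c (q n *s v)" by (simp add: Finite_Cartesian_Product.vec_eq_iff ac_simps)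
            then show ?thesis using that W_scale graded_submoduleD(7)[OF P] by (simp add: B_def)
          qed
        qed
        show "var i *s v \<in> B n (Suc m)" if v: "v \<in> B n m" for m v i
        proof -
          have "q n *s (var i *s v) = var i *s (q n *s v)" by (simp add: vector_smult_assoc mult.commute)
          then show ?thesis
            using v W_mult[OF homogeneous_var(1), of v \<Lambda> m i] graded_submoduleD(3)[OF P, of "q n *s v" "m + n" i]
            by (simp add: B_def)
        qed
      qed
    qed (rule B_mono)
    then obtain n0 where n0: "\<And>n. n \<ge> n0 \<Longrightarrow> B n = B n0" by blast
    have "\<exists>s<n0. l j \<in> bad (insert (l s) \<Lambda>)" if j: "j \<ge> n0" for j
    proof -
      have "l j \<in> bad \<Lambda>" using l(2) by blast
      then obtain m v where lj: "l j \<notin> \<Lambda>" and v: "v \<in> W \<Lambda> m" "lin (l j) *s v \<in> ?P (Suc m)" "v \<notin> ?P m"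
        by (auto simp: bad_def)
      have "q (Suc j) *s v = q j *s (lin (l j) *s v)" by (simp add: q_Suc vector_smult_assoc mult.commute)
      then have "v \<in> B (Suc j) m" using P_mult[OF q v(2), of j] v(1) by (simp add: B_def)
      then have "v \<in> B n0 m" using n0[of "Suc j"] j by simp
      then have ex: "q n0 *s v \<in> ?P (m + n0)" by (simp add: B_def)
      \<comment> \<open>the last nonzero product \<open>q s *s v\<close> is killed by both \<open>lin (l s)\<close> and \<open>lin (l j)\<close>\<close>
      define t where "t = (LEAST t. q t *s v \<in> ?P (m + t))"
      have t: "q t *s v \<in> ?P (m + t)" "t \<le> n0" unfolding t_def using ex by (rule LeastI, rule Least_le)
      have "q 0 *s v \<notin> ?P (m + 0)" using v(3) by (simp add: q_def)
      then obtain s where s: "t = Suc s" using t(1) by (cases t) auto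
      have u: "q s *s v \<notin> ?P (m + s)" using not_less_Least[of s "\<lambda>t. q t *s v \<in> ?P (m + t)"] s by (simp add: t_def)
      have "lin (l s) *s (q s *s v) \<in> ?P (Suc (m + s))" using t(1) s by (simp add: q_Suc)
      then have uW: "q s *s v \<in> W (insert (l s) \<Lambda>) (m + s)" using W_mult[OF q v(1)] by (simp add: W_def)
      have "lin (l j) *s (q s *s v) = q s *s (lin (l j) *s v)" by (simp add: vector_smult_assoc mult.commute)
      then have "lin (l j) *s (q s *s v) \<in> ?P (Suc (m + s))" using P_mult[OF q v(2), of s] by simp
      moreover have "l j \<noteq> l s" using l(1) s t(2) j by (auto dest: injD)
      ultimately have "l j \<in> bad (insert (l s) \<Lambda>)" using uW u lj unfolding bad_def by blast
      moreover have "s < n0" using s t(2) by simp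
      ultimately show ?thesis by blast
    qed
    then have "l ` {n0..} \<subseteq> (\<Union>s<n0. bad (insert (l s) \<Lambda>))" by fastforce
    moreover have "infinite (l ` {n0..})"
      using l(1) by (simp add: finite_image_iff inj_on_subset infinite_Ici)
    ultimately have "\<exists>s<n0. infinite (bad (insert (l s) \<Lambda>))"
      by (meson finite_UN_I finite_lessThan finite_subset lessThan_iff)
    moreover have "l s \<notin> \<Lambda>" for s using l(2) by (auto simp: bad_def)
    ultimately show ?thesis by blast
  qed
  have "\<exists>\<Lambda>. finite \<Lambda> \<and> card \<Lambda> = k \<and> infinite (bad \<Lambda>)" for k
  proof (induction k)
    case 0 then show ?case using inf0 by (intro exI[of _ "{}"]) simp
  next
    case (Suc k)
    then obtain \<Lambda> where "finite \<Lambda>" "card \<Lambda> = k" "infinite (bad \<Lambda>)" by blast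
    then show ?case using step[of \<Lambda>] by (metis card_insert_disjoint finite_insert)
  qed
  then obtain \<Lambda> where \<Lambda>: "finite \<Lambda>" "card \<Lambda> = 3" "infinite (bad \<Lambda>)" by blast
  then obtain \<alpha> where "\<alpha> \<in> bad \<Lambda>" by (metis ex_in_conv finite.emptyI)
  then obtain n v where v: "\<alpha> \<notin> \<Lambda>" "v \<in> W \<Lambda> n" "lin \<alpha> *s v \<in> ?P (Suc n)" "v \<notin> ?P n" by (auto simp: bad_def)
  have "var i *s v \<in> ?P (Suc n)" for i
    by (rule lin_span[OF graded_submoduleD(1)[OF P], of "insert \<alpha> \<Lambda>"]) (use v \<Lambda> in \<open>auto simp: W_def\<close>)
  then have "v \<in> sat e ?P n"
    using v(2) by (intro satI_powers[OF P]) (auto simp: W_def intro!: exI[of _ 1])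
  then show False using v(4) sat_sat[OF N] by simp
qed

subsection \<open>Hilbert polynomials\<close>

text \<open>Telescope the expansion of $(x+1)^{n+1} - x^{n+1}$ to find the antidifference of $x^n$.\<close>

lemma ex_antidifference: "\<exists>q :: rat poly. \<forall>x. poly q (x + 1) - poly q x = poly p x"
proof -
  have mono: "\<exists>q :: rat poly. \<forall>x. poly q (x + 1) - poly q x = x ^ n" for n
  proof (induction n rule: less_induct)
    case (less n)
    then obtain q :: "nat \<Rightarrow> rat poly" where q: "\<And>k x. k < n \<Longrightarrow> poly (q k) (x + 1) - poly (q k) x = x ^ k" by metis
    define r where "r = smult (inverse (of_nat (Suc n))) (monom 1 (Suc n) - (\<Sum>k<n. smult (of_nat (Suc n choose k)) (q k)))"
    have "poly r (x + 1) - poly r x = x ^ n" for x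
    proof -
      have "(x + 1) ^ Suc n = (\<Sum>k\<le>Suc n. of_nat (Suc n choose k) * x ^ k)"
        using binomial_ring[of x 1 "Suc n"] by simp
      also have "\<dots> = (\<Sum>k<n. of_nat (Suc n choose k) * x ^ k) + of_nat (Suc n) * x ^ n + x ^ Suc n"
        by (simp add: lessThan_Suc_atMost[symmetric] del: power_Suc)
      finally have "(x + 1) ^ Suc n - x ^ Suc n - (\<Sum>k<n. of_nat (Suc n choose k) * x ^ k) = of_nat (Suc n) * x ^ n"
        by simp
      moreover have "(\<Sum>k<n. of_nat (Suc n choose k) * x ^ k) =
          (\<Sum>k<n. of_nat (Suc n choose k) * poly (q k) (x + 1)) - (\<Sum>k<n. of_nat (Suc n choose k) * poly (q k) x)"
        unfolding sum_subtractf[symmetric] right_diff_distrib[symmetric] by (intro sum.cong refl) (simp add: q)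
      ultimately have "of_nat (Suc n) * (poly r (x + 1) - poly r x) = of_nat (Suc n) * x ^ n"
        unfolding r_def by (simp add: poly_sum poly_monom field_simps del: power_Suc of_nat_Suc)
      then show ?thesis by (simp del: of_nat_Suc)
    qed
    then show ?case by blast
  qed
  then obtain q :: "nat \<Rightarrow> rat poly" where q: "\<And>n x. poly (q n) (x + 1) - poly (q n) x = x ^ n" by metis
  have "poly (\<Sum>i\<le>degree p. smult (coeff p i) (q i)) (x + 1) - poly (\<Sum>i\<le>degree p. smult (coeff p i) (q i)) x = poly p x" for x
    unfolding poly_sum poly_smult sum_subtractf[symmetric] right_diff_distrib[symmetric] q by (simp add: poly_altdef)
  then show ?thesis by blast
qed

lemma eventually_poly_from_difference:
  fixes f :: "nat \<Rightarrow> rat"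
  assumes "\<forall>\<^sub>F n in sequentially. f (Suc n) - f n = poly p (of_nat (Suc n))"
  shows "\<exists>q. \<forall>\<^sub>F n in sequentially. f n = poly q (of_nat n)"
proof -
  obtain q where q: "\<And>x. poly q (x + 1) - poly q x = poly (pcompose p [:1, 1:]) x" using ex_antidifference by blast
  obtain n0 where n0: "\<And>n. n \<ge> n0 \<Longrightarrow> f (Suc n) - f n = poly p (of_nat (Suc n))"
    using assms by (auto simp: eventually_sequentially)
  have "f n = poly (q + [:f n0 - poly q (of_nat n0):]) (of_nat n)" if "n \<ge> n0" for n
    using that
  proof (induction n rule: dec_induct)
    case (step n)
    then show ?case using n0[of n] q[of "of_nat n"] by (simp add: poly_pcompose algebra_simps)
  qed simp
  then show ?thesis unfolding eventually_sequentially by blast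
qed

definition add_lin :: "('r \<Rightarrow> nat) \<Rightarrow> 'k::field \<Rightarrow> (nat \<Rightarrow> ('k poly4 ^ 'r) set) \<Rightarrow> nat \<Rightarrow> ('k poly4 ^ 'r) set" where
  "add_lin e \<alpha> N n = (case n of 0 \<Rightarrow> N 0 | Suc m \<Rightarrow> {x + lin \<alpha> *s v | x v. x \<in> N (Suc m) \<and> v \<in> gr e m})"

lemma add_lin_Suc: "add_lin e \<alpha> N (Suc m) = {x + lin \<alpha> *s v | x v. x \<in> N (Suc m) \<and> v \<in> gr e m}"
  by (simp add: add_lin_def)

lemma add_linI: "x \<in> N (Suc m) \<Longrightarrow> v \<in> gr e m \<Longrightarrow> x + lin \<alpha> *s v \<in> add_lin e \<alpha> N (Suc m)"
  unfolding add_lin_Suc by blast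

lemma graded_submodule_add_lin:
  assumes N: "graded_submodule e N"
  shows "graded_submodule e (add_lin e \<alpha> N)" and "N n \<subseteq> add_lin e \<alpha> N n"
    and "v \<in> gr e n \<Longrightarrow> lin \<alpha> *s v \<in> add_lin e \<alpha> N (Suc n)"
proof -
  note G = graded_submodule_gr[of e]
  show sub: "N n \<subseteq> add_lin e \<alpha> N n" for n
    using graded_submoduleD(4)[OF G] by (cases n) (force simp: add_lin_def)+
  show "lin \<alpha> *s v \<in> add_lin e \<alpha> N (Suc n)" if "v \<in> gr e n" for v n
    using graded_submoduleD(4)[OF N] that by (force simp: add_lin_Suc)
  show "graded_submodule e (add_lin e \<alpha> N)"
    unfolding graded_submodule_def
  proof (intro allI conjI ballI)
    fix n
    show "V.subspace (add_lin e \<alpha> N n)"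
    proof (cases n)
      case (Suc m)
      show ?thesis unfolding V.subspace_def Suc
      proof (intro conjI ballI allI)
        show "0 \<in> add_lin e \<alpha> N (Suc m)" using sub graded_submoduleD(4)[OF N] by blast
        fix x assume "x \<in> add_lin e \<alpha> N (Suc m)"
        then obtain a v where x: "x = a + lin \<alpha> *s v" "a \<in> N (Suc m)" "v \<in> gr e m" by (auto simp: add_lin_Suc)
        have "vscale c x = vscale c a + lin \<alpha> *s vscale c v" for c by (simp add: x Finite_Cartesian_Product.vec_eq_iff algebra_simps)
        then show "vscale c x \<in> add_lin e \<alpha> N (Suc m)" for c
          using graded_submoduleD(7)[OF N x(2), of c] graded_submoduleD(7)[OF G x(3), of c]
          unfolding add_lin_Suc by blast
        fix y assume "y \<in> add_lin e \<alpha> N (Suc m)"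
        then obtain b w where y: "y = b + lin \<alpha> *s w" "b \<in> N (Suc m)" "w \<in> gr e m" by (auto simp: add_lin_Suc)
        have "x + y = (a + b) + lin \<alpha> *s (v + w)" by (simp add: x y Finite_Cartesian_Product.vec_eq_iff algebra_simps)
        then show "x + y \<in> add_lin e \<alpha> N (Suc m)"
          using graded_submoduleD(5)[OF N x(2) y(2)] graded_submoduleD(5)[OF G x(3) y(3)]
          unfolding add_lin_Suc by blast
      qed
    qed (simp add: add_lin_def graded_submoduleD(1)[OF N])
    show "add_lin e \<alpha> N n \<subseteq> gr e n"
    proof (cases n)
      case (Suc m)
      have "a + lin \<alpha> *s v \<in> gr e (Suc m)" if "a \<in> N (Suc m)" "v \<in> gr e m" for a v
        using that graded_submoduleD(2)[OF N, of "Suc m"] graded_submodule_mult[OF G homogeneous_lin, of v m \<alpha>]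
        by (intro graded_submoduleD(5)[OF G]) auto
      then show ?thesis using Suc by (auto simp: add_lin_Suc)
    qed (simp add: add_lin_def graded_submoduleD(2)[OF N])
    fix x i assume x: "x \<in> add_lin e \<alpha> N n"
    show "var i *s x \<in> add_lin e \<alpha> N (Suc n)"
    proof (cases n)
      case 0
      then have "var i *s x \<in> N (Suc n)" using x graded_submoduleD(3)[OF N] by (simp add: add_lin_def)
      then show ?thesis using sub by blast
    next
      case (Suc m)
      then obtain a v where x: "x = a + lin \<alpha> *s v" "a \<in> N (Suc m)" "v \<in> gr e m" using x by (auto simp: add_lin_Suc)
      have "var i *s x = var i *s a + lin \<alpha> *s (var i *s v)"
        by (simp add: x Finite_Cartesian_Product.vec_eq_iff algebra_simps)
      then show ?thesis
        using add_linI[of "var i *s a" N "Suc m" "var i *s v" e \<alpha>] graded_submoduleD(3)[OF N x(2), of i]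
          graded_submoduleD(3)[OF G x(3), of i] Suc by (simp only:)
    qed
  qed
qed

lemma linear_vmult: "Vector_Spaces.linear vscale vscale ((*s) f :: 'k::field poly4 ^ 'r \<Rightarrow> _)"
  by unfold_locales (simp_all add: Finite_Cartesian_Product.vec_eq_iff algebra_simps)

text \<open>Multiplication by \<open>lin \<alpha>\<close> identifies \<open>gr e n / N n\<close> with a submodule of \<open>gr e (n+1) / N (n+1)\<close>
  as soon as it is injective.\<close>

lemma dim_add_lin:
  fixes e :: "'r::finite \<Rightarrow> nat" and N :: "nat \<Rightarrow> ('k::field poly4 ^ 'r) set"
  assumes N: "graded_submodule e N" and reg: "\<And>v. v \<in> gr e n \<Longrightarrow> lin \<alpha> *s v \<in> N (Suc n) \<Longrightarrow> v \<in> N n"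
  shows "V.dim (gr e n :: ('k poly4 ^ 'r) set) + V.dim (N (Suc n)) = V.dim (add_lin e \<alpha> N (Suc n)) + V.dim (N n)"
proof (rule VV.dim_quotient_iso[OF linear_vmult[of "lin \<alpha>"]])
  note A = graded_submodule_add_lin[OF N]
  show "lin \<alpha> *s v \<in> N (Suc n) \<longleftrightarrow> v \<in> N n" if "v \<in> gr e n" for v
    using reg[OF that] graded_submodule_mult[OF N homogeneous_lin] by auto
  show "\<exists>v\<in>gr e n. w - lin \<alpha> *s v \<in> N (Suc n)" if "w \<in> add_lin e \<alpha> N (Suc n)" for w
  proof -
    obtain x v where w: "w = x + lin \<alpha> *s v" "x \<in> N (Suc n)" "v \<in> gr e n" using \<open>w \<in> _\<close> by (auto simp: add_lin_Suc)
    then show ?thesis by (intro bexI[of _ v]) simp_all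
  qed
qed (use graded_submoduleD[OF N] graded_submoduleD(1)[OF graded_submodule_add_lin(1)[OF N]]
      graded_submodule_add_lin(2,3)[OF N] finite_dim_graded_submodule[OF graded_submodule_add_lin(1)[OF N]]
      dim_gr(1) in auto)

lemma gr_Suc_split:
  assumes "v \<in> gr e (Suc n)"
  shows "\<exists>w. (\<forall>i. w i \<in> gr e n) \<and> v = (\<Sum>i\<in>UNIV. var i *s w i)"
proof -
  have "\<forall>j. \<exists>g. (\<forall>i. homogeneous (n + e j) (g i)) \<and> v $ j = (\<Sum>i\<in>UNIV. var i * g i)"
  proof
    fix j
    have "homogeneous (Suc (n + e j)) (v $ j)" using assms by (simp add: gr_def)
    from homogeneous_Suc_split[OF this]
    show "\<exists>g. (\<forall>i. homogeneous (n + e j) (g i)) \<and> v $ j = (\<Sum>i\<in>UNIV. var i * g i)" .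
  qed
  then obtain g where "\<forall>j. (\<forall>i. homogeneous (n + e j) (g j i)) \<and> v $ j = (\<Sum>i\<in>UNIV. var i * g j i)"
    by (rule choice[THEN exE])
  then show ?thesis
    by (intro exI[of _ "\<lambda>i. \<chi> j. g j i"]) (simp add: gr_def Finite_Cartesian_Product.vec_eq_iff)
qed

text \<open>Dividing successively by four general linear forms leaves a module of finite length, and each
  division takes the difference of the Hilbert function.\<close>

theorem hilbert_function_eventually_poly:
  fixes e :: "'r::finite \<Rightarrow> nat" and N :: "nat \<Rightarrow> ('k::field_char_0 poly4 ^ 'r) set"
  assumes N: "graded_submodule e N"
  shows "\<exists>p :: rat poly. \<forall>\<^sub>F n in sequentially.
    of_nat (V.dim (gr e n :: ('k poly4 ^ 'r) set)) - of_nat (V.dim (N n)) = poly p (of_nat n)"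
proof -
  let ?g = "\<lambda>n. of_nat (V.dim (gr e n :: ('k poly4 ^ 'r) set)) :: rat"
  have "\<exists>p :: rat poly. \<forall>\<^sub>F n in sequentially. ?g n - of_nat (V.dim (N n)) = poly p (of_nat n)"
    if "graded_submodule e N" "finite \<Lambda>" "card \<Lambda> + k = 4"
      "\<And>\<alpha> n v. \<alpha> \<in> \<Lambda> \<Longrightarrow> v \<in> gr e n \<Longrightarrow> lin \<alpha> *s v \<in> N (Suc n)"
    for N :: "nat \<Rightarrow> ('k poly4 ^ 'r) set" and k \<Lambda>
    using that
  proof (induction k arbitrary: N \<Lambda>)
    case 0
    have "N (Suc n) = gr e (Suc n)" for n
    proof
      show "gr e (Suc n) \<subseteq> N (Suc n)"
      proof
        fix v :: "'k poly4 ^ 'r" assume "v \<in> gr e (Suc n)"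
        then obtain w where w: "\<And>i. w i \<in> gr e n" "v = (\<Sum>i\<in>UNIV. var i *s w i)" using gr_Suc_split by blast
        show "v \<in> N (Suc n)" unfolding w(2)
          using 0 w(1) by (intro graded_submoduleD(8)[OF 0(1)] lin_span[OF graded_submoduleD(1)[OF 0(1)], of \<Lambda>]) auto
      qed
    qed (rule graded_submoduleD(2)[OF 0(1)])
    then have "\<forall>n\<ge>1. ?g n - of_nat (V.dim (N n)) = poly 0 (of_nat n)" by (metis Suc_le_D One_nat_def diff_self poly_0)
    then show ?case unfolding eventually_sequentially by blast
  next
    case (Suc k)
    note N = Suc.prems(1)
    have "infinite (UNIV :: 'k set)" by (rule infinite_UNIV_char_0)
    then have "\<exists>\<alpha>. \<alpha> \<notin> \<Lambda> \<union> {\<alpha>. \<exists>n. \<exists>v\<in>gr e n. lin \<alpha> *s v \<in> sat e N (Suc n) \<and> v \<notin> sat e N n}"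
      using Suc.prems(2) finite_lin_zero_divisors[OF N] by (intro ex_new_if_finite) auto
    then obtain \<alpha> where \<alpha>: "\<alpha> \<notin> \<Lambda>" "\<And>n v. v \<in> gr e n \<Longrightarrow> lin \<alpha> *s v \<in> sat e N (Suc n) \<Longrightarrow> v \<in> sat e N n" by auto
    obtain n0 where n0: "\<And>n. n \<ge> n0 \<Longrightarrow> sat e N n = N n" using sat_eventually[OF N] by blast
    define N' where "N' = add_lin e \<alpha> N"
    note A = graded_submodule_add_lin[OF N, where \<alpha> = \<alpha>, folded N'_def]
    have "\<exists>p :: rat poly. \<forall>\<^sub>F n in sequentially. ?g n - of_nat (V.dim (N' n)) = poly p (of_nat n)"
    proof (rule Suc.IH)
      show "finite (insert \<alpha> \<Lambda>)" "card (insert \<alpha> \<Lambda>) + k = 4" using Suc.prems(2,3) \<alpha>(1) by auto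
      show "lin \<mu> *s v \<in> N' (Suc n)" if "\<mu> \<in> insert \<alpha> \<Lambda>" "v \<in> gr e n" for \<mu> n v
        using that Suc.prems(4) A(2,3) by blast
    qed (rule A)
    then obtain p :: "rat poly" where p: "\<forall>\<^sub>F n in sequentially. ?g n - of_nat (V.dim (N' n)) = poly p (of_nat n)" by blast
    have "\<forall>\<^sub>F n in sequentially. (?g (Suc n) - of_nat (V.dim (N (Suc n)))) - (?g n - of_nat (V.dim (N n))) = poly p (of_nat (Suc n))"
      using eventually_ge_at_top[of n0] eventually_sequentially_Suc[THEN iffD2, OF p]
    proof eventually_elim
      case (elim n)
      have "V.dim (gr e n :: ('k poly4 ^ 'r) set) + V.dim (N (Suc n)) = V.dim (N' (Suc n)) + V.dim (N n)"
        unfolding N'_def using \<alpha>(2)[of _ n] n0[of n] n0[of "Suc n"] elim(1) by (intro dim_add_lin[OF N]) auto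
      then have "?g n + of_nat (V.dim (N (Suc n))) = of_nat (V.dim (N' (Suc n))) + of_nat (V.dim (N n))"
        by (metis of_nat_add)
      then show ?case using elim(2) by simp
    qed
    then show ?case by (rule eventually_poly_from_difference)
  qed
  from this[of N "{}" 4] show ?thesis using N by simp
qed

section \<open>Homogeneous prime ideals\<close>

definition homogeneous_ideal :: "'k::field poly4 set \<Rightarrow> bool" where
  "homogeneous_ideal J \<longleftrightarrow> 0 \<in> J \<and> (\<forall>f\<in>J. \<forall>g\<in>J. f + g \<in> J) \<and> (\<forall>f\<in>J. \<forall>h. h * f \<in> J)
     \<and> (\<forall>f\<in>J. \<forall>n. homogeneous_part n f \<in> J)"

lemma homogeneous_idealD:
  assumes "homogeneous_ideal J"
  shows "0 \<in> J" "f \<in> J \<Longrightarrow> g \<in> J \<Longrightarrow> f + g \<in> J" "f \<in> J \<Longrightarrow> h * f \<in> J" "f \<in> J \<Longrightarrow> f * h \<in> J"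
    "f \<in> J \<Longrightarrow> homogeneous_part n f \<in> J" "f \<in> J \<Longrightarrow> - f \<in> J" "f \<in> J \<Longrightarrow> g \<in> J \<Longrightarrow> f - g \<in> J"
proof -
  have D: "0 \<in> J" "f \<in> J \<Longrightarrow> g \<in> J \<Longrightarrow> f + g \<in> J" "f \<in> J \<Longrightarrow> h * f \<in> J"
     "f \<in> J \<Longrightarrow> homogeneous_part n f \<in> J" for f g h n
    using assms unfolding homogeneous_ideal_def by blast+
  show "0 \<in> J" "f \<in> J \<Longrightarrow> g \<in> J \<Longrightarrow> f + g \<in> J" "f \<in> J \<Longrightarrow> h * f \<in> J"
     "f \<in> J \<Longrightarrow> homogeneous_part n f \<in> J" by (fact D)+
  show "f \<in> J \<Longrightarrow> f * h \<in> J" using D(3)[of f h] by (simp add: mult.commute)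
  have neg: "f \<in> J \<Longrightarrow> - f \<in> J" for f using D(3)[of f "-1"] by simp
  then show "f \<in> J \<Longrightarrow> - f \<in> J" .
  show "f \<in> J \<Longrightarrow> g \<in> J \<Longrightarrow> f - g \<in> J" using D(2)[of f "- g"] neg[of g] by simp
qed

lemma homogeneous_ideal_sum:
  "homogeneous_ideal J \<Longrightarrow> (\<And>i. i \<in> A \<Longrightarrow> f i \<in> J) \<Longrightarrow> sum f A \<in> J"
  by (induction A rule: infinite_finite_induct) (auto intro: homogeneous_idealD(1,2))

text \<open>It suffices to test primality on homogeneous elements: look at the highest parts of the two
  factors which do not lie in the ideal.\<close>

lemma homogeneous_ideal_prime:
  assumes P: "homogeneous_ideal P"
    and hom: "\<And>a b m n. homogeneous m a \<Longrightarrow> homogeneous n b \<Longrightarrow> a * b \<in> P \<Longrightarrow> a \<in> P \<or> b \<in> P"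
    and fg: "f * g \<in> P"
  shows "f \<in> P \<or> g \<in> P"
proof (rule ccontr)
  assume "\<not> (f \<in> P \<or> g \<in> P)"
  let ?A = "\<lambda>f. {n. homogeneous_part n f \<notin> P}"
  have fin: "finite (?A f)" for f
    by (rule finite_subset[OF _ finite_homogeneous_parts[of f]]) (use homogeneous_idealD(1)[OF P] in auto)
  have ne: "?A f \<noteq> {}" if "f \<notin> P" for f
  proof
    assume "?A f = {}"
    then have "(\<Sum>n\<le>d. homogeneous_part n f) \<in> P" for d by (intro homogeneous_ideal_sum[OF P]) auto
    then show False using that sum_homogeneous_parts[of f] by (metis order_refl)
  qed
  define a b where "a = Max (?A f)" and "b = Max (?A g)"
  have "f \<notin> P" "g \<notin> P" using \<open>\<not> _\<close> by simp_all
  then have ab: "a \<in> ?A f" "b \<in> ?A g"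
    unfolding a_def b_def using Max_in[OF fin ne, of f] Max_in[OF fin ne, of g] by blast+
  have gt: "homogeneous_part i f \<in> P" if "i > a" for i
    using that Max_ge[OF fin, of i f] unfolding a_def by force
  have gt': "homogeneous_part i g \<in> P" if "i > b" for i
    using that Max_ge[OF fin, of i g] unfolding b_def by force
  let ?t = "\<lambda>i. homogeneous_part i f * homogeneous_part (a + b - i) g"
  have "?t i \<in> P" if "i \<in> {..a + b} - {a}" for i
  proof (cases "i > a")
    case True then show ?thesis using gt homogeneous_idealD(4)[OF P] by blast
  next
    case False
    then have "a + b - i > b" using that by auto
    then show ?thesis using gt' homogeneous_idealD(3)[OF P] by blast
  qed
  then have "(\<Sum>i\<in>{..a + b} - {a}. ?t i) \<in> P" by (intro homogeneous_ideal_sum[OF P])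
  moreover have "(\<Sum>i\<le>a + b. ?t i) \<in> P"
    using homogeneous_idealD(5)[OF P fg, of "a + b"] by (simp add: homogeneous_part_mult)
  moreover have "(\<Sum>i\<le>a + b. ?t i) = ?t a + (\<Sum>i\<in>{..a + b} - {a}. ?t i)" by (rule sum.remove) auto
  ultimately have "(?t a + (\<Sum>i\<in>{..a + b} - {a}. ?t i)) - (\<Sum>i\<in>{..a + b} - {a}. ?t i) \<in> P"
    by (intro homogeneous_idealD(7)[OF P]) simp_all
  then have "?t a \<in> P" by simp
  then have "homogeneous_part a f \<in> P \<or> homogeneous_part b g \<in> P"
    using hom[OF homogeneous_homogeneous_part homogeneous_homogeneous_part] by fastforce
  then show False using ab by blast
qed

text \<open>Krull's lemma: an ideal maximal among those that avoid a multiplicative set is prime.\<close>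

lemma ex_homogeneous_prime:
  assumes J: "homogeneous_ideal J" and S: "1 \<in> S" "\<And>s t. s \<in> S \<Longrightarrow> t \<in> S \<Longrightarrow> s * t \<in> S" and "J \<inter> S = {}"
  shows "\<exists>P. homogeneous_ideal P \<and> J \<subseteq> P \<and> P \<inter> S = {} \<and> (\<forall>f g. f * g \<in> P \<longrightarrow> f \<in> P \<or> g \<in> P)"
proof -
  define \<A> where "\<A> = {P. homogeneous_ideal P \<and> J \<subseteq> P \<and> P \<inter> S = {}}"
  have "\<exists>M\<in>\<A>. \<forall>X\<in>\<A>. M \<subseteq> X \<longrightarrow> X = M"
  proof (rule subset_Zorn_nonempty)
    show "\<A> \<noteq> {}" using J assms(4) by (auto simp: \<A>_def)
    fix \<C> assume \<C>: "\<C> \<noteq> {}" "subset.chain \<A> \<C>"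
    have sub: "\<C> \<subseteq> \<A>" using \<C>(2) by (simp add: subset.chain_def)
    have lin: "X \<subseteq> Y \<or> Y \<subseteq> X" if "X \<in> \<C>" "Y \<in> \<C>" for X Y
      using \<C>(2) that unfolding subset.chain_def by blast
    have hi: "homogeneous_ideal X" if "X \<in> \<C>" for X using sub that by (auto simp: \<A>_def)
    have "homogeneous_ideal (\<Union>\<C>)"
      unfolding homogeneous_ideal_def
    proof (intro conjI ballI allI)
      show "0 \<in> \<Union>\<C>" using \<C>(1) hi homogeneous_idealD(1) by blast
      fix f assume "f \<in> \<Union>\<C>"
      then obtain X where X: "X \<in> \<C>" "f \<in> X" by blast
      show "h * f \<in> \<Union>\<C>" "homogeneous_part n f \<in> \<Union>\<C>" for h n
        using X hi homogeneous_idealD(3,5) by blast+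
      fix g assume "g \<in> \<Union>\<C>"
      then obtain Y where Y: "Y \<in> \<C>" "g \<in> Y" by blast
      from lin[OF X(1) Y(1)] show "f + g \<in> \<Union>\<C>"
        using X Y hi homogeneous_idealD(2) by blast
    qed
    moreover have "J \<subseteq> \<Union>\<C>" using \<C>(1) sub by (auto simp: \<A>_def)
    moreover have "\<Union>\<C> \<inter> S = {}" using sub by (auto simp: \<A>_def)
    ultimately show "\<Union>\<C> \<in> \<A>" by (simp add: \<A>_def)
  qed
  then obtain P where "P \<in> \<A>" and max\<A>: "\<forall>X\<in>\<A>. P \<subseteq> X \<longrightarrow> X = P" by (rule bexE)
  then have P: "homogeneous_ideal P" "J \<subseteq> P" "P \<inter> S = {}" by (simp_all add: \<A>_def)
  have max: "X = P" if "homogeneous_ideal X" "P \<subseteq> X" "X \<inter> S = {}" for X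
  proof -
    have "X \<in> \<A>" using that P(2) by (simp add: \<A>_def)
    then show ?thesis using max\<A> that(2) by blast
  qed
  have meets: "\<exists>p\<in>P. \<exists>c. p + c * a \<in> S" if a: "homogeneous m a" "a \<notin> P" for a m
  proof (rule ccontr)
    assume none: "\<not> (\<exists>p\<in>P. \<exists>c. p + c * a \<in> S)"
    let ?X = "{p + c * a | p c. p \<in> P}"
    have "homogeneous_ideal ?X"
      unfolding homogeneous_ideal_def
    proof (intro conjI ballI allI)
      show "0 \<in> ?X" using homogeneous_idealD(1)[OF P(1)] by (force intro!: exI[of _ 0])
      fix f assume "f \<in> ?X"
      then obtain p c where f: "f = p + c * a" "p \<in> P" by blast
      have "h * f = h * p + (h * c) * a" for h by (simp add: f algebra_simps)
      then show "h * f \<in> ?X" for h using homogeneous_idealD(3)[OF P(1) f(2), of h] by blast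
      have "homogeneous_part n (a * c) = (if m \<le> n then homogeneous_part (n - m) c else 0) * a" for n
        using homogeneous_part_mult_homogeneous[OF a(1), of n c] by (simp add: mult.commute)
      then have "homogeneous_part n f = homogeneous_part n p + (if m \<le> n then homogeneous_part (n - m) c else 0) * a" for n
        by (simp add: f homogeneous_part_add mult.commute)
      then show "homogeneous_part n f \<in> ?X" for n using homogeneous_idealD(5)[OF P(1) f(2)] by blast
      fix g assume "g \<in> ?X"
      then obtain q e where g: "g = q + e * a" "q \<in> P" by blast
      have "f + g = (p + q) + (c + e) * a" by (simp add: f g algebra_simps)
      then show "f + g \<in> ?X" using homogeneous_idealD(2)[OF P(1) f(2) g(2)] by blast
    qed
    moreover have "P \<subseteq> ?X"
    proof
      fix x assume "x \<in> P"
      moreover have "x = x + 0 * a" by simp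
      ultimately show "x \<in> ?X" by blast
    qed
    moreover have "?X \<inter> S = {}" using none by blast
    ultimately have "?X = P" using max by blast
    moreover have "a = 0 + 1 * a" by simp
    then have "a \<in> ?X" using homogeneous_idealD(1)[OF P(1)] by blast
    ultimately show False using a(2) by blast
  qed
  have "f \<in> P \<or> g \<in> P" if "f * g \<in> P" for f g
  proof (rule homogeneous_ideal_prime[OF P(1) _ that], rule ccontr)
    fix a b m n assume ab: "homogeneous m a" "homogeneous n b" "a * b \<in> P" "\<not> (a \<in> P \<or> b \<in> P)"
    obtain p c where p: "p \<in> P" "p + c * a \<in> S" using meets[OF ab(1)] ab(4) by blast
    obtain q e where q: "q \<in> P" "q + e * b \<in> S" using meets[OF ab(2)] ab(4) by blast
    have "(p + c * a) * (q + e * b) = p * (q + e * b) + ((c * a) * q + (c * e) * (a * b))"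
      by (simp add: algebra_simps)
    also have "\<dots> \<in> P"
      by (intro homogeneous_idealD(2,3)[OF P(1)] homogeneous_idealD(4)[OF P(1) p(1)] q(1) ab(3))
    finally show False using S(2)[OF p(2) q(2)] P(3) by blast
  qed
  then show ?thesis using P by blast
qed

definition graded_ideal :: "(nat \<Rightarrow> 'k::field poly4 set) \<Rightarrow> bool" where
  "graded_ideal J \<longleftrightarrow> (\<forall>n. 0 \<in> J n \<and> (\<forall>f\<in>J n. homogeneous n f \<and> (\<forall>g\<in>J n. f + g \<in> J n)
     \<and> (\<forall>m h. homogeneous m h \<longrightarrow> h * f \<in> J (n + m))))"

lemma graded_idealD:
  assumes "graded_ideal J"
  shows "0 \<in> J n" "f \<in> J n \<Longrightarrow> homogeneous n f" "f \<in> J n \<Longrightarrow> g \<in> J n \<Longrightarrow> f + g \<in> J n"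
    "f \<in> J n \<Longrightarrow> homogeneous m h \<Longrightarrow> h * f \<in> J (n + m)"
  using assms unfolding graded_ideal_def by blast+

lemma homogeneous_ideal_of_graded:
  assumes J: "graded_ideal J"
  shows "homogeneous_ideal {f. \<forall>n. homogeneous_part n f \<in> J n}"
  unfolding homogeneous_ideal_def
proof (intro conjI ballI allI)
  show "0 \<in> {f. \<forall>n. homogeneous_part n f \<in> J n}" using graded_idealD(1)[OF J] by simp
  fix f assume "f \<in> {f. \<forall>n. homogeneous_part n f \<in> J n}"
  then have f: "homogeneous_part n f \<in> J n" for n by blast
  have sum: "(\<And>i. i \<in> A \<Longrightarrow> t i \<in> J n) \<Longrightarrow> sum t A \<in> J n" for t n and A :: "nat set"
    by (induction A rule: infinite_finite_induct) (auto intro: graded_idealD(1,3)[OF J])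
  have "homogeneous_part n (h * f) \<in> J n" for n h
    unfolding homogeneous_part_mult
  proof (rule sum)
    fix i assume "i \<in> {..n}"
    then show "homogeneous_part i h * homogeneous_part (n - i) f \<in> J n"
      using graded_idealD(4)[OF J f[of "n - i"] homogeneous_homogeneous_part[of i h]] by simp
  qed
  then show "h * f \<in> {f. \<forall>n. homogeneous_part n f \<in> J n}" for h by blast
  show "homogeneous_part n f \<in> {f. \<forall>n. homogeneous_part n f \<in> J n}" for n
    using f graded_idealD(1)[OF J] by (simp add: homogeneous_part_homogeneous[OF homogeneous_homogeneous_part])
  fix g assume "g \<in> {f. \<forall>n. homogeneous_part n f \<in> J n}"
  then show "f + g \<in> {f. \<forall>n. homogeneous_part n f \<in> J n}"
    using f graded_idealD(3)[OF J] by (simp add: homogeneous_part_add)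
qed

lemma graded_ideal_mem_iff:
  assumes J: "graded_ideal J" and "homogeneous m f"
  shows "f \<in> {f. \<forall>n. homogeneous_part n f \<in> J n} \<longleftrightarrow> f \<in> J m"
  using graded_idealD(1)[OF J] homogeneous_part_homogeneous[OF assms(2)] by auto

section \<open>The points of projective space\<close>

lemma Proj_homogeneous_ideal: "\<pp> \<in> Proj \<Longrightarrow> homogeneous_ideal \<pp>"
  unfolding Proj_def homogeneous_ideal_def by blast

lemmas ProjD = homogeneous_idealD[OF Proj_homogeneous_ideal]

lemma Proj_one: "\<pp> \<in> Proj \<Longrightarrow> 1 \<notin> \<pp>" and Proj_var: "\<pp> \<in> Proj \<Longrightarrow> \<exists>i. var i \<notin> \<pp>"
  and Proj_mult_iff: "\<pp> \<in> Proj \<Longrightarrow> f * g \<in> \<pp> \<longleftrightarrow> f \<in> \<pp> \<or> g \<in> \<pp>"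
  and Proj_zero: "\<pp> \<in> Proj \<Longrightarrow> 0 \<in> \<pp>"
proof -
  assume p: "\<pp> \<in> Proj"
  then show "1 \<notin> \<pp>" "\<exists>i. var i \<notin> \<pp>" "0 \<in> \<pp>" by (simp_all add: Proj_def)
  have "f * g \<in> \<pp> \<longrightarrow> f \<in> \<pp> \<or> g \<in> \<pp>" using p by (simp add: Proj_def)
  then show "f * g \<in> \<pp> \<longleftrightarrow> f \<in> \<pp> \<or> g \<in> \<pp>" using ProjD(3)[OF p, of g f] ProjD(4)[OF p, of f g] by blast
qed

lemma Proj_power: "\<pp> \<in> Proj \<Longrightarrow> f \<notin> \<pp> \<Longrightarrow> f ^ n \<notin> \<pp>"
  by (induction n) (auto simp: Proj_one Proj_mult_iff)

lemma Proj_prod: "\<pp> \<in> Proj \<Longrightarrow> (\<And>i. i \<in> A \<Longrightarrow> f i \<notin> \<pp>) \<Longrightarrow> prod f A \<notin> \<pp>"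
  by (induction A rule: infinite_finite_induct) (auto simp: Proj_one Proj_mult_iff)

lemma Proj_I:
  assumes "homogeneous_ideal P" "\<And>f g. f * g \<in> P \<Longrightarrow> f \<in> P \<or> g \<in> P" "homogeneous n h" "0 < n" "h \<notin> P"
  shows "P \<in> Proj"
proof -
  have "1 \<notin> P" using homogeneous_idealD(3)[OF assms(1), of 1 h] assms(5) by auto
  moreover have "\<exists>i. var i \<notin> P"
  proof (rule ccontr)
    assume "\<nexists>i. var i \<notin> P"
    then have var: "var i \<in> P" for i by blast
    obtain g where g: "h = (\<Sum>i\<in>UNIV. var i * g i)"
      using homogeneous_Suc_split[of "n - 1" h] assms(3,4) by auto
    have "h \<in> P" unfolding g
      by (intro homogeneous_ideal_sum[OF assms(1)] homogeneous_idealD(4)[OF assms(1)] var)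
    then show False using assms(5) by blast
  qed
  ultimately show ?thesis using assms(1,2) unfolding Proj_def homogeneous_ideal_def by blast
qed

lemma var_neq_0 [simp]: "var i \<noteq> (0 :: ('n, 'k::comm_ring_1) mpoly)"
  unfolding var_def by (metis lookup_single_eq lookup_zero zero_neq_one)

lemma zero_in_Proj: "{0} \<in> (Proj :: 'k::field poly4 set set)"
proof (rule Proj_I)
  show "homogeneous_ideal {0 :: 'k poly4}" by (simp add: homogeneous_ideal_def)
  show "homogeneous 1 (var 0 :: 'k poly4)" by simp
  show "var 0 \<notin> {0 :: 'k poly4}" by simp
qed auto

text \<open>Otherwise a homogeneous prime ideal containing the ideal and avoiding all powers of \<open>h\<close> would be a
  point at which \<open>h\<close> does not vanish although the ideal does.\<close>

lemma graded_nullstellensatz: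
  assumes J: "graded_ideal J" and h: "homogeneous a h" "0 < a"
    and V: "\<And>\<pp>. \<pp> \<in> Proj \<Longrightarrow> h \<notin> \<pp> \<Longrightarrow> \<exists>n. \<exists>g\<in>J n. g \<notin> \<pp>"
  shows "\<exists>N. h ^ N \<in> J (a * N)"
proof (rule ccontr)
  assume none: "\<nexists>N. h ^ N \<in> J (a * N)"
  let ?J = "{f. \<forall>n. homogeneous_part n f \<in> J n}"
  have "?J \<inter> range (\<lambda>N. h ^ N) = {}"
    using none graded_ideal_mem_iff[OF J homogeneous_power[OF h(1)]] by blast
  moreover have mult: "s * t \<in> range (\<lambda>N. h ^ N)" if "s \<in> range (\<lambda>N. h ^ N)" "t \<in> range (\<lambda>N. h ^ N)" for s t
    using that by (auto simp: power_add[symmetric])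
  moreover have "1 \<in> range (\<lambda>N. h ^ N)" by (metis power_0 rangeI)
  ultimately have "\<exists>P. homogeneous_ideal P \<and> ?J \<subseteq> P \<and> P \<inter> range (\<lambda>N. h ^ N) = {}
      \<and> (\<forall>f g. f * g \<in> P \<longrightarrow> f \<in> P \<or> g \<in> P)"
    by (intro ex_homogeneous_prime homogeneous_ideal_of_graded[OF J])
  then obtain P where P: "homogeneous_ideal P" "?J \<subseteq> P" "P \<inter> range (\<lambda>N. h ^ N) = {}"
    "\<And>f g. f * g \<in> P \<Longrightarrow> f \<in> P \<or> g \<in> P"
    by blast
  have hP: "h \<notin> P" using P(3) by (metis disjoint_iff power_one_right rangeI)
  then have "P \<in> Proj" using Proj_I[OF P(1,4) h] by blast
  then obtain n g where "g \<in> J n" "g \<notin> P" using V hP by blast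
  moreover have "g \<in> ?J" using \<open>g \<in> J n\<close> graded_ideal_mem_iff[OF J graded_idealD(2)[OF J]] by blast
  ultimately show False using P(2) by blast
qed

text \<open>The forms that vanish wherever finitely many elements of \<open>H\<close> do constitute a graded ideal without
  zeros, so it contains powers of the variables.\<close>

lemma Proj_quasi_compact:
  fixes H :: "'k::field poly4 set"
  assumes "\<And>\<pp>. \<pp> \<in> Proj \<Longrightarrow> \<exists>h\<in>H. h \<notin> \<pp> \<and> (\<exists>n. homogeneous n h)"
  shows "\<exists>H'\<subseteq>H. finite H' \<and> (\<forall>\<pp>\<in>Proj. \<exists>h\<in>H'. h \<notin> \<pp>)"
proof -
  define J where "J n = {g. homogeneous n g \<and> (\<exists>H'\<subseteq>H. finite H' \<and> (\<forall>\<pp>\<in>Proj. H' \<subseteq> \<pp> \<longrightarrow> g \<in> \<pp>))}" for n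
  have J: "graded_ideal J"
    unfolding graded_ideal_def
  proof (intro allI conjI ballI impI)
    show "0 \<in> J n" for n using Proj_zero by (auto simp: J_def)
    fix n f assume "f \<in> J n"
    then obtain H1 where f: "homogeneous n f" "H1 \<subseteq> H" "finite H1" "\<forall>\<pp>\<in>Proj. H1 \<subseteq> \<pp> \<longrightarrow> f \<in> \<pp>" by (auto simp: J_def)
    show "homogeneous n f" by fact
    show "h * f \<in> J (n + m)" if "homogeneous m h" for m h
    proof -
      have "\<forall>\<pp>\<in>Proj. H1 \<subseteq> \<pp> \<longrightarrow> h * f \<in> \<pp>" using f(4) ProjD(3)[of _ f h] by simp
      moreover have "homogeneous (n + m) (h * f)" using homogeneous_mult[OF that f(1)] by (simp add: add.commute)
      ultimately show ?thesis unfolding J_def using f(2,3) by blast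
    qed
    fix g assume "g \<in> J n"
    then obtain H2 where g: "homogeneous n g" "H2 \<subseteq> H" "finite H2" "\<forall>\<pp>\<in>Proj. H2 \<subseteq> \<pp> \<longrightarrow> g \<in> \<pp>" by (auto simp: J_def)
    have "\<forall>\<pp>\<in>Proj. H1 \<union> H2 \<subseteq> \<pp> \<longrightarrow> f + g \<in> \<pp>"
      using f(4) g(4) ProjD(2)[of _ f g] by simp
    then show "f + g \<in> J n" using f g homogeneous_add[OF f(1) g(1)] unfolding J_def
      by (auto intro!: exI[of _ "H1 \<union> H2"])
  qed
  have "\<exists>N. var i ^ N \<in> J (1 * N)" for i
  proof (rule graded_nullstellensatz[OF J])
    fix \<pp> :: "'k poly4 set" assume "\<pp> \<in> Proj"
    then obtain h n where "h \<in> H" "h \<notin> \<pp>" "homogeneous n h" using assms by blast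
    then have "h \<in> J n" unfolding J_def by (auto intro!: exI[of _ "{h}"])
    then show "\<exists>n. \<exists>g\<in>J n. g \<notin> \<pp>" using \<open>h \<notin> \<pp>\<close> by blast
  qed auto
  have "\<exists>H'\<subseteq>H. finite H' \<and> (\<forall>\<pp>\<in>Proj. H' \<subseteq> \<pp> \<longrightarrow> var i \<in> \<pp>)" for i
  proof -
    obtain N H' where "H' \<subseteq> H" "finite H'" "\<forall>\<pp>\<in>Proj. H' \<subseteq> \<pp> \<longrightarrow> var i ^ N \<in> \<pp>"
      using \<open>\<And>i. \<exists>N. var i ^ N \<in> J (1 * N)\<close>[of i] unfolding J_def by blast
    then show ?thesis using Proj_power[of _ "var i" N] by blast
  qed
  then obtain H' where H': "\<And>i. H' i \<subseteq> H" "\<And>i. finite (H' i)"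
    "\<And>i \<pp>. \<pp> \<in> Proj \<Longrightarrow> H' i \<subseteq> \<pp> \<Longrightarrow> (var i :: 'k poly4) \<in> \<pp>" by metis
  have "\<exists>h\<in>(\<Union>i. H' i). h \<notin> \<pp>" if "\<pp> \<in> Proj" for \<pp>
    using H'(3)[OF that] Proj_var[OF that] by blast
  then show ?thesis using H'(1,2) by (intro exI[of _ "\<Union>i. H' i"]) auto
qed

lemma openin_zariski_Proj: "openin zariski Proj"
  unfolding openin_zariski by (rule exI[of _ "{1}"]) (auto simp: vanishing_locus_def Proj_one)

lemma openin_zariski_subset: "openin zariski U \<Longrightarrow> U \<subseteq> Proj"
  unfolding openin_zariski by auto

lemma topspace_zariski: "topspace zariski = Proj"
  using openin_zariski_subset openin_zariski_Proj by (meson openin_subset openin_topspace subset_antisym)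

lemma zariski_basic_neighbourhood:
  assumes "openin zariski U" "\<pp> \<in> U"
  shows "\<exists>n h. 0 < n \<and> homogeneous n h \<and> h \<notin> \<pp> \<and> (\<forall>\<qq>\<in>Proj. h \<notin> \<qq> \<longrightarrow> \<qq> \<in> U)"
proof -
  obtain I where I: "U = Proj - vanishing_locus I" using assms(1) unfolding openin_zariski by blast
  have p: "\<pp> \<in> Proj" using assms(2) I by blast
  obtain f where f: "f \<in> I" "f \<notin> \<pp>" using assms(2) unfolding I vanishing_locus_def by blast
  have "\<exists>n. homogeneous_part n f \<notin> \<pp>"
  proof (rule ccontr)
    assume "\<nexists>n. homogeneous_part n f \<notin> \<pp>"
    then have "(\<Sum>n\<le>d. homogeneous_part n f) \<in> \<pp>" for d
      by (intro homogeneous_ideal_sum[OF Proj_homogeneous_ideal[OF p]]) auto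
    then show False using f(2) sum_homogeneous_parts[of f] by (metis order_refl)
  qed
  then obtain n where n: "homogeneous_part n f \<notin> \<pp>" by blast
  obtain i where i: "var i \<notin> \<pp>" using Proj_var[OF p] by blast
  have "\<qq> \<in> U" if "\<qq> \<in> Proj" "var i * homogeneous_part n f \<notin> \<qq>" for \<qq>
  proof -
    have "f \<notin> \<qq>" using that ProjD(3,5)[OF that(1)] by blast
    then show ?thesis using f(1) that(1) unfolding I vanishing_locus_def by blast
  qed
  moreover have "homogeneous (Suc n) (var i * homogeneous_part n f)"
    using homogeneous_mult[OF homogeneous_var(1) homogeneous_homogeneous_part[of n f], of i] by simp
  ultimately show ?thesis using n i Proj_mult_iff[OF p] by (intro exI[of _ "Suc n"] exI[of _ "var i * homogeneous_part n f"]) auto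
qed

lemma generic_point_in_open:
  assumes "openin zariski U" "\<pp> \<in> U"
  shows "{0} \<in> U"
proof -
  obtain n h where h: "h \<notin> \<pp>" "\<forall>\<qq>\<in>Proj. h \<notin> \<qq> \<longrightarrow> \<qq> \<in> U" using zariski_basic_neighbourhood[OF assms] by blast
  have "\<pp> \<in> Proj" using assms openin_zariski_subset by blast
  then have "h \<noteq> 0" using h(1) Proj_zero by blast
  then show ?thesis using h(2) zero_in_Proj by blast
qed

section \<open>Stalks and global sections of line bundles\<close>

lemma O_stalk_iff: "x \<in> O_stalk d \<pp> \<longleftrightarrow> (\<exists>a b m n. x = to_fract a / to_fract b \<and> homogeneous m a \<and> homogeneous n b
    \<and> b \<notin> \<pp> \<and> int m = int n + d)"
  unfolding O_stalk_def by (simp add: Fract_conv_to_fract)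

lemma O_stalkI: "homogeneous m a \<Longrightarrow> homogeneous n b \<Longrightarrow> b \<notin> \<pp> \<Longrightarrow> int m = int n + d \<Longrightarrow>
    to_fract a / to_fract b \<in> O_stalk d \<pp>"
  unfolding O_stalk_iff by blast

lemma O_stalk_to_fract: "\<pp> \<in> Proj \<Longrightarrow> homogeneous m f \<Longrightarrow> to_fract f \<in> O_stalk (int m) \<pp>"
  using O_stalkI[of m f 0 1 \<pp> "int m"] Proj_one[of \<pp>] by simp

lemma O_stalk_inverse: "\<pp> \<in> Proj \<Longrightarrow> homogeneous n b \<Longrightarrow> b \<notin> \<pp> \<Longrightarrow> inverse (to_fract b) \<in> O_stalk (- int n) \<pp>"
  using O_stalkI[of 0 1 n b \<pp> "- int n"] by (simp add: inverse_eq_divide)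

lemma O_stalk_zero: assumes "\<pp> \<in> Proj" shows "0 \<in> O_stalk d \<pp>"
proof -
  obtain i where "var i \<notin> \<pp>" using Proj_var[OF assms] by blast
  then have "var i ^ nat \<bar>d\<bar> \<notin> \<pp>" using Proj_power[OF assms] by blast
  moreover have "homogeneous (nat \<bar>d\<bar>) (var i ^ nat \<bar>d\<bar> :: 'a poly4)"
    using homogeneous_power[OF homogeneous_var(2)[of i], of "nat \<bar>d\<bar>"] by simp
  ultimately show ?thesis using O_stalkI[of "nat (\<bar>d\<bar> + d)" 0 "nat \<bar>d\<bar>" "var i ^ nat \<bar>d\<bar>" \<pp> d] by simp
qed

lemma O_stalk_add:
  assumes p: "\<pp> \<in> Proj" and "x \<in> O_stalk d \<pp>" "y \<in> O_stalk d \<pp>"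
  shows "x + y \<in> O_stalk d \<pp>"
proof -
  obtain a b m n where x: "x = to_fract a / to_fract b" "homogeneous m a" "homogeneous n b" "b \<notin> \<pp>" "int m = int n + d"
    using assms(2) unfolding O_stalk_iff by blast
  obtain a' b' m' n' where y: "y = to_fract a' / to_fract b'" "homogeneous m' a'" "homogeneous n' b'" "b' \<notin> \<pp>" "int m' = int n' + d"
    using assms(3) unfolding O_stalk_iff by blast
  have "b \<noteq> 0" "b' \<noteq> 0" using x y Proj_zero[OF p] by blast+
  then have "x + y = to_fract (a * b' + a' * b) / to_fract (b * b')"
    unfolding x(1) y(1) by (subst add_frac_eq) (simp_all add: mult.commute)
  moreover have "m' + n = m + n'" using x(5) y(5) by linarith
  then have "homogeneous (m + n') (a * b' + a' * b)"
    using homogeneous_mult[OF x(2) y(3)] homogeneous_mult[OF y(2) x(3)] by (intro homogeneous_add) auto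
  moreover have "b * b' \<notin> \<pp>" using x y Proj_mult_iff[OF p] by blast
  moreover have "int (m + n') = int (n + n') + d" using x(5) by simp
  ultimately show ?thesis using O_stalkI homogeneous_mult[OF x(3) y(3)] by metis
qed

lemma O_stalk_mult:
  assumes p: "\<pp> \<in> Proj" and "x \<in> O_stalk d \<pp>" "y \<in> O_stalk d' \<pp>"
  shows "x * y \<in> O_stalk (d + d') \<pp>"
proof -
  obtain a b m n where x: "x = to_fract a / to_fract b" "homogeneous m a" "homogeneous n b" "b \<notin> \<pp>" "int m = int n + d"
    using assms(2) unfolding O_stalk_iff by blast
  obtain a' b' m' n' where y: "y = to_fract a' / to_fract b'" "homogeneous m' a'" "homogeneous n' b'" "b' \<notin> \<pp>" "int m' = int n' + d'"
    using assms(3) unfolding O_stalk_iff by blast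
  have "x * y = to_fract (a * a') / to_fract (b * b')" by (simp add: x y)
  moreover have "b * b' \<notin> \<pp>" using x y Proj_mult_iff[OF p] by blast
  moreover have "int (m + m') = int (n + n') + (d + d')" using x(5) y(5) by simp
  ultimately show ?thesis using O_stalkI homogeneous_mult[OF x(3) y(3)] homogeneous_mult[OF x(2) y(2)] by metis
qed

lemma O_stalk_uminus:
  assumes "\<pp> \<in> Proj" "x \<in> O_stalk d \<pp>"
  shows "- x \<in> O_stalk d \<pp>"
proof -
  obtain a b m n where x: "x = to_fract a / to_fract b" "homogeneous m a" "homogeneous n b" "b \<notin> \<pp>" "int m = int n + d"
    using assms(2) unfolding O_stalk_iff by blast
  have "- x = to_fract (- a) / to_fract b" by (simp add: x(1))
  then show ?thesis using O_stalkI[OF homogeneous_uminus[OF x(2)] x(3-5)] by simp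
qed

lemma is_subfield_O_stalk: "is_subfield (O_stalk 0 {0} :: 'k::field ratfun set)"
  unfolding is_subfield_def
proof (intro conjI ballI)
  note p = zero_in_Proj
  show "0 \<in> O_stalk 0 {0 :: 'k poly4}" by (rule O_stalk_zero[OF p])
  show "1 \<in> O_stalk 0 {0 :: 'k poly4}" using O_stalk_to_fract[OF p homogeneous_one] by simp
  fix a :: "'k ratfun" assume a: "a \<in> O_stalk 0 {0}"
  show "- a \<in> O_stalk 0 {0}" by (rule O_stalk_uminus[OF p a])
  show "a + b \<in> O_stalk 0 {0}" "a * b \<in> O_stalk 0 {0}" if b: "b \<in> O_stalk 0 {0}" for b
    using O_stalk_add[OF p a b] O_stalk_mult[OF p a b] by simp_all
  obtain x y m n where x: "a = to_fract x / to_fract y" "homogeneous m x" "homogeneous n y" "y \<notin> {0}" "int m = int n + 0"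
    using a unfolding O_stalk_iff by blast
  show "inverse a \<in> O_stalk 0 {0}"
  proof (cases "x = 0")
    case True then show ?thesis using x(1) O_stalk_zero[OF p] by simp
  next
    case False
    then have "to_fract y / to_fract x \<in> O_stalk 0 {0}" using x by (intro O_stalkI) auto
    then show ?thesis using x(1) by simp
  qed
qed

definition to_fract_vec :: "'k::field poly4 ^ 'r \<Rightarrow> 'k ratfun ^ 'r" where
  "to_fract_vec u = (\<chi> i. to_fract (u $ i))"

lemma to_fract_vec_nth [simp]: "to_fract_vec u $ i = to_fract (u $ i)"
  by (simp add: to_fract_vec_def)

lemma to_fract_vec_simps:
  "to_fract_vec (u + v) = to_fract_vec u + to_fract_vec v" "to_fract_vec (u - v) = to_fract_vec u - to_fract_vec v"
  "to_fract_vec (f *s u) = to_fract f *s to_fract_vec u" "to_fract_vec 0 = 0"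
  "to_fract_vec u = to_fract_vec v \<longleftrightarrow> u = v"
  by (simp_all add: Finite_Cartesian_Product.vec_eq_iff)

lemma to_fract_vec_mem_sum_O:
  "\<pp> \<in> Proj \<Longrightarrow> u \<in> gr e t \<Longrightarrow> to_fract_vec u \<in> sum_O (\<lambda>i. int (e i) + int t) \<pp>"
  using O_stalk_to_fract[of \<pp>] unfolding sum_O_def gr_def by (fastforce simp: add.commute)

lemma sum_O_clear_denominators:
  fixes v :: "'k::field ratfun ^ 'r::finite"
  assumes p: "\<pp> \<in> Proj" and v: "v \<in> sum_O (\<lambda>i. int (e i) + int t) \<pp>"
  shows "\<exists>n b u. homogeneous n b \<and> b \<notin> \<pp> \<and> u \<in> gr e (t + n) \<and> to_fract b *s v = to_fract_vec u"
proof -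
  have "\<forall>i. \<exists>a b m n. v $ i = to_fract a / to_fract b \<and> homogeneous m a \<and> homogeneous n b
    \<and> b \<notin> \<pp> \<and> int m = int n + (int (e i) + int t)"
    using v unfolding sum_O_def O_stalk_iff by blast
  then obtain a b m n where v: "\<And>i. v $ i = to_fract (a i) / to_fract (b i)" "\<And>i. homogeneous (m i) (a i)"
    "\<And>i. homogeneous (n i) (b i)" "\<And>i. b i \<notin> \<pp>" "\<And>i. int (m i) = int (n i) + (int (e i) + int t)" by metis
  define u :: "'k poly4 ^ 'r" where "u = (\<chi> i. a i * (\<Prod>j\<in>UNIV - {i}. b j))"
  have rem: "(\<Prod>i\<in>UNIV. b i) = b i * (\<Prod>j\<in>UNIV - {i}. b j)" "(\<Sum>i\<in>UNIV. n i) = n i + (\<Sum>j\<in>UNIV - {i}. n j)" for i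
    by (simp_all add: prod.remove sum.remove)
  have b0: "b i \<noteq> 0" for i using v(4) Proj_zero[OF p] by metis
  have "homogeneous (\<Sum>i\<in>UNIV. n i) (\<Prod>i\<in>UNIV. b i)" by (intro homogeneous_prod v)
  moreover have "(\<Prod>i\<in>UNIV. b i) \<notin> \<pp>" by (intro Proj_prod[OF p] v)
  moreover have "homogeneous (t + (\<Sum>i\<in>UNIV. n i) + e i) (u $ i)" for i
  proof -
    have "m i = n i + e i + t" using v(5)[of i] by linarith
    then have eq: "t + (\<Sum>i\<in>UNIV. n i) + e i = m i + (\<Sum>j\<in>UNIV - {i}. n j)" using rem(2)[of i] by simp
    have "homogeneous (m i + (\<Sum>j\<in>UNIV - {i}. n j)) (a i * (\<Prod>j\<in>UNIV - {i}. b j))"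
      by (intro homogeneous_mult homogeneous_prod v)
    then show ?thesis unfolding eq by (simp add: u_def)
  qed
  then have "u \<in> gr e (t + (\<Sum>i\<in>UNIV. n i))" by (simp add: gr_def)
  moreover have "to_fract (\<Prod>i\<in>UNIV. b i) *s v = to_fract_vec u"
  proof (rule Finite_Cartesian_Product.vec_eq_iff[THEN iffD2], rule allI)
    fix i
    have "to_fract (\<Prod>i\<in>UNIV. b i) = to_fract (b i) * to_fract (\<Prod>j\<in>UNIV - {i}. b j)"
      by (subst rem(1)[of i]) simp
    then show "(to_fract (\<Prod>i\<in>UNIV. b i) *s v) $ i = to_fract_vec u $ i"
      using b0[of i] by (simp add: u_def v(1))
  qed
  ultimately show ?thesis by blast
qed

lemma var_power_cancel:
  fixes f g :: "'k::field poly4"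
  assumes "i \<noteq> j" and eq: "var j ^ N * f = var i ^ N * g"
  shows "\<exists>f'. f = var i ^ N * f'"
proof -
  have le: "N \<le> Poly_Mapping.lookup m i" if "m \<in> Poly_Mapping.keys f" for m
  proof -
    have "Poly_Mapping.lookup (var i ^ N * g) (Poly_Mapping.single j N + m) \<noteq> 0"
      using that unfolding eq[symmetric] by (simp add: var_power lookup_single_mult in_keys_iff)
    then have "Poly_Mapping.single j N + m \<in> Poly_Mapping.keys (Poly_Mapping.single (Poly_Mapping.single i N) 1 * g)"
      by (simp add: in_keys_iff var_power)
    then obtain k where "Poly_Mapping.single j N + m = Poly_Mapping.single i N + k"
      using keys_mult[of "Poly_Mapping.single (Poly_Mapping.single i N) 1" g] by (auto split: if_splits)
    from arg_cong[OF this, of "\<lambda>m. Poly_Mapping.lookup m i"] show ?thesis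
      using assms(1) by (simp add: lookup_add lookup_single when_def)
  qed
  define f' where "f' = (\<Sum>m\<in>Poly_Mapping.keys f. Poly_Mapping.single (m - Poly_Mapping.single i N) (Poly_Mapping.lookup f m))"
  have "Poly_Mapping.single i N + (m - Poly_Mapping.single i N) = m" if "m \<in> Poly_Mapping.keys f" for m
    using le[OF that] by (intro poly_mapping_eqI) (auto simp: lookup_add lookup_minus lookup_single when_def)
  then have "var i ^ N * f' = (\<Sum>m\<in>Poly_Mapping.keys f. Poly_Mapping.single m (Poly_Mapping.lookup f m))"
    unfolding f'_def sum_distrib_left var_power mult_single by (intro sum.cong refl) auto
  then show ?thesis using poly_mapping_sum_singles[of f] by metis
qed

lemma homogeneous_divide_var:
  fixes f :: "'k::field poly4"
  assumes "homogeneous (n + N) (var i ^ N * f)"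
  shows "homogeneous n f"
proof (cases "f = 0")
  case False
  have "homogeneous N (var i ^ N :: 'k poly4)" using homogeneous_power[OF homogeneous_var(2)[of i], of N] by simp
  moreover have "var i ^ N \<noteq> (0 :: 'k poly4)" by simp
  moreover from this False have "var i ^ N * f \<noteq> 0" by simp
  ultimately show ?thesis using homogeneous_factors[OF assms] homogeneous_unique
    by (metis add.commute add_left_cancel)
qed simp

text \<open>$H^0(\mathbb{P}^3, \mathcal{O}(t)) = S_t$: the denominators of a global section form an ideal which
  contains powers of two different variables, and these have no common factor.\<close>

lemma global_sections_sum_O:
  fixes v :: "'k::field ratfun ^ 'r::finite"
  assumes v: "\<And>\<pp>. \<pp> \<in> Proj \<Longrightarrow> v \<in> sum_O (\<lambda>i. int (e i) + int t) \<pp>"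
  shows "\<exists>u\<in>gr e t. v = to_fract_vec u"
proof -
  define J where "J n = {b. homogeneous n b \<and> (\<exists>u\<in>gr e (t + n). to_fract b *s v = to_fract_vec u)}" for n
  have J: "graded_ideal J"
    unfolding graded_ideal_def
  proof (intro allI conjI ballI impI)
    show "0 \<in> J n" for n unfolding J_def
      using graded_submoduleD(4)[OF graded_submodule_gr, of e "t + n"] to_fract_vec_simps(4)[symmetric]
      by (auto intro!: bexI[of _ 0])
    fix n f assume "f \<in> J n"
    then obtain u where f: "homogeneous n f" "u \<in> gr e (t + n)" "to_fract f *s v = to_fract_vec u" by (auto simp: J_def)
    show "homogeneous n f" by fact
    show "h * f \<in> J (n + m)" if h: "homogeneous m h" for m h
    proof -
      have "to_fract (h * f) *s v = to_fract_vec (h *s u)"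
        unfolding to_fract_vec_simps f(3)[symmetric] by (simp add: vector_smult_assoc)
      moreover have "h *s u \<in> gr e (t + (n + m))" using gr_mult[OF h f(2)] by (simp add: add.assoc)
      ultimately show ?thesis unfolding J_def using homogeneous_mult[OF h f(1)] by (auto simp: add.commute)
    qed
    fix g assume "g \<in> J n"
    then obtain w where g: "homogeneous n g" "w \<in> gr e (t + n)" "to_fract g *s v = to_fract_vec w" by (auto simp: J_def)
    have "to_fract (f + g) *s v = to_fract_vec (u + w)"
      unfolding to_fract_vec_simps f(3)[symmetric] g(3)[symmetric] by (simp add: vector_sadd_rdistrib)
    then show "f + g \<in> J n" unfolding J_def
      using homogeneous_add[OF f(1) g(1)] graded_submoduleD(5)[OF graded_submodule_gr f(2) g(2)] by blast
  qed
  have "\<exists>N. var i ^ N \<in> J (1 * N)" for i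
    by (rule graded_nullstellensatz[OF J]) (use sum_O_clear_denominators[OF _ v] in \<open>auto simp: J_def\<close>, blast)
  then obtain N0 N1 where N01: "var 0 ^ N0 \<in> J N0" "var 1 ^ N1 \<in> J N1" by (metis mult_1)
  define N where "N = N0 + N1"
  have hp: "homogeneous n (var i ^ n :: 'k poly4)" for i n
    using homogeneous_power[OF homogeneous_var(2)[of i], of n] by simp
  have "var 1 ^ N \<in> J N" using graded_idealD(4)[OF J N01(2) hp[of N0 1]] by (simp add: N_def power_add add.commute)
  moreover have "var 0 ^ N \<in> J N" using graded_idealD(4)[OF J N01(1) hp[of N1 0]] by (simp add: N_def power_add mult.commute)
  ultimately obtain u w where u: "u \<in> gr e (t + N)" "to_fract (var 0 ^ N) *s v = to_fract_vec u"
    and w: "w \<in> gr e (t + N)" "to_fract (var 1 ^ N) *s v = to_fract_vec w" by (auto simp: J_def)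
  have "to_fract_vec (var 1 ^ N *s u) = to_fract_vec (var 0 ^ N *s w)"
    unfolding to_fract_vec_simps(3) u(2)[symmetric] w(2)[symmetric] by (simp add: vector_smult_assoc mult.commute)
  then have eq: "var 1 ^ N *s u = var 0 ^ N *s w" by (simp only: to_fract_vec_simps(5))
  have "\<exists>f'. u $ i = var 0 ^ N * f'" for i
    using var_power_cancel[of 0 1 N "u $ i" "w $ i"] arg_cong[OF eq, of "\<lambda>v. v $ i"] by simp
  then obtain f where f: "\<And>i. u $ i = var 0 ^ N * f i" by metis
  define z :: "'k poly4 ^ 'r" where "z = (\<chi> i. f i)"
  have uz: "u = var 0 ^ N *s z" using f by (simp add: z_def Finite_Cartesian_Product.vec_eq_iff)
  have "homogeneous (t + e i) (f i)" for i
  proof (rule homogeneous_divide_var[of _ N 0])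
    have "homogeneous (t + N + e i) (u $ i)" using u(1) by (simp add: gr_def)
    then show "homogeneous (t + e i + N) (var 0 ^ N * f i)" unfolding f[of i] by (simp add: ac_simps)
  qed
  then have "z \<in> gr e t" by (simp add: gr_def z_def)
  moreover have "to_fract (var 0 ^ N :: 'k poly4) \<noteq> 0" by simp
  then have "v = to_fract_vec z"
    using u(2) unfolding uz to_fract_vec_simps(3) by (simp add: Finite_Cartesian_Product.vec_eq_iff)
  ultimately show ?thesis by blast
qed

section \<open>Twists and spaces of sections\<close>

definition section_scale :: "'k::field \<Rightarrow> ('k poly4 set \<Rightarrow> 'k ratfun ^ 'r) \<Rightarrow> 'k poly4 set \<Rightarrow> 'k ratfun ^ 'r" where
  "section_scale c s = (\<lambda>\<pp>. to_fract (const_poly c) *s s \<pp>)"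

lemma vector_space_section_scale:
  "vector_space (section_scale :: 'k::field \<Rightarrow> ('k poly4 set \<Rightarrow> 'k ratfun ^ 'r) \<Rightarrow> _)"
  by unfold_locales
    (auto simp: section_scale_def fun_eq_iff const_poly_add const_poly_mult vector_add_ldistrib vector_sadd_rdistrib
      vector_smult_assoc)

text \<open>If the constant families with values in \<open>W\<close> represent all sections, then the space of sections modulo null
  sections is \<open>W/N\<close>.\<close>

lemma h0_eqI:
  fixes F :: "('k::field, 'n::finite) P3_sheaf" and W N :: "('k poly4 ^ 'n) set"
  assumes W: "V.subspace W" and N: "V.subspace N" "N \<subseteq> W" and fin: "finite_dim vscale W"
    and den: "\<And>\<pp>. \<pp> \<in> Proj \<Longrightarrow> 0 \<in> den F \<pp>"
      "\<And>\<pp> x y. \<pp> \<in> Proj \<Longrightarrow> x \<in> den F \<pp> \<Longrightarrow> y \<in> den F \<pp> \<Longrightarrow> x + y \<in> den F \<pp>"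
      "\<And>\<pp> x c. \<pp> \<in> Proj \<Longrightarrow> x \<in> den F \<pp> \<Longrightarrow> to_fract (const_poly c) *s x \<in> den F \<pp>"
    and img: "\<And>u. u \<in> W \<Longrightarrow> (\<lambda>\<pp>. to_fract_vec u) \<in> sections F"
    and surj: "\<And>s. s \<in> sections F \<Longrightarrow> \<exists>u\<in>W. \<forall>\<pp>\<in>Proj. s \<pp> - to_fract_vec u \<in> den F \<pp>"
    and ker: "\<And>u. u \<in> W \<Longrightarrow> (\<forall>\<pp>\<in>Proj. to_fract_vec u \<in> den F \<pp>) \<longleftrightarrow> u \<in> N"
  shows "h0 F = V.dim W - V.dim N"
proof -
  note vs = vector_space_section_scale[where 'k = 'k and 'r = 'n]
  interpret S: vector_space "section_scale :: 'k \<Rightarrow> ('k poly4 set \<Rightarrow> 'k ratfun ^ 'n) \<Rightarrow> _" by (rule vs)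
  let ?N = "null_sections F"
  have N0: "0 \<in> ?N" using den(1) by (simp add: null_sections_def zero_fun_def)
  have Nadd: "x + y \<in> ?N" if "x \<in> ?N" "y \<in> ?N" for x y
    using den(2) that by (simp add: null_sections_def)
  have Nscale: "section_scale c x \<in> ?N" if "x \<in> ?N" for c x
    using den(3) that by (simp add: null_sections_def section_scale_def)
  have ex: "has_quotient_dim UNIV section_scale (sections F) ?N (V.dim W - V.dim N)"
  proof (rule has_quotient_dim_transport[where ?s1.0 = vscale and W = W and N = N and f = "\<lambda>u \<pp>. to_fract_vec u"])
    show "vector_space (vscale :: 'k \<Rightarrow> 'k poly4 ^ 'n \<Rightarrow> _)" by (rule V.vector_space_axioms)
    show "Modules.module (section_scale :: 'k \<Rightarrow> ('k poly4 set \<Rightarrow> 'k ratfun ^ 'n) \<Rightarrow> _)" by (rule S.module_axioms)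
    show "(\<lambda>\<pp>. to_fract_vec (x + y)) = (\<lambda>\<pp>. to_fract_vec x) + (\<lambda>\<pp>. to_fract_vec y)" for x y :: "'k poly4 ^ 'n"
      by (simp add: to_fract_vec_simps plus_fun_def)
    show "(\<lambda>\<pp>. to_fract_vec (vscale c x)) = section_scale c (\<lambda>\<pp>. to_fract_vec x)" for c and x :: "'k poly4 ^ 'n"
      by (simp add: vscale_def section_scale_def to_fract_vec_simps)
    show "- x \<in> ?N" if "x \<in> ?N" for x using Nscale[OF that, of "-1"] by simp
    show "\<exists>u\<in>W. s - (\<lambda>\<pp>. to_fract_vec u) \<in> ?N" if "s \<in> sections F" for s
      using surj[OF that] by (simp add: null_sections_def)
    show "(\<lambda>\<pp>. to_fract_vec u) \<in> ?N \<longleftrightarrow> u \<in> N" if "u \<in> W" for u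
      using ker[OF that] by (simp add: null_sections_def)
    show "has_quotient_dim UNIV vscale W N (V.dim W - V.dim N)"
      by (rule V.has_quotient_dim_exists[OF W N fin])
  qed (use img Nadd V.subspace_add[OF W] V.subspace_scale[OF W] V.subspace_0[OF W] in simp_all)
  have "0 \<in> sections F" using img[OF V.subspace_0[OF W]] by (simp add: to_fract_vec_simps zero_fun_def)
  then have uniq: "n = V.dim W - V.dim N" if "has_quotient_dim UNIV section_scale (sections F) ?N n" for n
    using has_quotient_dim_unique[OF vs is_subfield_UNIV N0 Nadd Nscale _ that ex] by simp
  have sc: "(\<lambda>c s \<pp>. to_fract (const_poly c) *s s \<pp>) = (section_scale :: 'k \<Rightarrow> ('k poly4 set \<Rightarrow> 'k ratfun ^ 'n) \<Rightarrow> _)"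
    by (simp add: fun_eq_iff section_scale_def)
  show ?thesis unfolding h0_def sc using ex uniq by (rule the_equality)
qed

lemma sum_O_closed:
  assumes p: "\<pp> \<in> Proj"
  shows "0 \<in> sum_O e \<pp>" "v \<in> sum_O e \<pp> \<Longrightarrow> w \<in> sum_O e \<pp> \<Longrightarrow> v + w \<in> sum_O e \<pp>"
    "v \<in> sum_O e \<pp> \<Longrightarrow> - v \<in> sum_O e \<pp>"
    "c \<in> O_stalk t \<pp> \<Longrightarrow> v \<in> sum_O e \<pp> \<Longrightarrow> c *s v \<in> sum_O (\<lambda>i. e i + t) \<pp>"
  using O_stalk_zero[OF p] O_stalk_add[OF p] O_stalk_uminus[OF p] O_stalk_mult[OF p, of c t]
  by (auto simp: sum_O_def add.commute[of _ t])

lemma twist_stalks_sum_O: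
  assumes p: "\<pp> \<in> Proj"
  shows "twist_stalks (int t) (sum_O e) \<pp> = sum_O (\<lambda>i. e i + int t) \<pp>"
proof
  show "twist_stalks (int t) (sum_O e) \<pp> \<subseteq> sum_O (\<lambda>i. e i + int t) \<pp>"
    using sum_O_closed(4)[OF p] by (auto simp: twist_stalks_def)
  show "sum_O (\<lambda>i. e i + int t) \<pp> \<subseteq> twist_stalks (int t) (sum_O e) \<pp>"
  proof
    fix v assume v: "v \<in> sum_O (\<lambda>i. e i + int t) \<pp>"
    obtain i where i: "var i \<notin> \<pp>" using Proj_var[OF p] by blast
    let ?x = "var i ^ t"
    have hom: "homogeneous t (?x :: 'a poly4)" using homogeneous_power[OF homogeneous_var(2)[of i], of t] by simp
    have x: "?x \<notin> \<pp>" using Proj_power[OF p i] .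
    then have "to_fract ?x \<noteq> 0" using Proj_zero[OF p] by auto
    then have "v = to_fract ?x *s (inverse (to_fract ?x) *s v)" by (simp add: vector_smult_assoc)
    moreover have "inverse (to_fract ?x) *s v \<in> sum_O e \<pp>"
      using sum_O_closed(4)[OF p O_stalk_inverse[OF p hom x] v] by simp
    moreover have "to_fract ?x \<in> O_stalk (int t) \<pp>" by (rule O_stalk_to_fract[OF p hom])
    ultimately show "v \<in> twist_stalks (int t) (sum_O e) \<pp>" unfolding twist_stalks_def by blast
  qed
qed

section \<open>The cokernel of a homogeneous matrix\<close>

definition frac_map :: "'k::field poly4 ^ 'c ^ 'r \<Rightarrow> 'k ratfun ^ 'c \<Rightarrow> 'k ratfun ^ 'r" where
  "frac_map A v = (\<chi> i j. to_fract (A $ i $ j)) *v v"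

lemma frac_map_simps:
  "frac_map A (v + w) = frac_map A v + frac_map A w" "frac_map A (c *s v) = c *s frac_map A v"
  "frac_map A 0 = 0" "frac_map A (- v) = - frac_map A v"
  "frac_map A (to_fract_vec u) = to_fract_vec (A *v u)"
proof -
  have hom: "to_fract (sum f X) = (\<Sum>i\<in>X. to_fract (f i))" for f :: "'c \<Rightarrow> 'a poly4" and X
    by (induction X rule: infinite_finite_induct) auto
  show "frac_map A (v + w) = frac_map A v + frac_map A w" "frac_map A (c *s v) = c *s frac_map A v"
    "frac_map A 0 = 0" "frac_map A (- v) = - frac_map A v"
    "frac_map A (to_fract_vec u) = to_fract_vec (A *v u)"
    by (simp_all add: frac_map_def matrix_vector_mult_def Finite_Cartesian_Product.vec_eq_iff algebra_simps
        sum.distrib sum_distrib_left sum_negf hom)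
qed

definition matrix_image :: "'k::field poly4 ^ 'c ^ 'r \<Rightarrow> nat \<Rightarrow> ('k poly4 ^ 'r) set" where
  "matrix_image A n = (*v) A ` gr (\<lambda>_. 0) n"

text \<open>The image sheaf \<open>im(A)(t)\<close>, stalk by stalk.\<close>

definition image_stalk :: "'k::field poly4 ^ 'c ^ 'r \<Rightarrow> int \<Rightarrow> 'k poly4 set \<Rightarrow> ('k ratfun ^ 'r) set" where
  "image_stalk A t \<pp> = frac_map A ` sum_O (\<lambda>_. t) \<pp>"

definition coker_sheaf :: "('r \<Rightarrow> nat) \<Rightarrow> 'k::field poly4 ^ 'c ^ 'r \<Rightarrow> ('k, 'r::finite) P3_sheaf" where
  "coker_sheaf e A = \<lparr>num = sum_O (\<lambda>i. int (e i)), den = image_stalk A 0\<rparr>"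

lemma image_stalk_closed:
  assumes p: "\<pp> \<in> Proj"
  shows "0 \<in> image_stalk A t \<pp>"
    "x \<in> image_stalk A t \<pp> \<Longrightarrow> y \<in> image_stalk A t \<pp> \<Longrightarrow> x + y \<in> image_stalk A t \<pp>"
    "x \<in> image_stalk A t \<pp> \<Longrightarrow> - x \<in> image_stalk A t \<pp>"
    "x \<in> image_stalk A t \<pp> \<Longrightarrow> y \<in> image_stalk A t \<pp> \<Longrightarrow> x - y \<in> image_stalk A t \<pp>"
    "c \<in> O_stalk m \<pp> \<Longrightarrow> x \<in> image_stalk A t \<pp> \<Longrightarrow> c *s x \<in> image_stalk A (t + m) \<pp>"
proof -
  note cl = sum_O_closed[OF p]
  show "0 \<in> image_stalk A t \<pp>"
    unfolding image_stalk_def by (rule image_eqI[OF _ cl(1)]) (simp add: frac_map_simps)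
  show "c *s x \<in> image_stalk A (t + m) \<pp>" if c: "c \<in> O_stalk m \<pp>" and x: "x \<in> image_stalk A t \<pp>"
  proof -
    obtain v where v: "x = frac_map A v" "v \<in> sum_O (\<lambda>_. t) \<pp>" using x by (auto simp: image_stalk_def)
    show ?thesis unfolding image_stalk_def v(1) frac_map_simps(2)[symmetric] by (intro imageI cl(4) c v(2))
  qed
  show add: "x + y \<in> image_stalk A t \<pp>" if x: "x \<in> image_stalk A t \<pp>" and y: "y \<in> image_stalk A t \<pp>" for x y
  proof -
    obtain v w where v: "x = frac_map A v" "v \<in> sum_O (\<lambda>_. t) \<pp>" and w: "y = frac_map A w" "w \<in> sum_O (\<lambda>_. t) \<pp>"
      using x y by (auto simp: image_stalk_def)
    show ?thesis unfolding image_stalk_def v(1) w(1) frac_map_simps(1)[symmetric] by (intro imageI cl(2) v(2) w(2))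
  qed
  show neg: "- x \<in> image_stalk A t \<pp>" if x: "x \<in> image_stalk A t \<pp>" for x
  proof -
    obtain v where v: "x = frac_map A v" "v \<in> sum_O (\<lambda>_. t) \<pp>" using x by (auto simp: image_stalk_def)
    show ?thesis unfolding image_stalk_def v(1) frac_map_simps(4)[symmetric] by (intro imageI cl(3) v(2))
  qed
  show "x - y \<in> image_stalk A t \<pp>" if "x \<in> image_stalk A t \<pp>" "y \<in> image_stalk A t \<pp>"
    using add[OF that(1) neg[OF that(2)]] by simp
qed

lemma image_stalk_poly_mult:
  assumes p: "\<pp> \<in> Proj" and f: "homogeneous m f" and x: "x \<in> image_stalk A (int t) \<pp>"
  shows "to_fract f *s x \<in> image_stalk A (int (t + m)) \<pp>"
  using image_stalk_closed(5)[OF p O_stalk_to_fract[OF p f] x] by simp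

lemma image_stalk_cancel:
  assumes p: "\<pp> \<in> Proj" and f: "homogeneous m f" "f \<notin> \<pp>" and x: "to_fract f *s x \<in> image_stalk A (int (t + m)) \<pp>"
  shows "x \<in> image_stalk A (int t) \<pp>"
proof -
  have "to_fract f \<noteq> 0" using f(2) Proj_zero[OF p] by auto
  then have "inverse (to_fract f) *s (to_fract f *s x) = x" by (simp add: vector_smult_assoc)
  then show ?thesis using image_stalk_closed(5)[OF p O_stalk_inverse[OF p f] x] by simp
qed

lemma gr_zero [simp]: "0 \<in> gr e n"
  and gr_add: "v \<in> gr e n \<Longrightarrow> w \<in> gr e n \<Longrightarrow> v + w \<in> gr e n"
  and gr_diff: "v \<in> gr e n \<Longrightarrow> w \<in> gr e n \<Longrightarrow> v - w \<in> gr e n"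
  by (rule graded_submoduleD[OF graded_submodule_gr]; assumption)+

context
  fixes e :: "'r::finite \<Rightarrow> nat" and A :: "'k::field_char_0 poly4 ^ 'c::finite ^ 'r"
  assumes A: "\<And>i j. homogeneous (e i) (A $ i $ j)"
begin

lemma mult_mem_gr: "v \<in> gr (\<lambda>_. 0) n \<Longrightarrow> A *v v \<in> gr e n"
proof -
  assume "v \<in> gr (\<lambda>_. 0) n"
  then have "homogeneous n (v $ j)" for j by (simp add: gr_def)
  then have "homogeneous (n + e i) (\<Sum>j\<in>UNIV. A $ i $ j * v $ j)" for i
    using homogeneous_mult[OF A[of i]] by (intro homogeneous_sum) (simp add: add.commute)
  then show ?thesis by (simp add: gr_def matrix_vector_mult_def)
qed

lemma graded_submodule_matrix_image: "graded_submodule e (matrix_image A)"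
  unfolding graded_submodule_def
proof (intro allI conjI ballI)
  fix n
  note G = graded_submodule_gr[of "\<lambda>_. 0 :: nat"]
  show "matrix_image A n \<subseteq> gr e n" using mult_mem_gr by (auto simp: matrix_image_def)
  have sc: "A *v vscale c v = vscale c (A *v v)" for c v
    by (simp add: matrix_vector_mult_def Finite_Cartesian_Product.vec_eq_iff sum_distrib_left ac_simps)
  have "Vector_Spaces.linear vscale vscale ((*v) A)"
    by unfold_locales (simp_all add: sc matrix_vector_right_distrib)
  then show "V.subspace (matrix_image A n)"
    unfolding matrix_image_def by (intro VV.linear_subspace_image subspace_gr)
  fix w i assume "w \<in> matrix_image A n"
  then obtain v where v: "w = A *v v" "v \<in> gr (\<lambda>_. 0) n" by (auto simp: matrix_image_def)
  have "var i *s w = A *v (var i *s v)"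
    by (simp add: v(1) matrix_vector_mult_def Finite_Cartesian_Product.vec_eq_iff sum_distrib_left ac_simps)
  then show "var i *s w \<in> matrix_image A (Suc n)"
    unfolding matrix_image_def using graded_submoduleD(3)[OF G v(2)] by blast
qed

lemma image_stalk_iff:
  assumes p: "\<pp> \<in> Proj" and u: "u \<in> gr e t"
  shows "to_fract_vec u \<in> image_stalk A (int t) \<pp> \<longleftrightarrow>
    (\<exists>n b. homogeneous n b \<and> b \<notin> \<pp> \<and> b *s u \<in> matrix_image A (t + n))"
proof
  assume "to_fract_vec u \<in> image_stalk A (int t) \<pp>"
  then obtain w where w: "to_fract_vec u = frac_map A w" "w \<in> sum_O (\<lambda>_. int t) \<pp>" by (auto simp: image_stalk_def)
  obtain n b z where b: "homogeneous n b" "b \<notin> \<pp>" "z \<in> gr (\<lambda>_. 0) (t + n)" "to_fract b *s w = to_fract_vec z"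
    using sum_O_clear_denominators[OF p, of w "\<lambda>_. 0" t] w(2) by auto
  have "to_fract_vec (b *s u) = to_fract_vec (A *v z)"
    unfolding to_fract_vec_simps(3) w(1) frac_map_simps(2,5)[symmetric] b(4) ..
  then have "b *s u = A *v z" by (simp only: to_fract_vec_simps(5))
  then show "\<exists>n b. homogeneous n b \<and> b \<notin> \<pp> \<and> b *s u \<in> matrix_image A (t + n)"
    unfolding matrix_image_def using b by blast
next
  assume "\<exists>n b. homogeneous n b \<and> b \<notin> \<pp> \<and> b *s u \<in> matrix_image A (t + n)"
  then obtain n b z where b: "homogeneous n b" "b \<notin> \<pp>" "z \<in> gr (\<lambda>_. 0) (t + n)" "b *s u = A *v z"
    by (auto simp: matrix_image_def)
  have "to_fract_vec z \<in> sum_O (\<lambda>_. int (t + n)) \<pp>"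
    using to_fract_vec_mem_sum_O[OF p b(3)] by simp
  then have "to_fract_vec (b *s u) \<in> image_stalk A (int (t + n)) \<pp>"
    unfolding image_stalk_def b(4) frac_map_simps(5)[symmetric] by (rule imageI)
  then show "to_fract_vec u \<in> image_stalk A (int t) \<pp>"
    unfolding to_fract_vec_simps(3) by (rule image_stalk_cancel[OF p b(1,2)])
qed

lemma graded_ideal_colon: 
  assumes N: "graded_submodule e N"
  shows "graded_ideal (\<lambda>n. {b. homogeneous n b \<and> b *s u \<in> N (t + n)})"
  unfolding graded_ideal_def
proof (intro allI conjI ballI impI)
  fix n
  show "0 \<in> {b. homogeneous n b \<and> b *s u \<in> N (t + n)}" using graded_submoduleD(4)[OF N] by simp
  fix b assume b: "b \<in> {b. homogeneous n b \<and> b *s u \<in> N (t + n)}"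
  then show "homogeneous n b" by blast
  show "b + c \<in> {b. homogeneous n b \<and> b *s u \<in> N (t + n)}" if "c \<in> {b. homogeneous n b \<and> b *s u \<in> N (t + n)}" for c
    using b that graded_submoduleD(5)[OF N] homogeneous_add by (auto simp: vector_sadd_rdistrib)
  show "h * b \<in> {b. homogeneous (n + m) b \<and> b *s u \<in> N (t + (n + m))}" if h: "homogeneous m h" for m h
  proof -
    have "h *s (b *s u) \<in> N (t + n + m)" using b by (intro graded_submodule_mult[OF N h]) blast
    then show ?thesis using b homogeneous_mult[OF h, of n b] by (simp add: vector_smult_assoc ac_simps)
  qed
qed

text \<open>The forms that multiply \<open>u\<close> into the image constitute a graded ideal without zeros, so powers of the
  variables do.\<close>

lemma stalks_imp_sat:
  assumes u: "u \<in> gr e t" and st: "\<And>\<pp>. \<pp> \<in> Proj \<Longrightarrow> to_fract_vec u \<in> image_stalk A (int t) \<pp>"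
  shows "u \<in> sat e (matrix_image A) t"
proof (rule satI_powers[OF graded_submodule_matrix_image u])
  fix i :: 4
  have "\<exists>N. var i ^ N \<in> {b. homogeneous (1 * N) b \<and> b *s u \<in> matrix_image A (t + (1 * N))}"
  proof (rule graded_nullstellensatz[OF graded_ideal_colon[OF graded_submodule_matrix_image]])
    fix \<pp> :: "'k poly4 set" assume "\<pp> \<in> Proj"
    then show "\<exists>n. \<exists>g\<in>{b. homogeneous n b \<and> b *s u \<in> matrix_image A (t + n)}. g \<notin> \<pp>"
      using st[OF \<open>\<pp> \<in> Proj\<close>] image_stalk_iff[OF \<open>\<pp> \<in> Proj\<close> u] by blast
  qed simp_all
  then show "\<exists>N. var i ^ N *s u \<in> matrix_image A (t + N)" by auto
qed

lemma image_imp_stalks: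
  assumes "u \<in> matrix_image A t" "\<pp> \<in> Proj"
  shows "to_fract_vec u \<in> image_stalk A (int t) \<pp>"
proof -
  have "u \<in> gr e t" using assms(1) graded_submoduleD(2)[OF graded_submodule_matrix_image] by blast
  moreover have "homogeneous 0 (1 :: 'k poly4) \<and> 1 \<notin> \<pp> \<and> 1 *s u \<in> matrix_image A (t + 0)"
    using assms Proj_one by simp
  ultimately show ?thesis using image_stalk_iff[OF assms(2)] by blast
qed

text \<open>The vector \<open>u\<close> induces \<open>s\<close> as a section of the cokernel twisted by \<open>t\<close>.\<close>

definition represents :: "'k poly4 ^ 'r \<Rightarrow> nat \<Rightarrow> ('k poly4 set \<Rightarrow> 'k ratfun ^ 'r) \<Rightarrow> bool" where
  "represents u t s \<longleftrightarrow> u \<in> gr e t \<and> (\<forall>\<pp>\<in>Proj. s \<pp> - to_fract_vec u \<in> image_stalk A (int t) \<pp>)"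

abbreviation fmult :: "'k poly4 \<Rightarrow> ('k poly4 set \<Rightarrow> 'k ratfun ^ 'r) \<Rightarrow> 'k poly4 set \<Rightarrow> 'k ratfun ^ 'r" where
  "fmult f s \<equiv> (\<lambda>\<pp>. to_fract f *s s \<pp>)"

lemma represents_mult:
  assumes "represents u t s" "homogeneous m f"
  shows "represents (f *s u) (t + m) (fmult f s)"
  unfolding represents_def
proof (intro conjI ballI)
  show "f *s u \<in> gr e (t + m)" using assms gr_mult by (auto simp: represents_def)
  fix \<pp> :: "'k poly4 set" assume p: "\<pp> \<in> Proj"
  have "to_fract f *s s \<pp> - to_fract_vec (f *s u) = to_fract f *s (s \<pp> - to_fract_vec u)"
    by (simp add: to_fract_vec_simps vector_ssub_ldistrib)
  moreover have "s \<pp> - to_fract_vec u \<in> image_stalk A (int t) \<pp>" using assms(1) p by (simp add: represents_def)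
  ultimately show "to_fract f *s s \<pp> - to_fract_vec (f *s u) \<in> image_stalk A (int (t + m)) \<pp>"
    by (simp only: image_stalk_poly_mult[OF p assms(2)])
qed

lemma represents_diff:
  assumes "represents u t s" "represents u' t s"
  shows "u - u' \<in> sat e (matrix_image A) t"
proof (rule stalks_imp_sat)
  show "u - u' \<in> gr e t" using assms by (auto simp: represents_def intro: gr_diff)
  fix \<pp> :: "'k poly4 set" assume p: "\<pp> \<in> Proj"
  have "to_fract_vec (u - u') = (s \<pp> - to_fract_vec u') - (s \<pp> - to_fract_vec u)" by (simp add: to_fract_vec_simps)
  moreover have "s \<pp> - to_fract_vec u' \<in> image_stalk A (int t) \<pp>" "s \<pp> - to_fract_vec u \<in> image_stalk A (int t) \<pp>"
    using assms p by (simp_all add: represents_def)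
  ultimately show "to_fract_vec (u - u') \<in> image_stalk A (int t) \<pp>"
    by (simp only: image_stalk_closed(4)[OF p])
qed

definition multipliers :: "nat \<Rightarrow> ('k poly4 set \<Rightarrow> 'k ratfun ^ 'r) \<Rightarrow> nat \<Rightarrow> 'k poly4 set" where
  "multipliers t s n = {b. homogeneous n b \<and> (\<exists>u. represents u (t + n) (fmult b s))}"

lemma graded_ideal_multipliers: "graded_ideal (multipliers t s)"
  unfolding graded_ideal_def
proof (intro allI conjI ballI impI)
  fix n
  have "represents 0 (t + n) (fmult 0 s)"
    by (simp add: represents_def to_fract_vec_simps image_stalk_closed(1))
  then show "0 \<in> multipliers t s n" unfolding multipliers_def by (auto intro!: exI)
  fix b assume "b \<in> multipliers t s n"
  then obtain u where b: "homogeneous n b" "represents u (t + n) (fmult b s)" by (auto simp: multipliers_def)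
  show "homogeneous n b" by fact
  show "h * b \<in> multipliers t s (n + m)" if h: "homogeneous m h" for m h
    using represents_mult[OF b(2) h] homogeneous_mult[OF h b(1)]
    by (auto simp: multipliers_def vector_smult_assoc ac_simps)
  fix c assume "c \<in> multipliers t s n"
  then obtain w where c: "homogeneous n c" "represents w (t + n) (fmult c s)" by (auto simp: multipliers_def)
  have "represents (u + w) (t + n) (fmult (b + c) s)"
    unfolding represents_def
  proof (intro conjI ballI)
    show "u + w \<in> gr e (t + n)" using b c by (auto simp: represents_def intro: gr_add)
    fix \<pp> :: "'k poly4 set" assume p: "\<pp> \<in> Proj"
    have "to_fract (b + c) *s s \<pp> - to_fract_vec (u + w)
        = (to_fract b *s s \<pp> - to_fract_vec u) + (to_fract c *s s \<pp> - to_fract_vec w)"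
      by (simp add: to_fract_vec_simps vector_sadd_rdistrib)
    moreover have "to_fract b *s s \<pp> - to_fract_vec u \<in> image_stalk A (int (t + n)) \<pp>"
      "to_fract c *s s \<pp> - to_fract_vec w \<in> image_stalk A (int (t + n)) \<pp>"
      using b c p by (simp_all add: represents_def)
    ultimately show "to_fract (b + c) *s s \<pp> - to_fract_vec (u + w) \<in> image_stalk A (int (t + n)) \<pp>"
      by (simp only: image_stalk_closed(2)[OF p])
  qed
  then show "b + c \<in> multipliers t s n" using homogeneous_add[OF b(1) c(1)] by (auto simp: multipliers_def)
qed

text \<open>A section of the twisted cokernel, given by fractions on basic open sets.\<close>

definition local_section :: "nat \<Rightarrow> ('k poly4 set \<Rightarrow> 'k ratfun ^ 'r) \<Rightarrow> bool" where
  "local_section t s \<longleftrightarrow> (\<forall>\<pp>\<in>Proj. \<exists>n h u. homogeneous n h \<and> 0 < n \<and> h \<notin> \<pp> \<and> u \<in> gr e (t + n)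
     \<and> (\<forall>\<qq>\<in>Proj. h \<notin> \<qq> \<longrightarrow> to_fract h *s s \<qq> - to_fract_vec u \<in> image_stalk A (int (t + n)) \<qq>))"

text \<open>Gluing: on the intersection of two members of a finite cover by basic open sets the two local
  fractions agree up to a common power of the denominators, and after multiplication
  with this power every denominator becomes a global multiplier.\<close>

lemma local_section_multipliers:
  assumes s: "local_section t s" and p: "\<pp> \<in> Proj"
  shows "\<exists>n. \<exists>b\<in>multipliers t s n. b \<notin> \<pp>"
proof -
  define good where "good n h u \<longleftrightarrow> homogeneous n h \<and> 0 < n \<and> u \<in> gr e (t + n)
     \<and> (\<forall>\<qq>\<in>Proj. h \<notin> \<qq> \<longrightarrow> to_fract h *s s \<qq> - to_fract_vec u \<in> image_stalk A (int (t + n)) \<qq>)" for n h u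
  define H where "H = {h. \<exists>n u. good n h u}"
  have "\<exists>H'\<subseteq>H. finite H' \<and> (\<forall>\<pp>\<in>Proj. \<exists>h\<in>H'. h \<notin> \<pp>)"
  proof (rule Proj_quasi_compact)
    fix \<qq> :: "'k poly4 set" assume "\<qq> \<in> Proj"
    then obtain n h u where "good n h u" "h \<notin> \<qq>" using s unfolding local_section_def good_def by blast
    then show "\<exists>h\<in>H. h \<notin> \<qq> \<and> (\<exists>n. homogeneous n h)" unfolding H_def good_def by blast
  qed
  then obtain H' where H': "H' \<subseteq> H" "finite H'" "\<And>\<pp>. \<pp> \<in> Proj \<Longrightarrow> \<exists>h\<in>H'. h \<notin> \<pp>" by blast
  have "\<forall>h\<in>H'. \<exists>n u. good n h u" using H'(1) unfolding H_def by blast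
  then obtain d u where du: "\<And>h. h \<in> H' \<Longrightarrow> good (d h) h (u h)" by metis
  have hom: "homogeneous (d h) h" "0 < d h" "u h \<in> gr e (t + d h)" if "h \<in> H'" for h
    using du[OF that] by (simp_all add: good_def)
  have loc: "to_fract h *s s \<qq> - to_fract_vec (u h) \<in> image_stalk A (int (t + d h)) \<qq>"
    if "h \<in> H'" "\<qq> \<in> Proj" "h \<notin> \<qq>" for h \<qq>
    using du[OF that(1)] that(2,3) by (simp add: good_def)
  \<comment> \<open>the difference of the two fractions on an intersection, with denominators cleared\<close>
  define x where "x g h = h *s u g - g *s u h" for g h
  have x_gr: "x g h \<in> gr e (t + (d g + d h))" if "g \<in> H'" "h \<in> H'" for g h
    using gr_mult[OF hom(1)[OF that(2)] hom(3)[OF that(1)]] gr_mult[OF hom(1)[OF that(1)] hom(3)[OF that(2)]]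
      by (auto simp: x_def ac_simps intro!: gr_diff)
  have x_stalk: "to_fract_vec (x g h) \<in> image_stalk A (int (t + (d g + d h))) \<qq>"
    if g: "g \<in> H'" "h \<in> H'" and q: "\<qq> \<in> Proj" "g * h \<notin> \<qq>" for g h \<qq>
  proof -
    have ng: "g \<notin> \<qq>" "h \<notin> \<qq>" using q(2) Proj_mult_iff[OF q(1)] by auto
    have "to_fract_vec (x g h) = to_fract g *s (to_fract h *s s \<qq> - to_fract_vec (u h))
        - to_fract h *s (to_fract g *s s \<qq> - to_fract_vec (u g))"
      by (simp add: x_def to_fract_vec_simps vector_ssub_ldistrib vector_smult_assoc mult.commute)
    moreover have "to_fract g *s (to_fract h *s s \<qq> - to_fract_vec (u h)) \<in> image_stalk A (int (t + (d g + d h))) \<qq>"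
      using image_stalk_poly_mult[OF q(1) hom(1)[OF g(1)] loc[OF g(2) q(1) ng(2)]] by (simp add: ac_simps)
    moreover have "to_fract h *s (to_fract g *s s \<qq> - to_fract_vec (u g)) \<in> image_stalk A (int (t + (d g + d h))) \<qq>"
      using image_stalk_poly_mult[OF q(1) hom(1)[OF g(2)] loc[OF g(1) q(1) ng(1)]] by (simp add: ac_simps)
    ultimately show ?thesis by (simp only: image_stalk_closed(4)[OF q(1)])
  qed
  note N = graded_submodule_matrix_image
  have "\<exists>n. (g * h) ^ n *s x g h \<in> matrix_image A (t + (d g + d h) + (d g + d h) * n)" if g: "g \<in> H'" "h \<in> H'" for g h
  proof -
    have "\<exists>n. (g * h) ^ n \<in> {b. homogeneous ((d g + d h) * n) b \<and> b *s x g h \<in> matrix_image A (t + (d g + d h) + (d g + d h) * n)}"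
    proof (rule graded_nullstellensatz[OF graded_ideal_colon[OF N]])
      show "homogeneous (d g + d h) (g * h)" using g by (intro homogeneous_mult hom)
      show "0 < d g + d h" using hom(2)[OF g(1)] by simp
      fix \<qq> :: "'k poly4 set" assume q: "\<qq> \<in> Proj" "g * h \<notin> \<qq>"
      show "\<exists>n. \<exists>b\<in>{b. homogeneous n b \<and> b *s x g h \<in> matrix_image A (t + (d g + d h) + n)}. b \<notin> \<qq>"
        using x_stalk[OF g q] image_stalk_iff[OF q(1) x_gr[OF g]] by blast
    qed
    then show ?thesis by blast
  qed
  then obtain N0 where N0: "\<And>g h. g \<in> H' \<Longrightarrow> h \<in> H' \<Longrightarrow>
      (g * h) ^ N0 g h *s x g h \<in> matrix_image A (t + (d g + d h) + (d g + d h) * N0 g h)" by metis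
  define M where "M = (\<Sum>p\<in>H' \<times> H'. N0 (fst p) (snd p))"
  have M: "(g * h) ^ M *s x g h \<in> matrix_image A (t + (d g + d h) + (d g + d h) * M)" if g: "g \<in> H'" "h \<in> H'" for g h
  proof -
    have le: "N0 g h \<le> M" unfolding M_def
      using member_le_sum[of "(g, h)" "H' \<times> H'" "\<lambda>p. N0 (fst p) (snd p)"] g H'(2) by simp
    have "homogeneous ((d g + d h) * (M - N0 g h)) ((g * h) ^ (M - N0 g h))"
      using g by (intro homogeneous_power homogeneous_mult hom)
    from graded_submodule_mult[OF N this N0[OF g]]
    have "((g * h) ^ (M - N0 g h) * (g * h) ^ N0 g h) *s x g h
        \<in> matrix_image A (t + (d g + d h) + (d g + d h) * N0 g h + (d g + d h) * (M - N0 g h))"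
      by (simp only: vector_smult_assoc)
    moreover have "(d g + d h) * N0 g h + (d g + d h) * (M - N0 g h) = (d g + d h) * M"
      using le by (simp add: distrib_left[symmetric])
    ultimately show ?thesis using le by (simp add: power_add[symmetric] add.assoc)
  qed
  obtain h where h: "h \<in> H'" "h \<notin> \<pp>" using H'(3)[OF p] by blast
  have "represents (h ^ M *s u h) (t + d h * Suc M) (fmult (h ^ Suc M) s)"
    unfolding represents_def
  proof (intro conjI ballI)
    show "h ^ M *s u h \<in> gr e (t + d h * Suc M)"
      using gr_mult[OF homogeneous_power[OF hom(1)[OF h(1)], of M] hom(3)[OF h(1)]] by (simp add: ac_simps)
    fix \<qq> :: "'k poly4 set" assume q: "\<qq> \<in> Proj"
    obtain g where g: "g \<in> H'" "g \<notin> \<qq>" using H'(3)[OF q] by blast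
    let ?y = "to_fract (h ^ Suc M) *s s \<qq> - to_fract_vec (h ^ M *s u h)"
    have gM: "homogeneous (d g * Suc M) (g ^ Suc M)" using hom(1)[OF g(1)] by (rule homogeneous_power)
    have eq: "to_fract (g ^ Suc M) *s ?y = to_fract (g ^ M * h ^ Suc M) *s (to_fract g *s s \<qq> - to_fract_vec (u g))
        + to_fract_vec ((g * h) ^ M *s x g h)"
      by (simp add: x_def to_fract_vec_simps vector_ssub_ldistrib vector_smult_assoc power_mult_distrib ac_simps)
    have "homogeneous (d g * M + d h * Suc M) (g ^ M * h ^ Suc M)"
      using g h by (intro homogeneous_mult homogeneous_power hom)
    from image_stalk_poly_mult[OF q this loc[OF g(1) q g(2)]]
    have "to_fract (g ^ M * h ^ Suc M) *s (to_fract g *s s \<qq> - to_fract_vec (u g))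
        \<in> image_stalk A (int (t + d h * Suc M + d g * Suc M)) \<qq>"
      by (simp add: algebra_simps)
    moreover have "to_fract_vec ((g * h) ^ M *s x g h) \<in> image_stalk A (int (t + d h * Suc M + d g * Suc M)) \<qq>"
      using image_imp_stalks[OF M[OF g(1) h(1)] q] by (simp add: algebra_simps)
    ultimately have "to_fract (g ^ Suc M) *s ?y \<in> image_stalk A (int (t + d h * Suc M + d g * Suc M)) \<qq>"
      unfolding eq by (rule image_stalk_closed(2)[OF q])
    then show "?y \<in> image_stalk A (int (t + d h * Suc M)) \<qq>"
      by (rule image_stalk_cancel[OF q gM Proj_power[OF q g(2)]])
  qed
  then have "h ^ Suc M \<in> multipliers t s (d h * Suc M)"
    using homogeneous_power[OF hom(1)[OF h(1)], of "Suc M"] unfolding multipliers_def by blast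
  moreover have "h ^ Suc M \<notin> \<pp>" using Proj_power[OF p h(2)] .
  ultimately show ?thesis by blast
qed

lemma multiplier_powers:
  assumes "local_section t s" "homogeneous a h" "0 < a"
  shows "\<exists>N u. represents u (t + a * N) (fmult (h ^ N) s)"
proof -
  have "\<exists>N. h ^ N \<in> multipliers t s (a * N)"
    by (rule graded_nullstellensatz[OF graded_ideal_multipliers assms(2,3)])
      (rule local_section_multipliers[OF assms(1)])
  then show ?thesis by (auto simp: multipliers_def)
qed

text \<open>Serre's theorem for the cokernel.  Let \<open>x = lin \<alpha>\<close> be injective on the module \<open>M\<close>
  in large degrees.  If \<open>x s\<close> comes from \<open>u\<close> in \<open>M\<close>, then \<open>u\<close> is killed modulo \<open>x\<close> by
  powers of the variables, hence divisible by \<open>x\<close> once the degree is so large that \<open>M/xM\<close> is saturated;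
  and the quotient represents \<open>s\<close>.\<close>

lemma serre_surjective:
  "\<exists>t0. \<forall>t\<ge>t0. \<forall>s. local_section t s \<longrightarrow> (\<exists>u. represents u t s)"
proof -
  let ?N = "matrix_image A"
  note N = graded_submodule_matrix_image
  have "infinite (UNIV :: 'k set)" by (rule infinite_UNIV_char_0)
  then obtain \<alpha> where \<alpha>: "\<alpha> \<notin> {\<alpha>. \<exists>n. \<exists>v\<in>gr e n. lin \<alpha> *s v \<in> sat e ?N (Suc n) \<and> v \<notin> sat e ?N n}"
    using finite_lin_zero_divisors[OF N] ex_new_if_finite by blast
  then have reg: "v \<in> sat e ?N n" if "v \<in> gr e n" "lin \<alpha> *s v \<in> sat e ?N (Suc n)" for n v
    using that by blast
  let ?N' = "add_lin e \<alpha> ?N" and ?x = "lin \<alpha>"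
  note N' = graded_submodule_add_lin[OF N, where \<alpha> = \<alpha>]
  obtain t1 where t1: "\<And>n. n \<ge> t1 \<Longrightarrow> sat e ?N n = ?N n" using sat_eventually[OF N] by blast
  obtain t2 where t2: "\<And>n. n \<ge> t2 \<Longrightarrow> sat e ?N' n = ?N' n" using sat_eventually[OF N'(1)] by blast
  define t0 where "t0 = max t1 t2"
  have step: "\<exists>w. represents w t s"
    if t: "t \<ge> t0" and pow: "\<And>i. \<exists>M w. represents w (t + M) (fmult (var i ^ M) s)"
      and u: "represents u (Suc t) (fmult ?x s)" for t s u
  proof -
    obtain M w where w: "\<And>i. represents (w i) (t + M i) (fmult (var i ^ M i) s)" using pow by metis
    have hv: "homogeneous (M i) (var i ^ M i :: 'k poly4)" for i
      using homogeneous_power[OF homogeneous_var(2)[of i], of "M i"] by simp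
    have "var i ^ M i *s u \<in> ?N' (Suc t + M i)" for i
    proof -
      have a: "represents (var i ^ M i *s u) (Suc t + M i) (fmult (var i ^ M i) (fmult ?x s))"
        by (rule represents_mult[OF u hv])
      have "represents (?x *s w i) (t + M i + Suc 0) (fmult ?x (fmult (var i ^ M i) s))"
        by (rule represents_mult[OF w homogeneous_lin])
      moreover have "fmult ?x (fmult (var i ^ M i) s) = fmult (var i ^ M i) (fmult ?x s)"
        by (simp add: fun_eq_iff vector_smult_assoc mult.commute)
      ultimately have "represents (?x *s w i) (Suc t + M i) (fmult (var i ^ M i) (fmult ?x s))" by simp
      from represents_diff[OF a this]
      have "var i ^ M i *s u - ?x *s w i \<in> ?N (Suc (t + M i))" using t1[of "Suc t + M i"] t by (simp add: t0_def)
      moreover have "w i \<in> gr e (t + M i)" using w by (simp add: represents_def)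
      ultimately have "(var i ^ M i *s u - ?x *s w i) + ?x *s w i \<in> ?N' (Suc (t + M i))" by (rule add_linI)
      then show ?thesis by simp
    qed
    moreover have "u \<in> gr e (Suc t)" using u by (simp add: represents_def)
    ultimately have "u \<in> sat e ?N' (Suc t)" by (intro satI_powers[OF N'(1)]) blast+
    then have "u \<in> ?N' (Suc t)" using t2[of "Suc t"] t by (simp add: t0_def)
    then obtain y z where yz: "u = y + ?x *s z" "y \<in> ?N (Suc t)" "z \<in> gr e t" by (auto simp: add_lin_Suc)
    have xz: "to_fract ?x *s (s \<pp> - to_fract_vec z) \<in> image_stalk A (int (Suc t)) \<pp>" if p: "\<pp> \<in> Proj" for \<pp>
    proof -
      have "to_fract ?x *s (s \<pp> - to_fract_vec z) = (to_fract ?x *s s \<pp> - to_fract_vec u) + to_fract_vec y"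
        by (simp add: yz(1) to_fract_vec_simps vector_ssub_ldistrib)
      moreover have "to_fract ?x *s s \<pp> - to_fract_vec u \<in> image_stalk A (int (Suc t)) \<pp>"
        using u p by (simp add: represents_def)
      ultimately show ?thesis by (simp only: image_stalk_closed(2)[OF p _ image_imp_stalks[OF yz(2) p]])
    qed
    have pz: "to_fract (var i ^ M i) *s (s \<pp> - to_fract_vec z) \<in> image_stalk A (int (t + M i)) \<pp>" if p: "\<pp> \<in> Proj" for i \<pp>
    proof -
      define v where "v = w i - var i ^ M i *s z"
      have v: "v \<in> gr e (t + M i)" unfolding v_def
        using w[of i] gr_mult[OF hv yz(3)] by (auto simp: represents_def intro!: gr_diff)
      have rep: "to_fract (var i ^ M i) *s (s \<qq> - to_fract_vec z) - to_fract_vec v \<in> image_stalk A (int (t + M i)) \<qq>"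
        if "\<qq> \<in> Proj" for \<qq>
      proof -
        have "to_fract (var i ^ M i) *s (s \<qq> - to_fract_vec z) - to_fract_vec v
            = to_fract (var i ^ M i) *s s \<qq> - to_fract_vec (w i)"
          by (simp add: v_def to_fract_vec_simps vector_ssub_ldistrib)
        moreover have "to_fract (var i ^ M i) *s s \<qq> - to_fract_vec (w i) \<in> image_stalk A (int (t + M i)) \<qq>"
          using w[of i] that unfolding represents_def by blast
        ultimately show ?thesis by (simp only:)
      qed
      have "?x *s v \<in> sat e ?N (Suc (t + M i))"
      proof (rule stalks_imp_sat)
        show "?x *s v \<in> gr e (Suc (t + M i))" using gr_mult[OF homogeneous_lin v] by simp
        fix \<qq> :: "'k poly4 set" assume q: "\<qq> \<in> Proj"
        have "to_fract_vec (?x *s v) = to_fract (var i ^ M i) *s (to_fract ?x *s (s \<qq> - to_fract_vec z))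
            - to_fract ?x *s (to_fract (var i ^ M i) *s (s \<qq> - to_fract_vec z) - to_fract_vec v)"
          by (simp add: to_fract_vec_simps vector_ssub_ldistrib vector_smult_assoc mult.commute)
        moreover have "to_fract (var i ^ M i) *s (to_fract ?x *s (s \<qq> - to_fract_vec z)) \<in> image_stalk A (int (Suc (t + M i))) \<qq>"
          using image_stalk_poly_mult[OF q hv[of i] xz[OF q]] by (simp only: add_Suc)
        moreover have "to_fract ?x *s (to_fract (var i ^ M i) *s (s \<qq> - to_fract_vec z) - to_fract_vec v) \<in> image_stalk A (int (Suc (t + M i))) \<qq>"
          using image_stalk_poly_mult[OF q homogeneous_lin rep[OF q]] by (simp only: add_Suc_right add_0_right)
        ultimately show "to_fract_vec (?x *s v) \<in> image_stalk A (int (Suc (t + M i))) \<qq>"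
          by (simp only: image_stalk_closed(4)[OF q])
      qed
      then have "v \<in> sat e ?N (t + M i)" using reg[OF v] by blast
      then have "v \<in> ?N (t + M i)" using t1[of "t + M i"] t by (simp add: t0_def)
      from image_stalk_closed(2)[OF p rep[OF p] image_imp_stalks[OF this p]] show ?thesis by simp
    qed
    have "s \<pp> - to_fract_vec z \<in> image_stalk A (int t) \<pp>" if p: "\<pp> \<in> Proj" for \<pp>
    proof -
      obtain i where "var i \<notin> \<pp>" using Proj_var[OF p] by blast
      then show ?thesis using image_stalk_cancel[OF p hv[of i] _ pz[OF p]] Proj_power[OF p] by blast
    qed
    then show ?thesis using yz(3) by (auto simp: represents_def)
  qed
  have descend: "\<exists>w. represents w t s"
    if "t \<ge> t0" "\<And>i. \<exists>M w. represents w (t + M) (fmult (var i ^ M) s)" "represents u (t + K) (fmult (?x ^ K) s)" for K t s u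
    using that
  proof (induction K arbitrary: t s u)
    case 0
    then show ?case by (auto simp: represents_def)
  next
    case (Suc K)
    have "\<exists>w. represents w (Suc t) (fmult ?x s)"
    proof (rule Suc.IH)
      show "\<exists>M w. represents w (Suc t + M) (fmult (var i ^ M) (fmult ?x s))" for i
      proof -
        obtain M w where "represents w (t + M) (fmult (var i ^ M) s)" using Suc.prems(2) by blast
        from represents_mult[OF this homogeneous_lin[of \<alpha>]]
        have "represents (?x *s w) (Suc t + M) (fmult ?x (fmult (var i ^ M) s))" by simp
        moreover have "fmult ?x (fmult (var i ^ M) s) = fmult (var i ^ M) (fmult ?x s)"
          by (simp add: fun_eq_iff vector_smult_assoc mult.commute)
        ultimately show ?thesis by auto
      qed
      have "fmult (?x ^ Suc K) s = fmult (?x ^ K) (fmult ?x s)"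
        by (simp add: fun_eq_iff vector_smult_assoc mult.commute)
      then show "represents u (Suc t + K) (fmult (?x ^ K) (fmult ?x s))" using Suc.prems(3) by simp
    qed (use Suc.prems(1) in simp)
    then show ?case using step[OF Suc.prems(1,2)] by blast
  qed
  show ?thesis
  proof (intro exI[of _ t0] allI impI)
    fix t s assume t: "t \<ge> t0" and s: "local_section t s"
    have "\<exists>M w. represents w (t + M) (fmult (var i ^ M) s)" for i
      using multiplier_powers[OF s homogeneous_var(2)[of i]] by simp
    moreover obtain K u where "represents u (t + K) (fmult (?x ^ K) s)"
      using multiplier_powers[OF s homogeneous_lin[of \<alpha>]] by auto
    ultimately show "\<exists>u. represents u t s" using descend[OF t] by blast
  qed
qed

lemma twist_coker_sheaf:
  assumes p: "\<pp> \<in> Proj"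
  shows "num (twist (int t) (coker_sheaf e A)) \<pp> = sum_O (\<lambda>i. int (e i) + int t) \<pp>"
    and "den (twist (int t) (coker_sheaf e A)) \<pp> = image_stalk A (int t) \<pp>"
proof -
  show "num (twist (int t) (coker_sheaf e A)) \<pp> = sum_O (\<lambda>i. int (e i) + int t) \<pp>"
    by (simp add: twist_def coker_sheaf_def twist_stalks_sum_O[OF p])
  have "image_stalk A (int t) \<pp> = frac_map A ` twist_stalks (int t) (sum_O (\<lambda>_. 0)) \<pp>"
    unfolding image_stalk_def twist_stalks_sum_O[OF p] by simp
  also have "\<dots> = twist_stalks (int t) (image_stalk A 0) \<pp>"
  proof (intro subset_antisym subsetI)
    fix x assume "x \<in> frac_map A ` twist_stalks (int t) (sum_O (\<lambda>_. 0)) \<pp>"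
    then obtain c v where "x = frac_map A (c *s v)" "c \<in> O_stalk (int t) \<pp>" "v \<in> sum_O (\<lambda>_. 0) \<pp>"
      by (auto simp: twist_stalks_def)
    then show "x \<in> twist_stalks (int t) (image_stalk A 0) \<pp>"
      unfolding twist_stalks_def image_stalk_def frac_map_simps(2) by blast
  next
    fix x assume "x \<in> twist_stalks (int t) (image_stalk A 0) \<pp>"
    then obtain c v where "x = c *s frac_map A v" "c \<in> O_stalk (int t) \<pp>" "v \<in> sum_O (\<lambda>_. 0) \<pp>"
      by (auto simp: twist_stalks_def image_stalk_def)
    then show "x \<in> frac_map A ` twist_stalks (int t) (sum_O (\<lambda>_. 0)) \<pp>"
      unfolding twist_stalks_def frac_map_simps(2)[symmetric] by blast
  qed
  finally show "den (twist (int t) (coker_sheaf e A)) \<pp> = image_stalk A (int t) \<pp>"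
    by (simp add: twist_def coker_sheaf_def)
qed

lemma sections_coker_imp_local:
  assumes "s \<in> sections (twist (int t) (coker_sheaf e A))"
  shows "local_section t s"
  unfolding local_section_def
proof
  fix \<pp> :: "'k poly4 set" assume p: "\<pp> \<in> Proj"
  obtain U a where U: "openin zariski U" "\<pp> \<in> U" "\<And>\<qq>. \<qq> \<in> U \<Longrightarrow> a \<in> num (twist (int t) (coker_sheaf e A)) \<qq>"
      "\<And>\<qq>. \<qq> \<in> U \<Longrightarrow> s \<qq> - a \<in> den (twist (int t) (coker_sheaf e A)) \<qq>"
    using assms p unfolding sections_def by blast
  obtain m g where g: "0 < m" "homogeneous m g" "g \<notin> \<pp>" "\<And>\<qq>. \<qq> \<in> Proj \<Longrightarrow> g \<notin> \<qq> \<Longrightarrow> \<qq> \<in> U"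
    using zariski_basic_neighbourhood[OF U(1,2)] by blast
  have "a \<in> sum_O (\<lambda>i. int (e i) + int t) \<pp>" using U(2,3) twist_coker_sheaf(1)[OF p] by blast
  then obtain n b u where b: "homogeneous n b" "b \<notin> \<pp>" "u \<in> gr e (t + n)" "to_fract b *s a = to_fract_vec u"
    using sum_O_clear_denominators[OF p] by blast
  have gb: "homogeneous (m + n) (g * b)" by (rule homogeneous_mult[OF g(2) b(1)])
  have "to_fract (g * b) *s s \<qq> - to_fract_vec (g *s u) \<in> image_stalk A (int (t + (m + n))) \<qq>"
    if q: "\<qq> \<in> Proj" "g * b \<notin> \<qq>" for \<qq>
  proof -
    have "\<qq> \<in> U" using g(4) q Proj_mult_iff[OF q(1)] by blast
    then have "s \<qq> - a \<in> image_stalk A (int t) \<qq>" using U(4) twist_coker_sheaf(2)[OF q(1)] by blast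
    from image_stalk_poly_mult[OF q(1) gb this]
    show ?thesis by (simp add: to_fract_vec_simps b(4)[symmetric] vector_ssub_ldistrib vector_smult_assoc)
  qed
  moreover have "g *s u \<in> gr e (t + (m + n))" using gr_mult[OF g(2) b(3)] by (simp add: ac_simps)
  moreover have "g * b \<notin> \<pp>" using g b Proj_mult_iff[OF p] by blast
  ultimately show "\<exists>n h u. homogeneous n h \<and> 0 < n \<and> h \<notin> \<pp> \<and> u \<in> gr e (t + n)
     \<and> (\<forall>\<qq>\<in>Proj. h \<notin> \<qq> \<longrightarrow> to_fract h *s s \<qq> - to_fract_vec u \<in> image_stalk A (int (t + n)) \<qq>)"
    using gb g(1) by (intro exI[of _ "m + n"] exI[of _ "g * b"] exI[of _ "g *s u"]) auto
qed

text \<open>In large degrees every section comes from a vector of forms by Serre's theorem, and the vectors that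
  induce the zero section are those in the image, which is saturated there.\<close>

theorem h0_coker_sheaf:
  "\<forall>\<^sub>F t in sequentially. h0 (twist (int t) (coker_sheaf e A))
     = V.dim (gr e t :: ('k poly4 ^ 'r) set) - V.dim (matrix_image A t)"
proof -
  note N = graded_submodule_matrix_image
  obtain t1 where t1: "\<And>t s. t \<ge> t1 \<Longrightarrow> local_section t s \<Longrightarrow> \<exists>u. represents u t s" using serre_surjective by blast
  obtain t2 where t2: "\<And>n. n \<ge> t2 \<Longrightarrow> sat e (matrix_image A) n = matrix_image A n" using sat_eventually[OF N] by blast
  have "h0 (twist (int t) (coker_sheaf e A)) = V.dim (gr e t :: ('k poly4 ^ 'r) set) - V.dim (matrix_image A t)"
    if t: "t \<ge> max t1 t2" for t
  proof (rule h0_eqI)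
    let ?F = "twist (int t) (coker_sheaf e A)"
    show "\<exists>u\<in>gr e t. \<forall>\<pp>\<in>Proj. s \<pp> - to_fract_vec u \<in> den ?F \<pp>" if "s \<in> sections ?F" for s
      using t1[OF _ sections_coker_imp_local[OF that]] t twist_coker_sheaf(2) by (auto simp: represents_def)
    show "(\<forall>\<pp>\<in>Proj. to_fract_vec u \<in> den ?F \<pp>) \<longleftrightarrow> u \<in> matrix_image A t" if "u \<in> gr e t" for u
      using stalks_imp_sat[OF that] image_imp_stalks[of u t] t2[of t] t twist_coker_sheaf(2) by auto
    show "(\<lambda>\<pp>. to_fract_vec u) \<in> sections ?F" if u: "u \<in> gr e t" for u
      unfolding sections_def
    proof (intro CollectI ballI exI conjI)
      show "openin zariski (Proj :: 'k poly4 set set)" by (rule openin_zariski_Proj)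
      fix \<pp> \<qq> :: "'k poly4 set" assume "\<pp> \<in> Proj" and q: "\<qq> \<in> Proj"
      show "\<pp> \<in> Proj" by fact
      show "to_fract_vec u \<in> num ?F \<qq>" using to_fract_vec_mem_sum_O[OF q u] twist_coker_sheaf(1)[OF q] by simp
      show "to_fract_vec u - to_fract_vec u \<in> den ?F \<qq>" using image_stalk_closed(1)[OF q] twist_coker_sheaf(2)[OF q] by simp
    qed
    fix \<pp> :: "'k poly4 set" assume p: "\<pp> \<in> Proj"
    show "0 \<in> den ?F \<pp>" "x \<in> den ?F \<pp> \<Longrightarrow> y \<in> den ?F \<pp> \<Longrightarrow> x + y \<in> den ?F \<pp>" for x y
      unfolding twist_coker_sheaf(2)[OF p] using image_stalk_closed[OF p] by blast+
    show "to_fract (const_poly c) *s x \<in> den ?F \<pp>" if "x \<in> den ?F \<pp>" for x c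
      using that image_stalk_poly_mult[OF p homogeneous_const, of x A t c] unfolding twist_coker_sheaf(2)[OF p] by simp
  qed (use graded_submoduleD[OF N] dim_gr(1) in auto)
  then show ?thesis unfolding eventually_sequentially by blast
qed

end

section \<open>Hilbert polynomials and ranks\<close>

text \<open>The polynomial with value $\binom{x+c+3}{3}$ at \<open>x\<close>.\<close>

definition binom_poly :: "rat \<Rightarrow> rat poly" where
  "binom_poly c = smult (1/6) ([:c + 3, 1:] * [:c + 2, 1:] * [:c + 1, 1:])"

lemma poly_binom_poly: "poly (binom_poly c) x = (x + c + 3) * (x + c + 2) * (x + c + 1) / 6"
  by (simp add: binom_poly_def algebra_simps)

lemma coeff_binom_poly:
  "coeff (binom_poly c) 3 = 1 / 6" "coeff (binom_poly c) 2 = 1 + c / 2"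
  "coeff (binom_poly c) 1 = 11 / 6 + 2 * c + c ^ 2 / 2" "degree (binom_poly c) \<le> 3"
proof -
  have eq: "binom_poly c = [:(c + 3) * (c + 2) * (c + 1) / 6, 11 / 6 + 2 * c + c ^ 2 / 2, 1 + c / 2, 1 / 6:]"
    by (simp add: binom_poly_def power2_eq_square algebra_simps)
  show "coeff (binom_poly c) 3 = 1 / 6" "coeff (binom_poly c) 2 = 1 + c / 2"
    "coeff (binom_poly c) 1 = 11 / 6 + 2 * c + c ^ 2 / 2" "degree (binom_poly c) \<le> 3"
    unfolding eq by (simp_all add: numeral_eq_Suc)
qed

lemma of_nat_choose_3: "of_nat ((n + 3) choose 3) = poly (binom_poly 0) (of_nat n)"
proof (induction n)
  case (Suc n)
  have "Suc (n + 3) choose Suc 2 = ((n + 3) choose 2) + ((n + 3) choose Suc 2)" by (rule binomial_Suc_Suc)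
  then have "(Suc n + 3) choose 3 = ((n + 3) choose 2) + ((n + 3) choose 3)"
    by (simp only: add_Suc numeral_3_eq_3 numeral_2_eq_2)
  moreover have "even ((n + 3) * (n + 2))" by simp
  then have "2 * ((n + 3) choose 2) = (n + 3) * (n + 2)" using choose_two[of "n + 3"] by simp
  then have "(of_nat (2 * ((n + 3) choose 2)) :: rat) = of_nat ((n + 3) * (n + 2))" by (simp only:)
  then have "2 * (of_nat ((n + 3) choose 2) :: rat) = (of_nat n + 3) * (of_nat n + 2)"
    by (simp only: of_nat_mult of_nat_add of_nat_numeral)
  ultimately show ?case using Suc by (simp add: poly_binom_poly field_simps)
qed (simp add: poly_binom_poly)

lemma of_nat_choose_3_shift: "of_nat ((n + c + 3) choose 3) = poly (binom_poly (of_nat c)) (of_nat n)"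
  using of_nat_choose_3[of "n + c"] by (simp add: poly_binom_poly algebra_simps)

lemma of_nat_choose_3_diff: "c \<le> n \<Longrightarrow> of_nat ((n - c + 3) choose 3) = poly (binom_poly (- of_nat c)) (of_nat n)"
  using of_nat_choose_3[of "n - c"] by (simp add: poly_binom_poly of_nat_diff algebra_simps)

lemma poly_eq_if_eventually:
  fixes p q :: "rat poly"
  assumes "\<forall>\<^sub>F n in sequentially. poly p (of_nat n) = poly q (of_nat n)"
  shows "p = q"
proof (rule ccontr)
  assume "p \<noteq> q"
  then have "finite {x. poly (p - q) x = 0}" by (intro poly_roots_finite) simp
  moreover obtain n0 where "\<And>n. n \<ge> n0 \<Longrightarrow> poly p (of_nat n) = poly q (of_nat n)"
    using assms by (auto simp: eventually_sequentially)
  then have "(of_nat :: nat \<Rightarrow> rat) ` {n0..} \<subseteq> {x. poly (p - q) x = 0}" by auto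
  ultimately have "finite ((of_nat :: nat \<Rightarrow> rat) ` {n0..})" by (rule finite_subset[rotated])
  then show False by (simp add: finite_image_iff inj_on_def infinite_Ici)
qed

lemma hilbert_polyI:
  fixes P :: "rat poly"
  assumes "\<forall>\<^sub>F t in sequentially. of_nat (h0 (twist (int t) F)) = poly P (of_nat t)"
  shows "hilbert_poly F = P"
  unfolding hilbert_poly_def
proof (rule the_equality)
  show "\<forall>\<^sub>F t in sequentially. poly P (of_nat t) = of_nat (h0 (twist (int t) F))"
    using assms by eventually_elim simp
  fix Q :: "rat poly" assume "\<forall>\<^sub>F t in sequentially. poly Q (of_nat t) = of_nat (h0 (twist (int t) F))"
  with assms have "\<forall>\<^sub>F t in sequentially. poly Q (of_nat t) = poly P (of_nat t)" by eventually_elim simp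
  then show "Q = P" by (rule poly_eq_if_eventually)
qed

lemma poly_ge_lead_coeff:
  fixes p :: "rat poly"
  assumes "0 < lead_coeff p"
  shows "\<exists>n0. \<forall>n\<ge>n0. lead_coeff p \<le> poly p (of_nat n)"
  using assms
proof (induction p)
  case (pCons a q)
  show ?case
  proof (cases "q = 0")
    case False
    then have lc: "lead_coeff (pCons a q) = lead_coeff q" by simp
    then obtain n0 where n0: "\<And>n. n \<ge> n0 \<Longrightarrow> lead_coeff q \<le> poly q (of_nat n)" using pCons by auto
    have pos: "0 < lead_coeff q" using pCons.prems lc by simp
    obtain n1 :: nat where n1: "1 + \<bar>a\<bar> / lead_coeff q \<le> of_nat n1" using real_arch_simple by blast
    have "lead_coeff q \<le> poly (pCons a q) (of_nat n)" if "n \<ge> max n0 n1" for n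
    proof -
      have "1 + \<bar>a\<bar> / lead_coeff q \<le> of_nat n" using n1 that by (meson max.boundedE of_nat_mono order_trans)
      then have "(1 + \<bar>a\<bar> / lead_coeff q) * lead_coeff q \<le> of_nat n * lead_coeff q"
        using pos by (intro mult_right_mono) auto
      then have "lead_coeff q + \<bar>a\<bar> \<le> of_nat n * lead_coeff q" using pos False by (simp add: distrib_right)
      also have "\<dots> \<le> of_nat n * poly q (of_nat n)" using n0 that by (intro mult_left_mono) auto
      finally show ?thesis by simp
    qed
    then show ?thesis unfolding lc by blast
  qed simp
qed simp

text \<open>The leading coefficients of \<open>P\<close> and \<open>R - P\<close> are both nonnegative, which is impossible if
  the degree of \<open>P\<close> exceeds that of \<open>R\<close>.\<close>

lemma poly_squeeze:
  fixes P R :: "rat poly"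
  assumes "\<forall>\<^sub>F n in sequentially. 0 \<le> poly P (of_nat n)" "\<forall>\<^sub>F n in sequentially. poly P (of_nat n) \<le> poly R (of_nat n)"
    and "degree R \<le> m"
  shows "degree P \<le> m" "0 \<le> coeff P m"
proof -
  have lead: "0 \<le> lead_coeff p" if p: "\<forall>\<^sub>F n in sequentially. 0 \<le> poly p (of_nat n)" for p :: "rat poly"
  proof (rule ccontr)
    assume neg: "\<not> 0 \<le> lead_coeff p"
    then have "0 < lead_coeff (- p)" by simp
    from poly_ge_lead_coeff[OF this] obtain n1
      where n1: "\<And>n. n \<ge> n1 \<Longrightarrow> lead_coeff (- p) \<le> poly (- p) (of_nat n)" by blast
    obtain n0 where n0: "\<And>n. n \<ge> n0 \<Longrightarrow> 0 \<le> poly p (of_nat n)" using p by (auto simp: eventually_sequentially)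
    have "poly (- p) (of_nat (max n0 n1)) \<ge> lead_coeff (- p)" by (rule n1) simp
    moreover have "0 \<le> poly p (of_nat (max n0 n1))" by (rule n0) simp
    ultimately show False using neg by simp
  qed
  have RP: "\<forall>\<^sub>F n in sequentially. 0 \<le> poly (R - P) (of_nat n)" using assms(2) by eventually_elim simp
  show deg: "degree P \<le> m"
  proof (rule ccontr)
    assume "\<not> degree P \<le> m"
    then have lt: "degree R < degree P" using assms(3) by simp
    then have "lead_coeff (R - P) = - lead_coeff P"
      by (metis degree_minus diff_conv_add_uminus lead_coeff_add_le lead_coeff_minus)
    then have "lead_coeff P \<le> 0" using lead[OF RP] by simp
    then have "lead_coeff P = 0" using lead[OF assms(1)] by simp
    then show False using lt by simp
  qed
  show "0 \<le> coeff P m"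
    using lead[OF assms(1)] deg by (cases "degree P = m") (auto simp: coeff_eq_0)
qed

section \<open>Subsheaves of free sheaves\<close>

text \<open>The closure properties of a coherent subsheaf of a free sheaf, without the openness of the family.\<close>

definition O_submodule :: "('k::field, 'n::finite) stalks \<Rightarrow> bool" where
  "O_submodule B \<longleftrightarrow> (\<forall>\<pp>\<in>Proj. 0 \<in> B \<pp> \<and> (\<forall>v\<in>B \<pp>. \<forall>w\<in>B \<pp>. v + w \<in> B \<pp>)
     \<and> (\<forall>v\<in>B \<pp>. \<forall>c\<in>O_stalk 0 \<pp>. c *s v \<in> B \<pp>) \<and> B \<pp> \<subseteq> sum_O (\<lambda>_. 0) \<pp>)"

lemma twist_O_submodule:
  assumes B: "O_submodule B" and p: "\<pp> \<in> Proj"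
  shows "0 \<in> twist_stalks (int t) B \<pp>"
    "v \<in> twist_stalks (int t) B \<pp> \<Longrightarrow> w \<in> twist_stalks (int t) B \<pp> \<Longrightarrow> v + w \<in> twist_stalks (int t) B \<pp>"
    "homogeneous m f \<Longrightarrow> v \<in> twist_stalks (int t) B \<pp> \<Longrightarrow> to_fract f *s v \<in> twist_stalks (int (t + m)) B \<pp>"
    "twist_stalks (int t) B \<pp> \<subseteq> sum_O (\<lambda>_. int t) \<pp>"
proof -
  have B': "0 \<in> B \<pp>" "\<And>v w. v \<in> B \<pp> \<Longrightarrow> w \<in> B \<pp> \<Longrightarrow> v + w \<in> B \<pp>"
    "\<And>c v. v \<in> B \<pp> \<Longrightarrow> c \<in> O_stalk 0 \<pp> \<Longrightarrow> c *s v \<in> B \<pp>" "B \<pp> \<subseteq> sum_O (\<lambda>_. 0) \<pp>"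
    using B p unfolding O_submodule_def by blast+
  obtain i where i: "var i \<notin> \<pp>" using Proj_var[OF p] by blast
  let ?x = "to_fract (var i ^ t)"
  have hom: "homogeneous t (var i ^ t :: 'a poly4)" using homogeneous_power[OF homogeneous_var(2)[of i], of t] by simp
  have xp: "var i ^ t \<notin> \<pp>" using Proj_power[OF p i] .
  have x: "?x \<in> O_stalk (int t) \<pp>" by (rule O_stalk_to_fract[OF p hom])
  have x0: "?x \<noteq> 0" using xp Proj_zero[OF p] by auto
  have eq: "\<exists>v'\<in>B \<pp>. v = ?x *s v'" if v: "v \<in> twist_stalks (int t) B \<pp>" for v
  proof -
    obtain c w where c: "v = c *s w" "c \<in> O_stalk (int t) \<pp>" "w \<in> B \<pp>" using v unfolding twist_stalks_def by blast
    have "inverse ?x * c \<in> O_stalk 0 \<pp>" using O_stalk_mult[OF p O_stalk_inverse[OF p hom xp] c(2)] by simp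
    then have "(inverse ?x * c) *s w \<in> B \<pp>" by (rule B'(3)[OF c(3)])
    moreover have "v = ?x *s ((inverse ?x * c) *s w)"
      using x0 by (simp add: c(1) vector_smult_assoc mult.assoc[symmetric])
    ultimately show ?thesis by blast
  qed
  have I: "c *s w \<in> twist_stalks (int s) B \<pp>" if "c \<in> O_stalk (int s) \<pp>" "w \<in> B \<pp>" for c w s
    using that unfolding twist_stalks_def by blast
  show "0 \<in> twist_stalks (int t) B \<pp>" using I[OF x B'(1)] by simp
  show "v + w \<in> twist_stalks (int t) B \<pp>" if v: "v \<in> twist_stalks (int t) B \<pp>" and w: "w \<in> twist_stalks (int t) B \<pp>"
  proof -
    obtain v' where v': "v' \<in> B \<pp>" "v = ?x *s v'" using eq[OF v] by blast
    obtain w' where w': "w' \<in> B \<pp>" "w = ?x *s w'" using eq[OF w] by blast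
    have "v + w = ?x *s (v' + w')" unfolding v'(2) w'(2) by (rule vector_add_ldistrib[symmetric])
    then show ?thesis using I[OF x B'(2)[OF v'(1) w'(1)]] by (simp only:)
  qed
  show "to_fract f *s v \<in> twist_stalks (int (t + m)) B \<pp>" if f: "homogeneous m f" and v: "v \<in> twist_stalks (int t) B \<pp>"
  proof -
    obtain v' where v': "v' \<in> B \<pp>" "v = ?x *s v'" using eq v by blast
    have "to_fract f * ?x \<in> O_stalk (int (t + m)) \<pp>"
      using O_stalk_mult[OF p O_stalk_to_fract[OF p f] x] by (simp add: add.commute)
    from I[OF this v'(1)] show ?thesis unfolding v'(2) vector_smult_assoc .
  qed
  show "twist_stalks (int t) B \<pp> \<subseteq> sum_O (\<lambda>_. int t) \<pp>"
    using twist_stalks_sum_O[OF p, of t "\<lambda>_. 0"] B'(4) unfolding twist_stalks_def by auto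
qed

text \<open>The module of global sections of all nonnegative twists.\<close>

definition section_module :: "('k::field, 'n::finite) stalks \<Rightarrow> nat \<Rightarrow> ('k poly4 ^ 'n) set" where
  "section_module B t = {u. \<forall>\<pp>\<in>Proj. to_fract_vec u \<in> twist_stalks (int t) B \<pp>}"

lemma section_module_subset_gr:
  assumes B: "O_submodule B"
  shows "section_module B t \<subseteq> gr (\<lambda>_. 0) t"
proof
  fix u assume "u \<in> section_module B t"
  then have "to_fract_vec u \<in> sum_O (\<lambda>i. int 0 + int t) \<pp>" if "\<pp> \<in> Proj" for \<pp>
    using twist_O_submodule(4)[OF B that] that by (auto simp: section_module_def)
  from global_sections_sum_O[of "to_fract_vec u" "\<lambda>_. 0" t, OF this]
  show "u \<in> gr (\<lambda>_. 0) t" by (auto simp: to_fract_vec_simps)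
qed

lemma graded_submodule_section_module:
  assumes B: "O_submodule B"
  shows "graded_submodule (\<lambda>_. 0) (section_module B)"
  unfolding graded_submodule_def
proof (intro allI conjI ballI)
  show "section_module B n \<subseteq> gr (\<lambda>_. 0) n" for n by (rule section_module_subset_gr[OF B])
  show "V.subspace (section_module B n)" for n
    unfolding V.subspace_def section_module_def
    using twist_O_submodule(1,2)[OF B] twist_O_submodule(3)[OF B _ homogeneous_const]
    by (simp add: to_fract_vec_simps vscale_def)
  show "var i *s v \<in> section_module B (Suc n)" if "v \<in> section_module B n" for n v i
  proof -
    have "to_fract (var i) *s to_fract_vec v \<in> twist_stalks (int (n + Suc 0)) B \<pp>" if "\<pp> \<in> Proj" for \<pp>
      using \<open>v \<in> _\<close> that by (intro twist_O_submodule(3)[OF B that homogeneous_var(1)]) (simp add: section_module_def)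
    then show ?thesis by (simp add: section_module_def to_fract_vec_simps)
  qed
qed

text \<open>A section of a subsheaf of a constant sheaf is constant, because every nonempty open set
  contains the generic point.\<close>

lemma h0_subsheaf:
  fixes F :: "('k::field, 'n::finite) P3_sheaf"
  assumes B: "O_submodule (num F)" and den: "\<And>\<pp>. \<pp> \<in> Proj \<Longrightarrow> den F \<pp> = {0}"
  shows "h0 (twist (int t) F) = V.dim (section_module (num F) t)"
proof -
  let ?F = "twist (int t) F"
  note N = graded_submodule_section_module[OF B]
  have den': "den ?F \<pp> = {0}" if p: "\<pp> \<in> Proj" for \<pp>
    using O_stalk_zero[OF p, of "int t"] den[OF p] by (auto simp: twist_def twist_stalks_def)
  have num': "num ?F = twist_stalks (int t) (num F)" by (simp add: twist_def)
  have "h0 ?F = V.dim (section_module (num F) t) - V.dim ({0} :: ('k poly4 ^ 'n) set)"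
  proof (rule h0_eqI)
    show "V.subspace {0 :: 'k poly4 ^ 'n}" by simp
    show "(\<lambda>\<pp>. to_fract_vec u) \<in> sections ?F" if u: "u \<in> section_module (num F) t" for u
      unfolding sections_def
    proof (intro CollectI ballI exI conjI)
      show "openin zariski (Proj :: 'k poly4 set set)" by (rule openin_zariski_Proj)
      fix \<pp> \<qq> :: "'k poly4 set" assume "\<pp> \<in> Proj" and q: "\<qq> \<in> Proj"
      show "\<pp> \<in> Proj" by fact
      show "to_fract_vec u \<in> num ?F \<qq>" using u q by (simp add: num' section_module_def)
      show "to_fract_vec u - to_fract_vec u \<in> den ?F \<qq>" using den'[OF q] by simp
    qed
    show "\<exists>u\<in>section_module (num F) t. \<forall>\<pp>\<in>Proj. s \<pp> - to_fract_vec u \<in> den ?F \<pp>" if s: "s \<in> sections ?F" for s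
    proof -
      have const: "s \<pp> = s {0} \<and> s {0} \<in> twist_stalks (int t) (num F) \<pp>" if p: "\<pp> \<in> Proj" for \<pp>
      proof -
        obtain U a where U: "openin zariski U" "\<pp> \<in> U" "\<And>\<qq>. \<qq> \<in> U \<Longrightarrow> a \<in> num ?F \<qq> \<and> s \<qq> - a \<in> den ?F \<qq>"
          using s p unfolding sections_def by blast
        have "s \<qq> = a" if "\<qq> \<in> U" for \<qq>
          using U(3)[OF that] den'[of \<qq>] openin_zariski_subset[OF U(1)] that by auto
        then show ?thesis using U generic_point_in_open[OF U(1,2)] by (auto simp: num')
      qed
      have "\<exists>u\<in>gr (\<lambda>_. 0) t. s {0} = to_fract_vec u"
      proof (rule global_sections_sum_O)
        fix \<pp> :: "'k poly4 set" assume "\<pp> \<in> Proj"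
        then show "s {0} \<in> sum_O (\<lambda>i. int 0 + int t) \<pp>" using const twist_O_submodule(4)[OF B] by auto
      qed
      then obtain u where u: "s {0} = to_fract_vec u" by blast
      then have "u \<in> section_module (num F) t" using const by (simp add: section_module_def)
      moreover have "s \<pp> - to_fract_vec u \<in> den ?F \<pp>" if "\<pp> \<in> Proj" for \<pp>
        using const[OF that] u den'[OF that] by simp
      ultimately show ?thesis by blast
    qed
    show "(\<forall>\<pp>\<in>Proj. to_fract_vec u \<in> den ?F \<pp>) \<longleftrightarrow> u \<in> {0}" for u :: "'k poly4 ^ 'n"
    proof -
      have "to_fract_vec u = 0 \<longleftrightarrow> u = 0" using to_fract_vec_simps(4,5) by metis
      then show ?thesis using den' zero_in_Proj by auto
    qed
  qed (use den' graded_submoduleD(1,4)[OF N] finite_dim_graded_submodule[OF N] in auto)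
  moreover have "V.dim ({0} :: ('k poly4 ^ 'n) set) = 0"
    using V.dim_le_card[of "{0 :: 'k poly4 ^ 'n}" "{}"] by simp
  ultimately show ?thesis by simp
qed

lemma hilbert_poly_subsheaf:
  fixes F :: "('k::field_char_0, 'n::finite) P3_sheaf"
  assumes B: "O_submodule (num F)" and den: "\<And>\<pp>. \<pp> \<in> Proj \<Longrightarrow> den F \<pp> = {0}"
  shows "\<forall>\<^sub>F t in sequentially. of_nat (V.dim (section_module (num F) t)) = poly (hilbert_poly F) (of_nat t)"
proof -
  obtain p :: "rat poly" where p: "\<forall>\<^sub>F n in sequentially. of_nat (V.dim (gr (\<lambda>_. 0) n :: ('k poly4 ^ 'n) set))
      - of_nat (V.dim (section_module (num F) n)) = poly p (of_nat n)"
    using hilbert_function_eventually_poly[OF graded_submodule_section_module[OF B]] by blast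
  define P where "P = smult (of_nat CARD('n)) (binom_poly 0) - p"
  have P: "\<forall>\<^sub>F t in sequentially. of_nat (V.dim (section_module (num F) t)) = poly P (of_nat t)"
    using p by eventually_elim (simp add: P_def dim_gr(2) of_nat_choose_3)
  moreover have "hilbert_poly F = P"
    by (rule hilbert_polyI) (simp add: h0_subsheaf[OF B den] P)
  ultimately show ?thesis by simp
qed

lemma O_submodule_kernel:
  fixes A :: "'k::field poly4 ^ 'c::finite ^ 'r::finite"
  shows "O_submodule (\<lambda>\<pp>. {v \<in> sum_O (\<lambda>_. 0) \<pp>. frac_map A v = 0})"
  unfolding O_submodule_def using sum_O_closed(1,2) sum_O_closed(4)[where t = 0]
  by (simp add: frac_map_simps) blast

lemma coherent_closed:
  assumes "coherent B" and p: "\<pp> \<in> Proj"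
  shows "0 \<in> B \<pp>" "v \<in> B \<pp> \<Longrightarrow> w \<in> B \<pp> \<Longrightarrow> v + w \<in> B \<pp>" "v \<in> B \<pp> \<Longrightarrow> c \<in> O_stalk 0 \<pp> \<Longrightarrow> c *s v \<in> B \<pp>"
proof -
  obtain G where B: "B \<pp> = O_span \<pp> G" using assms unfolding coherent_def by blast
  show "0 \<in> B \<pp>" unfolding B O_span_def using O_stalk_zero[OF p]
    by (auto intro!: exI[of _ "\<lambda>_. 0"])
  show "v + w \<in> B \<pp>" if vw: "v \<in> B \<pp>" "w \<in> B \<pp>"
  proof -
    obtain c d where "v = (\<Sum>g\<in>G. c g *s g)" "\<forall>g\<in>G. c g \<in> O_stalk 0 \<pp>" "w = (\<Sum>g\<in>G. d g *s g)" "\<forall>g\<in>G. d g \<in> O_stalk 0 \<pp>"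
      using vw unfolding B O_span_def by blast
    then show ?thesis unfolding B O_span_def
      by (intro CollectI exI[of _ "\<lambda>g. c g + d g"]) (simp add: vector_sadd_rdistrib sum.distrib O_stalk_add[OF p])
  qed
  show "c *s v \<in> B \<pp>" if v: "v \<in> B \<pp>" and c: "c \<in> O_stalk 0 \<pp>"
  proof -
    obtain d where d: "v = (\<Sum>g\<in>G. d g *s g)" "\<forall>g\<in>G. d g \<in> O_stalk 0 \<pp>" using v unfolding B O_span_def by blast
    have "c *s v = (\<Sum>g\<in>G. (c * d g) *s g)"
      unfolding d(1) by (simp add: vec.scale_sum_right vector_smult_assoc)
    moreover have "\<forall>g\<in>G. c * d g \<in> O_stalk 0 \<pp>" using d(2) O_stalk_mult[OF p c, of _ 0] by simp
    ultimately show ?thesis unfolding B O_span_def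
      by (intro CollectI exI[of _ "\<lambda>g. c * d g"] conjI)
  qed
qed

lemma common_denominator:
  assumes "finite G" "\<forall>g\<in>G. c g \<in> O_stalk 0 {0 :: 'k::field poly4}"
  shows "\<exists>n b f. homogeneous n b \<and> b \<noteq> 0 \<and> (\<forall>g\<in>G. homogeneous n (f g) \<and> to_fract b * c g = to_fract (f g))"
  using assms
proof (induction G rule: finite_induct)
  case empty
  then show ?case by (intro exI[of _ 0] exI[of _ 1]) simp
next
  case (insert g G)
  have "\<forall>h\<in>G. c h \<in> O_stalk 0 {0 :: 'k poly4}" using insert.prems by blast
  then obtain n b f where b: "homogeneous n b" "b \<noteq> 0" "\<And>h. h \<in> G \<Longrightarrow> homogeneous n (f h)"
    "\<And>h. h \<in> G \<Longrightarrow> to_fract b * c h = to_fract (f h)" using insert.IH by blast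
  obtain x y m l where x: "c g = to_fract x / to_fract y" "homogeneous l x" "homogeneous m y" "y \<notin> {0}" "int l = int m + 0"
    using insert.prems unfolding O_stalk_iff by blast
  define f' where "f' h = (if h = g then b * x else y * f h)" for h
  have "homogeneous (m + n) (y * b)" by (rule homogeneous_mult[OF x(3) b(1)])
  moreover have "y * b \<noteq> 0" using x(4) b(2) by simp
  moreover have "homogeneous (m + n) (f' h)" if "h \<in> insert g G" for h
    using that homogeneous_mult[OF b(1) x(2)] homogeneous_mult[OF x(3) b(3)] x(5)
    by (auto simp: f'_def add.commute)
  moreover have "to_fract (y * b) * c h = to_fract (f' h)" if "h \<in> insert g G" for h
    using that b(4)[of h] x(1,4) by (auto simp: f'_def mult.assoc)
  ultimately show ?case by blast
qed

text \<open>The denominators needed at the finitely many members of an affine cover have a common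
  multiple, so that a nonzero element of the generic stalk becomes a global section.\<close>

lemma coherent_generic_section:
  fixes B :: "('k::field, 'n::finite) stalks"
  assumes coh: "coherent B" and B: "O_submodule B" and g: "g \<in> B {0}"
  shows "\<exists>n b u. b \<noteq> 0 \<and> to_fract b *s g = to_fract_vec u \<and> u \<in> section_module B n"
proof -
  define good where "good h n b \<longleftrightarrow> homogeneous n b \<and> b \<noteq> 0 \<and>
     (\<forall>\<qq>\<in>Proj. h \<notin> \<qq> \<longrightarrow> to_fract b *s g \<in> twist_stalks (int n) B \<qq>)" for h n b
  have I: "c *s v \<in> twist_stalks t B \<qq>" if "c \<in> O_stalk t \<qq>" "v \<in> B \<qq>" for c v t \<qq>
    using that unfolding twist_stalks_def by blast
  define H where "H = {h. \<exists>n b. good h n b}"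
  have "\<exists>H'\<subseteq>H. finite H' \<and> (\<forall>\<pp>\<in>Proj. \<exists>h\<in>H'. h \<notin> \<pp>)"
  proof (rule Proj_quasi_compact)
    fix \<pp> :: "'k poly4 set" assume p: "\<pp> \<in> Proj"
    obtain U G where U: "openin zariski U" "\<pp> \<in> U" "finite G" "\<And>\<qq>. \<qq> \<in> U \<Longrightarrow> B \<qq> = O_span \<qq> G"
    proof -
      from coh[unfolded coherent_def, THEN bspec, OF p]
      obtain U G where "openin zariski U \<and> \<pp> \<in> U \<and> finite G \<and> (\<forall>\<qq>\<in>U. B \<qq> = O_span \<qq> G)" by (elim exE)
      then show thesis by (intro that[of U G]) simp_all
    qed
    have gen: "{0} \<in> U" by (rule generic_point_in_open[OF U(1,2)])
    obtain c where c: "g = (\<Sum>h\<in>G. c h *s h)" "\<forall>h\<in>G. c h \<in> O_stalk 0 {0}"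
      using g U(4)[OF gen] unfolding O_span_def by blast
    obtain n b f where b: "homogeneous n b" "b \<noteq> 0" "\<And>h. h \<in> G \<Longrightarrow> homogeneous n (f h)"
      "\<And>h. h \<in> G \<Longrightarrow> to_fract b * c h = to_fract (f h)" using common_denominator[OF U(3) c(2)] by blast
    obtain m h where h: "homogeneous m h" "h \<notin> \<pp>" "\<And>\<qq>. \<qq> \<in> Proj \<Longrightarrow> h \<notin> \<qq> \<Longrightarrow> \<qq> \<in> U"
      using zariski_basic_neighbourhood[OF U(1,2)] by blast
    have "to_fract b *s g \<in> twist_stalks (int n) B \<qq>" if q: "\<qq> \<in> Proj" "h \<notin> \<qq>" for \<qq>
    proof -
      have "x \<in> B \<qq>" if "x \<in> G" for x
      proof -
        have "x = (\<Sum>y\<in>G. (if y = x then 1 else 0) *s y)"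
          using U(3) that by (simp add: if_distrib[of "\<lambda>c. c *s _"] cong: if_cong)
        moreover have "\<forall>y\<in>G. (if y = x then 1 else 0) \<in> O_stalk 0 \<qq>"
          using O_stalk_zero[OF q(1)] O_stalk_to_fract[OF q(1) homogeneous_one] by simp
        ultimately show ?thesis unfolding U(4)[OF h(3)[OF q]] O_span_def
          by (intro CollectI exI[of _ "\<lambda>y. if y = x then 1 else 0"] conjI)
      qed
      then have "to_fract (f x) *s x \<in> twist_stalks (int n) B \<qq>" if "x \<in> G" for x
        using that by (intro I O_stalk_to_fract[OF q(1) b(3)])
      then have "(\<Sum>x\<in>G. to_fract (f x) *s x) \<in> twist_stalks (int n) B \<qq>"
        using U(3)
      proof (induction G rule: infinite_finite_induct)
        case (insert x F)
        then show ?case by (simp add: twist_O_submodule(2)[OF B q(1)])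
      qed (simp_all add: twist_O_submodule(1)[OF B q(1)])
      moreover have "to_fract b *s g = (\<Sum>x\<in>G. to_fract (f x) *s x)"
        unfolding c(1) vec.scale_sum_right by (intro sum.cong refl) (simp add: vector_smult_assoc b(4))
      ultimately show ?thesis by simp
    qed
    then have "h \<in> H" unfolding H_def good_def using b by blast
    then show "\<exists>h\<in>H. h \<notin> \<pp> \<and> (\<exists>n. homogeneous n h)" using h by blast
  qed
  then obtain H' where H': "H' \<subseteq> H" "finite H'" "\<And>\<pp>. \<pp> \<in> Proj \<Longrightarrow> \<exists>h\<in>H'. h \<notin> \<pp>" by blast
  have "\<forall>h\<in>H'. \<exists>n b. good h n b" using H'(1) unfolding H_def by blast
  then obtain n b where nb: "\<And>h. h \<in> H' \<Longrightarrow> good h (n h) (b h)" by metis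
  define M where "M = (\<Sum>h\<in>H'. n h)"
  define D where "D = (\<Prod>h\<in>H'. b h)"
  have "D \<noteq> 0" unfolding D_def using nb H'(2) by (auto simp: good_def)
  have mem: "to_fract D *s g \<in> twist_stalks (int M) B \<pp>" if p: "\<pp> \<in> Proj" for \<pp>
  proof -
    obtain h where h: "h \<in> H'" "h \<notin> \<pp>" using H'(3)[OF p] by blast
    have "to_fract (b h) *s g \<in> twist_stalks (int (n h)) B \<pp>" using nb[OF h(1)] p h(2) by (simp add: good_def)
    moreover have "homogeneous (\<Sum>x\<in>H' - {h}. n x) (\<Prod>x\<in>H' - {h}. b x)"
      by (intro homogeneous_prod) (use nb in \<open>simp add: good_def\<close>)
    ultimately have "to_fract (\<Prod>x\<in>H' - {h}. b x) *s (to_fract (b h) *s g)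
        \<in> twist_stalks (int (n h + (\<Sum>x\<in>H' - {h}. n x))) B \<pp>"
      by (intro twist_O_submodule(3)[OF B p])
    moreover have "n h + (\<Sum>x\<in>H' - {h}. n x) = M" unfolding M_def using h(1) H'(2) by (simp add: sum.remove)
    moreover have "(\<Prod>x\<in>H' - {h}. b x) * b h = D" unfolding D_def using h(1) H'(2) by (simp add: prod.remove mult.commute)
    then have "to_fract (\<Prod>x\<in>H' - {h}. b x) *s (to_fract (b h) *s g) = to_fract D *s g"
      by (simp only: vector_smult_assoc to_fract_mult[symmetric])
    ultimately show ?thesis by (simp only:)
  qed
  have "\<exists>u\<in>gr (\<lambda>_. 0) M. to_fract D *s g = to_fract_vec u"
  proof (rule global_sections_sum_O)
    fix \<pp> :: "'k poly4 set" assume "\<pp> \<in> Proj"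
    then show "to_fract D *s g \<in> sum_O (\<lambda>i. int 0 + int M) \<pp>" using mem twist_O_submodule(4)[OF B] by auto
  qed
  then obtain u where "to_fract D *s g = to_fract_vec u" by blast
  moreover from this have "u \<in> section_module B M" using mem by (simp add: section_module_def)
  ultimately show ?thesis using \<open>D \<noteq> 0\<close> by blast
qed

section \<open>Unique factorization\<close>

text \<open>The ring of polynomials in four variables is isomorphic to an iterated univariate polynomial
  ring, whose elements factor into primes by Gauss' lemma.\<close>

definition nested_monom :: "'k::field \<Rightarrow> (4 \<Rightarrow>\<^sub>0 nat) \<Rightarrow> 'k poly poly poly poly" where
  "nested_monom c m = monom (monom (monom (monom c (Poly_Mapping.lookup m 3)) (Poly_Mapping.lookup m 2))
     (Poly_Mapping.lookup m 1)) (Poly_Mapping.lookup m 0)"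

definition nested_poly :: "'k::field poly4 \<Rightarrow> 'k poly poly poly poly" where
  "nested_poly f = (\<Sum>m\<in>Poly_Mapping.keys f. nested_monom (Poly_Mapping.lookup f m) m)"

lemma poly_mapping4_eq_iff:
  fixes m m' :: "4 \<Rightarrow>\<^sub>0 nat"
  shows "m = m' \<longleftrightarrow> Poly_Mapping.lookup m 0 = Poly_Mapping.lookup m' 0 \<and> Poly_Mapping.lookup m 1 = Poly_Mapping.lookup m' 1
    \<and> Poly_Mapping.lookup m 2 = Poly_Mapping.lookup m' 2 \<and> Poly_Mapping.lookup m 3 = Poly_Mapping.lookup m' 3"
    (is "_ \<longleftrightarrow> ?R")
proof
  assume ?R
  then have "Poly_Mapping.lookup m i = Poly_Mapping.lookup m' i" if "i \<in> {0, 1, 2, 3}" for i using that by auto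
  then show "m = m'" using UNIV_4_eq by (intro poly_mapping_eqI) blast
qed simp

lemma coeff_nested_poly:
  "coeff (coeff (coeff (coeff (nested_poly f) (Poly_Mapping.lookup m 0)) (Poly_Mapping.lookup m 1))
     (Poly_Mapping.lookup m 2)) (Poly_Mapping.lookup m 3) = Poly_Mapping.lookup f m"
proof -
  have "coeff (coeff (coeff (coeff (nested_monom c m') (Poly_Mapping.lookup m 0)) (Poly_Mapping.lookup m 1))
     (Poly_Mapping.lookup m 2)) (Poly_Mapping.lookup m 3) = (if m' = m then c else 0)" for c :: 'a and m'
    unfolding nested_monom_def poly_mapping4_eq_iff by simp
  then show ?thesis by (simp add: nested_poly_def coeff_sum in_keys_iff)
qed

lemma nested_poly_eqI:
  fixes p q :: "'k::field poly poly poly poly"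
  assumes "\<And>m :: 4 \<Rightarrow>\<^sub>0 nat. coeff (coeff (coeff (coeff p (Poly_Mapping.lookup m 0)) (Poly_Mapping.lookup m 1))
     (Poly_Mapping.lookup m 2)) (Poly_Mapping.lookup m 3) =
     coeff (coeff (coeff (coeff q (Poly_Mapping.lookup m 0)) (Poly_Mapping.lookup m 1))
     (Poly_Mapping.lookup m 2)) (Poly_Mapping.lookup m 3)"
  shows "p = q"
proof (intro poly_eqI)
  fix a b c d
  let ?m = "Poly_Mapping.single 0 a + Poly_Mapping.single 1 b + Poly_Mapping.single 2 c + Poly_Mapping.single 3 d :: 4 \<Rightarrow>\<^sub>0 nat"
  have "Poly_Mapping.lookup ?m 0 = a" "Poly_Mapping.lookup ?m 1 = b" "Poly_Mapping.lookup ?m 2 = c" "Poly_Mapping.lookup ?m 3 = d"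
    by (simp_all add: lookup_add lookup_single when_def)
  then show "coeff (coeff (coeff (coeff p a) b) c) d = coeff (coeff (coeff (coeff q a) b) c) d"
    using assms[of ?m] by simp
qed

lemma nested_poly_add: "nested_poly (f + g) = nested_poly f + nested_poly g"
  by (rule nested_poly_eqI) (simp add: coeff_nested_poly lookup_add)

lemma nested_poly_zero [simp]: "nested_poly 0 = 0"
  by (simp add: nested_poly_def)

lemma nested_poly_sum: "nested_poly (sum f A) = (\<Sum>i\<in>A. nested_poly (f i))"
  by (induction A rule: infinite_finite_induct) (simp_all add: nested_poly_add)

lemma nested_poly_single: "nested_poly (Poly_Mapping.single m c) = nested_monom c m"
  by (cases "c = 0") (simp_all add: nested_poly_def nested_monom_def)

lemma nested_poly_inj: "nested_poly f = nested_poly g \<longleftrightarrow> f = g"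
  by (metis coeff_nested_poly poly_mapping_eqI)

lemma nested_poly_mult: "nested_poly (f * g) = nested_poly f * nested_poly g"
proof -
  have single: "nested_monom (c * d) (m + m') = nested_monom c m * nested_monom d m'" for c d :: 'a and m m'
    by (simp add: nested_monom_def mult_monom lookup_add)
  have "f * g = (\<Sum>a\<in>Poly_Mapping.keys f. \<Sum>b\<in>Poly_Mapping.keys g.
      Poly_Mapping.single (a + b) (Poly_Mapping.lookup f a * Poly_Mapping.lookup g b))"
    using arg_cong2[of _ _ _ _ "(*)", OF poly_mapping_sum_singles[of f] poly_mapping_sum_singles[of g]]
    by (simp only: sum_product mult_single)
  then have "nested_poly (f * g) = (\<Sum>a\<in>Poly_Mapping.keys f. \<Sum>b\<in>Poly_Mapping.keys g.
      nested_monom (Poly_Mapping.lookup f a) a * nested_monom (Poly_Mapping.lookup g b) b)"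
    by (simp only: nested_poly_sum nested_poly_single single)
  also have "\<dots> = nested_poly f * nested_poly g"
    unfolding nested_poly_def[of f] nested_poly_def[of g] by (rule sum_product[symmetric])
  finally show ?thesis .
qed

lemma nested_poly_surj: "\<exists>f. nested_poly f = p"
proof -
  let ?X = "range (nested_poly :: 'a poly4 \<Rightarrow> _)"
  have sum: "sum t A \<in> ?X" if "\<And>i. i \<in> A \<Longrightarrow> t i \<in> ?X" for t and A :: "nat set"
  proof -
    have "\<forall>i\<in>A. \<exists>f. t i = nested_poly f" using that by blast
    then obtain f where "\<And>i. i \<in> A \<Longrightarrow> t i = nested_poly (f i)" by metis
    then have "sum t A = nested_poly (sum f A)" by (simp add: nested_poly_sum)
    then show ?thesis by blast
  qed
  have monom_sum: "monom (sum t A) n = (\<Sum>i\<in>A. monom (t i) n)" for t :: "nat \<Rightarrow> 'b::comm_monoid_add" and A n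
    by (induction A rule: infinite_finite_induct) (simp_all add: add_monom[symmetric])
  have 1: "monom (monom (monom (monom x d) c) b) a \<in> ?X" for x a b c d
  proof -
    let ?m = "Poly_Mapping.single 0 a + Poly_Mapping.single 1 b + Poly_Mapping.single 2 c + Poly_Mapping.single 3 d :: 4 \<Rightarrow>\<^sub>0 nat"
    have "Poly_Mapping.lookup ?m 0 = a" "Poly_Mapping.lookup ?m 1 = b" "Poly_Mapping.lookup ?m 2 = c" "Poly_Mapping.lookup ?m 3 = d"
      by (simp_all add: lookup_add lookup_single when_def)
    then have "nested_poly (Poly_Mapping.single ?m x) = monom (monom (monom (monom x d) c) b) a"
      by (simp add: nested_poly_single nested_monom_def)
    then show ?thesis by (metis rangeI)
  qed
  have 2: "monom (monom (monom q c) b) a \<in> ?X" for q a b c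
    by (subst poly_as_sum_of_monoms[of q, symmetric], unfold monom_sum) (intro sum 1)
  have 3: "monom (monom q b) a \<in> ?X" for q a b
    by (subst poly_as_sum_of_monoms[of q, symmetric], unfold monom_sum) (intro sum 2)
  have 4: "monom q a \<in> ?X" for q a
    by (subst poly_as_sum_of_monoms[of q, symmetric], unfold monom_sum) (intro sum 3)
  have "p \<in> ?X"
    by (subst poly_as_sum_of_monoms[of p, symmetric]) (intro sum 4)
  then show ?thesis by (metis rangeE)
qed

lemma nested_poly_dvd: "nested_poly f dvd nested_poly g \<longleftrightarrow> f dvd g"
proof
  assume "nested_poly f dvd nested_poly g"
  then obtain q where "nested_poly g = nested_poly f * q" by (rule dvdE)
  moreover obtain h where "q = nested_poly h" using nested_poly_surj by metis
  ultimately have "nested_poly g = nested_poly (f * h)" by (simp add: nested_poly_mult)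
  then show "f dvd g" by (simp add: nested_poly_inj)
qed (auto simp: nested_poly_mult elim!: dvdE)

lemma nested_poly_one: "nested_poly 1 = 1"
proof -
  have "1 = Poly_Mapping.single (0 :: 4 \<Rightarrow>\<^sub>0 nat) (1 :: 'a)" by simp
  from arg_cong[OF this, of nested_poly] have "nested_poly (1 :: 'a poly4) = nested_monom 1 0"
    unfolding nested_poly_single .
  then show ?thesis by (simp add: nested_monom_def one_poly_def[symmetric] monom_0)
qed

lemma prime_elem_nested_poly: "prime_elem (nested_poly f) \<longleftrightarrow> prime_elem f"
proof -
  have all: "(\<forall>a. P a) \<longleftrightarrow> (\<forall>f. P (nested_poly f))" for P :: "'a poly poly poly poly \<Rightarrow> bool"
    using nested_poly_surj by metis
  have "nested_poly f = 0 \<longleftrightarrow> f = 0" using nested_poly_inj[of f 0] by simp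
  moreover have "nested_poly f dvd 1 \<longleftrightarrow> f dvd 1" using nested_poly_dvd[of f 1] by (simp add: nested_poly_one)
  ultimately show ?thesis
    unfolding prime_elem_def by (subst all, subst all) (simp add: nested_poly_mult[symmetric] nested_poly_dvd)
qed

lemma poly4_prime_factorization:
  fixes f :: "'k::field poly4"
  assumes "f \<noteq> 0"
  shows "\<exists>F u. u dvd 1 \<and> f = u * prod_mset F \<and> (\<forall>\<pi>\<in>#F. prime_elem \<pi>)"
proof (cases "f dvd 1")
  case True
  then show ?thesis by (intro exI[of _ "{#}"] exI[of _ f]) simp
next
  case False
  have "nested_poly f \<noteq> 0" using assms nested_poly_inj[of f 0] by simp
  moreover have "\<not> nested_poly f dvd 1" using False nested_poly_dvd[of f 1] by (simp add: nested_poly_one)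
  ultimately obtain G where G: "mset_factors G (nested_poly f)" using ufd_class.mset_factors_exist by blast
  define F where "F = image_mset (inv_into UNIV nested_poly) G"
  have inv: "nested_poly (inv_into UNIV nested_poly g) = g" for g :: "'k poly poly poly poly"
    using nested_poly_surj[of g] by (intro f_inv_into_f) auto
  have "nested_poly (prod_mset (image_mset (inv_into UNIV nested_poly) H)) = prod_mset H" for H :: "'k poly poly poly poly multiset"
    by (induction H) (simp_all add: nested_poly_one nested_poly_mult inv)
  then have "nested_poly (prod_mset F) = nested_poly f" using G by (simp add: F_def mset_factors_def)
  then have "f = 1 * prod_mset F" by (simp add: nested_poly_inj)
  moreover have "\<forall>\<pi>\<in>#F. prime_elem \<pi>"
  proof
    fix \<pi> assume "\<pi> \<in># F"
    then obtain g where g: "g \<in># G" "\<pi> = inv_into UNIV nested_poly g" by (auto simp: F_def)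
    then have "irreducible g" using G by (simp add: mset_factors_def)
    then have "prime_elem g" by (rule prime_elem_iff_irreducible[THEN iffD2])
    moreover have "nested_poly \<pi> = g" unfolding g(2) by (rule inv)
    ultimately have "prime_elem (nested_poly \<pi>)" by (rule ssubst[rotated])
    then show "prime_elem \<pi>" by (rule prime_elem_nested_poly[THEN iffD1])
  qed
  ultimately show ?thesis by (intro exI[of _ F] exI[of _ 1] conjI dvd_refl)
qed

lemma prod_primes_dvd_cancel:
  fixes q :: "'k::field poly4"
  assumes "\<forall>\<pi>\<in>#F. prime_elem \<pi> \<and> \<not> \<pi> dvd q" "prod_mset F dvd q * x"
  shows "prod_mset F dvd x"
  using assms
proof (induction F)
  case (add \<pi> F)
  have "\<pi> * prod_mset F dvd q * x" using add.prems(2) by simp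
  then have "prod_mset F dvd q * x" by (rule dvd_mult_right)
  then have "prod_mset F dvd x" using add.IH add.prems(1) by simp
  then obtain y where y: "x = prod_mset F * y" by (rule dvdE)
  have "0 \<notin># F" using add.prems(1) not_prime_elem_zero by (metis union_iff add_mset_add_single)
  then have "prod_mset F \<noteq> 0" by (simp only: prod_mset_zero_iff not_False_eq_True)
  moreover have "prod_mset F * \<pi> dvd prod_mset F * (q * y)" using add.prems(2) by (simp add: y ac_simps)
  ultimately have "\<pi> dvd q * y" by simp
  then have "\<pi> dvd y" using add.prems(1) by (simp add: prime_elem_dvd_mult_iff)
  then show ?case unfolding y by (simp add: mult.commute[of \<pi>] mult_dvd_mono)
qed simp

text \<open>A prime that divides \<open>a + c b\<close> for two different constants \<open>c\<close> divides \<open>a\<close> and \<open>b\<close>, so every prime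
  of \<open>F\<close> excludes at most one constant.\<close>

lemma ex_prime_avoiding_combination2:
  fixes a b :: "'k::field_char_0 poly4"
  assumes "finite F" "\<forall>\<pi>\<in>F. prime_elem \<pi>"
  shows "\<exists>c. \<forall>\<pi>\<in>F. \<pi> dvd a + const_poly c * b \<longrightarrow> \<pi> dvd a \<and> \<pi> dvd b"
proof -
  define bad where "bad \<pi> = {c. \<pi> dvd a + const_poly c * b \<and> \<not> (\<pi> dvd a \<and> \<pi> dvd b)}" for \<pi>
  have "finite (bad \<pi>)" if "\<pi> \<in> F" for \<pi>
  proof -
    have "c = d" if "c \<in> bad \<pi>" "d \<in> bad \<pi>" for c d
    proof (rule ccontr)
      assume "c \<noteq> d"
      have "\<pi> dvd (a + const_poly c * b) - (a + const_poly d * b)" using that by (intro dvd_diff) (auto simp: bad_def)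
      then have "\<pi> dvd const_poly (c - d) * b" by (simp add: const_poly_diff algebra_simps)
      then have "\<pi> dvd const_poly (inverse (c - d)) * (const_poly (c - d) * b)" by (rule dvd_mult)
      also have "\<dots> = b" using \<open>c \<noteq> d\<close> by (simp add: mult.assoc[symmetric] const_poly_mult[symmetric])
      finally have "\<pi> dvd b" .
      moreover have "\<pi> dvd a + const_poly c * b" using that by (simp add: bad_def)
      ultimately have "\<pi> dvd a" by (metis dvd_add_left_iff dvd_mult)
      then show False using \<open>\<pi> dvd b\<close> that by (simp add: bad_def)
    qed
    then have "bad \<pi> \<subseteq> {SOME c. c \<in> bad \<pi>}" by (metis insertCI someI subsetI)
    then show ?thesis by (rule finite_subset) simp
  qed
  then have "finite (\<Union>\<pi>\<in>F. bad \<pi>)" using assms(1) by blast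
  then obtain c where "c \<notin> (\<Union>\<pi>\<in>F. bad \<pi>)" using ex_new_if_finite[OF infinite_UNIV_char_0] by blast
  then show ?thesis unfolding bad_def by blast
qed

lemma ex_prime_avoiding_combination:
  fixes a :: "'k::field_char_0 poly4 ^ 'r::finite"
  assumes F: "finite F" "\<forall>\<pi>\<in>F. prime_elem \<pi>"
  shows "\<exists>\<mu>. \<forall>\<pi>\<in>F. \<pi> dvd (\<Sum>i\<in>UNIV. const_poly (\<mu> i) * a $ i) \<longrightarrow> (\<forall>i. \<pi> dvd a $ i)"
proof -
  have "\<exists>\<mu>. \<forall>\<pi>\<in>F. \<pi> dvd (\<Sum>i\<in>I. const_poly (\<mu> i) * a $ i) \<longrightarrow> (\<forall>i\<in>I. \<pi> dvd a $ i)" if "finite I" for I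
    using that
  proof (induction I rule: finite_induct)
    case (insert j I)
    then obtain \<mu> where \<mu>: "\<And>\<pi>. \<pi> \<in> F \<Longrightarrow> \<pi> dvd (\<Sum>i\<in>I. const_poly (\<mu> i) * a $ i) \<Longrightarrow> \<forall>i\<in>I. \<pi> dvd a $ i" by blast
    define q where "q = (\<Sum>i\<in>I. const_poly (\<mu> i) * a $ i)"
    obtain c where c: "\<forall>\<pi>\<in>F. \<pi> dvd q + const_poly c * a $ j \<longrightarrow> \<pi> dvd q \<and> \<pi> dvd a $ j"
      using ex_prime_avoiding_combination2[OF F, of q "a $ j"] by (elim exE)
    have eq: "(\<Sum>i\<in>insert j I. const_poly ((\<mu>(j := c)) i) * a $ i) = q + const_poly c * a $ j"
    proof -
      have "(\<Sum>i\<in>I. const_poly ((\<mu>(j := c)) i) * a $ i) = q"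
        unfolding q_def using insert.hyps(2) by (intro sum.cong refl) auto
      then show ?thesis using insert.hyps by (simp add: add.commute)
    qed
    have "\<forall>\<pi>\<in>F. \<pi> dvd (\<Sum>i\<in>insert j I. const_poly ((\<mu>(j := c)) i) * a $ i) \<longrightarrow> (\<forall>i\<in>insert j I. \<pi> dvd a $ i)"
    proof (unfold eq, rule ballI, rule impI)
      fix \<pi> assume "\<pi> \<in> F" "\<pi> dvd q + const_poly c * a $ j"
      then have "\<pi> dvd q" "\<pi> dvd a $ j" using c by blast+
      then show "\<forall>i\<in>insert j I. \<pi> dvd a $ i" using \<mu>[OF \<open>\<pi> \<in> F\<close>] by (simp add: q_def)
    qed
    then show ?case by (rule exI[of _ "\<mu>(j := c)"])
  qed simp
  from this[of UNIV] show ?thesis by simp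
qed

section \<open>Lines in a free module\<close>

definition parallel :: "'k::field poly4 ^ 'r \<Rightarrow> 'k poly4 ^ 'r \<Rightarrow> bool" where
  "parallel a v \<longleftrightarrow> (\<forall>i j. a $ i * v $ j = a $ j * v $ i)"

text \<open>A generator of the module of all vectors of forms that are proportional to a given one.\<close>

definition shortest :: "nat \<Rightarrow> 'k::field poly4 ^ 'r \<Rightarrow> bool" where
  "shortest m a \<longleftrightarrow> a \<in> gr (\<lambda>_. 0) m \<and> a \<noteq> 0 \<and> (\<forall>l<m. \<forall>b\<in>gr (\<lambda>_. 0) l. parallel a b \<longrightarrow> b = 0)"

lemma unit_homogeneous_degree_0:
  fixes f :: "'k::field poly4"
  assumes "homogeneous 0 f" "f \<noteq> 0"
  shows "f dvd 1"
proof -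
  obtain c where c: "f = const_poly c" using homogeneous_0_imp_const assms(1) by blast
  then have "f * const_poly (inverse c) = 1" using assms(2) by (simp add: const_poly_mult[symmetric])
  then show ?thesis by (metis dvd_triv_left)
qed

text \<open>A common prime factor of the entries could be cancelled, which would lower the degree.  A
  coordinate \<open>p\<close> and a general constant combination \<open>q\<close> of coprime entries have no common prime factor,
  so that \<open>p, q\<close> is a regular sequence.\<close>

lemma shortest_coprime_pair:
  fixes a :: "'k::field_char_0 poly4 ^ 'r::finite"
  assumes sh: "shortest k a" and i0: "a $ i0 \<noteq> 0"
  shows "\<exists>\<mu>. \<forall>x. a $ i0 dvd (\<Sum>i\<in>UNIV. const_poly (\<mu> i) * a $ i) * x \<longrightarrow> a $ i0 dvd x"
proof -
  note a = sh[unfolded shortest_def, THEN conjunct1] i0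
  have min: "b = 0" if "l < k" "b \<in> gr (\<lambda>_. 0) l" "parallel a b" for l b
    using sh that unfolding shortest_def by blast
  obtain F u where F: "u dvd 1" "a $ i0 = u * prod_mset F" "\<forall>\<pi>\<in>#F. prime_elem \<pi>"
    using poly4_prime_factorization[OF a(2)] by (elim exE conjE)
  have no_common: "\<exists>i. \<not> \<pi> dvd a $ i" if \<pi>: "prime_elem \<pi>" for \<pi>
  proof (rule ccontr)
    assume "\<nexists>i. \<not> \<pi> dvd a $ i"
    then have "\<forall>i. \<exists>b. a $ i = \<pi> * b" unfolding dvd_def by blast
    then obtain b where b: "\<And>i. a $ i = \<pi> * b i" by metis
    have hom: "homogeneous k (\<pi> * b i)" for i using a(1) b by (simp add: gr_def)
    obtain r l where rl: "homogeneous r \<pi>" "homogeneous l (b i0)" "k = r + l"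
      using homogeneous_factors[OF hom] a(2) b by metis
    have \<pi>0: "\<pi> \<noteq> 0" using \<pi> by auto
    have "\<not> \<pi> dvd 1" using \<pi> by (simp add: prime_elem_def)
    then have "r \<noteq> 0" using rl(1) unit_homogeneous_degree_0[OF _ \<pi>0] by metis
    then have lk: "l < k" using rl(3) by simp
    have "homogeneous l (b i)" for i
    proof (cases "b i = 0")
      case False
      then obtain r' l' where "homogeneous r' \<pi>" "homogeneous l' (b i)" "k = r' + l'"
        using homogeneous_factors[OF hom] \<pi>0 by (metis mult_eq_0_iff)
      then show ?thesis using homogeneous_unique[OF rl(1) _ \<pi>0] rl(3) by auto
    qed simp
    then have "(\<chi> i. b i) \<in> gr (\<lambda>_. 0) l" by (simp add: gr_def)
    moreover have "parallel a (\<chi> i. b i)" by (simp add: parallel_def b ac_simps)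
    ultimately have "(\<chi> i. b i) = 0" using min[OF lk] by blast
    then have "b i0 = 0" by (simp add: Finite_Cartesian_Product.vec_eq_iff)
    then show False using a(2) b by simp
  qed
  obtain \<mu> where \<mu>: "\<forall>\<pi>\<in>#F. \<pi> dvd (\<Sum>i\<in>UNIV. const_poly (\<mu> i) * a $ i) \<longrightarrow> (\<forall>i. \<pi> dvd a $ i)"
    using ex_prime_avoiding_combination[OF finite_set_mset F(3), of a] by (elim exE)
  show ?thesis
  proof (intro exI[of _ \<mu>] allI impI)
    fix x assume that: "a $ i0 dvd (\<Sum>i\<in>UNIV. const_poly (\<mu> i) * a $ i) * x"
    have "prod_mset F dvd (\<Sum>i\<in>UNIV. const_poly (\<mu> i) * a $ i) * x" 
    proof (rule dvd_trans)
      show "prod_mset F dvd a $ i0" unfolding F(2) by (rule dvd_triv_right)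
    qed (rule that)
    then have "prod_mset F dvd x"
    proof (rule prod_primes_dvd_cancel[rotated])
      show "\<forall>\<pi>\<in>#F. prime_elem \<pi> \<and> \<not> \<pi> dvd (\<Sum>i\<in>UNIV. const_poly (\<mu> i) * a $ i)"
      proof (intro ballI conjI notI)
        fix \<pi> assume "\<pi> \<in># F"
        then show "prime_elem \<pi>" using F(3) by (rule bspec[rotated])
        assume "\<pi> dvd (\<Sum>i\<in>UNIV. const_poly (\<mu> i) * a $ i)"
        with bspec[OF \<mu> \<open>\<pi> \<in># F\<close>] have "\<forall>i. \<pi> dvd a $ i" by (rule mp)
        then show False using no_common[OF \<open>prime_elem \<pi>\<close>] by simp
      qed
    qed
    from mult_dvd_mono[OF F(1) this] show "a $ i0 dvd x" unfolding F(2) by simp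
  qed
qed

text \<open>From \<open>p v\<^sub>i = a\<^sub>i v\<^sub>p\<close> the entry \<open>p = a\<^sub>p\<close> divides \<open>q v\<^sub>p\<close>, hence \<open>v\<^sub>p\<close>, and the quotient is
  the factor.\<close>

lemma parallel_imp_multiple:
  fixes a v :: "'k::field poly4 ^ 'r::finite"
  assumes a: "a $ i0 \<noteq> 0" and \<mu>: "\<And>x. a $ i0 dvd (\<Sum>i\<in>UNIV. const_poly (\<mu> i) * a $ i) * x \<Longrightarrow> a $ i0 dvd x"
    and v: "parallel a v"
  shows "\<exists>f. v = f *s a"
proof -
  have eq: "(\<Sum>i\<in>UNIV. const_poly (\<mu> i) * a $ i) * v $ i0 = a $ i0 * (\<Sum>i\<in>UNIV. const_poly (\<mu> i) * v $ i)"
    unfolding sum_distrib_left sum_distrib_right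
    by (intro sum.cong refl) (use v in \<open>simp add: parallel_def mult.assoc mult.left_commute\<close>)
  have "a $ i0 dvd v $ i0" by (rule \<mu>) (unfold eq, rule dvd_triv_left)
  then obtain f where f: "v $ i0 = a $ i0 * f" by (rule dvdE)
  have "v $ j = f * a $ j" for j
  proof -
    have "a $ i0 * v $ j = a $ j * v $ i0" using v by (simp add: parallel_def)
    also have "\<dots> = a $ i0 * (f * a $ j)" by (simp add: f ac_simps)
    finally show ?thesis using a by simp
  qed
  then show ?thesis by (intro exI[of _ f]) (simp add: Finite_Cartesian_Product.vec_eq_iff)
qed

lemma homogeneous_scalar_of_multiple:
  fixes a :: "'k::field poly4 ^ 'r::finite"
  assumes a: "a \<in> gr (\<lambda>_. 0) k" "a $ i0 \<noteq> 0" and v: "f *s a \<in> gr (\<lambda>_. 0) t" and "f \<noteq> 0"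
  shows "\<exists>m. homogeneous m f \<and> t = m + k"
proof -
  have "homogeneous t (f * a $ i0)" using v by (simp add: gr_def)
  moreover have "f * a $ i0 \<noteq> 0" using a(2) assms(4) by simp
  ultimately obtain m l where ml: "homogeneous m f" "homogeneous l (a $ i0)" "t = m + l"
    using homogeneous_factors by metis
  then have "l = k" using a homogeneous_unique[of l "a $ i0" k] by (simp add: gr_def)
  then show ?thesis using ml by blast
qed

section \<open>Subspaces of a plane\<close>

lemma rkI:
  fixes F :: "('k::field, 'n::finite) P3_sheaf"
  assumes "has_quotient_dim (O_stalk 0 {0}) (*s) (num F {0}) (den F {0}) n" "0 \<in> num F {0}"
    "0 \<in> den F {0}" "\<And>x y. x \<in> den F {0} \<Longrightarrow> y \<in> den F {0} \<Longrightarrow> x + y \<in> den F {0}"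
    "\<And>c x. c \<in> O_stalk 0 {0} \<Longrightarrow> x \<in> den F {0} \<Longrightarrow> c *s x \<in> den F {0}"
  shows "rk F = n"
  unfolding rk_def
proof (rule the_equality)
  fix m assume "has_quotient_dim (O_stalk 0 {0}) (*s) (num F {0}) (den F {0}) m"
  from has_quotient_dim_unique[OF vec.vector_space_axioms is_subfield_O_stalk assms(3-5,2) this assms(1)]
  show "m = n" .
qed (rule assms(1))

lemma has_quotient_dim_0:
  assumes "W \<subseteq> N"
  shows "has_quotient_dim C \<mu> W N 0"
  unfolding has_quotient_dim_def using assms by (auto intro!: ex1I[of _ "\<lambda>_. undefined"])

lemma has_quotient_dim_1:
  fixes a :: "'f::field ^ 'n"
  assumes "a \<noteq> 0" "a \<in> W" and W: "\<And>w. w \<in> W \<Longrightarrow> \<exists>c\<in>C. w = c *s a"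
  shows "has_quotient_dim C (*s) W {0} 1"
  unfolding has_quotient_dim_def
proof (intro exI[of _ "\<lambda>_. a"] conjI allI impI ballI)
  fix w assume "w \<in> W"
  then obtain c where c: "c \<in> C" "w = c *s a" using W by blast
  show "\<exists>!c. c \<in> {..<1::nat} \<rightarrow>\<^sub>E C \<and> w - (\<Sum>i<1. c i *s a) \<in> {0}"
  proof (rule ex1I[of _ "\<lambda>i\<in>{..<1::nat}. c"])
    show "(\<lambda>i\<in>{..<1::nat}. c) \<in> {..<1} \<rightarrow>\<^sub>E C \<and> w - (\<Sum>i<1. (\<lambda>i\<in>{..<1::nat}. c) i *s a) \<in> {0}"
      using c by simp
    fix c' assume c': "c' \<in> {..<1::nat} \<rightarrow>\<^sub>E C \<and> w - (\<Sum>i<1. c' i *s a) \<in> {0}"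
    then have "c' 0 = c" using c assms(1) by simp
    then show "c' = (\<lambda>i\<in>{..<1::nat}. c)" using c' by (intro PiE_ext[of c' "{..<1}" "\<lambda>_. C"]) (auto simp: c)
  qed
qed (rule assms)

lemma has_quotient_dim_2:
  fixes a b :: "'f::field ^ 'n"
  assumes "a \<in> W" "b \<in> W" and W: "\<And>w. w \<in> W \<Longrightarrow> \<exists>c\<in>C. \<exists>d\<in>C. w = c *s a + d *s b"
    and ind: "\<And>c d. c *s a + d *s b = 0 \<Longrightarrow> c = 0 \<and> d = 0"
  shows "has_quotient_dim C (*s) W {0} 2"
  unfolding has_quotient_dim_def
proof (intro exI[of _ "\<lambda>i. if i = 0 then a else b"] conjI allI impI ballI)
  have sum2: "(\<Sum>i<2. g i) = g 0 + g 1" for g :: "nat \<Rightarrow> 'f ^ 'n" by (simp add: numeral_2_eq_2)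
  fix w assume "w \<in> W"
  then obtain c d where c: "c \<in> C" "d \<in> C" "w = c *s a + d *s b" using W by blast
  let ?c = "\<lambda>i\<in>{..<2::nat}. if i = 0 then c else d"
  show "\<exists>!c. c \<in> {..<2::nat} \<rightarrow>\<^sub>E C \<and> w - (\<Sum>i<2. c i *s (if i = 0 then a else b)) \<in> {0}"
  proof (rule ex1I[of _ ?c])
    show "?c \<in> {..<2} \<rightarrow>\<^sub>E C \<and> w - (\<Sum>i<2. ?c i *s (if i = 0 then a else b)) \<in> {0}"
      unfolding sum2 using c by auto
    fix c' assume c': "c' \<in> {..<2::nat} \<rightarrow>\<^sub>E C \<and> w - (\<Sum>i<2. c' i *s (if i = 0 then a else b)) \<in> {0}"
    then have "c *s a + d *s b - (c' 0 *s a + c' 1 *s b) = 0" unfolding sum2 using c by simp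
    then have "(c - c' 0) *s a + (d - c' 1) *s b = 0" by (simp add: vec.scale_left_diff_distrib algebra_simps)
    then have eq: "c' 0 = c" "c' 1 = d" using ind by (metis eq_iff_diff_eq_0)+
    show "c' = ?c"
    proof (rule PiE_ext[of c' "{..<2}" "\<lambda>_. C"])
      show "?c \<in> {..<2} \<rightarrow>\<^sub>E C" using c by simp
      fix i :: nat assume "i \<in> {..<2}"
      then have "i = 0 \<or> i = 1" by auto
      then show "c' i = ?c i" using eq by auto
    qed (use c' in blast)
  qed
qed (use assms(1,2) in auto)

text \<open>Two vectors of \<open>W\<close> that are not proportional over \<open>C\<close> have nonzero determinant \<open>D\<close> in the coordinates
  \<open>p, q\<close>, so by Cramer's rule they form a basis.\<close>

lemma plane_subspace_cases:
  fixes T W :: "('f::field ^ 'n) set"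
  assumes C: "is_subfield C"
    and coord: "\<And>v. v \<in> T \<Longrightarrow> v $ p \<in> C \<and> v $ q \<in> C" "\<And>v. v \<in> T \<Longrightarrow> v $ p = 0 \<Longrightarrow> v $ q = 0 \<Longrightarrow> v = 0"
    and T: "\<And>v w. v \<in> T \<Longrightarrow> w \<in> T \<Longrightarrow> v + w \<in> T" "\<And>c v. c \<in> C \<Longrightarrow> v \<in> T \<Longrightarrow> c *s v \<in> T"
    and W: "W \<subseteq> T" "0 \<in> W"
  shows "has_quotient_dim C (*s) W {0} 0 \<or> has_quotient_dim C (*s) W {0} 2 \<or>
    (has_quotient_dim C (*s) W {0} 1 \<and> (\<exists>a\<in>W. a \<noteq> 0 \<and> (\<forall>w\<in>W. \<exists>c\<in>C. w = c *s a)))"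
proof (cases "W \<subseteq> {0}")
  case True
  show ?thesis by (rule disjI1, rule has_quotient_dim_0[OF True])
next
  case False
  then obtain a where a: "a \<in> W" "a \<noteq> 0" by blast
  show ?thesis
  proof (cases "\<forall>w\<in>W. \<exists>c\<in>C. w = c *s a")
    case True
    then have "has_quotient_dim C (*s) W {0} 1" using has_quotient_dim_1[OF a(2,1)] by blast
    then show ?thesis using True a by blast
  next
    case False
    then obtain b where b: "b \<in> W" "\<not> (\<exists>c\<in>C. b = c *s a)" by blast
    note cl = is_subfieldD[OF C]
    have aT: "a \<in> T" and bT: "b \<in> T" using a b W by auto
    have comb: "c *s v + d *s w \<in> T" if "c \<in> C" "d \<in> C" "v \<in> T" "w \<in> T" for c d v w
      by (intro T that)
    have ab: "a $ p \<in> C" "a $ q \<in> C" "b $ p \<in> C" "b $ q \<in> C" using coord(1)[OF aT] coord(1)[OF bT] by simp_all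
    define D where "D = a $ p * b $ q - a $ q * b $ p"
    have D: "D \<noteq> 0"
    proof
      assume "D = 0"
      then have D0: "a $ p * b $ q = a $ q * b $ p" by (simp add: D_def)
      have "a $ p \<noteq> 0 \<or> a $ q \<noteq> 0" using coord(2)[OF aT] a(2) by blast
      then obtain r where r: "r \<in> {p, q}" "a $ r \<noteq> 0" by blast
      let ?c = "b $ r * inverse (a $ r)"
      have "a $ r \<in> C" "b $ r \<in> C" using r(1) ab by auto
      then have c: "?c \<in> C" by (intro cl(5,6))
      have "b + (- ?c) *s a = 0"
      proof (rule coord(2))
        show "b + (- ?c) *s a \<in> T" by (intro T aT bT cl(4) c)
        show "(b + (- ?c) *s a) $ p = 0" "(b + (- ?c) *s a) $ q = 0"
          using r D0 by (auto simp: field_simps)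
      qed
      then have "b = ?c *s a" by (simp add: vec.scale_minus_left)
      then show False using b(2) c by blast
    qed
    have "has_quotient_dim C (*s) W {0} 2"
    proof (rule has_quotient_dim_2[OF a(1) b(1)])
      fix w assume "w \<in> W"
      then have wT: "w \<in> T" using W by blast
      let ?c = "(w $ p * b $ q + - (w $ q * b $ p)) * inverse D" and ?d = "(a $ p * w $ q + - (a $ q * w $ p)) * inverse D"
      have wC: "w $ p \<in> C" "w $ q \<in> C" using coord(1)[OF wT] by simp_all
      have "a $ p * b $ q + - (a $ q * b $ p) \<in> C" by (intro cl(3-5) ab)
      then have DC: "D \<in> C" by (simp add: D_def)
      have cd: "?c \<in> C" "?d \<in> C" by (intro cl(3-6) ab wC DC)+
      have "w + (- 1) *s (?c *s a + ?d *s b) = 0"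
      proof (rule coord(2))
        show "w + (- 1) *s (?c *s a + ?d *s b) \<in> T" by (intro T comb cd aT bT wT cl(4) cl(2))
        have solve: "x = (y * inverse D) * u + (z * inverse D) * v" if "x * D = y * u + z * v" for x y z u v
        proof -
          have "x = x * D * inverse D" using D by simp
          then show ?thesis unfolding that by (simp add: algebra_simps)
        qed
        have "w $ p * D = (w $ p * b $ q + - (w $ q * b $ p)) * a $ p + (a $ p * w $ q + - (a $ q * w $ p)) * b $ p"
          "w $ q * D = (w $ p * b $ q + - (w $ q * b $ p)) * a $ q + (a $ p * w $ q + - (a $ q * w $ p)) * b $ q"
          by (simp_all add: D_def algebra_simps)
        from solve[OF this(1)] solve[OF this(2)]
        have "w $ p = ?c * a $ p + ?d * b $ p" "w $ q = ?c * a $ q + ?d * b $ q" .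
        moreover have "x + (- 1) * y = 0" if "x = y" for x y :: 'f using that by simp
        ultimately show "(w + (- 1) *s (?c *s a + ?d *s b)) $ p = 0" "(w + (- 1) *s (?c *s a + ?d *s b)) $ q = 0"
          by (simp_all only: vector_add_component vector_smult_component)
      qed
      moreover have "x = y" if "x + (- 1) *s y = 0" for x y :: "'f ^ 'n" using that by simp
      ultimately have "w = ?c *s a + ?d *s b" by blast
      then show "\<exists>c\<in>C. \<exists>d\<in>C. w = c *s a + d *s b" using cd by blast
    next
      fix c d assume "c *s a + d *s b = 0"
      then have "(c *s a + d *s b) $ p = 0" "(c *s a + d *s b) $ q = 0" by simp_all
      then have e: "c * a $ p + d * b $ p = 0" "c * a $ q + d * b $ q = 0" by simp_all
      have "c * D = (c * a $ p + d * b $ p) * b $ q - (c * a $ q + d * b $ q) * b $ p"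
        "d * D = (c * a $ q + d * b $ q) * a $ p - (c * a $ p + d * b $ p) * a $ q"
        by (simp_all add: D_def algebra_simps)
      then have "c * D = 0" "d * D = 0" by (simp_all only: e mult_zero_left diff_self)
      then show "c = 0 \<and> d = 0" using D by simp
    qed
    then show ?thesis by blast
  qed
qed

section \<open>Matrices with two rows\<close>

lemma four_indices:
  fixes j k :: 4
  assumes "j \<noteq> k"
  shows "\<exists>p q. distinct [p, q, j, k] \<and> UNIV = {p, q, j, k}"
proof -
  have "card (UNIV - {j, k}) = 2" using assms by (simp add: card_Diff_subset)
  then obtain p q where pq: "UNIV - {j, k} = {p, q}" "p \<noteq> q" by (auto simp: card_2_iff)
  then have "p \<noteq> j" "p \<noteq> k" "q \<noteq> j" "q \<noteq> k" by auto
  moreover have "UNIV = {p, q, j, k}" using pq(1) by blast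
  ultimately show ?thesis using pq(2) assms by auto
qed

lemma sum_four:
  assumes "distinct [p, q, j, k]" "UNIV = {p, q, j, k :: 4}"
  shows "(\<Sum>i\<in>UNIV. f i) = f p + (f q + (f j + (f k :: 'a::comm_monoid_add)))"
  unfolding assms(2) using assms(1) by simp

definition minor :: "'k::field poly4 ^ 4 ^ 2 \<Rightarrow> 4 \<Rightarrow> 4 \<Rightarrow> 'k poly4" where
  "minor A j k = A $ 1 $ j * A $ 2 $ k - A $ 1 $ k * A $ 2 $ j"

definition kernel_sheaf :: "'k::field poly4 ^ 4 ^ 2 \<Rightarrow> ('k, 4) P3_sheaf" where
  "kernel_sheaf A = \<lparr>num = (\<lambda>\<pp>. {v \<in> sum_O (\<lambda>_. 0) \<pp>. frac_map A v = 0}), den = (\<lambda>\<pp>. {0})\<rparr>"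

lemma vec_2_eq_iff: "v = w \<longleftrightarrow> v $ 1 = w $ 1 \<and> v $ (2 :: 2) = w $ 2"
  by (simp add: Finite_Cartesian_Product.vec_eq_iff forall_2)

text \<open>The kernel sheaf is saturated: a form vector with values in the generic kernel lies in the stalk of the
  kernel at every point.\<close>

lemma section_module_kernel:
  "section_module (num (kernel_sheaf A)) t = {u \<in> gr (\<lambda>_. 0) t. A *v u = 0}"
proof (intro subset_antisym subsetI)
  let ?B = "num (kernel_sheaf A)"
  have B: "O_submodule ?B" unfolding kernel_sheaf_def using O_submodule_kernel[of A] by simp
  fix u assume u: "u \<in> section_module ?B t"
  then obtain c v where "to_fract_vec u = c *s v" "v \<in> ?B {0}"
    using zero_in_Proj unfolding section_module_def twist_stalks_def by blast
  then have "frac_map A (to_fract_vec u) = 0" by (simp add: kernel_sheaf_def frac_map_simps(2))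
  then have "A *v u = 0" unfolding frac_map_simps(5) by (metis to_fract_vec_simps(4,5))
  then show "u \<in> {u \<in> gr (\<lambda>_. 0) t. A *v u = 0}" using section_module_subset_gr[OF B] u by blast
next
  fix u assume u: "u \<in> {u \<in> gr (\<lambda>_. 0) t. A *v u = 0}"
  show "u \<in> section_module (num (kernel_sheaf A)) t"
    unfolding section_module_def
  proof (intro CollectI ballI)
    fix \<pp> :: "'a poly4 set" assume p: "\<pp> \<in> Proj"
    have "to_fract_vec u \<in> sum_O (\<lambda>i. 0 + int t) \<pp>" using to_fract_vec_mem_sum_O[OF p, of u "\<lambda>_. 0" t] u by simp
    then have "to_fract_vec u \<in> twist_stalks (int t) (sum_O (\<lambda>_. 0)) \<pp>" unfolding twist_stalks_sum_O[OF p] .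
    then obtain c v where c: "to_fract_vec u = c *s v" "c \<in> O_stalk (int t) \<pp>" "v \<in> sum_O (\<lambda>_. 0) \<pp>"
      unfolding twist_stalks_def by blast
    have "c *s frac_map A v = 0"
      unfolding frac_map_simps(2)[symmetric] c(1)[symmetric] frac_map_simps(5) using u by (simp add: to_fract_vec_simps)
    then consider "c = 0" | "frac_map A v = 0" by auto
    then show "to_fract_vec u \<in> twist_stalks (int t) (num (kernel_sheaf A)) \<pp>"
    proof cases
      case 1
      then have "to_fract_vec u = c *s 0" using c(1) by simp
      moreover have "0 \<in> num (kernel_sheaf A) \<pp>" by (simp add: kernel_sheaf_def sum_O_closed(1)[OF p] frac_map_simps)
      ultimately show ?thesis unfolding twist_stalks_def using c(2) by blast
    next
      case 2
      then show ?thesis unfolding twist_stalks_def kernel_sheaf_def using c by auto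
    qed
  qed
qed

lemma linear_matrix_vector: "Vector_Spaces.linear vscale vscale ((*v) (A :: 'k::field poly4 ^ 'c ^ 'r))"
proof -
  have "A *v vscale c v = vscale c (A *v v)" for c v
    by (simp add: matrix_vector_mult_def Finite_Cartesian_Product.vec_eq_iff sum_distrib_left ac_simps)
  then show ?thesis by unfold_locales (simp_all add: matrix_vector_right_distrib)
qed

text \<open>A pair of rows of forms that are generically independent.  The indices \<open>j, k\<close> name a nonzero minor
  and \<open>p, q\<close> the other two columns, which are coordinates on the kernel at the generic point.\<close>

locale rank_two_matrix =
  fixes e :: "2 \<Rightarrow> nat" and A :: "'k::field_char_0 poly4 ^ 4 ^ 2" and j k p q :: 4
  assumes A: "\<And>i l. homogeneous (e i) (A $ i $ l)" and jk: "minor A j k \<noteq> 0"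
    and idx: "distinct [p, q, j, k]" "UNIV = {p, q, j, k}"
begin

lemma minor_homogeneous: "homogeneous (e 1 + e 2) (minor A a b)"
  unfolding minor_def by (intro homogeneous_diff homogeneous_mult A)

lemma minor_ratio: "to_fract (minor A a b) / to_fract (minor A j k) \<in> O_stalk 0 {0}"
  using minor_homogeneous jk by (intro O_stalkI) auto

lemma frac_map_eq_0_iff: "frac_map A v = 0 \<longleftrightarrow>
    (\<forall>r. to_fract (A $ r $ p) * v $ p + (to_fract (A $ r $ q) * v $ q + (to_fract (A $ r $ j) * v $ j
      + to_fract (A $ r $ k) * v $ k)) = 0)"
  by (simp add: frac_map_def matrix_vector_mult_def Finite_Cartesian_Product.vec_eq_iff sum_four[OF idx])

lemma minor_fract: "to_fract (minor A a b) = to_fract (A $ 1 $ a) * to_fract (A $ 2 $ b) - to_fract (A $ 1 $ b) * to_fract (A $ 2 $ a)"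
  by (simp add: minor_def)

lemma kernel_coordinates:
  assumes "frac_map A v = 0" "v $ p = 0" "v $ q = 0"
  shows "v = 0"
proof -
  have e: "to_fract (A $ r $ j) * v $ j + to_fract (A $ r $ k) * v $ k = 0" for r
    using assms unfolding frac_map_eq_0_iff by simp
  have "to_fract (minor A j k) * v $ j = (to_fract (A $ 1 $ j) * v $ j + to_fract (A $ 1 $ k) * v $ k) * to_fract (A $ 2 $ k)
      - (to_fract (A $ 2 $ j) * v $ j + to_fract (A $ 2 $ k) * v $ k) * to_fract (A $ 1 $ k)"
    "to_fract (minor A j k) * v $ k = (to_fract (A $ 2 $ j) * v $ j + to_fract (A $ 2 $ k) * v $ k) * to_fract (A $ 1 $ j)
      - (to_fract (A $ 1 $ j) * v $ j + to_fract (A $ 1 $ k) * v $ k) * to_fract (A $ 2 $ j)"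
    unfolding minor_fract by (simp_all add: algebra_simps)
  then have "to_fract (minor A j k) * v $ j = 0" "to_fract (minor A j k) * v $ k = 0"
    unfolding e by (simp_all only: mult_zero_left diff_self)
  then have "v $ j = 0" "v $ k = 0" using jk by simp_all
  then have "v $ i = 0" if "i \<in> {p, q, j, k}" for i using that assms by auto
  then show ?thesis unfolding idx(2)[symmetric] by (simp add: Finite_Cartesian_Product.vec_eq_iff)
qed

text \<open>The two coordinates \<open>p, q\<close> of a kernel element are free, and Cramer's rule determines the others.\<close>

lemma kernel_solution:
  assumes "s \<in> O_stalk 0 {0}" "t \<in> O_stalk 0 {0}"
  shows "\<exists>v\<in>sum_O (\<lambda>_. 0) {0}. frac_map A v = 0 \<and> v $ p = s \<and> v $ q = t"
proof -
  let ?m = "\<lambda>a b. to_fract (minor A a b)"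
  let ?r = "\<lambda>a b. ?m a b / ?m j k"
  note cl = O_stalk_add[OF zero_in_Proj] O_stalk_uminus[OF zero_in_Proj] O_stalk_mult[OF zero_in_Proj, where d = 0 and d' = 0, simplified]
  define v where "v = (\<chi> i. if i = p then s else if i = q then t
      else if i = j then - (s * ?r p k + t * ?r q k) else - (s * ?r j p + t * ?r j q))"
  have v: "v $ p = s" "v $ q = t" "v $ j = - (s * ?r p k + t * ?r q k)" "v $ k = - (s * ?r j p + t * ?r j q)"
    using idx(1) by (auto simp: v_def)
  have "- (s * ?r a b + t * ?r c d) \<in> O_stalk 0 {0}" for a b c d
    by (intro cl assms minor_ratio)
  then have "v $ i \<in> O_stalk 0 {0}" for i
    unfolding v_def using assms by (simp del: minus_add_distrib)
  then have "v \<in> sum_O (\<lambda>_. 0) {0}" by (simp add: sum_O_def)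
  moreover have "frac_map A v = 0"
    unfolding frac_map_eq_0_iff v
  proof
    fix r :: 2
    have D: "?m j k \<noteq> 0" using jk by simp
    have id: "to_fract (A $ r $ a) * ?m j k = to_fract (A $ r $ j) * ?m a k + to_fract (A $ r $ k) * ?m j a" for a
    proof -
      have "r = 1 \<or> r = 2" using exhaust_2 by blast
      then show ?thesis unfolding minor_fract by (auto simp: algebra_simps)
    qed
    have "(to_fract (A $ r $ p) * s + (to_fract (A $ r $ q) * t + (to_fract (A $ r $ j) * - (s * ?r p k + t * ?r q k)
      + to_fract (A $ r $ k) * - (s * ?r j p + t * ?r j q)))) * ?m j k
      = s * (to_fract (A $ r $ p) * ?m j k - (to_fract (A $ r $ j) * ?m p k + to_fract (A $ r $ k) * ?m j p))
        + t * (to_fract (A $ r $ q) * ?m j k - (to_fract (A $ r $ j) * ?m q k + to_fract (A $ r $ k) * ?m j q))"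
      using D by (simp add: field_simps)
    then show "to_fract (A $ r $ p) * s + (to_fract (A $ r $ q) * t + (to_fract (A $ r $ j) * - (s * ?r p k + t * ?r q k)
      + to_fract (A $ r $ k) * - (s * ?r j p + t * ?r j q))) = 0"
      unfolding id using D by simp
  qed
  ultimately show ?thesis using v by blast
qed

lemma rk_kernel_sheaf: "rk (kernel_sheaf A) = 2"
proof -
  let ?C = "O_stalk 0 {0 :: 'k poly4}" and ?T = "num (kernel_sheaf A) {0}"
  note z = O_stalk_zero[OF zero_in_Proj] and o = is_subfieldD(2)[OF is_subfield_O_stalk]
  obtain a where a: "a \<in> ?T" "a $ p = 1" "a $ q = 0" using kernel_solution[OF o z[of 0]] by (auto simp: kernel_sheaf_def)
  obtain b where b: "b \<in> ?T" "b $ p = 0" "b $ q = 1" using kernel_solution[OF z[of 0] o] by (auto simp: kernel_sheaf_def)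
  have "has_quotient_dim ?C (*s) ?T {0} 2"
  proof (rule has_quotient_dim_2[OF a(1) b(1)])
    fix w assume w: "w \<in> ?T"
    have "w - (w $ p *s a + w $ q *s b) = 0"
    proof (rule kernel_coordinates)
      have "frac_map A (w + (- (w $ p)) *s a + (- (w $ q)) *s b) = 0"
        using w a(1) b(1) by (simp add: kernel_sheaf_def frac_map_simps del: vec.scale_minus_left)
      then show "frac_map A (w - (w $ p *s a + w $ q *s b)) = 0" by (simp add: algebra_simps)
    qed (use a b in simp_all)
    then have "w = w $ p *s a + w $ q *s b" by simp
    moreover have "w $ p \<in> ?C" "w $ q \<in> ?C" using w by (auto simp: kernel_sheaf_def sum_O_def)
    ultimately show "\<exists>c\<in>?C. \<exists>d\<in>?C. w = c *s a + d *s b" by blast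
  next
    fix c d assume "c *s a + d *s b = 0"
    then have "(c *s a + d *s b) $ p = 0" "(c *s a + d *s b) $ q = 0" by simp_all
    then show "c = 0 \<and> d = 0" using a b by simp
  qed
  then show ?thesis
    using sum_O_closed(1)[OF zero_in_Proj] by (intro rkI) (auto simp: kernel_sheaf_def frac_map_simps)
qed

text \<open>The generic stalk of the kernel is a plane with coordinates \<open>p, q\<close> over the function field.\<close>

lemma rank_one_subsheaf:
  assumes K: "coherent_subsheaf K (kernel_sheaf A)" and rk: "0 < rk K" "rk K < 2"
  shows "rk K = 1" "\<exists>a\<in>num K {0}. a \<noteq> 0 \<and> (\<forall>w\<in>num K {0}. \<exists>c. w = c *s a)"
proof -
  let ?C = "O_stalk 0 {0 :: 'k poly4}" and ?T = "num (kernel_sheaf A) {0}" and ?W = "num K {0}"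
  note z = zero_in_Proj
  have coh: "coherent (num K)" and den: "den K {0} = {0}" and sub: "?W \<subseteq> ?T"
    using K z by (auto simp: coherent_subsheaf_def kernel_sheaf_def)
  note T = O_submodule_kernel[of A, unfolded O_submodule_def, THEN bspec, OF z]
  have T1: "v + w \<in> ?T" if "v \<in> ?T" "w \<in> ?T" for v w
    using T that unfolding kernel_sheaf_def sheaf.select_convs by blast
  have T2: "c *s v \<in> ?T" if "c \<in> ?C" "v \<in> ?T" for c v
    using T that unfolding kernel_sheaf_def sheaf.select_convs by blast
  have W0: "0 \<in> ?W" using coherent_closed(1)[OF coh z] .
  have rkI': "rk K = n" if "has_quotient_dim ?C (*s) ?W {0} n" for n
    by (rule rkI) (use that W0 den in auto)
  have cases: "has_quotient_dim ?C (*s) ?W {0} 0 \<or> has_quotient_dim ?C (*s) ?W {0} 2 \<or>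
    (has_quotient_dim ?C (*s) ?W {0} 1 \<and> (\<exists>a\<in>?W. a \<noteq> 0 \<and> (\<forall>w\<in>?W. \<exists>c\<in>?C. w = c *s a)))"
  proof (rule plane_subspace_cases[OF is_subfield_O_stalk, where T = ?T and p = p and q = q])
    show "v $ p \<in> ?C \<and> v $ q \<in> ?C" if "v \<in> ?T" for v using that by (simp add: kernel_sheaf_def sum_O_def)
    show "v = 0" if "v \<in> ?T" "v $ p = 0" "v $ q = 0" for v
      using that by (intro kernel_coordinates) (simp_all add: kernel_sheaf_def)
  qed (use T1 T2 sub W0 in blast)+
  then have one: "has_quotient_dim ?C (*s) ?W {0} 1 \<and> (\<exists>a\<in>?W. a \<noteq> 0 \<and> (\<forall>w\<in>?W. \<exists>c\<in>?C. w = c *s a))"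
    using rkI' rk by fastforce
  then show "rk K = 1" using rkI' by blast
  show "\<exists>a\<in>?W. a \<noteq> 0 \<and> (\<forall>w\<in>?W. \<exists>c. w = c *s a)" using one by blast
qed

text \<open>Cramer's rule.\<close>

lemma cramer_image:
  assumes "w \<in> gr e n"
  shows "minor A j k *s w \<in> matrix_image A (n + (e 1 + e 2))"
proof -
  define z :: "'k poly4 ^ 4" where "z = (\<chi> i. if i = j then w $ 1 * A $ 2 $ k - w $ 2 * A $ 1 $ k
      else if i = k then A $ 1 $ j * w $ 2 - A $ 2 $ j * w $ 1 else 0)"
  have z: "z $ p = 0" "z $ q = 0" "z $ j = w $ 1 * A $ 2 $ k - w $ 2 * A $ 1 $ k" "z $ k = A $ 1 $ j * w $ 2 - A $ 2 $ j * w $ 1"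
    using idx(1) by (auto simp: z_def)
  have w: "homogeneous (n + e r) (w $ r)" for r using assms by (simp add: gr_def)
  have "homogeneous (n + (e 1 + e 2)) (w $ 1 * A $ 2 $ l)" "homogeneous (n + (e 1 + e 2)) (w $ 2 * A $ 1 $ l)" for l
    using homogeneous_mult[OF w[of 1] A[of 2 l]] homogeneous_mult[OF w[of 2] A[of 1 l]] by (simp_all add: ac_simps)
  then have "homogeneous (n + (e 1 + e 2)) (z $ i)" for i
    by (auto simp: z_def mult.commute intro!: homogeneous_diff)
  then have "z \<in> gr (\<lambda>_. 0) (n + (e 1 + e 2))" by (simp add: gr_def)
  moreover have "A *v z = minor A j k *s w"
    unfolding vec_2_eq_iff by (simp add: matrix_vector_mult_def sum_four[OF idx] z minor_def algebra_simps)
  ultimately show ?thesis unfolding matrix_image_def by (metis image_eqI)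
qed

text \<open>At the generic point the nonzero minor is invertible, so the matrix is surjective there.\<close>

lemma rk_coker_sheaf: "rk (coker_sheaf e A) = 0"
proof (rule rkI)
  note z = zero_in_Proj
  let ?C = "O_stalk 0 {0 :: 'k poly4}"
  have "num (coker_sheaf e A) {0} \<subseteq> den (coker_sheaf e A) {0}"
  proof
    fix w assume "w \<in> num (coker_sheaf e A) {0}"
    then have w: "w \<in> sum_O (\<lambda>i. int (e i) + int 0) {0}" by (simp add: coker_sheaf_def)
    obtain n b u where b: "homogeneous n b" "b \<notin> {0}" "u \<in> gr e (0 + n)" "to_fract b *s w = to_fract_vec u"
      using sum_O_clear_denominators[OF z w] by blast
    have "to_fract_vec (minor A j k *s u) \<in> image_stalk A (int (n + (e 1 + e 2))) {0}"
      using cramer_image[of u n] b(3) A by (intro image_imp_stalks[OF _ _ z]) auto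
    then have "to_fract (minor A j k * b) *s w \<in> image_stalk A (int (0 + (n + (e 1 + e 2)))) {0}"
      unfolding to_fract_vec_simps(3) b(4)[symmetric] by (simp add: vector_smult_assoc)
    moreover have "homogeneous (n + (e 1 + e 2)) (minor A j k * b)"
      using homogeneous_mult[OF minor_homogeneous b(1)] by (simp add: add.commute)
    moreover have "minor A j k * b \<notin> {0}" using jk b(2) by simp
    ultimately have "w \<in> image_stalk A (int 0) {0}" using image_stalk_cancel[OF z] by blast
    then show "w \<in> den (coker_sheaf e A) {0}" by (simp add: coker_sheaf_def)
  qed
  then show "has_quotient_dim ?C (*s) (num (coker_sheaf e A) {0}) (den (coker_sheaf e A) {0}) 0"
    by (rule has_quotient_dim_0)
  show "0 \<in> num (coker_sheaf e A) {0}" using sum_O_closed(1)[OF z] by (simp add: coker_sheaf_def)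
  show "0 \<in> den (coker_sheaf e A) {0}" using image_stalk_closed(1)[OF z] by (simp add: coker_sheaf_def)
  show "x + y \<in> den (coker_sheaf e A) {0}" if "x \<in> den (coker_sheaf e A) {0}" "y \<in> den (coker_sheaf e A) {0}" for x y
    using that image_stalk_closed(2)[OF z, of x A 0 y] by (simp add: coker_sheaf_def)
  show "c *s x \<in> den (coker_sheaf e A) {0}" if "c \<in> ?C" "x \<in> den (coker_sheaf e A) {0}" for x c
    using that image_stalk_closed(5)[OF z, of c 0 x A 0] by (simp add: coker_sheaf_def)
qed

section \<open>Hilbert polynomials of kernel and cokernel\<close>

lemma dim_kernel_image:
  "V.dim (matrix_image A t) + V.dim (section_module (num (kernel_sheaf A)) t) = 4 * ((t + 3) choose 3)"
proof -
  have "V.dim (gr (\<lambda>_. 0) t :: ('k poly4 ^ 4) set) = V.dim ((*v) A ` gr (\<lambda>_. 0) t) + V.dim {w \<in> gr (\<lambda>_. 0) t. A *v w = 0}"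
    by (rule VV.dim_image_eq'(1)[OF linear_matrix_vector subspace_gr dim_gr(1)])
  then show ?thesis by (simp add: matrix_image_def section_module_kernel dim_gr(2))
qed

lemma dim_image_le: "V.dim (matrix_image A t) \<le> V.dim (gr e t :: ('k poly4 ^ 2) set)"
  using graded_submoduleD(2)[OF graded_submodule_matrix_image[OF A]] by (intro V.dim_mono' dim_gr(1)) blast

lemma dim_gr_2: "V.dim (gr e t :: ('k poly4 ^ 2) set) = ((t + e 1 + 3) choose 3) + ((t + e 2 + 3) choose 3)"
  by (simp add: dim_gr(2) UNIV_2)

text \<open>In large degrees the Hilbert functions are the dimensions of the graded pieces, which are related by
  the rank formula for the matrix.\<close>

lemma hilbert_poly_coker:
  "\<forall>\<^sub>F t in sequentially. poly (hilbert_poly (coker_sheaf e A)) (of_nat t)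
      = of_nat (V.dim (gr e t :: ('k poly4 ^ 2) set)) - of_nat (V.dim (matrix_image A t))"
  "hilbert_poly (coker_sheaf e A) = binom_poly (of_nat (e 1)) + binom_poly (of_nat (e 2)) - smult 4 (binom_poly 0)
      + hilbert_poly (kernel_sheaf A)"
proof -
  let ?P = "binom_poly (of_nat (e 1)) + binom_poly (of_nat (e 2)) - smult 4 (binom_poly 0) + hilbert_poly (kernel_sheaf A)"
  have B: "O_submodule (num (kernel_sheaf A))" unfolding kernel_sheaf_def using O_submodule_kernel[of A] by simp
  have den: "den (kernel_sheaf A) \<pp> = {0}" for \<pp> by (simp add: kernel_sheaf_def)
  have ev: "\<forall>\<^sub>F t in sequentially. (of_nat (V.dim (gr e t :: ('k poly4 ^ 2) set)) - of_nat (V.dim (matrix_image A t)) :: rat)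
      = poly ?P (of_nat t)"
    using hilbert_poly_subsheaf[OF B den]
  proof eventually_elim
    case (elim t)
    have "(of_nat (V.dim (matrix_image A t)) :: rat) + of_nat (V.dim (section_module (num (kernel_sheaf A)) t))
        = 4 * of_nat ((t + 3) choose 3)"
      using arg_cong[OF dim_kernel_image[of t], of "of_nat :: nat \<Rightarrow> rat"]
      by (simp only: of_nat_add of_nat_mult of_nat_numeral)
    then have "(of_nat (V.dim (matrix_image A t)) :: rat)
        = 4 * poly (binom_poly 0) (of_nat t) - of_nat (V.dim (section_module (num (kernel_sheaf A)) t))"
      unfolding of_nat_choose_3 by (simp only: eq_diff_eq)
    then show ?case using elim by (simp add: dim_gr_2 of_nat_choose_3_shift)
  qed
  show "hilbert_poly (coker_sheaf e A) = ?P"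
  proof (rule hilbert_polyI)
    show "\<forall>\<^sub>F t in sequentially. of_nat (h0 (twist (int t) (coker_sheaf e A))) = poly ?P (of_nat t)"
      using h0_coker_sheaf[OF A] ev
      by eventually_elim (use dim_image_le in \<open>simp add: of_nat_diff\<close>)
  qed
  then show "\<forall>\<^sub>F t in sequentially. poly (hilbert_poly (coker_sheaf e A)) (of_nat t)
      = of_nat (V.dim (gr e t :: ('k poly4 ^ 2) set)) - of_nat (V.dim (matrix_image A t))"
    using ev by (simp only: eq_commute)
qed

text \<open>The cokernel is killed by a minor, so its Hilbert polynomial grows at most quadratically.\<close>

lemma degree_hilbert_poly_coker: "degree (hilbert_poly (coker_sheaf e A)) \<le> 2"
proof -
  let ?d = "e 1 + e 2"
  let ?R = "binom_poly (of_nat (e 1)) + binom_poly (of_nat (e 2)) - binom_poly (- of_nat (e 2)) - binom_poly (- of_nat (e 1))"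
  have nonneg: "\<forall>\<^sub>F t in sequentially. 0 \<le> poly (hilbert_poly (coker_sheaf e A)) (of_nat t)"
    using hilbert_poly_coker(1) by eventually_elim (use dim_image_le in simp)
  have le: "\<forall>\<^sub>F t in sequentially. poly (hilbert_poly (coker_sheaf e A)) (of_nat t) \<le> poly ?R (of_nat t)"
    using hilbert_poly_coker(1) eventually_ge_at_top[of ?d]
  proof eventually_elim
    case (elim t)
    define n where "n = t - ?d"
    have t: "t = n + ?d" using elim(2) by (simp add: n_def)
    have inj: "{w \<in> gr e n. minor A j k *s w = 0} = {0}" using jk by auto
    have "V.dim (gr e n :: ('k poly4 ^ 2) set) = V.dim ((*s) (minor A j k) ` gr e n) + V.dim {w \<in> gr e n. minor A j k *s w = 0}"
      by (rule VV.dim_image_eq'(1)[OF linear_vmult subspace_gr dim_gr(1)])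
    moreover have "V.dim ((*s) (minor A j k) ` gr e n) \<le> V.dim (matrix_image A t)"
      using cramer_image unfolding t
      by (intro V.dim_mono' finite_dim_graded_submodule[OF graded_submodule_matrix_image[OF A]]) auto
    moreover have "V.dim ({0} :: ('k poly4 ^ 2) set) = 0"
      using V.dim_le_card[of "{0 :: 'k poly4 ^ 2}" "{}"] by simp
    ultimately have "V.dim (gr e n :: ('k poly4 ^ 2) set) \<le> V.dim (matrix_image A t)" unfolding inj by simp
    then have "((n + e 1 + 3) choose 3) + ((n + e 2 + 3) choose 3) \<le> V.dim (matrix_image A t)" unfolding dim_gr_2 .
    moreover have "n + e 1 = t - e 2" "n + e 2 = t - e 1" "e 1 \<le> t" "e 2 \<le> t" using t by auto
    ultimately have "((t - e 2 + 3) choose 3) + ((t - e 1 + 3) choose 3) \<le> V.dim (matrix_image A t)" by simp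
    then have "of_nat ((t - e 2 + 3) choose 3) + of_nat ((t - e 1 + 3) choose 3) \<le> (of_nat (V.dim (matrix_image A t)) :: rat)"
      by (simp only: of_nat_add[symmetric] of_nat_le_iff)
    then show ?case using elim(1) of_nat_choose_3_diff[OF \<open>e 1 \<le> t\<close>] of_nat_choose_3_diff[OF \<open>e 2 \<le> t\<close>]
      by (simp add: dim_gr_2 of_nat_choose_3_shift)
  qed
  have "degree ?R \<le> 2"
  proof (rule degree_le, intro allI impI)
    fix i :: nat assume "2 < i"
    then show "coeff ?R i = 0"
    proof (cases "i = 3")
      case True
      then show ?thesis by (simp only: coeff_add coeff_diff coeff_binom_poly(1))
    next
      case False
      then have "degree (binom_poly c) < i" for c
        using \<open>2 < i\<close> by (intro le_less_trans[OF coeff_binom_poly(4)]) simp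
      then have "coeff (binom_poly c) i = 0" for c by (rule coeff_eq_0)
      then show ?thesis by simp
    qed
  qed
  from poly_squeeze(1)[OF nonneg le this] show ?thesis .
qed

text \<open>For a vector \<open>z\<close>, the expansion of the determinant with rows \<open>A\<close>, \<open>z\<close> and a free row
  along that row gives a kernel element.\<close>

definition det3 :: "'k poly4 ^ 4 \<Rightarrow> 4 \<Rightarrow> 4 \<Rightarrow> 4 \<Rightarrow> 'k poly4" where
  "det3 z a b c = z $ a * minor A b c - z $ b * minor A a c + z $ c * minor A a b"

definition cross :: "'k poly4 ^ 4 \<Rightarrow> 'k poly4 ^ 4" where
  "cross z = (\<chi> i. if i = p then det3 z q j k else if i = q then - det3 z p j k
     else if i = j then det3 z p q k else - det3 z p q j)"

lemma cross_nth: "cross z $ p = det3 z q j k" "cross z $ q = - det3 z p j k" "cross z $ j = det3 z p q k"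
  "cross z $ k = - det3 z p q j"
  using idx(1) by (auto simp: cross_def)

lemma cross_kernel: "A *v cross z = 0"
  unfolding vec_2_eq_iff
  by (simp add: matrix_vector_mult_def sum_four[OF idx] cross_nth det3_def minor_def algebra_simps)

lemma cross_gr:
  assumes "z \<in> gr (\<lambda>_. 0) n"
  shows "cross z \<in> gr (\<lambda>_. 0) (n + (e 1 + e 2))"
proof -
  have "homogeneous (n + (e 1 + e 2)) (det3 z a b c)" for a b c
    unfolding det3_def using assms minor_homogeneous
    by (intro homogeneous_add homogeneous_diff homogeneous_mult) (simp_all add: gr_def)
  then show ?thesis by (auto simp: gr_def cross_def intro!: homogeneous_uminus)
qed

text \<open>If the kernel element of \<open>z\<close> is proportional to a kernel vector \<open>a\<close>, then \<open>z\<close> annihilates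
  \<open>a\<close>: expand $\det(A_1, A_2, z; a, \cdot, \cdot)$ along the columns \<open>j, k\<close>.\<close>

lemma cross_parallel:
  assumes a: "A *v a = 0" and par: "cross z $ p * a $ q = cross z $ q * a $ p"
  shows "(\<Sum>i\<in>UNIV. z $ i * a $ i) = 0"
proof -
  have rows: "A $ r $ p * a $ p + (A $ r $ q * a $ q + (A $ r $ j * a $ j + A $ r $ k * a $ k)) = 0" for r
    using arg_cong[OF a, of "\<lambda>v. v $ r"] by (simp add: matrix_vector_mult_def sum_four[OF idx])
  have "(z $ p * a $ p + (z $ q * a $ q + (z $ j * a $ j + z $ k * a $ k))) * minor A j k
      = a $ p * det3 z p j k + a $ q * det3 z q j k
      - (A $ 1 $ p * a $ p + (A $ 1 $ q * a $ q + (A $ 1 $ j * a $ j + A $ 1 $ k * a $ k))) * (A $ 2 $ j * z $ k - A $ 2 $ k * z $ j)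
      - (A $ 2 $ p * a $ p + (A $ 2 $ q * a $ q + (A $ 2 $ j * a $ j + A $ 2 $ k * a $ k))) * (z $ j * A $ 1 $ k - z $ k * A $ 1 $ j)"
    unfolding det3_def minor_def by (simp add: algebra_simps)
  also have "\<dots> = a $ p * det3 z p j k + a $ q * det3 z q j k" unfolding rows by simp
  also have "\<dots> = 0" using par unfolding cross_nth by (simp add: algebra_simps)
  finally show ?thesis using jk unfolding sum_four[OF idx] by simp
qed

end

section \<open>Kernel vectors of low degree enlarge the cokernel\<close>

lemma gr_nth: "v \<in> gr e n \<Longrightarrow> homogeneous (n + e i) (v $ i)"
  by (simp add: gr_def)

lemma graded_dim_multiples:
  fixes a :: "'k::field poly4 ^ 'r::finite"
  assumes a: "a \<in> gr (\<lambda>_. 0) m" "a \<noteq> 0" and N: "graded_submodule (\<lambda>_. 0) N"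
    and "m \<le> t" and sub: "\<And>f. homogeneous (t - m) f \<Longrightarrow> f *s a \<in> N t"
  shows "(t - m + 3) choose 3 \<le> V.dim (N t)"
proof -
  let ?\<phi> = "\<lambda>v :: 'k poly4 ^ 1. v $ 1 *s a"
  let ?S = "gr (\<lambda>_. 0) (t - m) :: ('k poly4 ^ 1) set"
  have lin: "Vector_Spaces.linear vscale vscale ?\<phi>"
    by unfold_locales (simp_all add: Finite_Cartesian_Product.vec_eq_iff algebra_simps)
  have ker: "{w \<in> ?S. ?\<phi> w = 0} = {0}" using a(2) by (auto simp: Finite_Cartesian_Product.vec_eq_iff)
  have "V.dim ({0} :: ('k poly4 ^ 1) set) = 0" using V.dim_le_card[of "{0 :: 'k poly4 ^ 1}" "{}"] by simp
  then have "V.dim ?S = V.dim (?\<phi> ` ?S)"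
    using VV.dim_image_eq'(1)[OF lin subspace_gr dim_gr(1), of "\<lambda>_. 0" "t - m"] unfolding ker by simp
  also have "\<dots> \<le> V.dim (N t)"
    by (intro V.dim_mono' finite_dim_graded_submodule[OF N] image_subsetI sub) (simp add: gr_def)
  finally show ?thesis by (simp add: dim_gr(2) UNIV_1)
qed

lemma graded_dim_le_multiples:
  fixes a :: "'k::field poly4 ^ 'r::finite"
  assumes sub: "\<And>v. v \<in> W \<Longrightarrow> \<exists>f. homogeneous n f \<and> v = f *s a"
  shows "V.dim W \<le> (n + 3) choose 3"
proof -
  let ?\<phi> = "\<lambda>v :: 'k poly4 ^ 1. v $ 1 *s a"
  let ?S = "gr (\<lambda>_. 0) n :: ('k poly4 ^ 1) set"
  have lin: "Vector_Spaces.linear vscale vscale ?\<phi>"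
    by unfold_locales (simp_all add: Finite_Cartesian_Product.vec_eq_iff algebra_simps)
  have "W \<subseteq> ?\<phi> ` ?S"
  proof
    fix v assume "v \<in> W"
    then obtain f where f: "homogeneous n f" "v = f *s a" using sub by blast
    then have "(\<chi> i. f) \<in> ?S" "v = ?\<phi> (\<chi> i. f)" by (simp_all add: gr_def)
    then show "v \<in> ?\<phi> ` ?S" by (intro image_eqI)
  qed
  then have "V.dim W \<le> V.dim (?\<phi> ` ?S)"
    by (intro V.dim_mono' VV.dim_image_eq'(2)[OF lin subspace_gr dim_gr(1)])
  also have "\<dots> \<le> V.dim ?S" using VV.dim_image_eq'(1)[OF lin subspace_gr dim_gr(1), of "\<lambda>_. 0" n] by simp
  finally show ?thesis by (simp add: dim_gr(2) UNIV_1)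
qed

lemma matrix_vector_smult: "A *v (c *s x) = c *s (A *v x)"
  for A :: "'a::comm_ring_1 ^ 'n ^ 'm"
  by (simp add: matrix_vector_mult_def Finite_Cartesian_Product.vec_eq_iff sum_distrib_left ac_simps)

lemma sum_axis_const: "(\<Sum>i\<in>UNIV. (c *s axis i0 1 + f *s u) $ i * a $ i) = c * a $ i0 + f * (\<Sum>i\<in>UNIV. u $ i * a $ i)"
  for a u :: "'a::comm_ring_1 ^ 'r::finite"
proof -
  have "(\<Sum>i\<in>UNIV. axis i0 1 $ i * a $ i) = (\<Sum>i\<in>UNIV. if i = i0 then a $ i0 else 0)"
    by (intro sum.cong) (auto simp: axis_def)
  then have "(\<Sum>i\<in>UNIV. axis i0 1 $ i * a $ i) = a $ i0" by simp
  then show ?thesis by (simp add: distrib_right sum.distrib mult.assoc flip: sum_distrib_left)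
qed

context rank_two_matrix
begin

lemma det3_linear: "det3 (x + y) a b c = det3 x a b c + det3 y a b c" "det3 (h *s x) a b c = h * det3 x a b c"
  by (simp_all add: det3_def algebra_simps)

lemma cross_linear: "cross (x + y) = cross x + cross y" "cross (h *s x) = h *s cross x"
  by (simp_all add: Finite_Cartesian_Product.vec_eq_iff cross_def det3_linear)

text \<open>The kernel
  contains the multiples of \<open>a\<close> and the vectors \<open>cross z\<close>, where \<open>z\<close> runs over the combinations
  of two constant vectors; these are chosen such that their products \<open>P, Q\<close> with \<open>a\<close> form a regular
  sequence.  A relation then says that \<open>z\<close> annihilates \<open>a\<close>, so that it comes from the Koszul
  relation between \<open>P\<close> and \<open>Q\<close>.\<close>

lemma dim_kernel_ge:
  fixes m :: nat
  assumes sh: "shortest m a" and Aa: "A *v a = 0"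
    and m: "m \<le> e 1 + e 2" and n: "m \<le> n"
  shows "((n + (e 1 + e 2 - m) + 3) choose 3) + 2 * ((n + 3) choose 3)
    \<le> V.dim (section_module (num (kernel_sheaf A)) (n + (e 1 + e 2))) + ((n - m + 3) choose 3)"
proof -
  let ?d = "e 1 + e 2"
  obtain i0 where i0: "a $ i0 \<noteq> 0" using sh by (auto simp: shortest_def Finite_Cartesian_Product.vec_eq_iff)
  note a = sh[unfolded shortest_def, THEN conjunct1] Aa i0
  obtain \<mu> where \<mu>: "\<forall>x. a $ i0 dvd (\<Sum>i\<in>UNIV. const_poly (\<mu> i) * a $ i) * x \<longrightarrow> a $ i0 dvd x"
    using shortest_coprime_pair[OF sh i0] ..
  define u :: "'k poly4 ^ 4" where "u = (\<chi> i. const_poly (\<mu> i))"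
  define Q where "Q = (\<Sum>i\<in>UNIV. u $ i * a $ i)"
  have Q: "a $ i0 dvd x" if "a $ i0 dvd Q * x" for x using \<mu>[rule_format, of x] that by (simp add: Q_def u_def)
  define z :: "'k poly4 ^ 3 \<Rightarrow> 'k poly4 ^ 4" where "z v = v $ 2 *s axis i0 1 + v $ 3 *s u" for v
  define \<Psi> where "\<Psi> v = v $ 1 *s a + cross (z v)" for v
  let ?e = "\<lambda>i :: 3. if i = 1 then ?d - m else 0"
  let ?S = "gr ?e n :: ('k poly4 ^ 3) set" and ?W = "{w \<in> gr ?e n. \<Psi> w = 0}"
  have z_linear: "z (x + y) = z x + z y" "z (vscale c x) = const_poly c *s z x" for x y c
    by (simp_all add: z_def vec.scale_left_distrib vec.scale_right_distrib vector_smult_assoc)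
  have lin: "Vector_Spaces.linear vscale vscale \<Psi>"
  proof unfold_locales
    fix x y :: "'k poly4 ^ 3" and c :: 'k
    show "\<Psi> (x + y) = \<Psi> x + \<Psi> y"
      by (simp add: \<Psi>_def z_linear cross_linear vec.scale_left_distrib)
    show "\<Psi> (vscale c x) = vscale c (\<Psi> x)"
      by (simp add: \<Psi>_def z_linear(2)[unfolded vscale_def] cross_linear vscale_def vec.scale_right_distrib vector_smult_assoc)
  qed
  have "\<Psi> v \<in> section_module (num (kernel_sheaf A)) (n + ?d)" if v: "v \<in> ?S" for v
  proof -
    have v1: "homogeneous (n + (?d - m)) (v $ 1)" and v2: "homogeneous n (v $ 2)" and v3: "homogeneous n (v $ 3)"
      using gr_nth[OF v, of 1] gr_nth[OF v, of 2] gr_nth[OF v, of 3] by simp_all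
    have "v $ 1 *s a \<in> gr (\<lambda>_. 0) (m + (n + (?d - m)))" by (rule gr_mult[OF v1 a(1)])
    moreover have "m + (n + (?d - m)) = n + ?d" using m by simp
    moreover have "homogeneous (n + 0) (v $ 2 * axis i0 1 $ i)" "homogeneous (n + 0) (v $ 3 * u $ i)" for i
      by (intro homogeneous_mult v2 v3; simp add: axis_def u_def)+
    then have "z v \<in> gr (\<lambda>_. 0) n" by (simp add: gr_def z_def homogeneous_add)
    then have "cross (z v) \<in> gr (\<lambda>_. 0) (n + ?d)" by (rule cross_gr)
    ultimately have "\<Psi> v \<in> gr (\<lambda>_. 0) (n + ?d)" unfolding \<Psi>_def by (metis gr_add)
    moreover have "A *v \<Psi> v = 0"
      by (simp add: \<Psi>_def matrix_vector_right_distrib matrix_vector_smult a(2) cross_kernel)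
    ultimately show ?thesis by (simp add: section_module_kernel)
  qed
  then have "\<Psi> ` ?S \<subseteq> section_module (num (kernel_sheaf A)) (n + ?d)" by blast
  moreover have "graded_submodule (\<lambda>_. 0) (section_module (num (kernel_sheaf A)))"
    by (rule graded_submodule_section_module) (simp add: kernel_sheaf_def O_submodule_kernel)
  ultimately have le1: "V.dim (\<Psi> ` ?S) \<le> V.dim (section_module (num (kernel_sheaf A)) (n + ?d))"
    by (intro V.dim_mono' finite_dim_graded_submodule)
  \<comment> \<open>a relation makes \<open>cross (z v)\<close> a multiple of \<open>a\<close>\<close>
  have rel: "v $ 2 * a $ i0 + v $ 3 * Q = 0" if "\<Psi> v = 0" for v
  proof -
    have "(\<Psi> v) $ i = 0" for i using that by simp
    then have "cross (z v) $ i = - (v $ 1 * a $ i)" for i by (simp add: \<Psi>_def add_eq_0_iff)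
    then have "(\<Sum>i\<in>UNIV. z v $ i * a $ i) = 0" by (intro cross_parallel[OF a(2)]) simp
    then show ?thesis unfolding z_def sum_axis_const Q_def .
  qed
  \<comment> \<open>relations embed by their last coordinate into the multiples of \<open>a $ i0\<close>\<close>
  let ?\<tau> = "\<lambda>v :: 'k poly4 ^ 3. (\<chi> i. v $ 3) :: 'k poly4 ^ 1"
  have \<tau>: "Vector_Spaces.linear vscale vscale ?\<tau>"
    by unfold_locales (simp_all add: Finite_Cartesian_Product.vec_eq_iff)
  have W: "V.subspace ?W"
    using lin unfolding V.subspace_def
    by (auto simp: VV.linear_0[OF lin] VV.linear_add[OF lin] VV.linear_scale[OF lin]
        V.subspace_0[OF subspace_gr] V.subspace_add[OF subspace_gr] V.subspace_scale[OF subspace_gr])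
  have Wfin: "finite_dim vscale ?W" by (rule V.fin_dim_subset[OF dim_gr(1)]) blast
  have ker: "{w \<in> ?W. ?\<tau> w = 0} = {0}"
  proof (intro subset_antisym subsetI)
    fix w assume w: "w \<in> {w \<in> ?W. ?\<tau> w = 0}"
    then have w3: "w $ 3 = 0" by (simp add: Finite_Cartesian_Product.vec_eq_iff)
    then have w2: "w $ 2 = 0" using rel[of w] w a(3) by simp
    have "cross (z w) = 0 *s cross 0" unfolding cross_linear(2)[symmetric] by (simp add: z_def w2 w3)
    then have "w $ 1 *s a = 0" using w by (simp add: \<Psi>_def)
    then have "w $ 1 = 0" using a(3) by (auto simp: Finite_Cartesian_Product.vec_eq_iff)
    then show "w \<in> {0}" using w2 w3 by (simp add: Finite_Cartesian_Product.vec_eq_iff forall_3)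
  next
    fix w :: "'k poly4 ^ 3" assume "w \<in> {0}"
    moreover have "?\<tau> 0 = 0" by (simp add: Finite_Cartesian_Product.vec_eq_iff)
    ultimately show "w \<in> {w \<in> ?W. ?\<tau> w = 0}" using V.subspace_0[OF W] by simp
  qed
  have "V.dim ({0} :: ('k poly4 ^ 3) set) = 0" using V.dim_le_card[of "{0 :: 'k poly4 ^ 3}" "{}"] by simp
  then have "V.dim ?W = V.dim (?\<tau> ` ?W)" using VV.dim_image_eq'(1)[OF \<tau> W Wfin] unfolding ker by simp
  also have "\<dots> \<le> (n - m + 3) choose 3"
  proof (rule graded_dim_le_multiples[where a = "\<chi> i. a $ i0"])
    fix y assume "y \<in> ?\<tau> ` ?W"
    then obtain w where w: "w \<in> ?W" "y = ?\<tau> w" by blast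
    have "Q * w $ 3 = a $ i0 * (- w $ 2)" using rel[of w] w(1) by (simp add: mult.commute eq_neg_iff_add_eq_0 add.commute)
    then have "a $ i0 dvd Q * w $ 3" by (rule dvdI)
    then have "a $ i0 dvd w $ 3" by (rule Q)
    then obtain g where g: "w $ 3 = a $ i0 * g" by (rule dvdE)
    have hom: "homogeneous n (w $ 3)" using gr_nth[of w ?e n 3] w(1) by simp
    have a0: "homogeneous m (a $ i0)" using a(1) by (simp add: gr_def)
    have "\<exists>g. homogeneous (n - m) g \<and> w $ 3 = a $ i0 * g"
    proof (cases "w $ 3 = 0")
      case True then show ?thesis by (intro exI[of _ 0]) simp
    next
      case False
      then obtain x y where "homogeneous x (a $ i0)" "homogeneous y g" "n = x + y"
        using homogeneous_factors hom g by metis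
      moreover from this have "x = m" using homogeneous_unique a0 a(3) by blast
      ultimately show ?thesis using g by (intro exI[of _ g]) simp
    qed
    then obtain g where "homogeneous (n - m) g" "w $ 3 = a $ i0 * g" by blast
    then show "\<exists>f. homogeneous (n - m) f \<and> y = f *s (\<chi> i. a $ i0)"
      using w(2) by (intro exI[of _ g]) (simp add: Finite_Cartesian_Product.vec_eq_iff mult.commute)
  qed
  finally have le2: "V.dim ?W \<le> (n - m + 3) choose 3" .
  have "V.dim ?S = V.dim (\<Psi> ` ?S) + V.dim ?W" by (rule VV.dim_image_eq'(1)[OF lin subspace_gr dim_gr(1)])
  moreover have "V.dim ?S = ((n + (?d - m) + 3) choose 3) + 2 * ((n + 3) choose 3)"
  proof -
    have "(2::3) \<noteq> 1" "(3::3) \<noteq> 1" by simp_all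
    then show ?thesis unfolding dim_gr(2) sum_3 by (simp only: if_True if_False mult_2 add_0_right add.assoc refl)
  qed
  ultimately show ?thesis using le1 le2 by linarith
qed

text \<open>The cokernel has Hilbert polynomial of degree at most \<open>1\<close> when \<open>c1\<close> vanishes, which fixes the two upper
  coefficients for the kernel.\<close>

lemma coeff_hilbert_poly_kernel:
  assumes c1: "c1 (coker_sheaf e A) = 0"
  shows "coeff (hilbert_poly (kernel_sheaf A)) 3 = 1 / 3"
    "coeff (hilbert_poly (kernel_sheaf A)) 2 = 2 - of_nat (e 1 + e 2) / 2"
    "coeff (hilbert_poly (coker_sheaf e A)) 1 = 11 / 3 * (- 1) + 2 * of_nat (e 1 + e 2)
       + (of_nat (e 1) ^ 2 + of_nat (e 2) ^ 2) / 2 + coeff (hilbert_poly (kernel_sheaf A)) 1"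
    "i > 3 \<Longrightarrow> coeff (hilbert_poly (kernel_sheaf A)) i = 0"
proof -
  let ?Q = "hilbert_poly (coker_sheaf e A)" and ?T = "hilbert_poly (kernel_sheaf A)"
  have co: "coeff ?Q i = coeff (binom_poly (of_nat (e 1))) i + coeff (binom_poly (of_nat (e 2))) i
      - 4 * coeff (binom_poly 0) i + coeff ?T i" for i
    unfolding hilbert_poly_coker(2) by simp
  have "coeff ?Q 3 = 0" by (intro coeff_eq_0 le_less_trans[OF degree_hilbert_poly_coker]) simp
  then show "coeff ?T 3 = 1 / 3" unfolding co coeff_binom_poly by simp
  have "coeff ?Q 2 = 0" using c1 by (simp add: c1_def rk_coker_sheaf)
  then show "coeff ?T 2 = 2 - of_nat (e 1 + e 2) / 2" unfolding co coeff_binom_poly by (simp add: field_simps)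
  show "coeff ?Q 1 = 11 / 3 * (- 1) + 2 * of_nat (e 1 + e 2)
       + (of_nat (e 1) ^ 2 + of_nat (e 2) ^ 2) / 2 + coeff ?T 1"
    unfolding co coeff_binom_poly by (simp add: field_simps)
  show "coeff ?T i = 0" if "i > 3"
  proof -
    have "coeff (binom_poly c) i = 0" for c using that coeff_binom_poly(4)[of c] by (intro coeff_eq_0) simp
    moreover have "coeff ?Q i = 0" using that degree_hilbert_poly_coker by (intro coeff_eq_0) simp
    ultimately show ?thesis using co[of i] by simp
  qed
qed

lemma slope_kernel_sheaf:
  assumes "c1 (coker_sheaf e A) = 0"
  shows "slope (kernel_sheaf A) = - (of_nat (e 1 + e 2) / 2)"
  using coeff_hilbert_poly_kernel(2)[OF assms] by (simp add: slope_def c1_def rk_kernel_sheaf)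

text \<open>The lower bound of \<open>dim_kernel_ge\<close> has the same two upper coefficients as the Hilbert polynomial of the
  kernel, so the linear coefficients compare.\<close>

theorem deg1_coker_ge:
  fixes m :: nat
  assumes c1: "c1 (coker_sheaf e A) = 0"
    and a: "shortest m a" "A *v a = 0"
    and m: "m \<le> e 1 + e 2"
  shows "(of_nat (e 1) ^ 2 + of_nat (e 2) ^ 2) / 2 + of_nat (e 1 + e 2) ^ 2 / 2 - of_nat (e 1 + e 2) * of_nat m
    \<le> deg1 (coker_sheaf e A)"
proof -
  let ?d = "e 1 + e 2"
  let ?T = "hilbert_poly (kernel_sheaf A)"
  define L where "L = binom_poly (- of_nat m) + smult 2 (binom_poly (- of_nat ?d)) - binom_poly (- of_nat (?d + m))"
  have B: "O_submodule (num (kernel_sheaf A))" unfolding kernel_sheaf_def using O_submodule_kernel[of A] by simp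
  have den: "den (kernel_sheaf A) \<pp> = {0}" for \<pp> by (simp add: kernel_sheaf_def)
  have ge: "\<forall>\<^sub>F t in sequentially. 0 \<le> poly (?T - L) (of_nat t)"
    using hilbert_poly_subsheaf[OF B den] eventually_ge_at_top[of "?d + m"]
  proof eventually_elim
    case (elim t)
    define n where "n = t - ?d"
    have t: "n + ?d = t" "m \<le> n" "n + (?d - m) = t - m" "n - m = t - (?d + m)" using elim(2) m by (auto simp: n_def)
    have le: "((t - m + 3) choose 3) + 2 * ((t - ?d + 3) choose 3)
        \<le> V.dim (section_module (num (kernel_sheaf A)) t) + ((t - (?d + m) + 3) choose 3)"
      using dim_kernel_ge[OF a m t(2)] unfolding t unfolding n_def by blast
    have "m \<le> t" "?d \<le> t" using elim(2) by auto
    note ch = of_nat_choose_3_diff[OF this(1)] of_nat_choose_3_diff[OF this(2)] of_nat_choose_3_diff[OF elim(2)]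
    from le have "of_nat ((t - m + 3) choose 3) + 2 * of_nat ((t - ?d + 3) choose 3)
        \<le> (of_nat (V.dim (section_module (num (kernel_sheaf A)) t)) + of_nat ((t - (?d + m) + 3) choose 3) :: rat)"
      by (metis (no_types, lifting) of_nat_add of_nat_le_iff of_nat_mult of_nat_numeral)
    then have "poly (binom_poly (- of_nat m)) (of_nat t) + 2 * poly (binom_poly (- of_nat ?d)) (of_nat t)
        \<le> poly ?T (of_nat t) + poly (binom_poly (- of_nat (?d + m))) (of_nat t)"
      unfolding ch elim(1) .
    then show ?case unfolding L_def by simp
  qed
  have L: "coeff L i = coeff (binom_poly (- of_nat m)) i + 2 * coeff (binom_poly (- of_nat ?d)) i
     - coeff (binom_poly (- of_nat (?d + m))) i" for i by (simp add: L_def)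
  have deg: "degree (?T - L) \<le> 1"
  proof (rule degree_le, intro allI impI)
    fix i :: nat assume "1 < i"
    then consider "i = 2" | "i = 3" | "i > 3" by linarith
    then show "coeff (?T - L) i = 0"
    proof cases
      case 1
      then show ?thesis unfolding coeff_diff L 1 coeff_hilbert_poly_kernel(2)[OF c1] coeff_binom_poly by (simp add: field_simps)
    next
      case 2
      then show ?thesis unfolding coeff_diff L 2 coeff_hilbert_poly_kernel(1)[OF c1] coeff_binom_poly by simp
    next
      case 3
      then have "coeff (binom_poly c) i = 0" for c using coeff_binom_poly(4)[of c] by (intro coeff_eq_0) simp
      then show ?thesis unfolding coeff_diff L coeff_hilbert_poly_kernel(4)[OF c1 3] by simp
    qed
  qed
  have "0 \<le> coeff (?T - L) 1" by (rule poly_squeeze(2)[OF ge _ deg]) simp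
  then show ?thesis
    unfolding deg1_def coeff_hilbert_poly_kernel(3)[OF c1] coeff_diff L coeff_binom_poly
    by (simp add: power2_eq_square field_simps)
qed

end

section \<open>Slopes of rank one subsheaves of the kernel\<close>

lemma parallel_sym: "parallel a v \<Longrightarrow> parallel v a"
  unfolding parallel_def by (metis mult.commute)

lemma parallel_trans:
  fixes a x y :: "'k::field poly4 ^ 'r"
  assumes a: "a \<noteq> 0" and x: "parallel x a" and y: "parallel a y"
  shows "parallel x y"
proof -
  obtain l where l: "a $ l \<noteq> 0" using a by (auto simp: Finite_Cartesian_Product.vec_eq_iff)
  have "x $ i * y $ j = x $ j * y $ i" for i j
  proof -
    have xl: "x $ r * a $ l = x $ l * a $ r" for r using x by (simp add: parallel_def)
    have yl: "a $ l * y $ r = a $ r * y $ l" for r using y by (simp add: parallel_def)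
    have "(a $ l * a $ l) * (x $ i * y $ j) = (x $ i * a $ l) * (a $ l * y $ j)" by (simp only: ac_simps)
    also have "\<dots> = (x $ l * a $ i) * (a $ j * y $ l)" by (simp only: xl[of i] yl[of j])
    also have "\<dots> = (x $ l * a $ j) * (a $ i * y $ l)" by (simp only: ac_simps)
    also have "\<dots> = (x $ j * a $ l) * (a $ l * y $ i)" by (simp only: xl[of j] yl[of i])
    also have "\<dots> = (a $ l * a $ l) * (x $ j * y $ i)" by (simp only: ac_simps)
    finally show ?thesis using l by simp
  qed
  then show ?thesis by (simp add: parallel_def)
qed

lemma parallel_kernel:
  fixes A :: "'k::field poly4 ^ 'n::finite ^ 'm"
  assumes "A *v u = 0" "u \<noteq> 0" "parallel a u"
  shows "A *v a = 0"
proof -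
  obtain l where l: "u $ l \<noteq> 0" using assms(2) by (auto simp: Finite_Cartesian_Product.vec_eq_iff)
  have "u $ l *s a = a $ l *s u"
    using assms(3) by (simp add: parallel_def Finite_Cartesian_Product.vec_eq_iff mult.commute)
  then have "u $ l *s (A *v a) = a $ l *s (A *v u)" unfolding matrix_vector_smult[symmetric] by simp
  then show ?thesis using assms(1) l by (simp add: Finite_Cartesian_Product.vec_eq_iff)
qed

lemma ex_shortest_parallel:
  fixes u :: "'k::field poly4 ^ 'r"
  assumes u: "u \<in> gr (\<lambda>_. 0) n" "u \<noteq> 0"
  shows "\<exists>m a. shortest m a \<and> parallel a u \<and> m \<le> n"
proof -
  define P where "P m \<longleftrightarrow> (\<exists>a\<in>gr (\<lambda>_. 0) m. a \<noteq> 0 \<and> parallel a u)" for m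
  have Pn: "P n" unfolding P_def by (intro bexI[of _ u] conjI u) (simp add: parallel_def mult.commute)
  define m where "m = (LEAST m. P m)"
  have "P m" unfolding m_def by (rule LeastI[where P = P, OF Pn])
  then obtain a where a: "a \<in> gr (\<lambda>_. 0) m" "a \<noteq> 0" "parallel a u" unfolding P_def by blast
  have "b = 0" if l: "l < m" "b \<in> gr (\<lambda>_. 0) l" "parallel a b" for l b
  proof (rule ccontr)
    assume "b \<noteq> 0"
    moreover have "parallel b u" by (rule parallel_trans[OF a(2) parallel_sym[OF l(3)] a(3)])
    ultimately have "P l" unfolding P_def using l(2) by blast
    then have "m \<le> l" unfolding m_def by (rule Least_le)
    then show False using l(1) by simp
  qed
  then have "shortest m a" using a by (auto simp: shortest_def)
  moreover have "m \<le> n" unfolding m_def by (rule Least_le[where P = P, OF Pn])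
  ultimately show ?thesis using a(3) by blast
qed

lemma shortest_multiple:
  fixes a v :: "'k::field_char_0 poly4 ^ 'r::finite"
  assumes a: "shortest m a" and v: "v \<in> gr (\<lambda>_. 0) t" "parallel a v" and "m \<le> t"
  shows "\<exists>f. homogeneous (t - m) f \<and> v = f *s a"
proof -
  obtain i0 where i0: "a $ i0 \<noteq> 0" using a by (auto simp: shortest_def Finite_Cartesian_Product.vec_eq_iff)
  have agr: "a \<in> gr (\<lambda>_. 0) m" using a by (simp add: shortest_def)
  obtain \<mu> where \<mu>: "\<forall>x. a $ i0 dvd (\<Sum>i\<in>UNIV. const_poly (\<mu> i) * a $ i) * x \<longrightarrow> a $ i0 dvd x"
    using shortest_coprime_pair[OF a i0] ..
  obtain f where f: "v = f *s a"
    using parallel_imp_multiple[OF i0 \<mu>[rule_format] v(2)] ..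
  show ?thesis
  proof (cases "f = 0")
    case True then show ?thesis using f by (intro exI[of _ 0]) simp
  next
    case False
    then obtain n where "homogeneous n f" "t = n + m"
      using homogeneous_scalar_of_multiple[OF agr i0, of f t] v(1) f by blast
    then show ?thesis using f by (intro exI[of _ f]) simp
  qed
qed

context rank_two_matrix
begin

text \<open>A nonzero section \<open>u\<close> of a twist of \<open>K\<close> is proportional to a shortest vector \<open>a\<close>.  All sections are
  multiples of \<open>a\<close>, and the multiples of \<open>u\<close> are sections, so the Hilbert polynomial of \<open>K\<close> lies between
  those of two line bundles.\<close>

lemma slope_rank_one_subsheaf_le:
  assumes K: "coherent_subsheaf K (kernel_sheaf A)" and rk: "0 < rk K" "rk K < 2"
  shows "\<exists>m a. shortest m a \<and> A *v a = 0 \<and> slope K \<le> - of_nat m"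
proof -
  let ?B = "num K"
  have coh: "coherent ?B" and den: "\<And>\<pp>. \<pp> \<in> Proj \<Longrightarrow> den K \<pp> = {0}"
    and sub: "\<And>\<pp>. \<pp> \<in> Proj \<Longrightarrow> ?B \<pp> \<subseteq> {v \<in> sum_O (\<lambda>_. 0) \<pp>. frac_map A v = 0}"
    using K by (auto simp: coherent_subsheaf_def kernel_sheaf_def)
  have B: "O_submodule ?B"
    unfolding O_submodule_def using coherent_closed[OF coh] sub by blast
  obtain g where g: "g \<in> ?B {0}" "g \<noteq> 0" and gen: "\<And>w. w \<in> ?B {0} \<Longrightarrow> \<exists>c. w = c *s g"
    using rank_one_subsheaf(2)[OF K rk] by blast
  obtain n b u where b: "b \<noteq> 0" and u: "to_fract b *s g = to_fract_vec u" "u \<in> section_module ?B n"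
    using coherent_generic_section[OF coh B g(1)] by blast
  have u0: "u \<noteq> 0"
  proof
    assume "u = 0"
    then have "to_fract b *s g = 0" using u(1) by (simp add: to_fract_vec_simps(4))
    then show False using g(2) b by simp
  qed
  have ugr: "u \<in> gr (\<lambda>_. 0) n" using section_module_subset_gr[OF B] u(2) by blast
  have "frac_map A g = 0" using sub[OF zero_in_Proj] g(1) by blast
  then have "to_fract_vec (A *v u) = to_fract_vec 0"
    unfolding frac_map_simps(5)[symmetric] u(1)[symmetric] frac_map_simps(2) by (simp add: to_fract_vec_simps(4))
  then have Au: "A *v u = 0" unfolding to_fract_vec_simps(5) .
  obtain m a where a: "shortest m a" "parallel a u" "m \<le> n" using ex_shortest_parallel[OF ugr u0] by blast
  have Aa: "A *v a = 0" by (rule parallel_kernel[OF Au u0 a(2)])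
  have par: "parallel a w" if w: "w \<in> section_module ?B t" for w t
  proof -
    obtain c v where "to_fract_vec w = c *s v" "v \<in> ?B {0}"
      using w zero_in_Proj unfolding section_module_def twist_stalks_def by blast
    moreover obtain c' where "v = c' *s g" using gen calculation(2) by blast
    ultimately have w': "to_fract_vec w = (c * c') *s g" by (simp add: vector_smult_assoc)
    have "u $ i * w $ j = u $ j * w $ i" for i j
    proof -
      have "to_fract (u $ r) = to_fract b * g $ r" "to_fract (w $ r) = c * c' * g $ r" for r
        using arg_cong[OF u(1), of "\<lambda>x. x $ r"] arg_cong[OF w', of "\<lambda>x. x $ r"] by simp_all
      then have "to_fract (u $ i * w $ j) = to_fract (u $ j * w $ i)" by (simp only: to_fract_mult ac_simps)
      then show ?thesis by (simp only: to_fract_eq_iff)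
    qed
    then show ?thesis by (intro parallel_trans[OF u0 a(2)]) (simp add: parallel_def)
  qed
  let ?H = "hilbert_poly K"
  define M where "M = binom_poly (- of_nat m)"
  define R where "R = M - binom_poly (- of_nat n)"
  have dim: "V.dim (section_module ?B t) \<le> (t - m + 3) choose 3" if "m \<le> t" for t
  proof (rule graded_dim_le_multiples)
    fix v assume v: "v \<in> section_module ?B t"
    then have "v \<in> gr (\<lambda>_. 0) t" using section_module_subset_gr[OF B] by blast
    then show "\<exists>f. homogeneous (t - m) f \<and> v = f *s a" by (rule shortest_multiple[OF a(1) _ par[OF v] that])
  qed
  have dim': "(t - n + 3) choose 3 \<le> V.dim (section_module ?B t)" if "n \<le> t" for t
  proof (rule graded_dim_multiples[OF ugr u0 graded_submodule_section_module[OF B] that])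
    fix f :: "'k poly4" assume "homogeneous (t - n) f"
    from graded_submodule_mult[OF graded_submodule_section_module[OF B] this u(2)]
    show "f *s u \<in> section_module ?B t" using that by simp
  qed
  have ev: "\<forall>\<^sub>F t in sequentially. of_nat (V.dim (section_module ?B t)) = poly ?H (of_nat t)"
    by (rule hilbert_poly_subsheaf[OF B]) (rule den)
  have lo: "\<forall>\<^sub>F t in sequentially. 0 \<le> poly (M - ?H) (of_nat t)"
    using ev eventually_ge_at_top[of n]
  proof eventually_elim
    case (elim t)
    then have mt: "m \<le> t" using a(3) by simp
    have "(of_nat (V.dim (section_module ?B t)) :: rat) \<le> of_nat ((t - m + 3) choose 3)"
      unfolding of_nat_le_iff by (rule dim[OF mt])
    then show ?case unfolding elim(1) of_nat_choose_3_diff[OF mt] by (simp add: M_def)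
  qed
  have hi: "\<forall>\<^sub>F t in sequentially. poly (M - ?H) (of_nat t) \<le> poly R (of_nat t)"
    using ev eventually_ge_at_top[of n]
  proof eventually_elim
    case (elim t)
    have "of_nat ((t - n + 3) choose 3) \<le> (of_nat (V.dim (section_module ?B t)) :: rat)"
      unfolding of_nat_le_iff by (rule dim'[OF elim(2)])
    then show ?case unfolding elim(1) of_nat_choose_3_diff[OF elim(2)] by (simp add: R_def)
  qed
  have "degree R \<le> 2"
  proof (rule degree_le, intro allI impI)
    fix i :: nat assume "2 < i"
    then consider "i = 3" | "i > 3" by linarith
    then show "coeff R i = 0"
    proof cases
      case 1
      then show ?thesis by (simp add: R_def M_def coeff_binom_poly)
    next
      case 2
      then have "coeff (binom_poly c) i = 0" for c using coeff_binom_poly(4)[of c] by (intro coeff_eq_0) simp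
      then show ?thesis by (simp add: R_def M_def)
    qed
  qed
  from poly_squeeze(2)[OF lo hi this] have "coeff ?H 2 \<le> 1 - of_nat m / 2"
    by (simp add: M_def coeff_binom_poly)
  then have "slope K \<le> - of_nat m"
    using rank_one_subsheaf(1)[OF K rk] by (simp add: slope_def c1_def)
  then show ?thesis using a(1) Aa by blast
qed

text \<open>A subsheaf of slope at least \<open>x\<close> yields a kernel vector of degree at most \<open>- x\<close>, hence
  a lower bound for the degree of the cokernel.\<close>

lemma deg1_ge_of_slope:
  assumes c1: "c1 (coker_sheaf e A) = 0"
    and K: "coherent_subsheaf K (kernel_sheaf A)" and rk: "0 < rk K" "rk K < rk (kernel_sheaf A)"
    and x: "x \<le> slope K" "- of_nat (e 1 + e 2) \<le> x"
  shows "\<exists>m. of_nat m \<le> - x \<and>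
    (of_nat (e 1) ^ 2 + of_nat (e 2) ^ 2) / 2 + of_nat (e 1 + e 2) ^ 2 / 2 - of_nat (e 1 + e 2) * of_nat m
      \<le> deg1 (coker_sheaf e A)"
proof -
  obtain m a where a: "shortest m a" "A *v a = 0" and m: "slope K \<le> - of_nat m"
    using slope_rank_one_subsheaf_le[OF K rk[unfolded rk_kernel_sheaf]] by blast
  have mx: "of_nat m \<le> - x" using m x(1) by simp
  have "(of_nat m :: rat) \<le> of_nat (e 1 + e 2)" using mx x(2) by linarith
  then have "m \<le> e 1 + e 2" unfolding of_nat_le_iff .
  from deg1_coker_ge[OF c1 a this] mx show ?thesis by blast
qed

end

section \<open>A finite degeneracy locus\<close>

lemma closedin_zariski_specialization:
  assumes C: "closedin (subtopology zariski Z) C" and p: "\<pp> \<in> C" and q: "\<qq> \<in> Proj" "\<qq> \<in> Z" "\<pp> \<subseteq> \<qq>"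
  shows "\<qq> \<in> C"
proof (rule ccontr)
  assume "\<qq> \<notin> C"
  have sp: "topspace (subtopology zariski Z) = Proj \<inter> Z" by (simp add: topspace_zariski)
  have "openin (subtopology zariski Z) (Proj \<inter> Z - C)" and CZ: "C \<subseteq> Proj \<inter> Z"
    using C unfolding closedin_def sp by auto
  then obtain U where U: "openin zariski U" "Proj \<inter> Z - C = U \<inter> Z" unfolding openin_subtopology by blast
  obtain I where I: "U = Proj - vanishing_locus I" using U(1) unfolding openin_zariski by blast
  have "\<pp> \<in> Proj" "\<pp> \<notin> U" using CZ U(2) p by blast+
  then have "I \<subseteq> \<qq>" using I q(3) by (auto simp: vanishing_locus_def)
  then have "\<qq> \<notin> U" using I q(1) by (auto simp: vanishing_locus_def)
  then show False using U(2) q \<open>\<qq> \<notin> C\<close> by blast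
qed

lemma irreducible_closedin_primes_above:
  assumes "\<pp> \<in> Proj" "\<pp> \<in> Z"
  shows "irreducible_closedin (subtopology zariski Z) {\<rr> \<in> Proj \<inter> Z. \<pp> \<subseteq> \<rr>}"
  unfolding irreducible_closedin_def
proof (intro conjI allI impI)
  have "closedin zariski (vanishing_locus \<pp>)"
    unfolding closedin_def topspace_zariski openin_zariski by (auto simp: vanishing_locus_def)
  then have "closedin (subtopology zariski Z) (vanishing_locus \<pp> \<inter> Z)" unfolding closedin_subtopology by blast
  moreover have "vanishing_locus \<pp> \<inter> Z = {\<rr> \<in> Proj \<inter> Z. \<pp> \<subseteq> \<rr>}" by (auto simp: vanishing_locus_def)
  ultimately show "closedin (subtopology zariski Z) {\<rr> \<in> Proj \<inter> Z. \<pp> \<subseteq> \<rr>}" by simp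
  show "{\<rr> \<in> Proj \<inter> Z. \<pp> \<subseteq> \<rr>} \<noteq> {}" using assms by blast
  fix C D
  assume *: "closedin (subtopology zariski Z) C \<and> closedin (subtopology zariski Z) D \<and> {\<rr> \<in> Proj \<inter> Z. \<pp> \<subseteq> \<rr>} \<subseteq> C \<union> D"
  then have "\<pp> \<in> C \<or> \<pp> \<in> D" using assms by blast
  then show "{\<rr> \<in> Proj \<inter> Z. \<pp> \<subseteq> \<rr>} \<subseteq> C \<or> {\<rr> \<in> Proj \<inter> Z. \<pp> \<subseteq> \<rr>} \<subseteq> D"
    using closedin_zariski_specialization[of Z] * by blast
qed

text \<open>The closures of \<open>\<pp>\<close> and \<open>\<qq>\<close> in \<open>Z\<close> form a chain of irreducible closed sets.\<close>

lemma krull_dimension_0_maximal: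
  assumes dim: "has_krull_dimension (subtopology zariski Z) 0"
    and "\<pp> \<in> Proj \<inter> Z" "\<qq> \<in> Proj \<inter> Z" "\<qq> \<subseteq> \<pp>"
  shows "\<qq> = \<pp>"
proof (rule ccontr)
  assume "\<qq> \<noteq> \<pp>"
  define C where "C i = (if i = 0 then {\<rr> \<in> Proj \<inter> Z. \<pp> \<subseteq> \<rr>} else {\<rr> \<in> Proj \<inter> Z. \<qq> \<subseteq> \<rr>})" for i :: nat
  have "\<forall>i\<le>1. irreducible_closedin (subtopology zariski Z) (C i)"
    using irreducible_closedin_primes_above[of _ Z] assms(2,3) by (simp add: C_def)
  moreover have "\<forall>i<1. C i \<subset> C (Suc i)" using assms \<open>\<qq> \<noteq> \<pp>\<close> by (auto simp: C_def)
  ultimately have "1 \<le> (0::nat)" using dim unfolding has_krull_dimension_def Let_def by blast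
  then show False by simp
qed

text \<open>If \<open>lin \<alpha>\<close> is no zero divisor modulo the ideal of a closed set \<open>Z\<close> up to saturation, then a
  point of \<open>Z\<close> on the plane \<open>lin \<alpha> = 0\<close> is a proper specialization of another point of \<open>Z\<close>.  In
  dimension zero all but finitely many of the planes therefore miss \<open>Z\<close>.\<close>

lemma finite_lin_meets_zero_dimensional:
  fixes I :: "'k::field poly4 set"
  assumes dim: "has_krull_dimension (subtopology zariski (vanishing_locus I)) 0"
  shows "finite {\<alpha>. \<exists>\<pp>\<in>vanishing_locus I. lin \<alpha> \<in> \<pp>}"
proof -
  let ?Z = "vanishing_locus I"
  define N :: "nat \<Rightarrow> ('k poly4 ^ 1) set" where "N n = {v \<in> gr (\<lambda>_. 0) n. \<forall>\<pp>\<in>?Z. v $ 1 \<in> \<pp>}" for n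
  have ZP: "?Z \<subseteq> Proj" by (auto simp: vanishing_locus_def)
  have id: "homogeneous_ideal \<pp>" if "\<pp> \<in> ?Z" for \<pp> using that ZP Proj_homogeneous_ideal by blast
  have N: "graded_submodule (\<lambda>_. 0) N"
    unfolding graded_submodule_def
  proof (intro allI conjI ballI)
    fix n
    show "V.subspace (N n)"
      unfolding V.subspace_def N_def
      by (auto intro!: homogeneous_idealD(1,2)[OF id] homogeneous_idealD(3)[OF id]
        V.subspace_add[OF subspace_gr] V.subspace_scale[OF subspace_gr])
    show "N n \<subseteq> gr (\<lambda>_. 0) n" by (auto simp: N_def)
    fix v i assume v: "v \<in> N n"
    then have "var i *s v \<in> gr (\<lambda>_. 0) (n + 1)" by (intro gr_mult) (simp_all add: N_def)
    then show "var i *s v \<in> N (Suc n)" using v by (auto simp: N_def intro!: homogeneous_idealD(3)[OF id])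
  qed
  define Bad where "Bad = {\<alpha>. \<exists>n. \<exists>v\<in>gr (\<lambda>_. 0) n. lin \<alpha> *s v \<in> sat (\<lambda>_. 0) N (Suc n) \<and> v \<notin> sat (\<lambda>_. 0) N n}"
  have "finite Bad" unfolding Bad_def by (rule finite_lin_zero_divisors[OF N])
  moreover have "{\<alpha>. \<exists>\<pp>\<in>?Z. lin \<alpha> \<in> \<pp>} \<subseteq> Bad"
  proof (rule subsetI, rule ccontr)
    fix \<alpha> assume "\<alpha> \<in> {\<alpha>. \<exists>\<pp>\<in>?Z. lin \<alpha> \<in> \<pp>}" and good: "\<alpha> \<notin> Bad"
    then obtain \<pp> where p: "\<pp> \<in> ?Z" "lin \<alpha> \<in> \<pp>" by blast
    have pP: "\<pp> \<in> Proj" using p ZP by blast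
    define J where "J = \<Inter>?Z"
    have J: "homogeneous_ideal J"
      unfolding homogeneous_ideal_def J_def by (auto intro: homogeneous_idealD[OF id])
    \<comment> \<open>a prime between \<open>J\<close> and \<open>\<pp>\<close> avoiding \<open>S\<close> does not contain \<open>lin \<alpha>\<close>\<close>
    define S where "S = {lin \<alpha> ^ n * s | n s. s \<notin> \<pp>}"
    \<comment> \<open>powers of \<open>lin \<alpha>\<close> can be cancelled modulo the ideal of \<open>Z\<close>, up to saturation\<close>
    have cancel: "v \<in> sat (\<lambda>_. 0) N m" if "v \<in> gr (\<lambda>_. 0) m" "lin \<alpha> ^ n *s v \<in> N (m + n)" for n m v
      using that
    proof (induction n arbitrary: v m)
      case 0 then show ?case using sat_incl[OF N] by auto
    next
      case (Suc n)
      have "lin \<alpha> *s v \<in> gr (\<lambda>_. 0) (m + Suc 0)" by (rule gr_mult[OF homogeneous_lin Suc.prems(1)])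
      moreover have "lin \<alpha> ^ n *s (lin \<alpha> *s v) \<in> N (m + Suc 0 + n)"
        using Suc.prems(2) by (simp add: vector_smult_assoc mult.commute)
      ultimately have "lin \<alpha> *s v \<in> sat (\<lambda>_. 0) N (m + Suc 0)" by (rule Suc.IH)
      then show ?case using good Suc.prems(1) unfolding Bad_def by auto
    qed
    have "x \<notin> S" if x: "x \<in> J" for x
    proof
      assume "x \<in> S"
      then obtain n s where s: "x = lin \<alpha> ^ n * s" "s \<notin> \<pp>" unfolding S_def by blast
      obtain D where "s = (\<Sum>m\<le>D. homogeneous_part m s)" using sum_homogeneous_parts by blast
      then obtain m where m: "homogeneous_part m s \<notin> \<pp>"
        using homogeneous_ideal_sum[OF id[OF p(1)]] s(2) by metis
      have "homogeneous n (lin \<alpha> ^ n)" using homogeneous_power[OF homogeneous_lin, of n \<alpha>] by simp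
      then have "homogeneous_part (m + n) x = lin \<alpha> ^ n * homogeneous_part m s"
        unfolding s(1) by (simp add: homogeneous_part_mult_homogeneous)
      then have J': "lin \<alpha> ^ n * homogeneous_part m s \<in> J" using homogeneous_idealD(5)[OF J x] by metis
      define v :: "'k poly4 ^ 1" where "v = (\<chi> i. homogeneous_part m s)"
      have v: "v \<in> gr (\<lambda>_. 0) m" by (simp add: v_def gr_def)
      have "lin \<alpha> ^ n *s v \<in> gr (\<lambda>_. 0) (m + n)" by (rule gr_mult[OF \<open>homogeneous n (lin \<alpha> ^ n)\<close> v])
      then have "lin \<alpha> ^ n *s v \<in> N (m + n)" using J' by (simp add: N_def J_def v_def)
      from cancel[OF v this] obtain l where l: "\<And>f. homogeneous l f \<Longrightarrow> f *s v \<in> N (m + l)"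
        unfolding sat_def by blast
      obtain i where i: "var i \<notin> \<pp>" using Proj_var[OF pP] by blast
      have "homogeneous l (var i ^ l :: 'k poly4)" using homogeneous_power[OF homogeneous_var(2), of l i] by simp
      from l[OF this] p(1) have "var i ^ l * homogeneous_part m s \<in> \<pp>" by (simp add: N_def v_def)
      then show False using Proj_mult_iff[OF pP] Proj_power[OF pP i] m by blast
    qed
    then have JS: "J \<inter> S = {}" by blast
    have S1: "s \<in> S" if "s \<notin> \<pp>" for s
      unfolding S_def using that by (intro CollectI exI[of _ 0] exI[of _ s]) simp
    have Smult: "s * t \<in> S" if "s \<in> S" "t \<in> S" for s t
    proof -
      obtain n m s' t' where "s = lin \<alpha> ^ n * s'" "t = lin \<alpha> ^ m * t'" "s' \<notin> \<pp>" "t' \<notin> \<pp>"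
        using \<open>s \<in> S\<close> \<open>t \<in> S\<close> unfolding S_def by blast
      moreover from this have "s' * t' \<notin> \<pp>" using Proj_mult_iff[OF pP] by blast
      ultimately show ?thesis
        unfolding S_def by (intro CollectI exI[of _ "n + m"] exI[of _ "s' * t'"]) (simp add: power_add ac_simps)
    qed
    obtain \<qq> where q: "homogeneous_ideal \<qq>" "J \<subseteq> \<qq>" "\<qq> \<inter> S = {}" "\<And>f g. f * g \<in> \<qq> \<Longrightarrow> f \<in> \<qq> \<or> g \<in> \<qq>"
      using ex_homogeneous_prime[OF J S1[OF Proj_one[OF pP]] Smult JS] by blast
    have "lin \<alpha> \<in> S"
      unfolding S_def using Proj_one[OF pP] by (intro CollectI exI[of _ 1] exI[of _ "1 :: 'k poly4"]) simp
    then have lq: "lin \<alpha> \<notin> \<qq>" using q(3) by blast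
    have "\<qq> \<in> Proj" by (rule Proj_I[OF q(1,4) homogeneous_lin _ lq]) simp_all
    moreover have "I \<subseteq> J" by (auto simp: J_def vanishing_locus_def)
    ultimately have "\<qq> \<in> ?Z" using q(2) by (auto simp: vanishing_locus_def)
    moreover have "\<qq> \<subseteq> \<pp>" using S1 q(3) by blast
    ultimately have "\<qq> = \<pp>" using krull_dimension_0_maximal[OF dim] p(1) ZP by blast
    then show False using lq p(2) by blast
  qed
  ultimately show ?thesis by (rule rev_finite_subset)
qed

context rank_two_matrix
begin

lemma minor_mult_image:
  assumes "w \<in> gr e n"
  shows "minor A a b *s w \<in> matrix_image A (n + (e 1 + e 2))"
proof (cases "minor A a b = 0")
  case True
  then show ?thesis using graded_submoduleD(4)[OF graded_submodule_matrix_image[OF A]] by simp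
next
  case False
  then have "a \<noteq> b" by (auto simp: minor_def)
  then obtain p' q' where "distinct [p', q', a, b]" "UNIV = {p', q', a, b}" using four_indices by blast
  then have "rank_two_matrix e A a b p' q'" by (intro rank_two_matrix.intro A False)
  then show ?thesis using assms by (rule rank_two_matrix.cramer_image)
qed

text \<open>A plane that misses the degeneracy locus cuts the cokernel down to a module of finite length,
  so the Hilbert function of the cokernel is eventually constant.\<close>

lemma deg1_coker_eq_0:
  assumes dim: "has_krull_dimension (subtopology zariski (vanishing_locus {minor A a b | a b. True})) 0"
  shows "deg1 (coker_sheaf e A) = 0"
proof -
  let ?I = "{minor A a b | a b. True}" and ?N = "matrix_image A"
  note N = graded_submodule_matrix_image[OF A]
  let ?Bad = "{\<alpha>. \<exists>n. \<exists>v\<in>gr e n. lin \<alpha> *s v \<in> sat e ?N (Suc n) \<and> v \<notin> sat e ?N n}"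
  have fin: "finite ({\<alpha>. \<exists>\<pp>\<in>vanishing_locus ?I. lin \<alpha> \<in> \<pp>} \<union> ?Bad)"
    using finite_lin_meets_zero_dimensional[OF dim] finite_lin_zero_divisors[OF N] by simp
  obtain \<alpha> where "\<alpha> \<notin> {\<alpha>. \<exists>\<pp>\<in>vanishing_locus ?I. lin \<alpha> \<in> \<pp>} \<union> ?Bad"
    using ex_new_if_finite[OF infinite_UNIV_char_0 fin] ..
  then have miss: "\<And>\<pp>. \<pp> \<in> vanishing_locus ?I \<Longrightarrow> lin \<alpha> \<notin> \<pp>"
    and reg: "\<And>n v. v \<in> gr e n \<Longrightarrow> lin \<alpha> *s v \<in> sat e ?N (Suc n) \<Longrightarrow> v \<in> sat e ?N n" by blast+
  let ?M = "add_lin e \<alpha> ?N"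
  have M: "graded_submodule e ?M" by (rule graded_submodule_add_lin(1)[OF N])
  have "w \<in> sat e ?M m" if w: "w \<in> gr e m" for w m
  proof (rule satI_powers[OF M w])
    fix i :: 4
    have J: "graded_ideal (\<lambda>n. {b. homogeneous n b \<and> b *s w \<in> ?M (m + n)})"
      by (rule graded_ideal_colon[OF A M])
    have "\<exists>K. var i ^ K \<in> {b. homogeneous (1 * K) b \<and> b *s w \<in> ?M (m + 1 * K)}"
    proof (rule graded_nullstellensatz[OF J homogeneous_var(2)])
      fix \<pp> :: "'k poly4 set" assume p: "\<pp> \<in> Proj"
      show "\<exists>n. \<exists>g\<in>{b. homogeneous n b \<and> b *s w \<in> ?M (m + n)}. g \<notin> \<pp>"
      proof (cases "\<pp> \<in> vanishing_locus ?I")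
        case True
        have "lin \<alpha> *s w \<in> ?M (m + Suc 0)" using graded_submodule_add_lin(3)[OF N w] by simp
        then show ?thesis using miss[OF True] homogeneous_lin by blast
      next
        case False
        then obtain a b where ab: "minor A a b \<notin> \<pp>" using p by (auto simp: vanishing_locus_def)
        have "minor A a b *s w \<in> ?M (m + (e 1 + e 2))"
          using minor_mult_image[OF w] graded_submodule_add_lin(2)[OF N] by blast
        then show ?thesis using ab minor_homogeneous by blast
      qed
    qed simp
    then show "\<exists>K. var i ^ K *s w \<in> ?M (m + K)" by auto
  qed
  then have satM: "sat e ?M m = gr e m" for m by (auto simp: sat_def)
  obtain n0 where n0: "\<And>n. n \<ge> n0 \<Longrightarrow> sat e ?M n = ?M n" using sat_eventually[OF M] by blast
  obtain n1 where n1: "\<And>n. n \<ge> n1 \<Longrightarrow> sat e ?N n = ?N n" using sat_eventually[OF N] by blast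
  let ?h = "\<lambda>n. of_nat (V.dim (gr e n :: ('k poly4 ^ 2) set)) - (of_nat (V.dim (?N n)) :: rat)"
  have step: "?h (Suc n) = ?h n" if n: "n \<ge> n0 + n1" for n
  proof -
    have "v \<in> ?N n" if "v \<in> gr e n" "lin \<alpha> *s v \<in> ?N (Suc n)" for v
      using reg[of v n] that n1 n by simp
    then have "V.dim (gr e n :: ('k poly4 ^ 2) set) + V.dim (?N (Suc n)) = V.dim (?M (Suc n)) + V.dim (?N n)"
      by (rule dim_add_lin[OF N])
    moreover have "?M (Suc n) = gr e (Suc n)" using n0[of "Suc n"] satM n by simp
    ultimately have "V.dim (gr e n :: ('k poly4 ^ 2) set) + V.dim (?N (Suc n))
        = V.dim (gr e (Suc n) :: ('k poly4 ^ 2) set) + V.dim (?N n)" by simp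
    then show ?thesis
      using arg_cong[of _ _ "of_nat :: nat \<Rightarrow> rat"] by (fastforce simp: algebra_simps)
  qed
  have const: "?h n = ?h (n0 + n1)" if "n \<ge> n0 + n1" for n
    using that by (induction n rule: dec_induct) (simp_all only: step)
  have "hilbert_poly (coker_sheaf e A) = [:?h (n0 + n1):]"
  proof (rule poly_eq_if_eventually)
    show "\<forall>\<^sub>F n in sequentially. poly (hilbert_poly (coker_sheaf e A)) (of_nat n) = poly [:?h (n0 + n1):] (of_nat n)"
      using hilbert_poly_coker(1) eventually_ge_at_top[of "n0 + n1"]
    proof eventually_elim
      case (elim n)
      show ?case unfolding elim(1) const[OF elim(2)] by simp
    qed
  qed
  then show ?thesis by (simp add: deg1_def)
qed

end

section \<open>The Jacobian matrix of an algebraically independent pair\<close>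

lemma lookup_times_superset:
  fixes f g :: "('n, 'k::comm_ring_1) mpoly"
  assumes "finite S" "Poly_Mapping.keys f \<subseteq> S" "finite T" "Poly_Mapping.keys g \<subseteq> T"
  shows "Poly_Mapping.lookup (f * g) m = (\<Sum>a\<in>S. \<Sum>b\<in>T.
     (if a + b = m then Poly_Mapping.lookup f a * Poly_Mapping.lookup g b else 0))"
proof -
  have "Poly_Mapping.lookup (f * g) m = (\<Sum>a\<in>Poly_Mapping.keys f. \<Sum>b\<in>T.
     (if a + b = m then Poly_Mapping.lookup f a * Poly_Mapping.lookup g b else 0))"
    unfolding lookup_times by (intro sum.cong refl sum.mono_neutral_left assms) (auto simp: in_keys_iff)
  also have "\<dots> = (\<Sum>a\<in>S. \<Sum>b\<in>T. (if a + b = m then Poly_Mapping.lookup f a * Poly_Mapping.lookup g b else 0))"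
    by (intro sum.mono_neutral_left assms) (auto simp: in_keys_iff intro!: sum.neutral)
  finally show ?thesis .
qed

text \<open>The only way to write the sum of two upper bounds as a sum of exponents is the obvious one.\<close>

lemma lookup_mult_top:
  fixes f g :: "('n::{finite,linorder}, 'k::comm_ring_1) mpoly"
  assumes f: "\<And>a. a \<in> Poly_Mapping.keys f \<Longrightarrow> a \<le> M" and g: "\<And>b. b \<in> Poly_Mapping.keys g \<Longrightarrow> b \<le> N"
  shows "Poly_Mapping.lookup (f * g) (M + N) = Poly_Mapping.lookup f M * Poly_Mapping.lookup g N"
proof -
  define S where "S = insert M (Poly_Mapping.keys f)"
  define T where "T = insert N (Poly_Mapping.keys g)"
  have S: "finite S" "M \<in> S" "Poly_Mapping.keys f \<subseteq> S" and T: "finite T" "N \<in> T" "Poly_Mapping.keys g \<subseteq> T"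
    by (auto simp: S_def T_def)
  have eq: "a + b = M + N \<longleftrightarrow> a = M \<and> b = N" if "a \<in> S" "b \<in> T" for a b
  proof -
    have "a \<le> M" "b \<le> N" using that f g by (auto simp: S_def T_def)
    then show ?thesis
      by (metis add_le_cancel_left add_le_cancel_right order_antisym add_mono add_left_cancel add_right_cancel)
  qed
  have "Poly_Mapping.lookup (f * g) (M + N) = (\<Sum>a\<in>S. \<Sum>b\<in>T.
     (if a + b = M + N then Poly_Mapping.lookup f a * Poly_Mapping.lookup g b else 0))"
    by (rule lookup_times_superset[OF S(1,3) T(1,3)])
  also have "\<dots> = (\<Sum>a\<in>S. if a = M then \<Sum>b\<in>T. if b = N then Poly_Mapping.lookup f M * Poly_Mapping.lookup g N else 0 else 0)"
    by (intro sum.cong refl) (simp add: eq cong: if_cong)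
  also have "\<dots> = Poly_Mapping.lookup f M * Poly_Mapping.lookup g N" using S(1,2) T(1,2) by simp
  finally show ?thesis .
qed

text \<open>The logarithmic derivations $x_i \partial_i$ act diagonally on monomials.\<close>

definition log_deriv :: "'n \<Rightarrow> ('n, 'k::comm_ring_1) mpoly \<Rightarrow> ('n, 'k) mpoly" where
  "log_deriv i f = var i * partial_deriv i f"

lemma lookup_log_deriv:
  fixes f :: "('n, 'k::comm_ring_1) mpoly"
  shows "Poly_Mapping.lookup (log_deriv i f) m = of_nat (Poly_Mapping.lookup m i) * Poly_Mapping.lookup f m"
proof -
  have "var i * Poly_Mapping.single (m - Poly_Mapping.single i 1) (of_nat (Poly_Mapping.lookup m i) * c)
      = Poly_Mapping.single m (of_nat (Poly_Mapping.lookup m i) * c)" for m and c :: 'k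
  proof (cases "Poly_Mapping.lookup m i = 0")
    case False
    then have "Poly_Mapping.single i 1 + (m - Poly_Mapping.single i 1) = m"
      by (intro poly_mapping_eqI) (auto simp: lookup_add lookup_minus lookup_single when_def)
    then show ?thesis by (simp add: var_def mult_single)
  qed simp
  then have "log_deriv i f = (\<Sum>m\<in>Poly_Mapping.keys f.
      Poly_Mapping.single m (of_nat (Poly_Mapping.lookup m i) * Poly_Mapping.lookup f m))"
    unfolding log_deriv_def partial_deriv_def sum_distrib_left by simp
  then have "Poly_Mapping.lookup (log_deriv i f) m = (\<Sum>m'\<in>Poly_Mapping.keys f.
      if m' = m then of_nat (Poly_Mapping.lookup m i) * Poly_Mapping.lookup f m else 0)"
    by (auto simp: lookup_sum lookup_single when_def intro!: sum.cong)
  then show ?thesis by (auto simp: in_keys_iff)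
qed

lemma keys_log_deriv: "Poly_Mapping.keys (log_deriv i f) \<subseteq> Poly_Mapping.keys f"
  by (auto simp: in_keys_iff lookup_log_deriv)

lemma log_deriv_diff: "log_deriv i (f - g) = log_deriv i f - log_deriv i g"
  by (rule poly_mapping_eqI) (simp add: lookup_log_deriv lookup_minus right_diff_distrib)

lemma log_deriv_const_mult: "log_deriv i (const_poly c * f) = const_poly c * log_deriv i f"
  by (rule poly_mapping_eqI) (simp add: lookup_log_deriv mult.left_commute)

lemma log_deriv_mult:
  fixes f g :: "('n, 'k::comm_ring_1) mpoly"
  shows "log_deriv i (f * g) = log_deriv i f * g + f * log_deriv i g"
proof (rule poly_mapping_eqI)
  fix m
  let ?S = "Poly_Mapping.keys f" and ?T = "Poly_Mapping.keys g"
  have "of_nat (Poly_Mapping.lookup m i) * (if a + b = m then x else 0)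
      = (if a + b = m then of_nat (Poly_Mapping.lookup a i) * x + of_nat (Poly_Mapping.lookup b i) * x else 0)" for a b and x :: 'k
    by (auto simp: lookup_add algebra_simps)
  then have "Poly_Mapping.lookup (log_deriv i (f * g)) m = (\<Sum>a\<in>?S. \<Sum>b\<in>?T. if a + b = m then
      of_nat (Poly_Mapping.lookup a i) * (Poly_Mapping.lookup f a * Poly_Mapping.lookup g b)
      + of_nat (Poly_Mapping.lookup b i) * (Poly_Mapping.lookup f a * Poly_Mapping.lookup g b) else 0)"
    by (simp add: lookup_log_deriv lookup_times sum_distrib_left)
  also have "\<dots> = (\<Sum>a\<in>?S. \<Sum>b\<in>?T. (if a + b = m then Poly_Mapping.lookup (log_deriv i f) a * Poly_Mapping.lookup g b else 0)
      + (if a + b = m then Poly_Mapping.lookup f a * Poly_Mapping.lookup (log_deriv i g) b else 0))"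
    by (intro sum.cong refl) (simp add: lookup_log_deriv ac_simps)
  also have "\<dots> = Poly_Mapping.lookup (log_deriv i f * g + f * log_deriv i g) m"
    unfolding lookup_add sum.distrib
    by (intro arg_cong2[where f = "(+)"] lookup_times_superset[symmetric]) (simp_all add: keys_log_deriv)
  finally show "Poly_Mapping.lookup (log_deriv i (f * g)) m = Poly_Mapping.lookup (log_deriv i f * g + f * log_deriv i g) m" .
qed

lemma log_deriv_power: "log_deriv i (f ^ Suc n) = of_nat (Suc n) * f ^ n * log_deriv i f"
proof (induction n)
  case (Suc n)
  have "log_deriv i (f ^ Suc (Suc n)) = log_deriv i f * f ^ Suc n + f * log_deriv i (f ^ Suc n)"
    using log_deriv_mult[of i f "f ^ Suc n"] by simp
  then show ?case unfolding Suc.IH by (simp add: algebra_simps)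
qed simp

lemma euler_homogeneous:
  fixes f :: "('n::finite, 'k::comm_ring_1) mpoly"
  assumes "homogeneous n f"
  shows "(\<Sum>i\<in>UNIV. log_deriv i f) = of_nat n * f"
proof (rule poly_mapping_eqI)
  fix m
  have "of_nat n * f = const_poly (of_nat n) * f"
    by (induction n) (simp_all add: const_poly_add algebra_simps)
  then have "Poly_Mapping.lookup (of_nat n * f) m = of_nat n * Poly_Mapping.lookup f m" by simp
  moreover have "Poly_Mapping.lookup (\<Sum>i\<in>UNIV. log_deriv i f) m = of_nat (total_degree m) * Poly_Mapping.lookup f m"
    by (simp add: lookup_sum lookup_log_deriv total_degree_def sum_distrib_right)
  moreover have "total_degree m = n \<or> Poly_Mapping.lookup f m = 0" using assms by (auto simp: homogeneous_iff)
  ultimately show "Poly_Mapping.lookup (\<Sum>i\<in>UNIV. log_deriv i f) m = Poly_Mapping.lookup (of_nat n * f) m" by auto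
qed

text \<open>Two polynomials with the same logarithmic derivatives are proportional: otherwise subtract a
  multiple of the second from the first, so that the leading monomials differ, and compare the
  leading terms of the two products.\<close>

lemma proportional_if_log_deriv:
  fixes F G :: "('n::{finite,linorder}, 'k::field_char_0) mpoly"
  assumes eq: "\<And>i. G * log_deriv i F = F * log_deriv i G" and "G \<noteq> 0"
  shows "\<exists>c. F = const_poly c * G"
proof -
  define lm :: "('n, 'k) mpoly \<Rightarrow> 'n \<Rightarrow>\<^sub>0 nat" where "lm f = Max (Poly_Mapping.keys f)" for f
  have lm: "lm f \<in> Poly_Mapping.keys f" if "f \<noteq> 0" for f
  proof -
    have "Poly_Mapping.keys f \<noteq> {}" using that by simp
    then show ?thesis unfolding lm_def by (intro Max_in) simp_all
  qed
  have le: "a \<le> lm f" if "a \<in> Poly_Mapping.keys f" for a f using that by (simp add: lm_def)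
  have le': "a \<le> lm f" if "a \<in> Poly_Mapping.keys (log_deriv i f)" for a f i
    using that keys_log_deriv[of i f] by (intro le) blast
  define N where "N = lm G"
  have GN: "Poly_Mapping.lookup G N \<noteq> 0" using lm[OF assms(2)] by (simp add: N_def in_keys_iff)
  define c where "c = Poly_Mapping.lookup F N / Poly_Mapping.lookup G N"
  define H where "H = F - const_poly c * G"
  have HN: "Poly_Mapping.lookup H N = 0" using GN by (simp add: H_def c_def lookup_minus)
  have eqH: "G * log_deriv i H = H * log_deriv i G" for i
    unfolding H_def log_deriv_diff log_deriv_const_mult using eq[of i] by (simp add: algebra_simps)
  have "H = 0"
  proof (rule ccontr)
    assume H: "H \<noteq> 0"
    let ?M = "lm H"
    have HM: "Poly_Mapping.lookup H ?M \<noteq> 0" using lm[OF H] by (simp add: in_keys_iff)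
    have "Poly_Mapping.lookup N i = Poly_Mapping.lookup ?M i" for i
    proof -
      have "Poly_Mapping.lookup (G * log_deriv i H) (N + ?M) = Poly_Mapping.lookup G N * Poly_Mapping.lookup (log_deriv i H) ?M"
        by (rule lookup_mult_top) (simp_all add: le le' N_def)
      moreover have "Poly_Mapping.lookup (H * log_deriv i G) (?M + N) = Poly_Mapping.lookup H ?M * Poly_Mapping.lookup (log_deriv i G) N"
        by (rule lookup_mult_top) (simp_all add: le le' N_def)
      ultimately have "Poly_Mapping.lookup G N * (of_nat (Poly_Mapping.lookup ?M i) * Poly_Mapping.lookup H ?M)
          = Poly_Mapping.lookup H ?M * (of_nat (Poly_Mapping.lookup N i) * Poly_Mapping.lookup G N)"
        unfolding lookup_log_deriv eqH[of i] by (simp only: add.commute[of N])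
      then show ?thesis using GN HM by (simp add: mult.commute mult.left_commute)
    qed
    then have "N = ?M" by (rule poly_mapping_eqI)
    then show False using HN HM by simp
  qed
  then show ?thesis by (auto simp: H_def)
qed

lemma subst_poly_superset:
  assumes "finite S" "Poly_Mapping.keys P \<subseteq> S"
  shows "subst_poly \<phi> P = (\<Sum>m\<in>S. const_poly (Poly_Mapping.lookup P m) * (\<Prod>i\<in>UNIV. \<phi> i ^ Poly_Mapping.lookup m i))"
  unfolding subst_poly_def by (intro sum.mono_neutral_left assms) (auto simp: in_keys_iff)

text \<open>If all minors vanish, Euler's identity makes the logarithmic derivatives of $f_1$ and $f_2$ proportional
  with ratio $\deg f_1 : \deg f_2$.  Then $f_1^{\deg f_2}$ and $f_2^{\deg f_1}$ have the same logarithmic derivatives,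
  so they are proportional, which is an algebraic relation.\<close>

lemma minor_jacobian_neq_0:
  fixes \<sigma> :: "'k::field_char_0 poly4 ^ 2"
  assumes hom: "\<And>i. homogeneous (d i + 1) (\<sigma> $ i)" and ind: "algebraically_independent \<sigma>"
  shows "\<exists>j k. minor (jacobian \<sigma>) j k \<noteq> 0"
proof (rule ccontr)
  assume "\<not> (\<exists>j k. minor (jacobian \<sigma>) j k \<noteq> 0)"
  then have minor0: "partial_deriv j (\<sigma> $ 1) * partial_deriv k (\<sigma> $ 2) = partial_deriv k (\<sigma> $ 1) * partial_deriv j (\<sigma> $ 2)" for j k
    by (simp add: minor_def jacobian_def)
  let ?D = "\<lambda>j i. log_deriv j (\<sigma> $ i)"
  let ?f = "\<sigma> $ 1 ^ Suc (d 2)" and ?g = "\<sigma> $ 2 ^ Suc (d 1)"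
  have euler: "(\<Sum>k\<in>UNIV. ?D k i) = of_nat (Suc (d i)) * \<sigma> $ i" for i
    using euler_homogeneous[OF hom[of i]] by simp
  have "?D j 1 * ?D k 2 = ?D j 2 * ?D k 1" for j k
    unfolding log_deriv_def using arg_cong[OF minor0[of j k], of "\<lambda>x. var j * var k * x"] by (simp only: ac_simps)
  then have "(\<Sum>k\<in>UNIV. ?D j 1 * ?D k 2) = (\<Sum>k\<in>UNIV. ?D j 2 * ?D k 1)" for j by simp
  then have step: "?D j 1 * (of_nat (Suc (d 2)) * \<sigma> $ 2) = ?D j 2 * (of_nat (Suc (d 1)) * \<sigma> $ 1)" for j
    unfolding sum_distrib_left[symmetric] euler .
  have "?g * log_deriv j ?f = ?f * log_deriv j ?g" for j
  proof -
    have "?g * log_deriv j ?f = \<sigma> $ 2 ^ d 1 * \<sigma> $ 1 ^ d 2 * (?D j 1 * (of_nat (Suc (d 2)) * \<sigma> $ 2))"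
      unfolding log_deriv_power by (simp only: power_Suc ac_simps)
    also have "\<dots> = ?f * log_deriv j ?g"
      unfolding step log_deriv_power by (simp only: power_Suc ac_simps)
    finally show ?thesis .
  qed
  note same = this
  have no_relation: "P = 0" if "subst_poly (\<lambda>i. \<sigma> $ i) P = 0" for P :: "(2, 'k) mpoly"
    using ind that by (auto simp: algebraically_independent_def)
  let ?m = "Poly_Mapping.single (1::2) (Suc (d 2))" and ?n = "Poly_Mapping.single (2::2) (Suc (d 1))"
  have mn: "?m \<noteq> ?n"
  proof
    assume "?m = ?n"
    then have "Poly_Mapping.lookup ?m 1 = Poly_Mapping.lookup ?n 1" by simp
    then show False by (simp add: lookup_single when_def)
  qed
  have relation: "\<sigma> $ 1 ^ Suc (d 2) * const_poly b + const_poly c * \<sigma> $ 2 ^ Suc (d 1) \<noteq> 0" if "b \<noteq> 0 \<or> c \<noteq> 0" for b c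
  proof
    assume zero: "\<sigma> $ 1 ^ Suc (d 2) * const_poly b + const_poly c * \<sigma> $ 2 ^ Suc (d 1) = 0"
    define P where "P = Poly_Mapping.single ?m b + Poly_Mapping.single ?n c"
    have lookup: "Poly_Mapping.lookup P ?m = b" "Poly_Mapping.lookup P ?n = c"
      using mn by (simp_all add: P_def lookup_add lookup_single when_def)
    have "Poly_Mapping.keys P \<subseteq> {?m, ?n}"
      by (auto simp: P_def in_keys_iff lookup_add lookup_single when_def split: if_splits)
    then have "subst_poly (\<lambda>i. \<sigma> $ i) P = 0"
      using zero mn
      by (simp add: subst_poly_superset[of "{?m, ?n}"] lookup UNIV_2 lookup_single when_def mult.commute)
    then show False using no_relation lookup that by force
  qed
  have "?g \<noteq> 0" using relation[of 0 1] by auto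
  from proportional_if_log_deriv[OF same this] obtain c where c: "?f = const_poly c * ?g" ..
  have "const_poly (- c) = (- const_poly c :: 'k poly4)" using const_poly_diff[of 0 c] by simp
  then have "?f * const_poly 1 + const_poly (- c) * ?g = 0"
    unfolding c by (simp only: const_poly_1 mult_1_right mult_minus_left add.right_inverse)
  then show False using relation[of 1 "- c"] by simp
qed

lemma homogeneous_partial_deriv:
  assumes "homogeneous (Suc n) f"
  shows "homogeneous n (partial_deriv i f)"
  unfolding partial_deriv_def
proof (rule homogeneous_sum)
  fix m assume m: "m \<in> Poly_Mapping.keys f"
  show "homogeneous n (Poly_Mapping.single (m - Poly_Mapping.single i 1) (of_nat (Poly_Mapping.lookup m i) * Poly_Mapping.lookup f m))"
  proof (cases "Poly_Mapping.lookup m i = 0")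
    case False
    then have "Poly_Mapping.single i 1 + (m - Poly_Mapping.single i 1) = m"
      by (intro poly_mapping_eqI) (auto simp: lookup_add lookup_minus lookup_single when_def)
    then have "1 + total_degree (m - Poly_Mapping.single i 1) = Suc n"
      using assms m by (metis homogeneous_def total_degree_add total_degree_single)
    then show ?thesis by (intro homogeneous_single) simp
  qed simp
qed

lemma T_sheaf_eq: "T_sheaf \<sigma> = kernel_sheaf (jacobian \<sigma>)"
  by (simp add: T_sheaf_def kernel_sheaf_def jacobian_map_def frac_map_def)

lemma Q_sheaf_eq: "Q_sheaf \<sigma> d = coker_sheaf d (jacobian \<sigma>)"
  by (simp add: Q_sheaf_def coker_sheaf_def jacobian_map_def frac_map_def image_stalk_def fun_eq_iff)

section \<open>Stability\<close>

theorem corollary9p2: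
  fixes \<sigma> :: "'k::{alg_closed_field, field_char_0} poly4 ^ 2"
    and d :: "2 \<Rightarrow> nat"
  assumes "\<And>i. homogeneous (d i + 1) (\<sigma> $ i)"
    and "algebraically_independent \<sigma>"
    and "d 1 + d 2 > 0"
    and "c1 (Q_sheaf \<sigma> d) = 0"
  shows "(even (d 1 + d 2) \<longrightarrow>
           (deg1 (Q_sheaf \<sigma> d)
              < (of_nat (d 1) ^ 2 + of_nat (d 2) ^ 2 - of_nat (d 1) - of_nat (d 2) - 2) / 2
            \<longrightarrow> slope_stable (T_sheaf \<sigma>)) \<and>
           (deg1 (Q_sheaf \<sigma> d)
              < (of_nat (d 1) ^ 2 + of_nat (d 2) ^ 2 + of_nat (d 1) + of_nat (d 2)) / 2
            \<longrightarrow> slope_semistable (T_sheaf \<sigma>)))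
       \<and> (odd (d 1 + d 2) \<longrightarrow>
           deg1 (Q_sheaf \<sigma> d) < (of_nat (d 1) ^ 2 + of_nat (d 2) ^ 2 - 1) / 2
             \<longrightarrow> slope_stable (T_sheaf \<sigma>))
       \<and> (has_krull_dimension (subtopology zariski (jacobian_locus \<sigma>)) 0 \<longrightarrow>
           slope_stable (T_sheaf \<sigma>))"
proof -
  let ?A = "jacobian \<sigma>"
  obtain j k where jk: "minor ?A j k \<noteq> 0" using minor_jacobian_neq_0[OF assms(1,2)] by blast
  then have "j \<noteq> k" by (auto simp: minor_def)
  then obtain p q where pq: "distinct [p, q, j, k]" "UNIV = {p, q, j, k}" using four_indices by blast
  have hom: "homogeneous (d i) (?A $ i $ l)" for i l
    using homogeneous_partial_deriv[of "d i" "\<sigma> $ i" l] assms(1)[of i] by (simp add: jacobian_def)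
  have "rank_two_matrix d ?A j k p q" by (rule rank_two_matrix.intro[OF hom jk pq])
  then interpret J: rank_two_matrix d ?A j k p q .
  note c1 = assms(4)[unfolded Q_sheaf_eq]
  let ?T = "T_sheaf \<sigma>" and ?deg = "deg1 (Q_sheaf \<sigma> d)"
  define s D :: rat where "s = of_nat (d 1) ^ 2 + of_nat (d 2) ^ 2" and "D = of_nat (d 1 + d 2)"
  have sl: "slope ?T = - (D / 2)" unfolding T_sheaf_eq D_def by (rule J.slope_kernel_sheaf[OF c1])
  have D: "0 < D" unfolding D_def of_nat_0_less_iff by (rule assms(3))
  have bound: "\<exists>m. of_nat m \<le> - slope K \<and> s / 2 + D ^ 2 / 2 - D * of_nat m \<le> ?deg"
    if "coherent_subsheaf K ?T" "0 < rk K" "rk K < rk ?T" "slope ?T \<le> slope K" for K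
  proof -
    have "- D \<le> slope K" using that(4) sl D by linarith
    from J.deg1_ge_of_slope[OF c1 that(1-3)[unfolded T_sheaf_eq] order_refl this[unfolded D_def]]
    show ?thesis unfolding s_def D_def Q_sheaf_eq .
  qed
  have stable: "slope_stable ?T" if small: "?deg < s / 2"
    unfolding slope_stable_def
  proof (intro allI impI, rule ccontr)
    fix K assume K: "coherent_subsheaf K ?T \<and> 0 < rk K \<and> rk K < rk ?T" and "\<not> slope K < slope ?T"
    then have "slope ?T \<le> slope K" by simp
    then obtain m where m: "of_nat m \<le> - slope K" "s / 2 + D ^ 2 / 2 - D * of_nat m \<le> ?deg" using bound K by blast
    have "of_nat m \<le> D / 2" using m(1) \<open>slope ?T \<le> slope K\<close> sl by simp
    then have "D * of_nat m \<le> D * (D / 2)" using D by (intro mult_left_mono) simp_all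
    then show False using m(2) small by (simp add: power2_eq_square)
  qed
  have semistable: "slope_semistable ?T" if small: "?deg < s / 2 + D" and even: "even (d 1 + d 2)"
    unfolding slope_semistable_def
  proof (intro allI impI, rule ccontr)
    fix K assume K: "coherent_subsheaf K ?T \<and> 0 < rk K \<and> rk K < rk ?T" and "\<not> slope K \<le> slope ?T"
    then have less: "slope ?T < slope K" by simp
    then obtain m where m: "of_nat m \<le> - slope K" "s / 2 + D ^ 2 / 2 - D * of_nat m \<le> ?deg" using bound K by fastforce
    have "of_nat m < D / 2" using m(1) less sl by simp
    then have "of_nat (2 * m) < (of_nat (d 1 + d 2) :: rat)" by (simp add: D_def)
    then have "2 * m < d 1 + d 2" unfolding of_nat_less_iff .
    \<comment> \<open>parity sharpens the strict inequality by one\<close>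
    then have "2 * m + 2 \<le> d 1 + d 2" using even by presburger
    then have "of_nat (2 * m + 2) \<le> D" unfolding D_def of_nat_le_iff .
    then have "of_nat m \<le> D / 2 - 1" by simp
    then have "D * of_nat m \<le> D * (D / 2 - 1)" using D by (intro mult_left_mono) simp_all
    then show False using m(2) small by (simp add: power2_eq_square algebra_simps)
  qed
  have "slope_stable ?T" if "has_krull_dimension (subtopology zariski (jacobian_locus \<sigma>)) 0"
  proof (rule stable)
    have "jacobian_locus \<sigma> = vanishing_locus {minor ?A a b | a b. True}" by (simp add: jacobian_locus_def minor_def)
    then have "?deg = 0" using J.deg1_coker_eq_0 that by (simp add: Q_sheaf_eq)
    moreover have "0 < s"
    proof -
      have "0 < d 1 \<or> 0 < d 2" using assms(3) by auto
      then show ?thesis unfolding s_def by (auto intro: add_pos_nonneg add_nonneg_pos)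
    qed
    ultimately show "?deg < s / 2" by simp
  qed
  moreover have "D = of_nat (d 1) + of_nat (d 2)" by (simp add: D_def)
  moreover have "?deg < (s - of_nat (d 1) - of_nat (d 2) - 2) / 2 \<Longrightarrow> slope_stable ?T"
    by (rule stable) (use D calculation(2) in simp)
  moreover have "?deg < (s - 1) / 2 \<Longrightarrow> slope_stable ?T" by (rule stable) simp
  moreover have "?deg < (s + of_nat (d 1) + of_nat (d 2)) / 2 \<Longrightarrow> even (d 1 + d 2) \<Longrightarrow> slope_semistable ?T"
    by (rule semistable) (use D calculation(2) in simp_all)
  ultimately show ?thesis unfolding s_def by blast
qed

end
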